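(* Let $n\ge 3$ and let $\vec u(t)=(u(t),\dot u(t))$ be a global solution in $\mathcal H$ of the Klein-Gordon equation $$(\partial_t^2-\Delta_x+1)u=N(u,x,t)\,u,\qquad \vec u(0)=(u_0,\dot u_0)\in\mathcal H,$$ on $\mathbb R^n$. Assume that $$E:=\sup_{t\ge 0}\|\vec u(t)\|_{\mathcal H}<\infty\qquad\text{and}\qquad \sup_{t\ge 0}\|N(u(t),x,t)u(t)\|_{L^1_x(\mathbb R^n)}<\infty .$$ Let $$\mathscr I_{\mathrm{nl}}:=\{(\alpha,\beta)\in(0,1-2/n)\times(0,1):\ \beta<\tfrac{n}{n+3}(1-\alpha)-\tfrac{2}{n+3}\}.$$ Then for every $(\alpha,\beta)\in\mathscr I_{\mathrm{nl}}$ the limit $$\Omega_\alpha^*\vec u(0):=\lim_{t\to\infty}\mathcal F_\alpha(x,p,t)\,U_0(0,t)\,\vec u(t)$$ exists strongly in $\mathcal H$, and it is independent of $(\alpha,\beta)$: $\Omega_\alpha^*\vec u(0)=\Omega_{\alpha'}^*\vec u(0)$ for all $(\alpha,\beta),(\alpha',\beta')\in\mathscr I_{\mathrm{nl}}$.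
   Context: Notation. $p=-i\nabla_x$, and functions of $p$ are Fourier multipliers, in particular $\langle p\rangle=\sqrt{1-\Delta_x}$. $\mathcal H=H^1(\mathbb R^n)\times L^2(\mathbb R^n)$ with inner product $(\vec u,\vec v)_{\mathcal H}=(\langle p\rangle u_1,\langle p\rangle v_1)_{L^2}+(u_2,v_2)_{L^2}$. $u(t)=u(\cdot,t)$, $\dot u(t)=\partial_tu(\cdot,t)$. When $N$ depends on $u$, $N(u(t),x,t)$ is regarded as a time-dependent multiplication operator along the given orbit $\{u(t)\}_{t\ge0}$. Free evolution: $U_0(t,0)$ is the solution operator of $(\partial_t^2-\Delta+1)u_0=0$ on $\mathcal H$, i.e. $U_0(t,0)(f,g)=\big(\cos(t\langle p\rangle)f+\tfrac{\sin(t\langle p\rangle)}{\langle p\rangle}g,\ -\sin(t\langle p\rangle)\langle p\rangle f+\cos(t\langle p\rangle)g\big)$, and $U_0(0,t)=U_0(t,0)^{-1}=U_0(-t,0)$. Cut-offs: $F_c,F_1$ are smooth cut-off functions on $\mathbb R$ with $F_j(\lambda)=1$ for $\lambda\ge1$ and $F_j(\lambda)=0$ for $\lambda<1/2$ ($j=c,1$). $F_c(\frac{|x|}{t^\alpha}\le1)$ is multiplication by $1-F_c(|x|/t^\alpha)$; $F_1(|p|\le t^\beta)$ is the Fourier multiplier $1-F_1(|\xi|/t^\beta)$. For parameters $(\alpha,\beta)$ set $F_\alpha(x,p,t):=F_c(\frac{|x|}{t^\alpha}\le1)\,F_1(|p|\le t^\beta)$ and $$\mathcal F_\alpha(x,p,t)=\begin{pmatrix}\langle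 p\rangle^{-1}F_\alpha(x,p,t)\langle p\rangle&0\\0&F_\alpha(x,p,t)\end{pmatrix}.$$ *)

theory Defs
  imports "HOL-Analysis.Analysis"
begin

section \<open>Smooth functions and test functions\<close>

definition pderiv_along :: "'a \<Rightarrow> ('a::euclidean_space \<Rightarrow> 'b::real_normed_vector) \<Rightarrow> 'a \<Rightarrow> 'b" where
  "pderiv_along b f x = vector_derivative (\<lambda>s. f (x + s *\<^sub>R b)) (at 0)"

fun C_k :: "nat \<Rightarrow> ('a::euclidean_space \<Rightarrow> 'b::real_normed_vector) \<Rightarrow> bool" where
  "C_k 0 f \<longleftrightarrow> continuous_on UNIV f"
| "C_k (Suc k) f \<longleftrightarrow>
     (\<forall>b\<in>Basis. (\<forall>x. (\<lambda>s. f (x + s *\<^sub>R b)) differentiable (at (0::real))) \<and> C_k k (pderiv_along b f))"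

definition smooth :: "('a::euclidean_space \<Rightarrow> 'b::real_normed_vector) \<Rightarrow> bool" where
  "smooth f \<longleftrightarrow> (\<forall>k. C_k k f)"

definition laplacian :: "('a::euclidean_space \<Rightarrow> 'b::real_normed_vector) \<Rightarrow> 'a \<Rightarrow> 'b" where
  "laplacian f x = (\<Sum>b\<in>Basis. pderiv_along b (pderiv_along b f) x)"

definition test_function :: "('a::euclidean_space \<Rightarrow> complex) \<Rightarrow> bool" where
  "test_function \<phi> \<longleftrightarrow> smooth \<phi> \<and> compact (closure {x. \<phi> x \<noteq> 0})"

definition smooth_cutoff :: "(real \<Rightarrow> real) \<Rightarrow> bool" where
  "smooth_cutoff F \<longleftrightarrow> smooth F \<and> (\<forall>l\<ge>1. F l = 1) \<and> (\<forall>l<1/2. F l = 0)"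


section \<open>Square-integrable functions and the Fourier transform\<close>

text \<open>Elements of \<open>L\<^sup>2\<close> are represented by Borel functions; equality in \<open>L\<^sup>2\<close> is equality
  almost everywhere. The real-valued norms below are meaningful only for members of the
  respective space (the Bochner integral of a non-integrable function is \<open>0\<close>), so the notions of
  convergence demand membership explicitly.\<close>

definition L2 :: "('a::euclidean_space \<Rightarrow> complex) set" where
  "L2 = {f. f \<in> borel_measurable lborel \<and> integrable lborel (\<lambda>x. (norm (f x))\<^sup>2)}"

definition L2_norm :: "('a::euclidean_space \<Rightarrow> complex) \<Rightarrow> real" where
  "L2_norm f = sqrt (\<integral>x. (norm (f x))\<^sup>2 \<partial>lborel)"

definition L2_limit :: "('t \<Rightarrow> 'a::euclidean_space \<Rightarrow> complex) \<Rightarrow> ('a \<Rightarrow> complex) \<Rightarrow> 't filter \<Rightarrow> bool" where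
  "L2_limit X g F \<longleftrightarrow>
     (\<forall>\<^sub>F t in F. X t \<in> L2) \<and> g \<in> L2 \<and> ((\<lambda>t. L2_norm (X t - g)) \<longlongrightarrow> 0) F"

definition fourier_integral :: "('a::euclidean_space \<Rightarrow> complex) \<Rightarrow> 'a \<Rightarrow> complex" where
  "fourier_integral f \<xi> =
     of_real ((2 * pi) powr (- real DIM('a) / 2)) * (\<integral>x. cis (- (x \<bullet> \<xi>)) * f x \<partial>lborel)"

text \<open>The unitary Fourier transform of \<open>f \<in> L\<^sup>2\<close>: the \<open>L\<^sup>2\<close>-limit of the integrals over growing
  balls, determined up to a null set.\<close>

definition fourier :: "('a::euclidean_space \<Rightarrow> complex) \<Rightarrow> 'a \<Rightarrow> complex" where
  "fourier f = (SOME g. L2_limit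
      (\<lambda>R::real. fourier_integral (\<lambda>x. indicator (cball 0 R) x *\<^sub>R f x)) g at_top)"

definition inverse_fourier :: "('a::euclidean_space \<Rightarrow> complex) \<Rightarrow> 'a \<Rightarrow> complex" where
  "inverse_fourier g x = fourier g (- x)"

text \<open>The operator \<open>m(p)\<close>, to be applied to \<open>f\<close> with \<open>f\<close> and \<open>m \<cdot> fourier f\<close> in \<open>L\<^sup>2\<close>.\<close>

definition fourier_mult :: "('a::euclidean_space \<Rightarrow> real) \<Rightarrow> ('a \<Rightarrow> complex) \<Rightarrow> 'a \<Rightarrow> complex" where
  "fourier_mult m f = inverse_fourier (\<lambda>\<xi>. m \<xi> *\<^sub>R fourier f \<xi>)"

definition jbr :: "'a::euclidean_space \<Rightarrow> real" where
  "jbr \<xi> = sqrt (1 + (norm \<xi>)\<^sup>2)"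


section \<open>The energy space \<open>H\<^sup>1 \<times> L\<^sup>2\<close>\<close>

type_synonym 'a state = "('a \<Rightarrow> complex) \<times> ('a \<Rightarrow> complex)"

definition H1 :: "('a::euclidean_space \<Rightarrow> complex) set" where
  "H1 = {f \<in> L2. (\<lambda>\<xi>. jbr \<xi> *\<^sub>R fourier f \<xi>) \<in> L2}"

definition H_space :: "'a::euclidean_space state set" where
  "H_space = H1 \<times> L2"

definition H_norm :: "'a::euclidean_space state \<Rightarrow> real" where
  "H_norm w = sqrt ((L2_norm (fourier_mult jbr (fst w)))\<^sup>2 + (L2_norm (snd w))\<^sup>2)"

definition H_limit :: "('t \<Rightarrow> 'a::euclidean_space state) \<Rightarrow> 'a state \<Rightarrow> 't filter \<Rightarrow> bool" where
  "H_limit X w F \<longleftrightarrow>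
     (\<forall>\<^sub>F t in F. X t \<in> H_space) \<and> w \<in> H_space \<and> ((\<lambda>t. H_norm (X t - w)) \<longlongrightarrow> 0) F"

definition H_eq :: "'a::euclidean_space state \<Rightarrow> 'a state \<Rightarrow> bool" where
  "H_eq w w' \<longleftrightarrow> (AE x in lborel. fst w x = fst w' x \<and> snd w x = snd w' x)"


section \<open>Free evolution and cut-off operators\<close>

text \<open>\<open>U0 t\<close> is $U_0(t,0)$; hence $U_0(0,t)$ is \<open>U0 (- t)\<close>.\<close>

definition U0 :: "real \<Rightarrow> 'a::euclidean_space state \<Rightarrow> 'a state" where
  "U0 t w =
    ((\<lambda>x. fourier_mult (\<lambda>\<xi>. cos (t * jbr \<xi>)) (fst w) x
         + fourier_mult (\<lambda>\<xi>. sin (t * jbr \<xi>) / jbr \<xi>) (snd w) x),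
     (\<lambda>x. fourier_mult (\<lambda>\<xi>. - sin (t * jbr \<xi>) * jbr \<xi>) (fst w) x
         + fourier_mult (\<lambda>\<xi>. cos (t * jbr \<xi>)) (snd w) x))"

definition F_scalar :: "(real \<Rightarrow> real) \<Rightarrow> (real \<Rightarrow> real) \<Rightarrow> real \<Rightarrow> real \<Rightarrow> real
    \<Rightarrow> ('a::euclidean_space \<Rightarrow> complex) \<Rightarrow> 'a \<Rightarrow> complex" where
  "F_scalar Fc F1 \<alpha> \<beta> t f =
     (\<lambda>x. (1 - Fc (norm x / t powr \<alpha>)) *\<^sub>R
          fourier_mult (\<lambda>\<xi>. 1 - F1 (norm \<xi> / t powr \<beta>)) f x)"

definition F_matrix :: "(real \<Rightarrow> real) \<Rightarrow> (real \<Rightarrow> real) \<Rightarrow> real \<Rightarrow> real \<Rightarrow> real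
    \<Rightarrow> 'a::euclidean_space state \<Rightarrow> 'a state" where
  "F_matrix Fc F1 \<alpha> \<beta> t w =
     (fourier_mult (\<lambda>\<xi>. 1 / jbr \<xi>) (F_scalar Fc F1 \<alpha> \<beta> t (fourier_mult jbr (fst w))),
      F_scalar Fc F1 \<alpha> \<beta> t (snd w))"

definition I_nl :: "nat \<Rightarrow> (real \<times> real) set" where
  "I_nl n = {(\<alpha>, \<beta>). \<alpha> \<in> {0<..<1 - 2 / real n} \<and> \<beta> \<in> {0<..<1} \<and>
     \<beta> < real n / (real n + 3) * (1 - \<alpha>) - 2 / (real n + 3)}"


section \<open>Solutions of the Klein-Gordon equation\<close>

text \<open>\<open>(u, v)\<close> is a continuous curve in \<open>H\<^sup>1 \<times> L\<^sup>2\<close> on \<open>[0,\<infinity>)\<close>, \<open>v\<close> is the time derivative of \<open>u\<close>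
  in \<open>L\<^sup>2\<close>, and $\partial_t v = \Delta u - u + N(u,x,t)u$ holds in the sense of distributions in \<open>x\<close>,
  integrated in time. \<open>N\<close> receives the whole function \<open>u t\<close>, so that both local and nonlocal
  nonlinearities are covered; the values are complex, real-valued solutions being a special case.\<close>

definition KG_global_solution ::
  "(('a::euclidean_space \<Rightarrow> complex) \<Rightarrow> 'a \<Rightarrow> real \<Rightarrow> complex)
    \<Rightarrow> (real \<Rightarrow> 'a \<Rightarrow> complex) \<Rightarrow> (real \<Rightarrow> 'a \<Rightarrow> complex) \<Rightarrow> bool" where
  "KG_global_solution N u v \<longleftrightarrow>
     (\<forall>t\<ge>0. (u t, v t) \<in> H_space) \<and>
     (\<forall>t\<ge>0. H_limit (\<lambda>s. (u s, v s)) (u t, v t) (at t within {0..})) \<and>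
     (\<forall>t\<ge>0. L2_limit (\<lambda>s x. (u s x - u t x) / of_real (s - t)) (v t) (at t within {0..})) \<and>
     (\<forall>\<phi>. test_function \<phi> \<longrightarrow> (\<forall>t\<ge>0.
        integrable lborel (\<lambda>x. N (u t) x t * u t x * \<phi> x) \<and>
        ((\<lambda>s. (\<integral>x. u s x * (laplacian \<phi> x - \<phi> x) \<partial>lborel)
              + (\<integral>x. N (u s) x s * u s x * \<phi> x \<partial>lborel))
          has_integral ((\<integral>x. v t x * \<phi> x \<partial>lborel) - (\<integral>x. v 0 x * \<phi> x \<partial>lborel))) {0..t}))"

end

theory Submission
  imports Defs "HOL-Probability.Probability" "HOL-Complex_Analysis.Complex_Analysis" "HOL-Real_Asymp.Real_Asymp"
begin

text \<open>
  Conjugating the solution with the free flow gives \<open>U0 (- t) (u t, v t)\<close>, whose time derivative is the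
  free flow applied to the nonlinear term. The latter is bounded in \<open>L\<^sup>1\<close>, and after the frequency
  cut-off at height \<open>R\<close> the free propagator maps \<open>L\<^sup>1\<close> to \<open>L\<^sup>\<infinity>\<close> with norm at most a multiple of
  \<open>R\<^bsup>n/2+1\<^esup> s\<^bsup>-n/2\<^esup>\<close> for \<open>s \<ge> R \<ge> 1\<close>. As \<open>n \<ge> 3\<close> this is integrable in \<open>s\<close>, so the frequency-localised
  profiles at times \<open>t \<le> T\<close> differ pointwise by at most \<open>C R\<^bsup>n/2+1\<^esup> t\<^bsup>1-n/2\<^esup>\<close>. Consequently the profiles converge
  weakly in \<open>L2\<close> to a limit that does not depend on the cut-offs, and the same bound compares the
  profile with its limit. With \<open>R = t\<^bsup>\<beta>\<^esup>\<close>, restriction to \<open>|x| \<le> t\<^bsup>\<alpha>\<^esup>\<close> turns the pointwise bound into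
  an \<open>L2\<close> bound of order \<open>t\<^bsup>\<beta>(n/2+1)+1-n/2+\<alpha>n/2\<^esup>\<close>, whose exponent is negative on \<open>I_nl\<close>,
  while the cut-offs applied to the weak limit converge strongly
  to the identity.

  The dispersive bound is obtained without stationary phase. For \<open>Re z > 0\<close> the kernel of
  \<open>exp (- z jbr) / jbr\<close> is explicit for real \<open>z\<close> by subordination to Gaussians and extends by analytic
  continuation, which gives its decay near the imaginary axis. The frequency cut-off is
  a superposition of such exponentials: as a function of \<open>jbr / R\<close> it is a smooth compactly supported
  function times \<open>exp (- jbr / R)\<close>, and one-dimensional Fourier inversion applies.
\<close>

section \<open>The space of square-integrable functions\<close>

text \<open>The nonlinear term is controlled in L1 only, so the time derivative of the profile need
  not lie in L2, and it is only the cut-off profile that is shown to converge in norm. The weak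
  equation is given for compactly supported test functions that do not move in time, whereas
  dispersion concerns band-limited functions carrying the phase \<open>cis (s * jbr \<xi>)\<close>.
  Hence the equation is first extended to band-limited test functions, and the phase is then frozen
  at each time; this gives a one-sided derivative bound, which replaces a Duhamel integral.
  Multiplying the first component by \<open>jbr\<close> turns the free flow into a rotation, and the
  two signs \<theta> diagonalise it. As for the power of R: one factor R is the price of dividing
  the kernel by \<open>jbr\<close>, and the n/2 others come from Re z |Im z|, which is of order s/R
  at z = 1/R - i s. The parameter \<alpha> enters only through the volume of the ball to which the
  pointwise bound is restricted.\<close>

lemma L2_measurable [measurable_dest]: "f \<in> L2 \<Longrightarrow> f \<in> borel_measurable borel"
  by (simp add: L2_def)

lemma L2_integrable_sq: "f \<in> L2 \<Longrightarrow> integrable lborel (\<lambda>x. (norm (f x))\<^sup>2)"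
  by (simp add: L2_def)

lemma L2_norm_nonneg [simp]: "0 \<le> L2_norm f"
  by (simp add: L2_norm_def)

lemma L2_norm_sq: "(L2_norm f)\<^sup>2 = (\<integral>x. (norm (f x))\<^sup>2 \<partial>lborel)"
  by (simp add: L2_norm_def)

lemma L2_nn_integral:
  assumes "f \<in> L2"
  shows "(\<integral>\<^sup>+x. ennreal ((norm (f x))\<^sup>2) \<partial>lborel) = ennreal ((L2_norm f)\<^sup>2)"
  unfolding L2_norm_sq using L2_integrable_sq[OF assms]
  by (intro nn_integral_eq_integral) auto

lemma L2I_nn_integral:
  assumes [measurable]: "f \<in> borel_measurable borel"
    and "(\<integral>\<^sup>+x. ennreal ((norm (f x))\<^sup>2) \<partial>lborel) \<le> ennreal (C\<^sup>2)" and "0 \<le> C"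
  shows "f \<in> L2" "L2_norm f \<le> C"
proof -
  have "integrable lborel (\<lambda>x. (norm (f x))\<^sup>2)"
    by (rule integrableI_bounded) (use assms in \<open>auto simp: top_unique less_top[symmetric]\<close>)
  then show *: "f \<in> L2" by (simp add: L2_def)
  have "(L2_norm f)\<^sup>2 \<le> C\<^sup>2"
    using assms(2) unfolding L2_nn_integral[OF *] by (simp add: ennreal_le_iff)
  then show "L2_norm f \<le> C"
    using \<open>0 \<le> C\<close> by (rule power2_le_imp_le)
qed

lemma L2_dominated:
  assumes "f \<in> L2" and [measurable]: "g \<in> borel_measurable borel"
    and "AE x in lborel. norm (g x) \<le> C * norm (f x)" and "0 \<le> C"
  shows "g \<in> L2" "L2_norm g \<le> C * L2_norm f"
proof -
  have [measurable]: "f \<in> borel_measurable borel" using assms by measurable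
  have "(\<integral>\<^sup>+x. ennreal ((norm (g x))\<^sup>2) \<partial>lborel)
      \<le> (\<integral>\<^sup>+x. ennreal (C\<^sup>2) * ennreal ((norm (f x))\<^sup>2) \<partial>lborel)"
  proof (rule nn_integral_mono_AE, use assms(3) in eventually_elim)
    case (elim x)
    then have "(norm (g x))\<^sup>2 \<le> (C * norm (f x))\<^sup>2" by (intro power_mono) auto
    then show ?case
      by (simp add: ennreal_mult'[symmetric] power_mult_distrib ennreal_leI)
  qed
  also have "\<dots> = ennreal ((C * L2_norm f)\<^sup>2)"
    by (subst nn_integral_cmult) (auto simp: L2_nn_integral[OF assms(1)] ennreal_mult' power_mult_distrib)
  finally have "(\<integral>\<^sup>+x. ennreal ((norm (g x))\<^sup>2) \<partial>lborel) \<le> ennreal ((C * L2_norm f)\<^sup>2)" .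
  note * = L2I_nn_integral[OF assms(2) this]
  show "g \<in> L2" "L2_norm g \<le> C * L2_norm f"
    using assms(4) by (intro *; simp)+
qed

lemma L2_mult_bounded:
  assumes "f \<in> L2" and [measurable]: "m \<in> borel_measurable borel"
    and "\<And>x. norm (m x) \<le> C"
  shows "(\<lambda>x. m x * f x) \<in> L2" "L2_norm (\<lambda>x. m x * f x) \<le> C * L2_norm f"
proof -
  have [measurable]: "f \<in> borel_measurable borel" using assms by measurable
  have C: "0 \<le> C" using assms(3) norm_ge_zero order_trans by blast
  show "(\<lambda>x. m x * f x) \<in> L2" "L2_norm (\<lambda>x. m x * f x) \<le> C * L2_norm f"
    by (rule L2_dominated[OF assms(1)]; use C assms(3) in \<open>auto simp: norm_mult intro!: mult_right_mono\<close>)+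
qed

lemma L2_scaleR_bounded:
  assumes "f \<in> L2" and [measurable]: "m \<in> borel_measurable borel"
    and "\<And>x. \<bar>m x\<bar> \<le> (C::real)"
  shows "(\<lambda>x. m x *\<^sub>R f x) \<in> L2" "L2_norm (\<lambda>x. m x *\<^sub>R f x) \<le> C * L2_norm f"
  using L2_mult_bounded[OF assms(1), of "\<lambda>x. of_real (m x)" C] assms(3)
  by (auto simp: scaleR_conv_of_real)

lemma L2_cmult:
  assumes "f \<in> L2"
  shows "(\<lambda>x. c * f x) \<in> L2" "L2_norm (\<lambda>x. c * f x) = norm c * L2_norm f"
proof -
  show "(\<lambda>x. c * f x) \<in> L2" by (rule L2_mult_bounded(1)[OF assms, of _ "norm c"]) auto
  show "L2_norm (\<lambda>x. c * f x) = norm c * L2_norm f"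
    by (simp add: L2_norm_def norm_mult power_mult_distrib real_sqrt_mult)
qed

lemma L2_norm_minus: "L2_norm (\<lambda>x. - f x) = L2_norm f"
  by (simp add: L2_norm_def)

lemma L2_norm_commute: "L2_norm (\<lambda>x. f x - g x) = L2_norm (\<lambda>x. g x - f x)"
  by (simp add: L2_norm_def norm_minus_commute)

lemma L2_norm_cong_AE:
  assumes "AE x in lborel. f x = g x" "f \<in> borel_measurable borel" "g \<in> borel_measurable borel"
  shows "L2_norm f = L2_norm g"
  unfolding L2_norm_def using assms by (intro arg_cong[where f=sqrt] integral_cong_AE) auto

lemma L2_cong_AE:
  assumes "AE x in lborel. f x = g x" "f \<in> L2" "g \<in> borel_measurable borel"
  shows "g \<in> L2"
  by (rule L2_dominated(1)[OF assms(2), of _ 1]) (use assms in \<open>auto elim: eventually_mono\<close>)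

lemma L2_cnj:
  assumes "f \<in> L2" shows "(\<lambda>x. cnj (f x)) \<in> L2" "L2_norm (\<lambda>x. cnj (f x)) = L2_norm f"
proof -
  have [measurable]: "f \<in> borel_measurable borel" using assms by measurable
  show "(\<lambda>x. cnj (f x)) \<in> L2"
    by (rule L2_dominated(1)[OF assms, of _ 1]) (auto intro: measurable_compose[OF _ borel_measurable_continuous_onI] continuous_intros)
qed (simp add: L2_norm_def)

lemma L2_norm_zero [simp]: "L2_norm (\<lambda>x. 0) = 0"
  by (simp add: L2_norm_def)

lemma L2_norm_eq_0_AE:
  assumes "f \<in> L2" "L2_norm f = 0" shows "AE x in lborel. f x = 0"
proof -
  have "(\<integral>x. (norm (f x))\<^sup>2 \<partial>lborel) = 0" using L2_norm_sq[of f] assms by simp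
  then have "AE x in lborel. (norm (f x))\<^sup>2 = 0"
    using L2_integrable_sq[OF assms(1)] by (subst (asm) integral_nonneg_eq_0_iff_AE) auto
  then show ?thesis by eventually_elim simp
qed

lemma L2_mult_integrable:
  assumes "f \<in> L2" "g \<in> L2"
  shows "integrable lborel (\<lambda>x. f x * g x)"
proof (rule Bochner_Integration.integrable_bound)
  show "integrable lborel (\<lambda>x. (norm (f x))\<^sup>2 + (norm (g x))\<^sup>2)"
    using assms by (intro Bochner_Integration.integrable_add L2_integrable_sq)
  have [measurable]: "f \<in> borel_measurable borel" "g \<in> borel_measurable borel" using assms by measurable
  show "(\<lambda>x. f x * g x) \<in> borel_measurable lborel" by measurable
  have "a * b \<le> a\<^sup>2 + b\<^sup>2" if "0 \<le> a" "0 \<le> b" for a b :: real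
    using that sum_squares_bound[of a b] mult_nonneg_nonneg[of a b] by linarith
  then show "AE x in lborel. norm (f x * g x) \<le> norm ((norm (f x))\<^sup>2 + (norm (g x))\<^sup>2)"
    by (auto simp: norm_mult)
qed

lemma L2_Cauchy_Schwarz:
  assumes "f \<in> L2" "g \<in> L2"
  shows "(\<integral>x. norm (f x * g x) \<partial>lborel) \<le> L2_norm f * L2_norm g"
proof -
  define I where "I = (\<integral>x. norm (f x) * norm (g x) \<partial>lborel)"
  have i: "integrable lborel (\<lambda>x. norm (f x) * norm (g x))"
    using integrable_norm[OF L2_mult_integrable[OF assms]] by (simp add: norm_mult)
  note if2 = L2_integrable_sq[OF assms(1)] and ig = L2_integrable_sq[OF assms(2)]
  \<comment> \<open>The square of |f| + s |g| integrates to a quadratic in s that is never negative.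
    Below, s is its minimiser or, when g has norm zero and the quadratic is affine, a point where it
    would equal -1.\<close>
  have q: "0 \<le> (L2_norm f)\<^sup>2 + 2 * s * I + s\<^sup>2 * (L2_norm g)\<^sup>2" for s
  proof -
    have "0 \<le> (\<integral>x. (norm (f x) + s * norm (g x))\<^sup>2 \<partial>lborel)" by simp
    also have "\<dots> = (\<integral>x. (norm (f x))\<^sup>2 + 2 * s * (norm (f x) * norm (g x)) + s\<^sup>2 * (norm (g x))\<^sup>2 \<partial>lborel)"
      by (simp add: power2_eq_square algebra_simps)
    also have "\<dots> = (L2_norm f)\<^sup>2 + 2 * s * I + s\<^sup>2 * (L2_norm g)\<^sup>2"
      using i if2 ig by (simp add: L2_norm_sq I_def)
    finally show ?thesis .
  qed
  have I0: "0 \<le> I" unfolding I_def by simp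
  have "I\<^sup>2 \<le> (L2_norm f)\<^sup>2 * (L2_norm g)\<^sup>2"
  proof (cases "L2_norm g = 0")
    case True
    have "I = 0"
    proof (rule ccontr)
      assume "I \<noteq> 0"
      then have "2 * (- ((L2_norm f)\<^sup>2 + 1) / (2 * I)) * I = - ((L2_norm f)\<^sup>2 + 1)" by simp
      then show False using q[of "- ((L2_norm f)\<^sup>2 + 1) / (2 * I)"] True by simp
    qed
    then show ?thesis by simp
  next
    case False
    then have pos: "0 < (L2_norm g)\<^sup>2" by simp
    have "0 \<le> (L2_norm f)\<^sup>2 - I\<^sup>2 / (L2_norm g)\<^sup>2"
      using q[of "- I / (L2_norm g)\<^sup>2"] False by (simp add: power2_eq_square)
    then show ?thesis using pos by (simp add: pos_divide_le_eq)
  qed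
  then have "I \<le> L2_norm f * L2_norm g"
    unfolding power_mult_distrib[symmetric] by (rule power2_le_imp_le) simp
  then show ?thesis by (simp add: I_def norm_mult)
qed

lemma L2_pairing_bound:
  assumes "f \<in> L2" "g \<in> L2"
  shows "norm (\<integral>x. f x * g x \<partial>lborel) \<le> L2_norm f * L2_norm g"
  using integral_norm_bound[of lborel "\<lambda>x. f x * g x"] L2_Cauchy_Schwarz[OF assms] by linarith

lemma L2_add:
  assumes "f \<in> L2" "g \<in> L2"
  shows "(\<lambda>x. f x + g x) \<in> L2" "L2_norm (\<lambda>x. f x + g x) \<le> L2_norm f + L2_norm g"
proof -
  have [measurable]: "f \<in> borel_measurable borel" "g \<in> borel_measurable borel" using assms by measurable
  have i: "integrable lborel (\<lambda>x. norm (f x) * norm (g x))"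
    using integrable_norm[OF L2_mult_integrable[OF assms]] by (simp add: norm_mult)
  note if2 = L2_integrable_sq[OF assms(1)] and ig = L2_integrable_sq[OF assms(2)]
  have le: "(norm (f x + g x))\<^sup>2 \<le> (norm (f x))\<^sup>2 + 2 * (norm (f x) * norm (g x)) + (norm (g x))\<^sup>2" for x
    using power_mono[OF norm_triangle_ineq[of "f x" "g x"], of 2]
    by (simp add: power2_eq_square algebra_simps)
  have ib: "integrable lborel (\<lambda>x. (norm (f x))\<^sup>2 + 2 * (norm (f x) * norm (g x)) + (norm (g x))\<^sup>2)"
    using i if2 ig by simp
  have *: "integrable lborel (\<lambda>x. (norm (f x + g x))\<^sup>2)"
    by (rule Bochner_Integration.integrable_bound[OF ib]) (use le in \<open>auto intro: order_trans[OF _ abs_ge_self]\<close>)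
  then show "(\<lambda>x. f x + g x) \<in> L2" by (simp add: L2_def)
  have "(L2_norm (\<lambda>x. f x + g x))\<^sup>2
      \<le> (\<integral>x. (norm (f x))\<^sup>2 + 2 * (norm (f x) * norm (g x)) + (norm (g x))\<^sup>2 \<partial>lborel)"
    unfolding L2_norm_sq by (rule integral_mono[OF * ib le])
  also have "\<dots> = (L2_norm f)\<^sup>2 + 2 * (\<integral>x. norm (f x) * norm (g x) \<partial>lborel) + (L2_norm g)\<^sup>2"
    using i if2 ig by (simp add: L2_norm_sq)
  also have "\<dots> \<le> (L2_norm f + L2_norm g)\<^sup>2"
    using L2_Cauchy_Schwarz[OF assms] by (simp add: norm_mult power2_sum)
  finally show "L2_norm (\<lambda>x. f x + g x) \<le> L2_norm f + L2_norm g"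
    by (rule power2_le_imp_le) simp
qed

lemma L2_diff:
  assumes "f \<in> L2" "g \<in> L2"
  shows "(\<lambda>x. f x - g x) \<in> L2" "L2_norm (\<lambda>x. f x - g x) \<le> L2_norm f + L2_norm g"
  using L2_add[OF assms(1) L2_cmult(1)[OF assms(2), of "-1"]] by (auto simp: L2_norm_minus)

lemma L2_triangle:
  assumes "f \<in> L2" "g \<in> L2" "h \<in> L2"
  shows "L2_norm (\<lambda>x. f x - h x) \<le> L2_norm (\<lambda>x. f x - g x) + L2_norm (\<lambda>x. g x - h x)"
  using L2_add(2)[OF L2_diff(1)[OF assms(1,2)] L2_diff(1)[OF assms(2,3)]] by simp

lemma L2_norm_diff_bound:
  assumes "f \<in> L2" "g \<in> L2"
  shows "\<bar>L2_norm f - L2_norm g\<bar> \<le> L2_norm (\<lambda>x. f x - g x)"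
  using L2_add(2)[OF L2_diff(1)[OF assms] assms(2)] L2_add(2)[OF L2_diff(1)[OF assms(2,1)] assms(1)]
  by (simp add: L2_norm_commute[of g f])

text \<open>Fatou's lemma for the squared moduli. It gives membership and norm bound at once, and is
  the means by which damping factors and subsequences are removed below.\<close>

lemma L2_Fatou:
  assumes X: "\<And>n. X n \<in> L2" "\<forall>\<^sub>F n in sequentially. L2_norm (X n) \<le> C"
    and [measurable]: "g \<in> borel_measurable borel" and lim: "AE x in lborel. (\<lambda>n. X n x) \<longlonglongrightarrow> g x"
  shows "g \<in> L2" "L2_norm g \<le> C"
proof -
  have [measurable]: "X n \<in> borel_measurable borel" for n using X(1)[of n] by measurable
  obtain n where "L2_norm (X n) \<le> C" using eventually_happens[OF X(2)] by auto
  then have C: "0 \<le> C" using L2_norm_nonneg order_trans by blast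
  have "(\<integral>\<^sup>+x. ennreal ((norm (g x))\<^sup>2) \<partial>lborel)
      = (\<integral>\<^sup>+x. liminf (\<lambda>n. ennreal ((norm (X n x))\<^sup>2)) \<partial>lborel)"
  proof (rule nn_integral_cong_AE, use lim in eventually_elim)
    case (elim x)
    then have "(\<lambda>n. ennreal ((norm (X n x))\<^sup>2)) \<longlonglongrightarrow> ennreal ((norm (g x))\<^sup>2)"
      by (intro tendsto_intros) auto
    from lim_imp_Liminf[OF sequentially_bot this] show ?case by simp
  qed
  also have "\<dots> \<le> liminf (\<lambda>n. \<integral>\<^sup>+x. ennreal ((norm (X n x))\<^sup>2) \<partial>lborel)"
    by (rule nn_integral_liminf) measurable
  also have "\<dots> \<le> ennreal (C\<^sup>2)"
  proof (rule Liminf_le)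
    show "\<forall>\<^sub>F n in sequentially. (\<integral>\<^sup>+x. ennreal ((norm (X n x))\<^sup>2) \<partial>lborel) \<le> ennreal (C\<^sup>2)"
      using X(2) by eventually_elim (auto simp: L2_nn_integral[OF X(1)] intro!: ennreal_leI power_mono)
  qed simp
  finally show "g \<in> L2" "L2_norm g \<le> C" by (intro L2I_nn_integral; use C in simp)+
qed

text \<open>Riesz-Fischer: a subsequence with geometrically small gaps converges almost everywhere,
  and Fatou's lemma in the second index of the Cauchy estimate turns this into norm convergence of
  the whole sequence.\<close>

lemma L2_complete:
  assumes X: "\<And>n. X n \<in> L2"
    and C: "\<And>e. 0 < e \<Longrightarrow> \<exists>M. \<forall>m\<ge>M. \<forall>n\<ge>M. L2_norm (\<lambda>x. X m x - X n x) < e"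
  shows "\<exists>g\<in>L2. (\<lambda>n. L2_norm (\<lambda>x. X n x - g x)) \<longlonglongrightarrow> 0"
proof -
  have "\<forall>k. \<exists>M. \<forall>m\<ge>M. \<forall>n\<ge>M. L2_norm (\<lambda>x. X m x - X n x) < (1/4)^k"
    using C by simp
  then obtain M where M: "\<And>k m n. m \<ge> M k \<Longrightarrow> n \<ge> M k \<Longrightarrow> L2_norm (\<lambda>x. X m x - X n x) < (1/4)^k"
    by metis
  \<comment> \<open>Summing all earlier \<open>M j\<close> makes \<open>r\<close> monotone and at
    least \<open>M k\<close>; the added k forces it to infinity.\<close>
  define r where "r k = (\<Sum>j\<le>k. M j) + k" for k
  have rM: "M k \<le> r k" for k unfolding r_def using member_le_sum[of k "{..k}" M] by simp
  have r_mono: "r k \<le> r (Suc k)" for k by (simp add: r_def)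
  have rk: "k \<le> r k" for k by (simp add: r_def)
  have [measurable]: "X n \<in> borel_measurable borel" for n using X[of n] by measurable
  define D where "D k x = X (r (Suc k)) x - X (r k) x" for k x
  have [measurable]: "D k \<in> borel_measurable borel" for k unfolding D_def by measurable
  \<comment> \<open>The squared norms of the gaps are below 16^(-k). The weight 4^k keeps the series
    of integrals summable and still forces \<open>D k x\<close> below a multiple of 2^(-k) almost
    everywhere, so the telescoping series converges absolutely.\<close>
  have DL: "D k \<in> L2" and Dn: "L2_norm (D k) < (1/4)^k" for k
    unfolding D_def using L2_diff(1)[OF X X] M[of k "r (Suc k)" "r k"] rM[of k] r_mono[of k] by auto
  have "(\<integral>\<^sup>+x. (\<Sum>k. ennreal (4^k * (norm (D k x))\<^sup>2)) \<partial>lborel)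
      = (\<Sum>k. \<integral>\<^sup>+x. ennreal (4^k * (norm (D k x))\<^sup>2) \<partial>lborel)"
    by (rule nn_integral_suminf) measurable
  also have "\<dots> \<le> (\<Sum>k. ennreal ((1/4)^k))"
  proof (rule suminf_le)
    fix k
    have "(\<integral>\<^sup>+x. ennreal (4^k * (norm (D k x))\<^sup>2) \<partial>lborel) = ennreal (4^k * (L2_norm (D k))\<^sup>2)"
      by (simp add: ennreal_mult' nn_integral_cmult L2_nn_integral[OF DL])
    also have "\<dots> \<le> ennreal (4^k * ((1/4)^k)\<^sup>2)"
      using Dn[of k] by (intro ennreal_leI mult_left_mono power_mono) auto
    also have "4^k * ((1/4)^k)\<^sup>2 = (1/4::real)^k"
      by (simp add: power2_eq_square power_divide)
    finally show "(\<integral>\<^sup>+x. ennreal (4^k * (norm (D k x))\<^sup>2) \<partial>lborel) \<le> ennreal ((1/4)^k)" .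
  qed auto
  also have "\<dots> < \<infinity>" by (subst suminf_ennreal2) (auto simp: summable_geometric)
  finally have fin: "(\<integral>\<^sup>+x. (\<Sum>k. ennreal (4^k * (norm (D k x))\<^sup>2)) \<partial>lborel) \<noteq> \<infinity>"
    by (metis less_irrefl)
  have "AE x in lborel. (\<Sum>k. ennreal (4^k * (norm (D k x))\<^sup>2)) \<noteq> \<infinity>"
    by (rule nn_integral_PInf_AE[OF _ fin]) measurable
  then have conv: "AE x in lborel. convergent (\<lambda>k. X (r k) x)"
  proof eventually_elim
    case (elim x)
    define S where "S = (\<Sum>k. ennreal (4^k * (norm (D k x))\<^sup>2))"
    have "S \<noteq> \<infinity>" unfolding S_def by (rule elim)
    then obtain B where B: "S = ennreal B" "0 \<le> B"
      by (cases S) auto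
    have le: "norm (D k x) \<le> sqrt B * (1/2)^k" for k
    proof -
      have "(\<Sum>j\<in>{k}. ennreal (4^j * (norm (D j x))\<^sup>2)) \<le> S"
        unfolding S_def by (rule sum_le_suminf) auto
      then have "ennreal (4^k * (norm (D k x))\<^sup>2) \<le> S" by simp
      then have "4^k * (norm (D k x))\<^sup>2 \<le> B" unfolding B(1) using B(2) by (simp add: ennreal_le_iff)
      moreover have "(2^k)\<^sup>2 = (4::real)^k" by (simp add: power2_eq_square flip: power_mult_distrib)
      ultimately have "(2^k * norm (D k x))\<^sup>2 \<le> B" by (simp only: power_mult_distrib)
      then have "2^k * norm (D k x) \<le> sqrt B" using real_le_rsqrt by blast
      then show ?thesis by (simp add: power_divide pos_le_divide_eq mult.commute)
    qed
    have "summable (\<lambda>k. D k x)"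
      by (rule summable_comparison_test'[where N=0 and g="\<lambda>k. sqrt B * (1/2)^k"])
         (use le in \<open>auto intro!: summable_mult summable_geometric\<close>)
    then have "convergent (\<lambda>n. \<Sum>k<n. D k x)" by (simp add: summable_iff_convergent)
    moreover have "(\<Sum>k<n. D k x) = X (r n) x - X (r 0) x" for n
      unfolding D_def by (rule sum_lessThan_telescope)
    ultimately have "convergent (\<lambda>n. (X (r n) x - X (r 0) x) + X (r 0) x)"
      by (intro convergent_add convergent_const) simp
    then show ?case by simp
  qed
  define g where "g x = lim (\<lambda>k. X (r k) x)" for x
  have [measurable]: "g \<in> borel_measurable borel"
    unfolding g_def by (rule borel_measurable_lim_metric) measurable
  have lim: "AE x in lborel. (\<lambda>k. X (r k) x) \<longlonglongrightarrow> g x"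
    using conv by eventually_elim (simp add: g_def convergent_LIMSEQ_iff)
  have key: "(\<lambda>x. X n x - g x) \<in> L2 \<and> L2_norm (\<lambda>x. X n x - g x) \<le> e"
    if n: "n \<ge> N" and N: "\<forall>m\<ge>N. \<forall>n\<ge>N. L2_norm (\<lambda>x. X m x - X n x) < e" for n N e
  proof -
    have ev: "\<forall>\<^sub>F k in sequentially. L2_norm (\<lambda>x. X n x - X (r k) x) \<le> e"
      using eventually_ge_at_top[of N]
    proof eventually_elim
      case (elim k)
      then have "r k \<ge> N" using rk[of k] by linarith
      then show ?case using N n by (auto intro: less_imp_le)
    qed
    have l: "AE x in lborel. (\<lambda>k. X n x - X (r k) x) \<longlonglongrightarrow> X n x - g x"
      using lim by eventually_elim (intro tendsto_intros)
    show ?thesis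
      using L2_Fatou[of "\<lambda>k x. X n x - X (r k) x" e "\<lambda>x. X n x - g x", OF L2_diff(1)[OF X X] ev _ l] by simp
  qed
  obtain N where N: "\<forall>m\<ge>N. \<forall>n\<ge>N. L2_norm (\<lambda>x. X m x - X n x) < 1" using C[of 1] by auto
  have "g \<in> L2"
    using L2_diff(1)[OF X[of N] conjunct1[OF key[OF order_refl N]]] by simp
  moreover have "(\<lambda>n. L2_norm (\<lambda>x. X n x - g x)) \<longlonglongrightarrow> 0"
  proof (rule LIMSEQ_I)
    fix e :: real assume "0 < e"
    then obtain N where N: "\<forall>m\<ge>N. \<forall>n\<ge>N. L2_norm (\<lambda>x. X m x - X n x) < e/2" using C[of "e/2"] by auto
    have "norm (L2_norm (\<lambda>x. X n x - g x) - 0) < e" if "n \<ge> N" for n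
      using conjunct2[OF key[OF that N]] \<open>0 < e\<close> by simp
    then show "\<exists>N. \<forall>n\<ge>N. norm (L2_norm (\<lambda>x. X n x - g x) - 0) < e" by blast
  qed
  ultimately show ?thesis by blast
qed

lemma L2_norm_tendsto_dominated:
  fixes X :: "nat \<Rightarrow> 'a::euclidean_space \<Rightarrow> complex"
  assumes [measurable]: "\<And>n. X n \<in> borel_measurable borel" "g \<in> borel_measurable borel"
    and lim: "AE x in lborel. (\<lambda>n. X n x) \<longlonglongrightarrow> g x"
    and h: "h \<in> L2" and le: "\<And>n. AE x in lborel. norm (X n x - g x) \<le> norm (h x)"
  shows "(\<lambda>n. L2_norm (\<lambda>x. X n x - g x)) \<longlonglongrightarrow> 0"
proof -
  have "(\<lambda>n. \<integral>x. (norm (X n x - g x))\<^sup>2 \<partial>lborel) \<longlonglongrightarrow> (\<integral>x. 0 \<partial>(lborel :: 'a measure))"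
  proof (rule integral_dominated_convergence[where w="\<lambda>x. (norm (h x))\<^sup>2"])
    show "AE x in lborel. (\<lambda>n. (norm (X n x - g x))\<^sup>2) \<longlonglongrightarrow> 0"
      using lim
    proof eventually_elim
      case (elim x)
      then have "(\<lambda>n. (norm (X n x - g x))\<^sup>2) \<longlonglongrightarrow> (norm (g x - g x))\<^sup>2" by (intro tendsto_intros)
      then show ?case by simp
    qed
    show "AE x in lborel. norm ((norm (X n x - g x))\<^sup>2) \<le> (norm (h x))\<^sup>2" for n
      using le[of n] by eventually_elim (auto intro: power_mono)
  qed (use L2_integrable_sq[OF h] in auto)
  then have "(\<lambda>n. sqrt (\<integral>x. (norm (X n x - g x))\<^sup>2 \<partial>lborel)) \<longlonglongrightarrow> sqrt 0"
    by (intro tendsto_real_sqrt) simp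
  then show ?thesis by (simp add: L2_norm_def)
qed

text \<open>Fatou's lemma applied to X n - g bounds the distance between the two limits by every
  positive e. This identifies abstract L2 limits with explicit pointwise ones.\<close>

lemma L2_norm_tendsto_unique_AE:
  assumes "\<And>n. X n \<in> L2" "g \<in> L2" "h \<in> borel_measurable borel"
    and "(\<lambda>n. L2_norm (\<lambda>x. X n x - g x)) \<longlonglongrightarrow> 0" and lim: "AE x in lborel. (\<lambda>n. X n x) \<longlonglongrightarrow> h x"
  shows "AE x in lborel. g x = h x"
proof -
  have [measurable]: "g \<in> borel_measurable borel" "h \<in> borel_measurable borel" using assms by measurable
  have *: "(\<lambda>x. h x - g x) \<in> L2 \<and> L2_norm (\<lambda>x. h x - g x) \<le> e" if "0 < e" for e
  proof -
    have ev: "\<forall>\<^sub>F n in sequentially. L2_norm (\<lambda>x. X n x - g x) \<le> e"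
      using order_tendstoD(2)[OF assms(4) that] by eventually_elim simp
    have "AE x in lborel. (\<lambda>n. X n x - g x) \<longlonglongrightarrow> h x - g x"
      using lim by eventually_elim (intro tendsto_intros)
    then show ?thesis
      using L2_Fatou[of "\<lambda>n x. X n x - g x" e "\<lambda>x. h x - g x", OF L2_diff(1)[OF assms(1,2)] ev] by simp
  qed
  have "L2_norm (\<lambda>x. h x - g x) \<le> 0"
    by (rule field_le_epsilon) (use * in simp)
  then have "L2_norm (\<lambda>x. h x - g x) = 0"
    using L2_norm_nonneg[of "\<lambda>x. h x - g x"] by linarith
  with *[of 1] have "AE x in lborel. h x - g x = 0"
    by (intro L2_norm_eq_0_AE) auto
  then show ?thesis by eventually_elim simp
qed

lemma L2_limit_iff:
  "L2_limit X g F \<longleftrightarrow> (\<forall>\<^sub>F t in F. X t \<in> L2) \<and> g \<in> L2 \<and> ((\<lambda>t. L2_norm (\<lambda>x. X t x - g x)) \<longlongrightarrow> 0) F"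
  unfolding L2_limit_def fun_diff_def by (rule refl)

lemma L2_limit_unique_AE:
  assumes "L2_limit X g F" "L2_limit X h F" "F \<noteq> bot"
  shows "AE x in lborel. g x = h x"
proof -
  note g = assms(1)[unfolded L2_limit_iff] and h = assms(2)[unfolded L2_limit_iff]
  have gh: "g \<in> L2" "h \<in> L2" using g h by blast+
  have "L2_norm (\<lambda>x. g x - h x) \<le> 0"
  proof (rule tendsto_le[OF assms(3)])
    show "((\<lambda>t. L2_norm (\<lambda>x. X t x - g x) + L2_norm (\<lambda>x. X t x - h x)) \<longlongrightarrow> 0) F"
      using g h by (intro tendsto_add_zero) blast+
    have "\<forall>\<^sub>F t in F. X t \<in> L2" using g by blast
    then show "\<forall>\<^sub>F t in F. L2_norm (\<lambda>x. g x - h x) \<le> L2_norm (\<lambda>x. X t x - g x) + L2_norm (\<lambda>x. X t x - h x)"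
    proof eventually_elim
      case (elim t)
      then show ?case using L2_triangle[OF gh(1) elim gh(2)] by (simp add: L2_norm_commute[of g])
    qed
  qed (rule tendsto_const)
  then have "L2_norm (\<lambda>x. g x - h x) = 0"
    using L2_norm_nonneg[of "\<lambda>x. g x - h x"] by linarith
  then have "AE x in lborel. g x - h x = 0"
    by (intro L2_norm_eq_0_AE L2_diff gh)
  then show ?thesis by eventually_elim simp
qed

lemma L2_pairing_tendsto:
  assumes "\<forall>\<^sub>F t in F. f t \<in> L2" "\<forall>\<^sub>F t in F. g t \<in> L2" "f0 \<in> L2" "g0 \<in> L2"
    and f: "((\<lambda>t. L2_norm (\<lambda>x. f t x - f0 x)) \<longlongrightarrow> 0) F" and g: "((\<lambda>t. L2_norm (\<lambda>x. g t x - g0 x)) \<longlongrightarrow> 0) F"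
  shows "((\<lambda>t. \<integral>x. f t x * g t x \<partial>lborel) \<longlongrightarrow> (\<integral>x. f0 x * g0 x \<partial>lborel)) F"
proof (rule LIM_zero_cancel, rule Lim_null_comparison)
  show "((\<lambda>t. L2_norm (\<lambda>x. f t x - f0 x) * (L2_norm (\<lambda>x. g t x - g0 x) + L2_norm g0)
      + L2_norm f0 * L2_norm (\<lambda>x. g t x - g0 x)) \<longlongrightarrow> 0) F"
    using tendsto_add[OF tendsto_mult[OF f tendsto_add[OF g tendsto_const[of "L2_norm g0"]]] tendsto_mult_left[OF g, of "L2_norm f0"]]
    by simp
  show "\<forall>\<^sub>F t in F. norm ((\<integral>x. f t x * g t x \<partial>lborel) - (\<integral>x. f0 x * g0 x \<partial>lborel))
     \<le> L2_norm (\<lambda>x. f t x - f0 x) * (L2_norm (\<lambda>x. g t x - g0 x) + L2_norm g0)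
      + L2_norm f0 * L2_norm (\<lambda>x. g t x - g0 x)"
    using assms(1,2)
  proof eventually_elim
    case (elim t)
    have "(\<integral>x. f t x * g t x \<partial>lborel) - (\<integral>x. f0 x * g0 x \<partial>lborel)
      = (\<integral>x. (f t x - f0 x) * g t x \<partial>lborel) + (\<integral>x. f0 x * (g t x - g0 x) \<partial>lborel)"
      using L2_mult_integrable[OF elim] L2_mult_integrable[OF assms(3) elim(2)] L2_mult_integrable[OF assms(3,4)]
      by (simp add: algebra_simps)
    also have "norm \<dots> \<le> L2_norm (\<lambda>x. f t x - f0 x) * L2_norm (g t) + L2_norm f0 * L2_norm (\<lambda>x. g t x - g0 x)"
      by (intro order_trans[OF norm_triangle_ineq] add_mono L2_pairing_bound L2_diff elim assms(3,4))
    also have "\<dots> \<le> L2_norm (\<lambda>x. f t x - f0 x) * (L2_norm (\<lambda>x. g t x - g0 x) + L2_norm g0)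
      + L2_norm f0 * L2_norm (\<lambda>x. g t x - g0 x)"
      using L2_add(2)[OF L2_diff(1)[OF elim(2) assms(4)] assms(4)]
      by (intro add_mono mult_left_mono) auto
    finally show ?case .
  qed
qed

section \<open>The Riesz representation theorem\<close>

lemma L2_norm_add_sq:
  assumes "f \<in> L2" "g \<in> L2"
  shows "(L2_norm (\<lambda>x. f x + g x))\<^sup>2 = (L2_norm f)\<^sup>2 + 2 * Re (\<integral>x. f x * cnj (g x) \<partial>lborel) + (L2_norm g)\<^sup>2"
proof -
  have i: "integrable lborel (\<lambda>x. f x * cnj (g x))"
    by (intro L2_mult_integrable assms L2_cnj)
  have "(L2_norm (\<lambda>x. f x + g x))\<^sup>2
      = (\<integral>x. (norm (f x))\<^sup>2 + 2 * Re (f x * cnj (g x)) + (norm (g x))\<^sup>2 \<partial>lborel)"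
    unfolding L2_norm_sq by (simp only: cmod_power2) (simp add: power2_eq_square algebra_simps)
  also have "\<dots> = (L2_norm f)\<^sup>2 + 2 * Re (\<integral>x. f x * cnj (g x) \<partial>lborel) + (L2_norm g)\<^sup>2"
  proof -
    have *: "(\<integral>x. p x + 2 * r x + q x \<partial>lborel) = (\<integral>x. p x \<partial>lborel) + 2 * (\<integral>x. r x \<partial>lborel) + (\<integral>x. q x \<partial>lborel)"
      if "integrable lborel p" "integrable lborel r" "integrable lborel q" for p q r :: "'a \<Rightarrow> real"
      using that by simp
    show ?thesis
      using *[OF L2_integrable_sq[OF assms(1)] integrable_Re[OF i] L2_integrable_sq[OF assms(2)]]
      by (simp only: L2_norm_sq integral_Re[OF i])
  qed
  finally show ?thesis .
qed

text \<open>Direct method: minimise J f = ||f||^2 - 2 Re (L f). The pairing is bilinear, so the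
  representing function is the conjugate of the minimiser. The theorem is what turns the limits of
  the profile pairings into a function.\<close>

lemma L2_Riesz:
  fixes L :: "('a::euclidean_space \<Rightarrow> complex) \<Rightarrow> complex"
  assumes add: "\<And>f g. f \<in> L2 \<Longrightarrow> g \<in> L2 \<Longrightarrow> L (\<lambda>x. f x + g x) = L f + L g"
    and scale: "\<And>c f. f \<in> L2 \<Longrightarrow> L (\<lambda>x. c * f x) = c * L f"
    and bd: "\<And>f. f \<in> L2 \<Longrightarrow> norm (L f) \<le> E * L2_norm f"
  shows "\<exists>Y\<in>L2. \<forall>f\<in>L2. L f = (\<integral>x. Y x * f x \<partial>lborel)"
proof -
  define J where "J f = (L2_norm f)\<^sup>2 - 2 * Re (L f)" for f
  have diff: "L (\<lambda>x. f x - g x) = L f - L g" if "f \<in> L2" "g \<in> L2" for f g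
    using add[OF that(1) L2_cmult(1)[OF that(2), of "-1"]] scale[OF that(2), of "-1"] by simp
  have J_ge: "- E\<^sup>2 \<le> J f" if "f \<in> L2" for f
  proof -
    have "Re (L f) \<le> E * L2_norm f" using bd[OF that] complex_Re_le_cmod[of "L f"] by linarith
    moreover have "0 \<le> (L2_norm f - E)\<^sup>2" by simp
    ultimately show ?thesis by (simp add: J_def power2_diff mult.commute)
  qed
  define d where "d = Inf (J ` L2)"
  have zero: "(\<lambda>x::'a. 0) \<in> L2" by (simp add: L2_def)
  have bdd: "bdd_below (J ` L2)" using J_ge by (intro bdd_belowI[of _ "- E\<^sup>2"]) auto
  have d_le: "d \<le> J f" if "f \<in> L2" for f
    unfolding d_def using bdd that by (intro cInf_lower) auto
  \<comment> \<open>Parallelogram law: J at the midpoint F is at least d, so two functions with J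
    close to d are close to each other and a minimising sequence is Cauchy.\<close>
  have par: "(L2_norm (\<lambda>x. f x - g x))\<^sup>2 \<le> 2 * (J f - d) + 2 * (J g - d)" if fg: "f \<in> L2" "g \<in> L2" for f g
  proof -
    define F where "F x = 1/2 * (f x + g x)" for x
    have F: "F = (\<lambda>x. 1/2 * (f x + g x))" by (simp add: F_def fun_eq_iff)
    have h: "F \<in> L2" unfolding F by (intro L2_cmult L2_add fg)
    have "(L2_norm F)\<^sup>2 = (L2_norm (\<lambda>x. f x + g x))\<^sup>2 / 4"
      unfolding F by (subst L2_cmult(2)) (auto intro: L2_add fg simp: power_divide norm_divide)
    moreover have "L F = (L f + L g) / 2"
      unfolding F by (subst scale) (auto intro: L2_add fg simp: add fg)
    then have "Re (L F) = Re ((L f + L g) / 2)" by (simp only:)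
    then have "Re (L F) = (Re (L f) + Re (L g)) / 2" by (simp only: Re_divide_numeral plus_complex.sel)
    ultimately have "d \<le> (L2_norm (\<lambda>x. f x + g x))\<^sup>2 / 4 - 2 * ((Re (L f) + Re (L g)) / 2)"
      using d_le[OF h] unfolding J_def by (simp only:)
    then have "d \<le> (L2_norm (\<lambda>x. f x + g x))\<^sup>2 / 4 - (Re (L f) + Re (L g))" by argo
    moreover have "(L2_norm (\<lambda>x. f x - g x))\<^sup>2 = (L2_norm f)\<^sup>2 - 2 * Re (\<integral>x. f x * cnj (g x) \<partial>lborel) + (L2_norm g)\<^sup>2"
      using L2_norm_add_sq[OF fg(1) L2_cmult(1)[OF fg(2), of "-1"]] by (simp add: L2_norm_minus)
    ultimately show ?thesis
      using L2_norm_add_sq[OF fg] unfolding J_def by argo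
  qed
  have "\<exists>h\<in>L2. J h < d + 1 / real (Suc n)" for n
  proof -
    have "Inf (J ` L2) < d + 1 / real (Suc n)" by (simp add: d_def)
    then show ?thesis using zero bdd by (subst (asm) cInf_less_iff) auto
  qed
  then obtain h where h: "\<And>n. h n \<in> L2" "\<And>n. J (h n) < d + 1 / real (Suc n)" by metis
  have "\<exists>M. \<forall>m\<ge>M. \<forall>n\<ge>M. L2_norm (\<lambda>x. h m x - h n x) < e" if "0 < e" for e
  proof -
    have "0 < e\<^sup>2 / 4" using that by simp
    from reals_Archimedean[OF this] obtain M where M: "1 / real (Suc M) < e\<^sup>2 / 4"
      unfolding inverse_eq_divide by blast
    have "L2_norm (\<lambda>x. h m x - h n x) < e" if "m \<ge> M" "n \<ge> M" for m n
    proof -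
      have "1 / real (Suc m) \<le> 1 / real (Suc M)" "1 / real (Suc n) \<le> 1 / real (Suc M)"
        using that by (auto simp: frac_le)
      then have "(L2_norm (\<lambda>x. h m x - h n x))\<^sup>2 < e\<^sup>2"
        using par[OF h(1)[of m] h(1)[of n]] h(2)[of m] h(2)[of n] M by argo
      then show ?thesis using \<open>0 < e\<close> by (simp add: power2_less_imp_less)
    qed
    then show ?thesis by blast
  qed
  from L2_complete[OF h(1) this] obtain k where k: "k \<in> L2" "(\<lambda>n. L2_norm (\<lambda>x. h n x - k x)) \<longlonglongrightarrow> 0" by blast
  have n1: "(\<lambda>n. L2_norm (h n)) \<longlonglongrightarrow> L2_norm k"
    by (rule LIM_zero_cancel, rule Lim_null_comparison[OF _ k(2)])
       (use L2_norm_diff_bound[OF h(1) k(1)] in auto)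
  have n2: "(\<lambda>n. L (h n)) \<longlonglongrightarrow> L k"
  proof (rule LIM_zero_cancel, rule Lim_null_comparison)
    show "(\<lambda>n. E * L2_norm (\<lambda>x. h n x - k x)) \<longlonglongrightarrow> 0" using tendsto_mult_left[OF k(2), of E] by simp
    show "\<forall>\<^sub>F n in sequentially. norm (L (h n) - L k) \<le> E * L2_norm (\<lambda>x. h n x - k x)"
      using bd[OF L2_diff(1)[OF h(1) k(1)]] diff[OF h(1) k(1)] by auto
  qed
  have "(\<lambda>n. J (h n)) \<longlonglongrightarrow> J k"
    unfolding J_def by (intro tendsto_intros n1 n2)
  moreover have "(\<lambda>n. d + 1 / real (Suc n)) \<longlonglongrightarrow> d"
    using tendsto_add[OF tendsto_const[of d] LIMSEQ_inverse_real_of_nat] by (simp add: inverse_eq_divide)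
  ultimately have Jk: "J k \<le> d"
    by (rule LIMSEQ_le) (use h(2) in \<open>blast intro: less_imp_le\<close>)
  \<comment> \<open>First variation: J (k + s f) - J k is a quadratic in s that is never negative,
    so its linear coefficient D must vanish.\<close>
  have re: "Re (\<integral>x. k x * cnj (f x) \<partial>lborel) = Re (L f)" if f: "f \<in> L2" for f
  proof -
    define D where "D = Re (\<integral>x. k x * cnj (f x) \<partial>lborel) - Re (L f)"
    have q: "0 \<le> 2 * s * D + s\<^sup>2 * (L2_norm f)\<^sup>2" for s :: real
    proof -
      have sf: "(\<lambda>x. of_real s * f x) \<in> L2" by (intro L2_cmult f)
      have "J k \<le> J (\<lambda>x. k x + of_real s * f x)"
        using Jk d_le[OF L2_add(1)[OF k(1) sf]] by linarith
      also have "(\<integral>x. k x * cnj (of_real s * f x) \<partial>lborel) = of_real s * (\<integral>x. k x * cnj (f x) \<partial>lborel)"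
        by (subst integral_mult_right_zero[symmetric]) (simp add: mult_ac)
      then have "J (\<lambda>x. k x + of_real s * f x) = J k + 2 * s * D + s\<^sup>2 * (L2_norm f)\<^sup>2"
        unfolding J_def L2_norm_add_sq[OF k(1) sf] D_def using f k(1) sf
        by (simp add: add scale L2_cmult(2) power_mult_distrib algebra_simps)
      finally show ?thesis by simp
    qed
    have "D = 0"
    proof (rule ccontr)
      assume D: "D \<noteq> 0"
      \<comment> \<open>The added 1 keeps B positive when f has norm zero; at s = - D / B the
        quadratic equals - D^2 / B - (D / B)^2, negative unless D = 0.\<close>
      define B where "B = (L2_norm f)\<^sup>2 + 1"
      have B: "B > 0" unfolding B_def using zero_le_power2[of "L2_norm f"] by linarith
      have B1: "(L2_norm f)\<^sup>2 = B - 1" by (simp add: B_def)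
      have e: "2 * (- D / B) * D + (- D / B)\<^sup>2 * (B - 1) = - (D\<^sup>2 / B) - (D / B)\<^sup>2"
        using B by (simp add: field_simps power2_eq_square)
      have "0 < D\<^sup>2 / B" using B D by simp
      moreover have "0 \<le> - (D\<^sup>2 / B) - (D / B)\<^sup>2" using q[of "- D / B"] unfolding B1 e .
      ultimately show False using zero_le_power2[of "D/B"] by linarith
    qed
    then show ?thesis by (simp add: D_def)
  qed
  have "L f = (\<integral>x. cnj (k x) * f x \<partial>lborel)" if f: "f \<in> L2" for f
  proof (rule complex_eqI)
    have c: "(\<integral>x. k x * cnj (f x) \<partial>lborel) = cnj (\<integral>x. cnj (k x) * f x \<partial>lborel)" for f
    proof -
      have "(\<lambda>x. k x * cnj (f x)) = (\<lambda>x. cnj (cnj (k x) * f x))" by (simp add: fun_eq_iff)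
      then show ?thesis by (simp only: Bochner_Integration.integral_cnj)
    qed
    define I where "I = (\<integral>x. cnj (k x) * f x \<partial>lborel)"
    show "Re (L f) = Re (\<integral>x. cnj (k x) * f x \<partial>lborel)"
      using re[OF f] unfolding c[of f] by (simp only: cnj.sel)
    have i: "(\<integral>x. cnj (k x) * (- \<i> * f x) \<partial>lborel) = - \<i> * I"
      unfolding I_def using integral_mult_right_zero[of lborel "- \<i>" "\<lambda>x. cnj (k x) * f x"]
      by (simp only: mult.left_commute)
    \<comment> \<open>The identity of real parts, applied to - i f, is the identity of imaginary
      parts.\<close>
    have "Re (cnj (- \<i> * I)) = Re (- \<i> * L f)"
      using re[OF L2_cmult(1)[OF f, of "- \<i>"]] unfolding c[of "\<lambda>x. - \<i> * f x"] i scale[OF f] .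
    then show "Im (L f) = Im (\<integral>x. cnj (k x) * f x \<partial>lborel)"
      unfolding I_def[symmetric] by simp
  qed
  then show ?thesis by (intro bexI[of _ "\<lambda>x. cnj (k x)"] ballI L2_cnj(1) k(1))
qed

section \<open>Integration on Euclidean space\<close>

lemma distr_lborel_reflect: "distr lborel borel (\<lambda>x. a - x) = (lborel :: 'a::euclidean_space measure)"
  by (subst (2) lborel_affine[of "-1" a]) (auto simp: density_1)

lemma integral_lborel_reflect:
  fixes f :: "'a::euclidean_space \<Rightarrow> 'b::{banach,second_countable_topology}"
  shows "(\<integral>x. f (a - x) \<partial>lborel) = (\<integral>x. f x \<partial>lborel)"
proof (cases "f \<in> borel_measurable borel")
  case True
  then show ?thesis
    by (subst (2) distr_lborel_reflect[of a, symmetric]) (simp add: integral_distr)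
next
  \<comment> \<open>Reflection is an involution, so both integrands are non-measurable together and
    both integrals take the default value 0.\<close>
  case False
  have "(\<lambda>x. f (a - x)) \<notin> borel_measurable borel"
  proof
    assume "(\<lambda>x. f (a - x)) \<in> borel_measurable borel"
    then have "(\<lambda>x. f (a - (a - x))) \<in> borel_measurable borel" by measurable
    then show False using False by simp
  qed
  then have "\<not> integrable lborel (\<lambda>x. f (a - x))" "\<not> integrable lborel f"
    using False by (auto dest: borel_measurable_integrable)
  then show ?thesis by (simp add: not_integrable_integral_eq)
qed

lemma integrable_lborel_reflect:
  fixes f :: "'a::euclidean_space \<Rightarrow> 'b::{banach,second_countable_topology}"
  assumes "integrable lborel f" shows "integrable lborel (\<lambda>x. f (a - x))"
proof -
  have [measurable]: "f \<in> borel_measurable borel" using assms by auto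
  have "integrable (distr lborel borel (\<lambda>x. a - x)) f" using assms by (simp add: distr_lborel_reflect)
  then show ?thesis by (subst (asm) integrable_distr_eq) auto
qed

lemma nn_integral_lborel_reflect:
  assumes [measurable]: "f \<in> borel_measurable borel"
  shows "(\<integral>\<^sup>+x. f (a - x) \<partial>lborel) = (\<integral>\<^sup>+x. f x \<partial>(lborel :: 'a::euclidean_space measure))"
  by (subst (2) distr_lborel_reflect[of a, symmetric]) (simp add: nn_integral_distr)

lemma AE_lborel_uminus:
  assumes "AE x in (lborel :: 'a::euclidean_space measure). P x"
  shows "AE x in lborel. P (- x)"
proof -
  have "AE x in distr lborel borel (\<lambda>x::'a. 0 - x). P x"
    unfolding distr_lborel_reflect by (rule assms)
  then show ?thesis using AE_distrD[of "\<lambda>x. 0 - x" lborel borel P] by simp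
qed

lemma integral_lborel_scaleR:
  fixes f :: "'a::euclidean_space \<Rightarrow> 'b::{banach,second_countable_topology}"
  assumes [measurable]: "f \<in> borel_measurable borel" and "0 < c"
  shows "(\<integral>x. f x \<partial>lborel) = c ^ DIM('a) *\<^sub>R (\<integral>x. f (c *\<^sub>R x) \<partial>lborel)"
proof -
  have "(\<integral>x. f x \<partial>lborel)
      = (\<integral>x. f x \<partial>density (distr lborel borel (\<lambda>x::'a. 0 + c *\<^sub>R x)) (\<lambda>_. ennreal (\<bar>c\<bar> ^ DIM('a))))"
    using lborel_affine[of c "0::'a"] \<open>0 < c\<close> by (simp add: ennreal_power)
  also have "\<dots> = c ^ DIM('a) *\<^sub>R (\<integral>x. f (c *\<^sub>R x) \<partial>lborel)"
    using \<open>0 < c\<close> by (subst integral_density) (auto simp: integral_distr)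
  finally show ?thesis .
qed

lemma lborel_Fubini_dominated:
  fixes K :: "'a::euclidean_space \<Rightarrow> 'b::euclidean_space \<Rightarrow> complex"
  assumes [measurable]: "(\<lambda>(x, y). K x y) \<in> borel_measurable (borel \<Otimes>\<^sub>M borel)"
    and f: "integrable lborel f" and g: "integrable lborel g"
    and le: "\<And>x y. norm (K x y) \<le> f x * g y"
  shows "(\<integral>x. (\<integral>y. K x y \<partial>lborel) \<partial>lborel) = (\<integral>y. (\<integral>x. K x y \<partial>lborel) \<partial>lborel)"
    and "integrable lborel (\<lambda>x. \<integral>y. K x y \<partial>lborel)"
    and "integrable lborel (\<lambda>y. \<integral>x. K x y \<partial>lborel)"
proof -
  have [measurable]: "f \<in> borel_measurable borel" "g \<in> borel_measurable borel" using f g by auto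
  have "integrable (lborel \<Otimes>\<^sub>M lborel) (\<lambda>(x, y). f x * g y)"
    by (rule lborel_pair.Fubini_integrable)
       (use f g in \<open>auto simp: abs_mult integrable_norm[of _ f, simplified]\<close>)
  then have *: "integrable (lborel \<Otimes>\<^sub>M lborel) (\<lambda>(x, y). K x y)"
    by (rule Bochner_Integration.integrable_bound) (auto intro!: AE_I2 order_trans[OF le abs_ge_self])
  show "(\<integral>x. (\<integral>y. K x y \<partial>lborel) \<partial>lborel) = (\<integral>y. (\<integral>x. K x y \<partial>lborel) \<partial>lborel)"
    using lborel_pair.Fubini_integral[OF *] by simp
  show "integrable lborel (\<lambda>x. \<integral>y. K x y \<partial>lborel)"
    using lborel_pair.integrable_fst[OF *] by simp
  show "integrable lborel (\<lambda>y. \<integral>x. K x y \<partial>lborel)"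
    using lborel_pair.integrable_snd[OF *] by simp
qed

lemma lborel_integral_Basis_prod:
  fixes h :: "'a::euclidean_space \<Rightarrow> real \<Rightarrow> complex"
  assumes h: "\<And>b. b \<in> Basis \<Longrightarrow> integrable lborel (h b)"
  shows "integrable lborel (\<lambda>x::'a. \<Prod>b\<in>Basis. h b (x \<bullet> b))"
    and "(\<integral>x. (\<Prod>b\<in>Basis. h b (x \<bullet> b)) \<partial>(lborel :: 'a measure)) = (\<Prod>b\<in>Basis. (\<integral>s. h b s \<partial>lborel))"
proof -
  interpret P: product_sigma_finite "\<lambda>b::'a. lborel :: real measure" ..
  have [measurable]: "h b \<in> borel_measurable borel" if "b \<in> Basis" for b using h[OF that] by auto
  let ?T = "\<lambda>f. \<Sum>b\<in>Basis. f b *\<^sub>R (b::'a)"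
  have T: "?T f \<bullet> b = f b" if "b \<in> Basis" for f b using that by simp
  have m: "(\<lambda>x::'a. \<Prod>b\<in>Basis. h b (x \<bullet> b)) \<in> borel_measurable borel" by measurable
  have [measurable]: "?T \<in> measurable (\<Pi>\<^sub>M b\<in>Basis. lborel) borel" by measurable
  have eq: "(\<Prod>b\<in>Basis. h b (?T f \<bullet> b)) = (\<Prod>b\<in>Basis. h b (f b))" for f
    by (rule prod.cong) auto
  have "integrable (\<Pi>\<^sub>M b\<in>Basis. lborel) (\<lambda>f. \<Prod>b\<in>(Basis::'a set). h b (f b))"
    by (rule P.product_integrable_prod) (auto intro: h)
  then show "integrable lborel (\<lambda>x::'a. \<Prod>b\<in>Basis. h b (x \<bullet> b))"
    by (subst lborel_eq, subst integrable_distr_eq) (use m in \<open>auto simp only: eq intro!: TrueI\<close>, measurable)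
  have "(\<integral>x. (\<Prod>b\<in>Basis. h b (x \<bullet> b)) \<partial>(lborel :: 'a measure))
      = (\<integral>f. (\<Prod>b\<in>(Basis::'a set). h b (f b)) \<partial>(\<Pi>\<^sub>M b\<in>Basis. lborel))"
    by (subst lborel_eq, subst integral_distr) (use m in \<open>auto simp only: eq intro!: TrueI\<close>, measurable)
  also have "\<dots> = (\<Prod>b\<in>Basis. (\<integral>s. h b s \<partial>lborel))"
    by (rule P.product_integral_prod) (auto intro: h)
  finally show "(\<integral>x. (\<Prod>b\<in>Basis. h b (x \<bullet> b)) \<partial>(lborel :: 'a measure)) = (\<Prod>b\<in>Basis. (\<integral>s. h b s \<partial>lborel))" .
qed

lemma cis_borel_measurable [measurable]:
  "f \<in> borel_measurable M \<Longrightarrow> (\<lambda>x. cis (f x)) \<in> borel_measurable M"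
  by (rule measurable_compose[of f]) (auto intro!: borel_measurable_continuous_onI continuous_intros)

lemma cis_sum: "finite A \<Longrightarrow> cis (\<Sum>a\<in>A. f a) = (\<Prod>a\<in>A. cis (f a))"
  by (induction A rule: finite_induct) (auto simp: cis_mult[symmetric])

section \<open>Gaussians\<close>

text \<open>The characteristic function of the standard normal distribution, rescaled by sqrt
  \<kappa>.\<close>

lemma gaussian_fourier_real:
  assumes "0 < (\<kappa>::real)"
  shows "integrable lborel (\<lambda>x::real. cis (- (x * \<xi>)) * of_real (exp (- \<kappa> * x\<^sup>2 / 2)))"
    and "(\<integral>x. cis (- (x * \<xi>)) * of_real (exp (- \<kappa> * x\<^sup>2 / 2)) \<partial>lborel)
      = of_real (sqrt (2 * pi / \<kappa>) * exp (- \<xi>\<^sup>2 / (2 * \<kappa>)))"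
proof -
  have i0: "integrable lborel (\<lambda>x. cis (- (x * t)) * of_real (std_normal_density x))" for t
    by (rule Bochner_Integration.integrable_bound[of _ std_normal_density])
       (auto simp: norm_mult intro!: integrable_normal_density)
  have v0: "(\<integral>x. cis (- (x * t)) * of_real (std_normal_density x) \<partial>lborel) = of_real (exp (- t\<^sup>2 / 2))" for t
  proof -
    have "char std_normal_distribution (- t) = (\<integral>x. cis (- (x * t)) * of_real (std_normal_density x) \<partial>lborel)"
      unfolding char_def
      by (subst integral_density)
         (auto simp: scaleR_conv_of_real cis_conv_exp mult_ac intro!: Bochner_Integration.integral_cong)
    then show ?thesis by (simp add: char_std_normal_distribution)
  qed
  define t where "t = \<xi> / sqrt \<kappa>"
  have eq: "cis (- ((sqrt \<kappa> * x) * t)) * of_real (std_normal_density (sqrt \<kappa> * x))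
     = of_real (1 / sqrt (2 * pi)) * (cis (- (x * \<xi>)) * of_real (exp (- \<kappa> * x\<^sup>2 / 2)))" for x
    using assms by (simp add: t_def std_normal_density_def power_mult_distrib mult_ac)
  have "integrable lborel (\<lambda>x. cis (- ((0 + sqrt \<kappa> * x) * t)) * of_real (std_normal_density (0 + sqrt \<kappa> * x)))"
    using assms lborel_integrable_real_affine[OF i0[of t], of "sqrt \<kappa>" 0] by simp
  then have i: "integrable lborel (\<lambda>x. of_real (1 / sqrt (2 * pi)) * (cis (- (x * \<xi>)) * of_real (exp (- \<kappa> * x\<^sup>2 / 2))))"
    by (simp only: add_0 eq)
  then have "integrable lborel (\<lambda>x. of_real (sqrt (2*pi)) * (of_real (1 / sqrt (2 * pi)) * (cis (- (x * \<xi>)) * of_real (exp (- \<kappa> * x\<^sup>2 / 2)))))"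
    by (rule integrable_mult_right)
  then show "integrable lborel (\<lambda>x::real. cis (- (x * \<xi>)) * of_real (exp (- \<kappa> * x\<^sup>2 / 2)))"
    by (simp add: mult.assoc[symmetric] flip: of_real_mult)
  have "complex_of_real (exp (- t\<^sup>2 / 2)) = sqrt \<kappa> *\<^sub>R (\<integral>x. cis (- ((0 + sqrt \<kappa> * x) * t)) * of_real (std_normal_density (0 + sqrt \<kappa> * x)) \<partial>lborel)"
    using assms lborel_integral_real_affine[of "sqrt \<kappa>" "\<lambda>x. cis (- (x * t)) * of_real (std_normal_density x)" 0] v0[of t]
    by simp
  also have "\<dots> = sqrt \<kappa> *\<^sub>R (of_real (1 / sqrt (2 * pi)) * (\<integral>x. cis (- (x * \<xi>)) * of_real (exp (- \<kappa> * x\<^sup>2 / 2)) \<partial>lborel))"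
    by (simp only: add_0 eq integral_mult_right_zero)
  finally have e: "complex_of_real (exp (- t\<^sup>2 / 2))
     = of_real (sqrt \<kappa> / sqrt (2 * pi)) * (\<integral>x. cis (- (x * \<xi>)) * of_real (exp (- \<kappa> * x\<^sup>2 / 2)) \<partial>lborel)"
    by (simp add: scaleR_conv_of_real)
  have t2: "- t\<^sup>2 / 2 = - \<xi>\<^sup>2 / (2 * \<kappa>)" using assms by (simp add: t_def power_divide)
  have "complex_of_real (sqrt (2 * pi / \<kappa>)) * of_real (sqrt \<kappa> / sqrt (2 * pi)) = of_real 1"
    unfolding of_real_mult[symmetric] of_real_eq_iff using assms by (simp add: real_sqrt_divide)
  then show "(\<integral>x. cis (- (x * \<xi>)) * of_real (exp (- \<kappa> * x\<^sup>2 / 2)) \<partial>lborel)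
      = of_real (sqrt (2 * pi / \<kappa>) * exp (- \<xi>\<^sup>2 / (2 * \<kappa>)))"
    using e unfolding t2 of_real_mult by (simp add: mult.assoc[symmetric] del: of_real_divide)
qed

lemma
  fixes \<xi> :: "'a::euclidean_space"
  assumes "0 < \<kappa>"
  shows gaussian_fourier_integrable: "integrable lborel (\<lambda>x::'a. cis (- (x \<bullet> \<xi>)) * of_real (exp (- \<kappa> * (norm x)\<^sup>2 / 2)))"
    and gaussian_fourier: "(\<integral>x. cis (- (x \<bullet> \<xi>)) * of_real (exp (- \<kappa> * (norm x)\<^sup>2 / 2)) \<partial>lborel)
      = of_real (sqrt (2 * pi / \<kappa>) ^ DIM('a) * exp (- (norm \<xi>)\<^sup>2 / (2 * \<kappa>)))"
proof -
  let ?h = "\<lambda>(b::'a) x. cis (- (x * (\<xi> \<bullet> b))) * complex_of_real (exp (- \<kappa> * x\<^sup>2 / 2))"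
  have n2: "(norm x)\<^sup>2 = (\<Sum>b\<in>Basis. (x \<bullet> b)\<^sup>2)" for x :: 'a
    unfolding power2_norm_eq_inner by (subst euclidean_inner) (simp add: power2_eq_square)
  have eq: "cis (- (x \<bullet> \<xi>)) * of_real (exp (- \<kappa> * (norm x)\<^sup>2 / 2)) = (\<Prod>b\<in>Basis. ?h b (x \<bullet> b))" for x :: 'a
  proof -
    have "cis (- (x \<bullet> \<xi>)) = (\<Prod>b\<in>Basis. cis (- (x \<bullet> b * (\<xi> \<bullet> b))))"
      by (subst euclidean_inner) (simp add: sum_negf[symmetric] cis_sum)
    moreover have "exp (- \<kappa> * (norm x)\<^sup>2 / 2) = (\<Prod>b\<in>Basis. exp (- \<kappa> * (x \<bullet> b)\<^sup>2 / 2))"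
      unfolding n2 by (simp add: exp_sum[symmetric] sum_distrib_left sum_divide_distrib sum_negf)
    ultimately show ?thesis by (simp add: prod.distrib)
  qed
  have exi: "exp (- (norm \<xi>)\<^sup>2 / (2 * \<kappa>)) = (\<Prod>b\<in>Basis. exp (- (\<xi> \<bullet> b)\<^sup>2 / (2 * \<kappa>)))"
    unfolding n2 by (simp add: exp_sum[symmetric] sum_divide_distrib sum_negf)
  note i = gaussian_fourier_real[OF assms]
  show "integrable lborel (\<lambda>x::'a. cis (- (x \<bullet> \<xi>)) * of_real (exp (- \<kappa> * (norm x)\<^sup>2 / 2)))"
    unfolding eq by (rule lborel_integral_Basis_prod(1)) (rule i(1))
  show "(\<integral>x. cis (- (x \<bullet> \<xi>)) * of_real (exp (- \<kappa> * (norm x)\<^sup>2 / 2)) \<partial>lborel)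
      = of_real (sqrt (2 * pi / \<kappa>) ^ DIM('a) * exp (- (norm \<xi>)\<^sup>2 / (2 * \<kappa>)))"
    unfolding eq exi by (subst lborel_integral_Basis_prod(2)) (simp_all only: i prod.distrib of_real_mult of_real_prod prod_constant of_real_power)
qed

lemma
  assumes "0 < (\<kappa>::real)"
  shows gaussian_integrable: "integrable lborel (\<lambda>x::'a::euclidean_space. exp (- \<kappa> * (norm x)\<^sup>2 / 2))"
    and gaussian_integral: "(\<integral>x. exp (- \<kappa> * (norm x)\<^sup>2 / 2) \<partial>(lborel :: 'a measure)) = sqrt (2 * pi / \<kappa>) ^ DIM('a)"
proof -
  have i: "integrable lborel (\<lambda>x::'a. complex_of_real (exp (- \<kappa> * (norm x)\<^sup>2 / 2)))"
    using gaussian_fourier_integrable[OF assms, of "0::'a"] by simp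
  from integrable_Re[OF i] show "integrable lborel (\<lambda>x::'a. exp (- \<kappa> * (norm x)\<^sup>2 / 2))" by simp
  have "complex_of_real (\<integral>x. exp (- \<kappa> * (norm x)\<^sup>2 / 2) \<partial>(lborel :: 'a measure)) = of_real (sqrt (2 * pi / \<kappa>) ^ DIM('a))"
    using gaussian_fourier[OF assms, of "0::'a"] by (subst integral_complex_of_real[symmetric]) simp
  then show "(\<integral>x. exp (- \<kappa> * (norm x)\<^sup>2 / 2) \<partial>(lborel :: 'a measure)) = sqrt (2 * pi / \<kappa>) ^ DIM('a)"
    unfolding of_real_eq_iff .
qed

section \<open>The Fourier integral\<close>

lemma fourier_const: "(2 * pi) powr (- real n / 2) = 1 / sqrt (2 * pi) ^ n"
proof -
  have "(2 * pi) powr (- real n / 2) = ((2 * pi) powr (1/2)) powr (- real n)"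
    by (simp add: powr_powr)
  also have "\<dots> = 1 / sqrt (2 * pi) ^ n"
    by (simp add: powr_half_sqrt powr_minus powr_realpow inverse_eq_divide)
  finally show ?thesis .
qed

lemma cnj_borel_measurable [measurable]:
  "f \<in> borel_measurable M \<Longrightarrow> (\<lambda>x. cnj (f x)) \<in> borel_measurable M"
  by (rule measurable_compose[of f]) (auto intro!: borel_measurable_continuous_onI continuous_intros)

lemma fourier_integrand_integrable:
  fixes f :: "'a::euclidean_space \<Rightarrow> complex"
  assumes "integrable lborel f"
  shows "integrable lborel (\<lambda>x. cis (- (x \<bullet> \<xi>)) * f x)" "integrable lborel (\<lambda>x. cis (x \<bullet> \<xi>) * f x)"
proof -
  have [measurable]: "f \<in> borel_measurable borel" using assms by auto
  show "integrable lborel (\<lambda>x. cis (- (x \<bullet> \<xi>)) * f x)" "integrable lborel (\<lambda>x. cis (x \<bullet> \<xi>) * f x)"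
    by (rule Bochner_Integration.integrable_bound[OF assms]; simp add: norm_mult)+
qed

lemma fourier_integral_bound:
  fixes f :: "'a::euclidean_space \<Rightarrow> complex"
  shows "norm (fourier_integral f \<xi>) \<le> (2 * pi) powr (- real DIM('a) / 2) * (\<integral>x. norm (f x) \<partial>lborel)"
proof -
  have "norm (\<integral>x. cis (- (x \<bullet> \<xi>)) * f x \<partial>lborel) \<le> (\<integral>x. norm (cis (- (x \<bullet> \<xi>)) * f x) \<partial>lborel)"
    by (rule integral_norm_bound)
  then show ?thesis
    by (auto simp: fourier_integral_def norm_mult intro!: mult_left_mono)
qed

lemma fourier_integral_measurable [measurable]:
  fixes f :: "'a::euclidean_space \<Rightarrow> complex"
  assumes [measurable]: "f \<in> borel_measurable borel"
  shows "fourier_integral f \<in> borel_measurable borel"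
  unfolding fourier_integral_def[abs_def] by measurable

lemma fourier_integral_add:
  assumes "integrable lborel f" "integrable lborel g"
  shows "fourier_integral (\<lambda>x. f x + g x) \<xi> = fourier_integral f \<xi> + fourier_integral g \<xi>"
  using fourier_integrand_integrable(1)[OF assms(1), of \<xi>] fourier_integrand_integrable(1)[OF assms(2), of \<xi>]
  by (simp add: fourier_integral_def distrib_left right_diff_distrib)

lemma fourier_integral_cmult: "fourier_integral (\<lambda>x. c * f x) \<xi> = c * fourier_integral f \<xi>"
proof -
  have "(\<lambda>x. cis (- (x \<bullet> \<xi>)) * (c * f x)) = (\<lambda>x. c * (cis (- (x \<bullet> \<xi>)) * f x))"
    by (simp add: fun_eq_iff)
  then show ?thesis by (simp add: fourier_integral_def)
qed

lemma fourier_integral_diff: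
  assumes "integrable lborel f" "integrable lborel g"
  shows "fourier_integral (\<lambda>x. f x - g x) \<xi> = fourier_integral f \<xi> - fourier_integral g \<xi>"
  using fourier_integrand_integrable(1)[OF assms(1), of \<xi>] fourier_integrand_integrable(1)[OF assms(2), of \<xi>]
  by (simp add: fourier_integral_def distrib_left right_diff_distrib)

lemma fourier_integral_cong_AE:
  assumes "AE x in lborel. f x = g x" and [measurable]: "f \<in> borel_measurable borel" "g \<in> borel_measurable borel"
  shows "fourier_integral f = fourier_integral g"
proof
  fix \<xi>
  have "(\<integral>x. cis (- (x \<bullet> \<xi>)) * f x \<partial>lborel) = (\<integral>x. cis (- (x \<bullet> \<xi>)) * g x \<partial>lborel)"
    using assms(1) by (intro integral_cong_AE) (auto elim: eventually_mono)
  then show "fourier_integral f \<xi> = fourier_integral g \<xi>" by (simp add: fourier_integral_def)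
qed

lemma fourier_integral_reflect:
  "fourier_integral (\<lambda>x. f (- x)) \<xi> = fourier_integral f (- \<xi>)"
  using integral_lborel_reflect[of "\<lambda>x. cis (x \<bullet> \<xi>) * f x" 0] by (simp add: fourier_integral_def)

text \<open>The centred Gaussian density of variance \<kappa> in each coordinate. Convolution with
  it is the multiplier exp (- \<kappa> |\<xi>|^2 / 2), and for \<kappa> tending to 0 it is an
  approximate identity.\<close>

definition heat :: "real \<Rightarrow> 'a::euclidean_space \<Rightarrow> real" where
  "heat \<kappa> x = exp (- (norm x)\<^sup>2 / (2 * \<kappa>)) / sqrt (2 * pi * \<kappa>) ^ DIM('a)"

lemma heat_nonneg: "0 < \<kappa> \<Longrightarrow> 0 \<le> heat \<kappa> x" by (simp add: heat_def)

lemma heat_measurable [measurable]: "heat \<kappa> \<in> borel_measurable borel"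
  unfolding heat_def[abs_def] by measurable

lemma heat_integrable: "0 < \<kappa> \<Longrightarrow> integrable lborel (heat \<kappa>)"
  using gaussian_integrable[of "1/\<kappa>"] by (auto simp: heat_def[abs_def] mult.commute)

lemma heat_integral: "0 < \<kappa> \<Longrightarrow> (\<integral>x. heat \<kappa> (x::'a::euclidean_space) \<partial>lborel) = 1"
  using gaussian_integral[of "1/\<kappa>", where 'a='a] by (simp add: heat_def mult.commute)

lemma heat_scaleR:
  assumes "0 < \<kappa>"
  shows "sqrt \<kappa> ^ DIM('a) * heat \<kappa> (sqrt \<kappa> *\<^sub>R x) = heat 1 (x::'a::euclidean_space)"
proof -
  have n: "(norm (sqrt \<kappa> *\<^sub>R x))\<^sup>2 = \<kappa> * (norm x)\<^sup>2"
    using assms by (simp add: power_mult_distrib)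
  have e: "- (\<kappa> * (norm x)\<^sup>2) / (2 * \<kappa>) = - (norm x)\<^sup>2 / (2 * 1)" using assms by simp
  have "sqrt (2 * pi * \<kappa>) ^ DIM('a) = sqrt \<kappa> ^ DIM('a) * sqrt (2 * pi * 1) ^ DIM('a)"
    by (simp only: real_sqrt_mult power_mult_distrib) simp
  then show ?thesis unfolding heat_def n e using assms by simp
qed

text \<open>Regularised inversion: Gaussian damping makes the double integral absolutely convergent,
  so Fubini applies and the inner integral is the explicit Gaussian transform. The argument - x
  turns the outer transform into an inverse one.\<close>

lemma fourier_heat_convolution:
  fixes f :: "'a::euclidean_space \<Rightarrow> complex"
  assumes f: "integrable lborel f" and \<kappa>: "0 < \<kappa>"
  shows "fourier_integral (\<lambda>\<xi>. of_real (exp (- \<kappa> * (norm \<xi>)\<^sup>2 / 2)) * fourier_integral f \<xi>) (- x)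
      = (\<integral>y. of_real (heat \<kappa> (x - y)) * f y \<partial>lborel)"
proof -
  have [measurable]: "f \<in> borel_measurable borel" using f by auto
  define c where "c = (2 * pi) powr (- real DIM('a) / 2)"
  let ?e = "\<lambda>\<xi>::'a. exp (- \<kappa> * (norm \<xi>)\<^sup>2 / 2)"
  let ?K = "\<lambda>\<xi> y. cis (x \<bullet> \<xi>) * (of_real (?e \<xi>) * (cis (- (y \<bullet> \<xi>)) * f y))"
  have F: "(\<integral>\<xi>. (\<integral>y. ?K \<xi> y \<partial>lborel) \<partial>lborel) = (\<integral>y. (\<integral>\<xi>. ?K \<xi> y \<partial>lborel) \<partial>lborel)"
    by (rule lborel_Fubini_dominated[of _ ?e "\<lambda>y. norm (f y)"])
       (use f gaussian_integrable[OF \<kappa>] in \<open>auto simp: norm_mult\<close>)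
  let ?I = "\<lambda>\<xi>. \<integral>y. cis (- (y \<bullet> \<xi>)) * f y \<partial>lborel"
  have "fourier_integral (\<lambda>\<xi>. of_real (?e \<xi>) * fourier_integral f \<xi>) (- x)
      = of_real c * (\<integral>\<xi>. of_real c * (cis (x \<bullet> \<xi>) * (of_real (?e \<xi>) * ?I \<xi>)) \<partial>lborel)"
    by (simp add: fourier_integral_def c_def inner_commute mult.left_commute)
  also have "\<dots> = of_real c * (of_real c * (\<integral>\<xi>. (\<integral>y. ?K \<xi> y \<partial>lborel) \<partial>lborel))"
    by (simp only: integral_mult_right_zero)
  also have "(\<integral>\<xi>. (\<integral>y. ?K \<xi> y \<partial>lborel) \<partial>lborel)
      = (\<integral>y. f y * (\<integral>\<xi>. cis (- (\<xi> \<bullet> (y - x))) * of_real (?e \<xi>) \<partial>lborel) \<partial>lborel)"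
  proof -
    have "cis (- (\<xi> \<bullet> (y - x))) = cis (x \<bullet> \<xi>) * cis (- (y \<bullet> \<xi>))" for \<xi> y
      by (simp add: cis_mult inner_diff_right inner_commute)
    then have "?K \<xi> y = f y * (cis (- (\<xi> \<bullet> (y - x))) * of_real (?e \<xi>))" for \<xi> y
      by (simp add: mult_ac)
    then show ?thesis unfolding F by (simp only: integral_mult_right_zero)
  qed
  also have "of_real c * (of_real c * (\<integral>y. f y * (\<integral>\<xi>. cis (- (\<xi> \<bullet> (y - x))) * of_real (?e \<xi>) \<partial>lborel) \<partial>lborel))
      = (\<integral>y. of_real (c * c * (sqrt (2 * pi / \<kappa>) ^ DIM('a) * exp (- (norm (y - x))\<^sup>2 / (2 * \<kappa>)))) * f y \<partial>lborel)"
    unfolding gaussian_fourier[OF \<kappa>] by (simp only: integral_mult_right_zero[symmetric]) (simp add: mult_ac)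
  also have "\<dots> = (\<integral>y. of_real (heat \<kappa> (x - y)) * f y \<partial>lborel)"
  proof -
    have "c * c * sqrt (2 * pi / \<kappa>) ^ DIM('a) = 1 / sqrt (2 * pi * \<kappa>) ^ DIM('a)"
    proof -
      have "c * c * sqrt (2 * pi / \<kappa>) ^ DIM('a) = (1 / sqrt (2*pi) * (1 / sqrt (2 * pi)) * sqrt (2 * pi / \<kappa>)) ^ DIM('a)"
        unfolding c_def fourier_const by (simp only: power_mult_distrib power_divide power_one)
      also have "1 / sqrt (2*pi) * (1 / sqrt (2 * pi)) * sqrt (2 * pi / \<kappa>) = 1 / sqrt (2 * pi * \<kappa>)"
        using \<kappa> by (simp add: real_sqrt_mult real_sqrt_divide field_simps)
      finally show ?thesis by (simp add: power_divide)
    qed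
    then show ?thesis by (simp add: heat_def norm_minus_commute mult.assoc[symmetric])
  qed
  finally show ?thesis .
qed

text \<open>Schur's test: |f x| |f y| is at most half the sum of the squares, and the kernel has
  mass 1 in either variable, so each half contributes half of ||f||^2.\<close>

lemma heat_pairing_bound:
  fixes f :: "'a::euclidean_space \<Rightarrow> complex"
  assumes fL: "f \<in> L2" and f: "integrable lborel f" and \<kappa>: "0 < \<kappa>"
  shows "norm (\<integral>x. cnj (f x) * (\<integral>y. of_real (heat \<kappa> (x - y)) * f y \<partial>lborel) \<partial>lborel) \<le> (L2_norm f)\<^sup>2"
proof -
  have [measurable]: "f \<in> borel_measurable borel" using f by auto
  have hb: "heat \<kappa> z \<le> 1 / sqrt (2 * pi * \<kappa>) ^ DIM('a)" for z :: 'a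
    using \<kappa> by (auto simp: heat_def intro!: divide_right_mono)
  have h1: "(\<integral>\<^sup>+y. ennreal (heat \<kappa> (x - y)) \<partial>lborel) = 1" for x :: 'a
    using nn_integral_lborel_reflect[of "\<lambda>y. ennreal (heat \<kappa> y)" x] heat_integral[OF \<kappa>, where 'a='a]
      nn_integral_eq_integral[OF heat_integrable[OF \<kappa>, where 'a='a]] heat_nonneg[OF \<kappa>]
    by auto
  have h2: "(\<integral>\<^sup>+x. ennreal (heat \<kappa> (x - y)) \<partial>lborel) = 1" for y :: 'a
    using h1[of y] by (simp add: heat_def norm_minus_commute)
  let ?p = "\<lambda>x y. ennreal ((norm (f x))\<^sup>2 / 2) * ennreal (heat \<kappa> (x - y)) + ennreal ((norm (f y))\<^sup>2 / 2) * ennreal (heat \<kappa> (x - y))"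
  let ?g = "\<lambda>x. \<integral>y. of_real (heat \<kappa> (x - y)) * f y \<partial>lborel"
  have ig: "integrable lborel (\<lambda>y. of_real (heat \<kappa> (x - y)) * f y)" for x
  proof (rule Bochner_Integration.integrable_bound)
    show "integrable lborel (\<lambda>y. (1 / sqrt (2 * pi * \<kappa>) ^ DIM('a)) * norm (f y))" using f by simp
    show "AE y in lborel. norm (of_real (heat \<kappa> (x - y)) * f y) \<le> norm ((1 / sqrt (2 * pi * \<kappa>) ^ DIM('a)) * norm (f y))"
    proof (rule AE_I2)
      fix y
      have "heat \<kappa> (x - y) * norm (f y) \<le> (1 / sqrt (2 * pi * \<kappa>) ^ DIM('a)) * norm (f y)"
        by (intro mult_right_mono hb) simp
      then show "norm (of_real (heat \<kappa> (x - y)) * f y) \<le> norm ((1 / sqrt (2 * pi * \<kappa>) ^ DIM('a)) * norm (f y))"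
        using heat_nonneg[OF \<kappa>, of "x - y"] \<kappa> by (simp add: norm_mult abs_mult)
    qed
  qed measurable
  have ii: "integrable lborel (\<lambda>x. cnj (f x) * ?g x)"
  proof -
    have "norm (cnj (f x) * (of_real (heat \<kappa> (x - y)) * f y))
        \<le> norm (f x) * (1 / sqrt (2 * pi * \<kappa>) ^ DIM('a) * norm (f y))" for x y
    proof -
      have "norm (cnj (f x) * (of_real (heat \<kappa> (x - y)) * f y)) = norm (f x) * (heat \<kappa> (x - y) * norm (f y))"
        using heat_nonneg[OF \<kappa>, of "x - y"] by (simp add: norm_mult)
      also have "\<dots> \<le> norm (f x) * (1 / sqrt (2 * pi * \<kappa>) ^ DIM('a) * norm (f y))"
        by (intro mult_left_mono mult_right_mono hb) auto
      finally show ?thesis .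
    qed
    then have "integrable lborel (\<lambda>x. \<integral>y. cnj (f x) * (of_real (heat \<kappa> (x - y)) * f y) \<partial>lborel)"
      using f by (intro lborel_Fubini_dominated(2)[of _ "\<lambda>x. norm (f x)" "\<lambda>y. 1 / sqrt (2 * pi * \<kappa>) ^ DIM('a) * norm (f y)"]) auto
    then show ?thesis by simp
  qed
  have "ennreal (norm (\<integral>x. cnj (f x) * ?g x \<partial>lborel)) \<le> (\<integral>\<^sup>+x. ennreal (norm (cnj (f x) * ?g x)) \<partial>lborel)"
    by (rule integral_norm_bound_ennreal[OF ii])
  also have "\<dots> \<le> (\<integral>\<^sup>+x. (\<integral>\<^sup>+y. ?p x y \<partial>lborel) \<partial>lborel)"
  proof (rule nn_integral_mono)
    fix x
    have "ennreal (norm (cnj (f x) * ?g x)) = ennreal (norm (f x)) * ennreal (norm (?g x))"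
      by (simp add: norm_mult ennreal_mult)
    also have "\<dots> \<le> ennreal (norm (f x)) * (\<integral>\<^sup>+y. ennreal (norm (of_real (heat \<kappa> (x - y)) * f y)) \<partial>lborel)"
      by (intro mult_left_mono integral_norm_bound_ennreal[OF ig]) auto
    also have "\<dots> = (\<integral>\<^sup>+y. ennreal (norm (f x)) * ennreal (norm (of_real (heat \<kappa> (x - y)) * f y)) \<partial>lborel)"
      by (rule nn_integral_cmult[symmetric]) measurable
    also have "\<dots> \<le> (\<integral>\<^sup>+y. ?p x y \<partial>lborel)"
    proof (rule nn_integral_mono)
      fix y
      let ?h = "heat \<kappa> (x - y)" and ?a = "(norm (f x))\<^sup>2 / 2" and ?b = "(norm (f y))\<^sup>2 / 2"
      have h: "0 \<le> ?h" by (rule heat_nonneg[OF \<kappa>])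
      have "norm (f x) * norm (f y) \<le> ?a + ?b"
        using sum_squares_bound[of "norm (f x)" "norm (f y)"] by linarith
      from mult_right_mono[OF this h] have "norm (f x) * norm (f y) * ?h \<le> ?a * ?h + ?b * ?h"
        unfolding distrib_right .
      moreover have "norm (of_real ?h * f y) = norm (f y) * ?h"
        using h by (simp add: norm_mult)
      ultimately have "norm (f x) * norm (of_real ?h * f y) \<le> ?a * ?h + ?b * ?h"
        by (simp only: mult.assoc)
      then have "ennreal (norm (f x) * norm (of_real ?h * f y)) \<le> ennreal (?a * ?h + ?b * ?h)"
        by (rule ennreal_leI)
      also have "\<dots> = ennreal (?a * ?h) + ennreal (?b * ?h)"
        using h by (intro ennreal_plus) auto
      also have "ennreal (?a * ?h) = ennreal ?a * ennreal ?h" using h by (intro ennreal_mult) auto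
      also have "ennreal (?b * ?h) = ennreal ?b * ennreal ?h" using h by (intro ennreal_mult) auto
      also have "ennreal (norm (f x) * norm (of_real ?h * f y)) = ennreal (norm (f x)) * ennreal (norm (of_real ?h * f y))"
        by (intro ennreal_mult) auto
      finally show "ennreal (norm (f x)) * ennreal (norm (of_real ?h * f y)) \<le> ?p x y" .
    qed
    finally show "ennreal (norm (cnj (f x) * ?g x)) \<le> (\<integral>\<^sup>+y. ?p x y \<partial>lborel)" .
  qed
  also have "\<dots> = (\<integral>\<^sup>+x. (\<integral>\<^sup>+y. ennreal ((norm (f x))\<^sup>2 / 2) * ennreal (heat \<kappa> (x - y)) \<partial>lborel) \<partial>lborel)
      + (\<integral>\<^sup>+x. (\<integral>\<^sup>+y. ennreal ((norm (f y))\<^sup>2 / 2) * ennreal (heat \<kappa> (x - y)) \<partial>lborel) \<partial>lborel)"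
  proof -
    have "(\<integral>\<^sup>+y. ?p x y \<partial>lborel) = (\<integral>\<^sup>+y. ennreal ((norm (f x))\<^sup>2 / 2) * ennreal (heat \<kappa> (x - y)) \<partial>lborel)
      + (\<integral>\<^sup>+y. ennreal ((norm (f y))\<^sup>2 / 2) * ennreal (heat \<kappa> (x - y)) \<partial>lborel)" for x
      by (rule nn_integral_add) measurable
    then show ?thesis by (simp only:) (rule nn_integral_add; measurable)
  qed
  also have "(\<integral>\<^sup>+x. (\<integral>\<^sup>+y. ennreal ((norm (f y))\<^sup>2 / 2) * ennreal (heat \<kappa> (x - y)) \<partial>lborel) \<partial>lborel)
     = (\<integral>\<^sup>+y. (\<integral>\<^sup>+x. ennreal ((norm (f y))\<^sup>2 / 2) * ennreal (heat \<kappa> (x - y)) \<partial>lborel) \<partial>lborel)"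
    by (rule lborel_pair.Fubini') measurable
  also have "(\<integral>\<^sup>+x. (\<integral>\<^sup>+y. ennreal ((norm (f x))\<^sup>2 / 2) * ennreal (heat \<kappa> (x - y)) \<partial>lborel) \<partial>lborel)
     = (\<integral>\<^sup>+x. ennreal ((norm (f x))\<^sup>2 / 2) \<partial>lborel)"
    by (subst nn_integral_cmult, measurable) (simp only: h1 mult_1_right)
  also have "(\<integral>\<^sup>+y. (\<integral>\<^sup>+x. ennreal ((norm (f y))\<^sup>2 / 2) * ennreal (heat \<kappa> (x - y)) \<partial>lborel) \<partial>lborel)
     = (\<integral>\<^sup>+x. ennreal ((norm (f x))\<^sup>2 / 2) \<partial>lborel)"
    by (subst nn_integral_cmult, measurable) (simp only: h2 mult_1_right)
  also have "(\<integral>\<^sup>+x. ennreal ((norm (f x))\<^sup>2 / 2) \<partial>lborel) + (\<integral>\<^sup>+x. ennreal ((norm (f x))\<^sup>2 / 2) \<partial>lborel)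
     = (\<integral>\<^sup>+x. ennreal ((norm (f x))\<^sup>2) \<partial>lborel)"
    by (subst nn_integral_add[symmetric], measurable) (simp add: ennreal_plus[symmetric] del: ennreal_plus)
  also have "\<dots> = ennreal ((L2_norm f)\<^sup>2)" by (rule L2_nn_integral[OF fL])
  finally show ?thesis by (simp add: ennreal_le_iff)
qed

text \<open>The squared norm of the damped transform is, by regularised inversion, the pairing of f
  with its mollification, hence at most ||f||^2; Fatou's lemma then removes the damping. Equality
  has to wait for inversion on all of L2.\<close>

lemma fourier_integral_L2:
  fixes f :: "'a::euclidean_space \<Rightarrow> complex"
  assumes fL: "f \<in> L2" and f: "integrable lborel f"
  shows "fourier_integral f \<in> L2" "L2_norm (fourier_integral f) \<le> L2_norm f"
proof -
  have [measurable]: "f \<in> borel_measurable borel" using f by auto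
  define c where "c = (2 * pi) powr (- real DIM('a) / 2)"
  define B where "B = c * (\<integral>x. norm (f x) \<partial>lborel)"
  have B: "norm (fourier_integral f \<xi>) \<le> B" for \<xi> unfolding B_def c_def by (rule fourier_integral_bound)
  have B0: "0 \<le> B" using B norm_ge_zero order_trans by blast
  define X where "X k \<xi> = exp (- (1 / real (Suc k)) * (norm \<xi>)\<^sup>2 / 2) *\<^sub>R fourier_integral f \<xi>" for k and \<xi> :: 'a
  have [measurable]: "X k \<in> borel_measurable borel" for k unfolding X_def by measurable
  have X: "X k \<in> L2" "L2_norm (X k) \<le> L2_norm f" for k
  proof -
    \<comment> \<open>The damping in \<open>X k\<close> has parameter 1 / (k + 1); squaring the
      modulus doubles it.\<close>
    define \<kappa> where "\<kappa> = 2 / real (Suc k)"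
    have \<kappa>: "0 < \<kappa>" by (simp add: \<kappa>_def)
    let ?e = "\<lambda>\<xi>::'a. exp (- \<kappa> * (norm \<xi>)\<^sup>2 / 2)"
    have sq: "(norm (X k \<xi>))\<^sup>2 = ?e \<xi> * (norm (fourier_integral f \<xi>))\<^sup>2" for \<xi>
      by (simp add: X_def \<kappa>_def power_mult_distrib flip: exp_of_nat_mult)
    have i: "integrable lborel (\<lambda>\<xi>. (norm (X k \<xi>))\<^sup>2)"
      unfolding sq
      by (rule Bochner_Integration.integrable_bound[OF integrable_mult_left[OF gaussian_integrable[OF \<kappa>], of "B\<^sup>2"]])
         (use B in \<open>auto simp: abs_mult intro!: power_mono mult_left_mono\<close>)
    then show XL: "X k \<in> L2" by (simp add: L2_def)
    let ?g = "\<lambda>x. \<integral>y. of_real (heat \<kappa> (x - y)) * f y \<partial>lborel"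
    let ?K = "\<lambda>\<xi> x. of_real c * (of_real (?e \<xi>) * fourier_integral f \<xi>) * (cnj (f x) * cis (x \<bullet> \<xi>))"
    have c0: "0 \<le> c" by (simp add: c_def)
    have F: "(\<integral>\<xi>. (\<integral>x. ?K \<xi> x \<partial>lborel) \<partial>lborel) = (\<integral>x. (\<integral>\<xi>. ?K \<xi> x \<partial>lborel) \<partial>lborel)"
      by (rule lborel_Fubini_dominated[of _ "\<lambda>\<xi>. c * (?e \<xi> * B)" "\<lambda>x. norm (f x)"])
         (use f gaussian_integrable[OF \<kappa>] B c0 in \<open>auto simp: norm_mult intro!: mult_right_mono mult_left_mono\<close>)
    have cn: "cnj (fourier_integral f \<xi>) = of_real c * (\<integral>x. cnj (f x) * cis (x \<bullet> \<xi>) \<partial>lborel)" for \<xi>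
      by (simp add: fourier_integral_def c_def cis_cnj mult.commute flip: Bochner_Integration.integral_cnj)
    have "of_real ((L2_norm (X k))\<^sup>2) = (\<integral>\<xi>. complex_of_real ((norm (X k \<xi>))\<^sup>2) \<partial>lborel)"
      by (simp only: L2_norm_sq integral_complex_of_real)
    also have "\<dots> = (\<integral>\<xi>. of_real (?e \<xi>) * (fourier_integral f \<xi> * cnj (fourier_integral f \<xi>)) \<partial>lborel)"
      unfolding sq by (simp only: of_real_mult complex_norm_square)
    also have "\<dots> = (\<integral>\<xi>. (\<integral>x. ?K \<xi> x \<partial>lborel) \<partial>lborel)"
    proof -
      have "?K \<xi> x = of_real (?e \<xi>) * (fourier_integral f \<xi> * (of_real c * (cnj (f x) * cis (x \<bullet> \<xi>))))" for \<xi> x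
        by (simp add: mult_ac)
      then show ?thesis unfolding cn by (simp only: integral_mult_right_zero)
    qed
    also have "\<dots> = (\<integral>x. cnj (f x) * (of_real c * (\<integral>\<xi>. cis (- (\<xi> \<bullet> (- x))) * (of_real (?e \<xi>) * fourier_integral f \<xi>) \<partial>lborel)) \<partial>lborel)"
    proof -
      have "?K \<xi> x = cnj (f x) * (of_real c * (cis (- (\<xi> \<bullet> (- x))) * (of_real (?e \<xi>) * fourier_integral f \<xi>)))" for \<xi> x
        by (simp add: mult_ac inner_commute)
      then show ?thesis unfolding F by (simp only: integral_mult_right_zero)
    qed
    also have "\<dots> = (\<integral>x. cnj (f x) * ?g x \<partial>lborel)"
      using fourier_heat_convolution[OF f \<kappa>] by (simp add: fourier_integral_def c_def)
    finally have "norm (complex_of_real ((L2_norm (X k))\<^sup>2)) \<le> (L2_norm f)\<^sup>2"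
      using heat_pairing_bound[OF fL f \<kappa>] by simp
    then have "(L2_norm (X k))\<^sup>2 \<le> (L2_norm f)\<^sup>2" unfolding norm_of_real by simp
    then show "L2_norm (X k) \<le> L2_norm f" by (rule power2_le_imp_le) simp
  qed
  have "(\<lambda>k. X k \<xi>) \<longlonglongrightarrow> fourier_integral f \<xi>" for \<xi>
  proof -
    have "(\<lambda>k. exp (- (1 / real (Suc k)) * (norm \<xi>)\<^sup>2 / 2)) \<longlonglongrightarrow> exp (- 0 * (norm \<xi>)\<^sup>2 / 2)"
      using LIMSEQ_inverse_real_of_nat by (intro tendsto_intros) (simp_all add: inverse_eq_divide)
    then have "(\<lambda>k. X k \<xi>) \<longlonglongrightarrow> 1 *\<^sub>R fourier_integral f \<xi>"
      unfolding X_def by (intro tendsto_intros) simp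
    then show ?thesis by simp
  qed
  then show "fourier_integral f \<in> L2" "L2_norm (fourier_integral f) \<le> L2_norm f"
    using L2_Fatou[of X "L2_norm f" "fourier_integral f"] X by auto
qed

section \<open>The Fourier transform on square-integrable functions\<close>

lemma indicator_cball_L2: "(\<lambda>x::'a::euclidean_space. indicator (cball 0 R) x :: complex) \<in> L2"
proof -
  have "integrable lborel (\<lambda>x::'a. indicator (cball 0 R) x :: real)"
    using emeasure_bounded_finite[of "cball (0::'a) R"] by (intro integrable_real_indicator) auto
  moreover have "(\<lambda>x::'a. (norm (indicator (cball 0 R) x :: complex))\<^sup>2) = (\<lambda>x. indicator (cball 0 R) x)"
    by (auto simp: fun_eq_iff indicator_def)
  moreover have "(\<lambda>x::'a. indicator (cball 0 R) x :: complex) \<in> borel_measurable borel"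
    by (rule borel_measurable_indicator) simp
  ultimately show ?thesis by (simp add: L2_def)
qed

lemma
  fixes f :: "'a::euclidean_space \<Rightarrow> complex"
  assumes "f \<in> L2"
  shows L2_trunc: "(\<lambda>x. indicator (cball 0 R) x *\<^sub>R f x) \<in> L2"
    and L2_norm_trunc: "L2_norm (\<lambda>x. indicator (cball 0 R) x *\<^sub>R f x) \<le> L2_norm f"
    and L2_trunc_integrable: "integrable lborel (\<lambda>x. indicator (cball 0 R) x *\<^sub>R f x)"
proof -
  show "(\<lambda>x. indicator (cball 0 R) x *\<^sub>R f x) \<in> L2"
    by (rule L2_scaleR_bounded(1)[OF assms, of _ 1]) (auto simp: indicator_def)
  show "L2_norm (\<lambda>x. indicator (cball 0 R) x *\<^sub>R f x) \<le> L2_norm f"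
  proof -
    have m: "indicat_real (cball (0::'a) R) \<in> borel_measurable borel"
      by (rule borel_measurable_indicator) simp
    have b: "\<bar>indicat_real (cball (0::'a) R) x\<bar> \<le> 1" for x by (simp add: indicator_def)
    show ?thesis using L2_scaleR_bounded(2)[OF assms m b] by simp
  qed
  have "(\<lambda>x. indicator (cball 0 R) x * f x) = (\<lambda>x. indicator (cball 0 R) x *\<^sub>R f x)"
    by (auto simp: fun_eq_iff indicator_def)
  then show "integrable lborel (\<lambda>x. indicator (cball 0 R) x *\<^sub>R f x)"
    using L2_mult_integrable[OF indicator_cball_L2[of R] assms] by simp
qed

lemma L2_trunc_tendsto:
  fixes f :: "'a::euclidean_space \<Rightarrow> complex"
  assumes "f \<in> L2"
  shows "((\<lambda>R. L2_norm (\<lambda>x. indicator (cball 0 R) x *\<^sub>R f x - f x)) \<longlongrightarrow> 0) at_top"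
proof (rule tendsto_at_topI_sequentially)
  fix X :: "nat \<Rightarrow> real" assume X: "filterlim X at_top sequentially"
  have [measurable]: "f \<in> borel_measurable borel" using assms by measurable
  show "(\<lambda>n. L2_norm (\<lambda>x. indicator (cball 0 (X n)) x *\<^sub>R f x - f x)) \<longlonglongrightarrow> 0"
  proof (rule L2_norm_tendsto_dominated[OF _ _ _ assms])
    show "AE x in lborel. (\<lambda>n. indicator (cball 0 (X n)) x *\<^sub>R f x) \<longlonglongrightarrow> f x"
    proof (rule AE_I2)
      fix x :: 'a
      have "\<forall>\<^sub>F n in sequentially. norm x \<le> X n"
        using X by (auto simp: filterlim_at_top)
      then have "\<forall>\<^sub>F n in sequentially. indicator (cball 0 (X n)) x *\<^sub>R f x = f x"
        by eventually_elim (simp add: indicator_def)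
      then show "(\<lambda>n. indicator (cball 0 (X n)) x *\<^sub>R f x) \<longlonglongrightarrow> f x"
        by (rule tendsto_eventually)
    qed
  qed (auto simp: indicator_def)
qed

lemma fourier_integral_L2_diff:
  assumes "f \<in> L2" "integrable lborel f" "g \<in> L2" "integrable lborel g"
  shows "L2_norm (\<lambda>x. fourier_integral f x - fourier_integral g x) \<le> L2_norm (\<lambda>x. f x - g x)"
proof -
  have "(\<lambda>x. fourier_integral f x - fourier_integral g x) = fourier_integral (\<lambda>x. f x - g x)"
    using fourier_integral_diff[OF assms(2,4)] by (simp add: fun_eq_iff)
  moreover have "integrable lborel (\<lambda>x. f x - g x)" using assms by simp
  ultimately show ?thesis using fourier_integral_L2(2)[OF L2_diff(1)[OF assms(1,3)]] by simp
qed

text \<open>Existence of the limit behind the choice operator in \<open>fourier\<close>. The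
  transforms of truncations differ by at most the sum of the two truncation errors; completeness
  gives the limit along integer radii, and the error bound carries it over to all real
  radii.\<close>

lemma fourier_L2_limit:
  fixes f :: "'a::euclidean_space \<Rightarrow> complex"
  assumes "f \<in> L2"
  shows "L2_limit (\<lambda>R::real. fourier_integral (\<lambda>x. indicator (cball 0 R) x *\<^sub>R f x)) (fourier f) at_top"
proof -
  let ?t = "\<lambda>R x. indicator (cball 0 R) x *\<^sub>R f x"
  let ?T = "\<lambda>R. fourier_integral (?t R)"
  define d where "d R = L2_norm (\<lambda>x. ?t R x - f x)" for R
  have d: "(d \<longlongrightarrow> 0) at_top" unfolding d_def by (rule L2_trunc_tendsto[OF assms])
  have dn: "(\<lambda>n. d (real n)) \<longlonglongrightarrow> 0"
    using filterlim_compose[OF d filterlim_real_sequentially] .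
  have TL: "?T R \<in> L2" for R
    by (rule fourier_integral_L2(1)[OF L2_trunc[OF assms] L2_trunc_integrable[OF assms]])
  have TT: "L2_norm (\<lambda>x. ?T R x - ?T S x) \<le> d R + d S" for R S
  proof -
    have "L2_norm (\<lambda>x. ?T R x - ?T S x) \<le> L2_norm (\<lambda>x. ?t R x - ?t S x)"
      by (intro fourier_integral_L2_diff L2_trunc L2_trunc_integrable assms)
    also have "\<dots> \<le> L2_norm (\<lambda>x. ?t R x - f x) + L2_norm (\<lambda>x. f x - ?t S x)"
      by (intro L2_triangle L2_trunc assms)
    finally show ?thesis by (simp add: d_def L2_norm_commute[of f])
  qed
  have "\<exists>M. \<forall>m\<ge>M. \<forall>n\<ge>M. L2_norm (\<lambda>x. ?T (real m) x - ?T (real n) x) < e" if "0 < e" for e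
  proof -
    have "\<forall>\<^sub>F n in sequentially. d (real n) < e / 2" using order_tendstoD(2)[OF dn, of "e/2"] that by simp
    then obtain M where "\<And>n. n \<ge> M \<Longrightarrow> d (real n) < e / 2" by (auto simp: eventually_sequentially)
    then have "L2_norm (\<lambda>x. ?T (real m) x - ?T (real n) x) < e" if "m \<ge> M" "n \<ge> M" for m n
      using TT[of "real m" "real n"] that add_strict_mono[of "d (real m)" "e/2" "d (real n)" "e/2"] by fastforce
    then show ?thesis by blast
  qed
  from L2_complete[OF TL this] obtain g
    where g: "g \<in> L2" "(\<lambda>n. L2_norm (\<lambda>x. ?T (real n) x - g x)) \<longlonglongrightarrow> 0" by blast
  have le: "L2_norm (\<lambda>x. ?T R x - g x) \<le> d R" for R
  proof (rule LIMSEQ_le_const)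
    show "(\<lambda>n. d R + d (real n) + L2_norm (\<lambda>x. ?T (real n) x - g x)) \<longlonglongrightarrow> d R"
      using tendsto_add[OF tendsto_add[OF tendsto_const[of "d R"] dn] g(2)] by simp
    have "L2_norm (\<lambda>x. ?T R x - g x) \<le> d R + d (real n) + L2_norm (\<lambda>x. ?T (real n) x - g x)" for n
      using L2_triangle[OF TL[of R] TL[of "real n"] g(1)] TT[of R "real n"] by linarith
    then show "\<exists>N. \<forall>n\<ge>N. L2_norm (\<lambda>x. ?T R x - g x) \<le> d R + d (real n) + L2_norm (\<lambda>x. ?T (real n) x - g x)"
      by blast
  qed
  have "((\<lambda>R. L2_norm (\<lambda>x. ?T R x - g x)) \<longlongrightarrow> 0) at_top"
    by (rule Lim_null_comparison[OF _ d]) (use le in auto)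
  then have "L2_limit ?T g at_top" using TL g(1) by (simp add: L2_limit_iff)
  then have "\<exists>g. L2_limit ?T g at_top" by blast
  from someI_ex[OF this] show ?thesis unfolding fourier_def .
qed

lemma fourier_unique_AE:
  assumes "f \<in> L2" "L2_limit (\<lambda>R::real. fourier_integral (\<lambda>x. indicator (cball 0 R) x *\<^sub>R f x)) g at_top"
  shows "AE x in lborel. fourier f x = g x"
  by (rule L2_limit_unique_AE[OF fourier_L2_limit[OF assms(1)] assms(2)]) simp

lemma fourier_L2:
  fixes f :: "'a::euclidean_space \<Rightarrow> complex"
  assumes "f \<in> L2"
  shows "fourier f \<in> L2" "L2_norm (fourier f) \<le> L2_norm f"
proof -
  let ?T = "\<lambda>R::real. fourier_integral (\<lambda>x. indicator (cball 0 R) x *\<^sub>R f x)"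
  note l = fourier_L2_limit[OF assms, unfolded L2_limit_iff]
  show F: "fourier f \<in> L2" using l by blast
  have TL: "?T R \<in> L2" "L2_norm (?T R) \<le> L2_norm f" for R
    using fourier_integral_L2[OF L2_trunc[OF assms] L2_trunc_integrable[OF assms]] L2_norm_trunc[OF assms, of R]
    by (auto intro: order_trans)
  have "L2_norm (fourier f) \<le> L2_norm f + L2_norm (\<lambda>x. ?T R x - fourier f x)" for R
    using L2_norm_diff_bound[OF TL(1) F, of R] TL(2)[of R] by linarith
  moreover have "((\<lambda>R. L2_norm f + L2_norm (\<lambda>x. ?T R x - fourier f x)) \<longlongrightarrow> L2_norm f + 0) at_top"
    using l by (intro tendsto_add tendsto_const) blast
  ultimately show "L2_norm (fourier f) \<le> L2_norm f"
    by (intro tendsto_lowerbound[of _ "L2_norm f" at_top]) auto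
qed

lemma fourier_add:
  assumes "f \<in> L2" "g \<in> L2"
  shows "AE x in lborel. fourier (\<lambda>x. f x + g x) x = fourier f x + fourier g x"
proof (rule fourier_unique_AE[OF L2_add(1)[OF assms]])
  let ?T = "\<lambda>f R. fourier_integral (\<lambda>x. indicator (cball 0 R) x *\<^sub>R f x)"
  note lf = fourier_L2_limit[OF assms(1), unfolded L2_limit_iff] and lg = fourier_L2_limit[OF assms(2), unfolded L2_limit_iff]
  note t = L2_trunc[OF assms(1)] L2_trunc_integrable[OF assms(1)] L2_trunc[OF assms(2)] L2_trunc_integrable[OF assms(2)]
  have eq: "?T (\<lambda>x. f x + g x) R = (\<lambda>x. ?T f R x + ?T g R x)" for R :: real
    using fourier_integral_add[OF t(2,4)] by (simp add: fun_eq_iff scaleR_add_right)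
  note T = fourier_integral_L2(1)[OF t(1,2)] fourier_integral_L2(1)[OF t(3,4)]
  have "((\<lambda>R. L2_norm (\<lambda>x. ?T f R x - fourier f x) + L2_norm (\<lambda>x. ?T g R x - fourier g x)) \<longlongrightarrow> 0) at_top"
    using lf lg by (intro tendsto_add_zero) blast+
  then have "((\<lambda>R. L2_norm (\<lambda>x. (?T f R x + ?T g R x) - (fourier f x + fourier g x))) \<longlongrightarrow> 0) at_top"
  proof (rule Lim_null_comparison[rotated], intro always_eventually allI)
    fix R :: real
    have "(\<lambda>x. (?T f R x + ?T g R x) - (fourier f x + fourier g x))
        = (\<lambda>x. (?T f R x - fourier f x) + (?T g R x - fourier g x))" by (simp add: fun_eq_iff)
    then show "norm (L2_norm (\<lambda>x. (?T f R x + ?T g R x) - (fourier f x + fourier g x)))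
       \<le> L2_norm (\<lambda>x. ?T f R x - fourier f x) + L2_norm (\<lambda>x. ?T g R x - fourier g x)"
      using L2_add(2)[OF L2_diff(1)[OF T(1)[of R] fourier_L2(1)[OF assms(1)]] L2_diff(1)[OF T(2)[of R] fourier_L2(1)[OF assms(2)]]]
      by simp
  qed
  then show "L2_limit (\<lambda>R::real. ?T (\<lambda>x. f x + g x) R) (\<lambda>x. fourier f x + fourier g x) at_top"
    unfolding L2_limit_iff eq using T fourier_L2(1)[OF assms(1)] fourier_L2(1)[OF assms(2)]
    by (auto intro!: L2_add always_eventually)
qed

lemma fourier_cmult:
  assumes "f \<in> L2"
  shows "AE x in lborel. fourier (\<lambda>x. c * f x) x = c * fourier f x"
proof (rule fourier_unique_AE[OF L2_cmult(1)[OF assms]])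
  let ?T = "\<lambda>f R. fourier_integral (\<lambda>x. indicator (cball 0 R) x *\<^sub>R f x)"
  note lf = fourier_L2_limit[OF assms, unfolded L2_limit_iff]
  have eq: "?T (\<lambda>x. c * f x) R = (\<lambda>x. c * ?T f R x)" for R :: real
    using fourier_integral_cmult[of c "\<lambda>x. indicator (cball 0 R) x *\<^sub>R f x"] by (simp add: fun_eq_iff)
  note T = fourier_integral_L2(1)[OF L2_trunc[OF assms] L2_trunc_integrable[OF assms]]
  have n: "L2_norm (\<lambda>x. c * ?T f R x - c * fourier f x) = norm c * L2_norm (\<lambda>x. ?T f R x - fourier f x)" for R :: real
    using L2_cmult(2)[OF L2_diff(1)[OF T[of R] fourier_L2(1)[OF assms]], of c] by (simp add: right_diff_distrib)
  have "((\<lambda>R. norm c * L2_norm (\<lambda>x. ?T f R x - fourier f x)) \<longlongrightarrow> 0) at_top"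
    using lf by (intro tendsto_mult_right_zero) blast
  then show "L2_limit (\<lambda>R::real. ?T (\<lambda>x. c * f x) R) (\<lambda>x. c * fourier f x) at_top"
    unfolding L2_limit_iff eq n using T fourier_L2(1)[OF assms]
    by (auto intro!: L2_cmult always_eventually)
qed

lemma fourier_diff:
  assumes "f \<in> L2" "g \<in> L2"
  shows "AE x in lborel. fourier (\<lambda>x. f x - g x) x = fourier f x - fourier g x"
  using fourier_add[OF assms(1) L2_cmult(1)[OF assms(2), of "-1"]] fourier_cmult[OF assms(2), of "-1"]
  by eventually_elim simp

text \<open>The choice in \<open>fourier\<close> sees its argument only through integrals, which
  ignore null sets. The conclusion is therefore literal equality and can be used for
  rewriting.\<close>

lemma fourier_cong_AE:
  fixes f g :: "'a::euclidean_space \<Rightarrow> complex"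
  assumes "AE x in lborel. f x = g x" and [measurable]: "f \<in> borel_measurable borel" "g \<in> borel_measurable borel"
  shows "fourier f = fourier g"
proof -
  have "fourier_integral (\<lambda>x. indicator (cball 0 R) x *\<^sub>R f x) = fourier_integral (\<lambda>x. indicator (cball 0 R) x *\<^sub>R g x)" for R
  proof (rule fourier_integral_cong_AE)
    show "AE x in lborel. indicator (cball 0 R) x *\<^sub>R f x = indicator (cball 0 R) x *\<^sub>R g x"
      using assms(1) by eventually_elim simp
  qed (intro borel_measurable_scaleR borel_measurable_indicator assms; simp)+
  then show ?thesis unfolding fourier_def by simp
qed

lemma fourier_eq_integral_AE:
  assumes "f \<in> L2" "integrable lborel f"
  shows "AE x in lborel. fourier f x = fourier_integral f x"
proof (rule fourier_unique_AE[OF assms(1)])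
  let ?T = "\<lambda>R. fourier_integral (\<lambda>x. indicator (cball 0 R) x *\<^sub>R f x)"
  have "((\<lambda>R. L2_norm (\<lambda>x. ?T R x - fourier_integral f x)) \<longlongrightarrow> 0) at_top"
  proof (rule Lim_null_comparison[OF _ L2_trunc_tendsto[OF assms(1)]], intro always_eventually allI)
    fix R :: real
    show "norm (L2_norm (\<lambda>x. ?T R x - fourier_integral f x)) \<le> L2_norm (\<lambda>x. indicator (cball 0 R) x *\<^sub>R f x - f x)"
      using fourier_integral_L2_diff[OF L2_trunc[OF assms(1)] L2_trunc_integrable[OF assms(1)] assms, of R] by simp
  qed
  then show "L2_limit (\<lambda>R::real. ?T R) (fourier_integral f) at_top"
    unfolding L2_limit_iff
    using fourier_integral_L2(1)[OF assms] fourier_integral_L2(1)[OF L2_trunc[OF assms(1)] L2_trunc_integrable[OF assms(1)]]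
    by (auto intro!: always_eventually)
qed

lemma L2_reflect:
  fixes f :: "'a::euclidean_space \<Rightarrow> complex"
  assumes "f \<in> L2"
  shows "(\<lambda>x. f (- x)) \<in> L2"
proof -
  have [measurable]: "f \<in> borel_measurable borel" using assms by measurable
  have "(\<lambda>x. f (- x)) \<in> borel_measurable borel" by measurable
  then show ?thesis
    using integrable_lborel_reflect[OF L2_integrable_sq[OF assms], of 0] by (simp add: L2_def)
qed

lemma L2_norm_reflect: "L2_norm (\<lambda>x. f (- x)) = L2_norm f"
  using integral_lborel_reflect[of "\<lambda>x. (norm (f x))\<^sup>2" 0] by (simp add: L2_norm_def)

lemma fourier_reflect:
  fixes f :: "'a::euclidean_space \<Rightarrow> complex"
  assumes "f \<in> L2"
  shows "AE x in lborel. fourier (\<lambda>x. f (- x)) x = fourier f (- x)"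
proof (rule fourier_unique_AE[OF L2_reflect[OF assms]])
  let ?T = "\<lambda>R. fourier_integral (\<lambda>x. indicator (cball 0 R) x *\<^sub>R f x)"
  have eq: "fourier_integral (\<lambda>x. indicator (cball 0 R) x *\<^sub>R f (- x)) = (\<lambda>x. ?T R (- x))" for R
  proof
    fix x
    have "(\<lambda>x. indicator (cball 0 R) x *\<^sub>R f (- x)) = (\<lambda>x. indicator (cball 0 R) (- x) *\<^sub>R f (- x))"
      by (auto simp: fun_eq_iff indicator_def)
    then show "fourier_integral (\<lambda>x. indicator (cball 0 R) x *\<^sub>R f (- x)) x = ?T R (- x)"
      using fourier_integral_reflect[of "\<lambda>x. indicator (cball 0 R) x *\<^sub>R f x" x] by simp
  qed
  have n: "L2_norm (\<lambda>x. ?T R (- x) - fourier f (- x)) = L2_norm (\<lambda>x. ?T R x - fourier f x)" for R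
    using L2_norm_reflect[of "\<lambda>x. ?T R x - fourier f x"] by simp
  show "L2_limit (\<lambda>R::real. fourier_integral (\<lambda>x. indicator (cball 0 R) x *\<^sub>R f (- x))) (\<lambda>x. fourier f (- x)) at_top"
    unfolding L2_limit_iff eq n
    using fourier_L2_limit[OF assms, unfolded L2_limit_iff] fourier_L2(1)[OF assms]
      fourier_integral_L2(1)[OF L2_trunc[OF assms] L2_trunc_integrable[OF assms]]
    by (auto intro!: always_eventually L2_reflect)
qed

section \<open>Inversion and the Parseval identity\<close>

text \<open>Reflection and dilation by sqrt \<kappa> move the parameter from the kernel into the
  argument of f. The density is then fixed, and dominated convergence only needs f bounded and
  continuous.\<close>

lemma heat_approximation:
  fixes f :: "'a::euclidean_space \<Rightarrow> complex"
  assumes f: "continuous_on UNIV f" "\<And>x. norm (f x) \<le> B" and \<kappa>: "\<And>k. 0 < \<kappa> k" "\<kappa> \<longlonglongrightarrow> 0"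
  shows "(\<lambda>k. \<integral>y. of_real (heat (\<kappa> k) (x - y)) * f y \<partial>lborel) \<longlonglongrightarrow> f x"
proof -
  have [measurable]: "f \<in> borel_measurable borel" using f(1) by (rule borel_measurable_continuous_onI)
  have eq: "(\<integral>y. of_real (heat (\<kappa> k) (x - y)) * f y \<partial>lborel)
      = (\<integral>y. of_real (heat 1 y) * f (x - sqrt (\<kappa> k) *\<^sub>R y) \<partial>lborel)" for k
  proof -
    have "(\<integral>y. of_real (heat (\<kappa> k) (x - y)) * f y \<partial>lborel) = (\<integral>y. of_real (heat (\<kappa> k) y) * f (x - y) \<partial>lborel)"
      using integral_lborel_reflect[of "\<lambda>y. of_real (heat (\<kappa> k) y) * f (x - y)" x] by simp
    also have "\<dots> = sqrt (\<kappa> k) ^ DIM('a) *\<^sub>R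
        (\<integral>y. of_real (heat (\<kappa> k) (sqrt (\<kappa> k) *\<^sub>R y)) * f (x - sqrt (\<kappa> k) *\<^sub>R y) \<partial>lborel)"
      using \<kappa>(1) by (intro integral_lborel_scaleR) auto
    also have "\<dots> = (\<integral>y. of_real (sqrt (\<kappa> k) ^ DIM('a) * heat (\<kappa> k) (sqrt (\<kappa> k) *\<^sub>R y)) * f (x - sqrt (\<kappa> k) *\<^sub>R y) \<partial>lborel)"
      by (subst Bochner_Integration.integral_scaleR_right[symmetric]) (simp add: scaleR_conv_of_real mult.assoc)
    finally show ?thesis unfolding heat_scaleR[OF \<kappa>(1)] .
  qed
  have "(\<lambda>k. \<integral>y. of_real (heat 1 y) * f (x - sqrt (\<kappa> k) *\<^sub>R y) \<partial>lborel)
      \<longlonglongrightarrow> (\<integral>y. of_real (heat 1 y) * f x \<partial>(lborel :: 'a measure))"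
  proof (rule integral_dominated_convergence[where w="\<lambda>y::'a. heat 1 y * B"])
    show "integrable lborel (\<lambda>y::'a. heat 1 y * B)" using heat_integrable[of 1, where 'a='a] by simp
    show "AE y in lborel. (\<lambda>k. of_real (heat 1 y) * f (x - sqrt (\<kappa> k) *\<^sub>R y)) \<longlonglongrightarrow> of_real (heat 1 y) * f x"
    proof (rule AE_I2)
      fix y
      have "(\<lambda>k. x - sqrt (\<kappa> k) *\<^sub>R y) \<longlonglongrightarrow> x - sqrt 0 *\<^sub>R y" using \<kappa>(2) by (intro tendsto_intros)
      then have "(\<lambda>k. f (x - sqrt (\<kappa> k) *\<^sub>R y)) \<longlonglongrightarrow> f x"
        using f(1) continuous_on_eq_continuous_at[of UNIV f] isCont_tendsto_compose[of x f] by simp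
      then show "(\<lambda>k. of_real (heat 1 y) * f (x - sqrt (\<kappa> k) *\<^sub>R y)) \<longlonglongrightarrow> of_real (heat 1 y) * f x"
        by (intro tendsto_intros)
    qed
    show "AE y in lborel. norm (of_real (heat 1 y) * f (x - sqrt (\<kappa> k) *\<^sub>R y)) \<le> heat 1 y * B" for k
      using f(2) by (auto simp: norm_mult abs_of_nonneg[OF heat_nonneg] intro!: AE_I2 mult_left_mono heat_nonneg)
  qed auto
  also have "(\<integral>y. of_real (heat 1 y) * f x \<partial>(lborel :: 'a measure)) = (\<integral>y. complex_of_real (heat 1 (y::'a)) \<partial>lborel) * f x"
    by (rule integral_mult_left_zero)
  also have "\<dots> = f x"
    unfolding integral_complex_of_real using heat_integral[of 1, where 'a='a] by simp
  finally show ?thesis unfolding eq .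
qed

lemma gaussian_mollifier_tendsto:
  "(\<lambda>k. exp (- (1 / real (Suc k)) * (norm \<xi>)\<^sup>2 / 2)) \<longlonglongrightarrow> 1"
proof -
  have "(\<lambda>k. exp (- (1 / real (Suc k)) * (norm \<xi>)\<^sup>2 / 2)) \<longlonglongrightarrow> exp (- 0 * (norm \<xi>)\<^sup>2 / 2)"
    using LIMSEQ_inverse_real_of_nat by (intro tendsto_intros) (simp_all add: inverse_eq_divide)
  then show ?thesis by simp
qed

text \<open>The Gaussian damping is removed in two ways: by dominated convergence, as the transform
  is integrable, and by the approximate identity, as f is bounded and continuous. On the line this
  is what expands the frequency cut-off into exponentials.\<close>

lemma fourier_inversion_pointwise:
  fixes f :: "'a::euclidean_space \<Rightarrow> complex"
  assumes f: "continuous_on UNIV f" "\<And>x. norm (f x) \<le> B" "integrable lborel f"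
    and i: "integrable lborel (fourier_integral f)"
  shows "fourier_integral (fourier_integral f) (- x) = f x"
proof -
  have [measurable]: "f \<in> borel_measurable borel" using f(1) by (rule borel_measurable_continuous_onI)
  let ?e = "\<lambda>k \<xi>::'a. exp (- (1 / real (Suc k)) * (norm \<xi>)\<^sup>2 / 2)"
  have "(\<lambda>k. \<integral>\<xi>. cis (- (\<xi> \<bullet> (- x))) * (of_real (?e k \<xi>) * fourier_integral f \<xi>) \<partial>lborel)
      \<longlonglongrightarrow> (\<integral>\<xi>. cis (- (\<xi> \<bullet> (- x))) * fourier_integral f \<xi> \<partial>lborel)"
  proof (rule integral_dominated_convergence[where w="\<lambda>\<xi>. norm (fourier_integral f \<xi>)"])
    show "AE \<xi> in lborel. (\<lambda>k. cis (- (\<xi> \<bullet> (- x))) * (of_real (?e k \<xi>) * fourier_integral f \<xi>))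
        \<longlonglongrightarrow> cis (- (\<xi> \<bullet> (- x))) * fourier_integral f \<xi>"
    proof (rule AE_I2)
      fix \<xi> :: 'a
      have "(\<lambda>k. cis (- (\<xi> \<bullet> (- x))) * (of_real (?e k \<xi>) * fourier_integral f \<xi>))
        \<longlonglongrightarrow> cis (- (\<xi> \<bullet> (- x))) * (of_real 1 * fourier_integral f \<xi>)"
        by (intro tendsto_intros gaussian_mollifier_tendsto)
      then show "(\<lambda>k. cis (- (\<xi> \<bullet> (- x))) * (of_real (?e k \<xi>) * fourier_integral f \<xi>))
        \<longlonglongrightarrow> cis (- (\<xi> \<bullet> (- x))) * fourier_integral f \<xi>" by simp
    qed
    show "AE \<xi> in lborel. norm (cis (- (\<xi> \<bullet> (- x))) * (of_real (?e k \<xi>) * fourier_integral f \<xi>)) \<le> norm (fourier_integral f \<xi>)" for k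
      by (auto simp: norm_mult intro!: mult_left_le_one_le)
  qed (use i in auto)
  then have "(\<lambda>k. fourier_integral (\<lambda>\<xi>. of_real (?e k \<xi>) * fourier_integral f \<xi>) (- x))
      \<longlonglongrightarrow> fourier_integral (fourier_integral f) (- x)"
    unfolding fourier_integral_def[of "\<lambda>\<xi>. of_real (_ \<xi>) * fourier_integral f \<xi>"]
      fourier_integral_def[of "fourier_integral f"]
    by (intro tendsto_mult tendsto_const)
  moreover have "(\<lambda>k. fourier_integral (\<lambda>\<xi>. of_real (?e k \<xi>) * fourier_integral f \<xi>) (- x)) \<longlonglongrightarrow> f x"
    using heat_approximation[OF f(1,2), of "\<lambda>k. 1 / real (Suc k)" x] LIMSEQ_inverse_real_of_nat
    by (subst fourier_heat_convolution[OF f(3)]) (auto simp: inverse_eq_divide)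
  ultimately show ?thesis by (rule LIMSEQ_unique)
qed

lemma L2_of_bounded_integrable:
  assumes "integrable lborel f" "\<And>x. norm (f x) \<le> B"
  shows "f \<in> L2"
proof -
  have [measurable]: "f \<in> borel_measurable borel" using assms by auto
  have "integrable lborel (\<lambda>x. (norm (f x))\<^sup>2)"
    by (rule Bochner_Integration.integrable_bound[of _ "\<lambda>x. B * norm (f x)"])
       (use assms in \<open>auto simp: power2_eq_square intro!: AE_I2 mult_right_mono order_trans[OF _ abs_ge_self]\<close>)
  then show ?thesis by (simp add: L2_def)
qed

text \<open>Here the transform is only known to lie in L2. Its damped versions \<open>X k\<close>
  converge to it in L2, so their transforms converge in L2 to the double transform; pointwise these
  are mollifications of f at - x.\<close>

lemma fourier_fourier_continuous:
  fixes f :: "'a::euclidean_space \<Rightarrow> complex"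
  assumes f: "continuous_on UNIV f" "\<And>x. norm (f x) \<le> B" "integrable lborel f"
  shows "AE x in lborel. fourier (fourier f) x = f (- x)"
proof -
  have [measurable]: "f \<in> borel_measurable borel" using f(1) by (rule borel_measurable_continuous_onI)
  have fL: "f \<in> L2" by (rule L2_of_bounded_integrable[OF f(3,2)])
  note FL = fourier_integral_L2(1)[OF fL f(3)]
  define C where "C = (2 * pi) powr (- real DIM('a) / 2) * (\<integral>x. norm (f x) \<partial>lborel)"
  have C: "norm (fourier_integral f \<xi>) \<le> C" for \<xi> unfolding C_def by (rule fourier_integral_bound)
  define X where "X k \<xi> = of_real (exp (- (1 / real (Suc k)) * (norm \<xi>)\<^sup>2 / 2)) * fourier_integral f \<xi>" for k and \<xi> :: 'a
  have [measurable]: "X k \<in> borel_measurable borel" for k unfolding X_def by measurable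
  have Xle: "norm (X k \<xi>) \<le> norm (fourier_integral f \<xi>)" for k \<xi>
    by (auto simp: X_def norm_mult intro!: mult_left_le_one_le)
  have XL: "X k \<in> L2" for k
    by (rule L2_dominated(1)[OF FL, of _ 1]) (use Xle in auto)
  have Xi: "integrable lborel (X k)" for k
    by (rule Bochner_Integration.integrable_bound[OF integrable_mult_left[OF gaussian_integrable[of "1 / real (Suc k)"], of C]])
       (use C in \<open>auto simp: X_def norm_mult abs_mult intro!: AE_I2 mult_left_mono order_trans[OF _ abs_ge_self]\<close>)
  have lim: "(\<lambda>k. L2_norm (\<lambda>\<xi>. X k \<xi> - fourier_integral f \<xi>)) \<longlonglongrightarrow> 0"
  proof (rule L2_norm_tendsto_dominated[OF _ _ _ L2_cmult(1)[OF FL, of 2]])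
    show "AE x in lborel. (\<lambda>k. X k x) \<longlonglongrightarrow> fourier_integral f x"
    proof (rule AE_I2)
      fix x
      have "(\<lambda>k. X k x) \<longlonglongrightarrow> of_real 1 * fourier_integral f x"
        unfolding X_def by (intro tendsto_intros gaussian_mollifier_tendsto)
      then show "(\<lambda>k. X k x) \<longlonglongrightarrow> fourier_integral f x" by simp
    qed
    show "AE x in lborel. norm (X k x - fourier_integral f x) \<le> norm (2 * fourier_integral f x)" for k
      using Xle by (auto simp: norm_mult intro!: AE_I2 order_trans[OF norm_triangle_ineq4])
  qed auto
  have "AE x in lborel. fourier (fourier_integral f) x = f (- x)"
  proof (rule L2_norm_tendsto_unique_AE[of "\<lambda>k. fourier_integral (X k)"])
    show "fourier_integral (X k) \<in> L2" for k by (rule fourier_integral_L2(1)[OF XL Xi])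
    show "fourier (fourier_integral f) \<in> L2" by (rule fourier_L2(1)[OF FL])
    show "(\<lambda>x. f (- x)) \<in> borel_measurable borel" by measurable
    show "(\<lambda>k. L2_norm (\<lambda>x. fourier_integral (X k) x - fourier (fourier_integral f) x)) \<longlonglongrightarrow> 0"
    proof (rule Lim_null_comparison[OF _ lim], intro always_eventually allI)
      fix k
      have "AE x in lborel. fourier_integral (X k) x - fourier (fourier_integral f) x = fourier (\<lambda>x. X k x - fourier_integral f x) x"
        using fourier_eq_integral_AE[OF XL Xi, of k] fourier_diff[OF XL FL, of k] by eventually_elim simp
      moreover have "fourier (\<lambda>x. X k x - fourier_integral f x) \<in> L2"
        by (intro fourier_L2 L2_diff XL FL)
      ultimately have "L2_norm (\<lambda>x. fourier_integral (X k) x - fourier (fourier_integral f) x) = L2_norm (fourier (\<lambda>x. X k x - fourier_integral f x))"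
        using L2_diff(1)[OF fourier_integral_L2(1)[OF XL Xi] fourier_L2(1)[OF FL], of k]
        by (intro L2_norm_cong_AE) (auto dest: L2_measurable)
      also have "\<dots> \<le> L2_norm (\<lambda>x. X k x - fourier_integral f x)"
        by (intro fourier_L2 L2_diff XL FL)
      finally show "norm (L2_norm (\<lambda>x. fourier_integral (X k) x - fourier (fourier_integral f) x)) \<le> L2_norm (\<lambda>x. X k x - fourier_integral f x)"
        by simp
    qed
    show "AE x in lborel. (\<lambda>k. fourier_integral (X k) x) \<longlonglongrightarrow> f (- x)"
    proof (rule AE_I2)
      fix x
      have "fourier_integral (X k) x = (\<integral>y. of_real (heat (1 / real (Suc k)) (- x - y)) * f y \<partial>lborel)" for k
        using fourier_heat_convolution[OF f(3), of "1 / real (Suc k)" "- x"] by (simp add: X_def[abs_def])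
      then show "(\<lambda>k. fourier_integral (X k) x) \<longlonglongrightarrow> f (- x)"
        using heat_approximation[OF f(1,2), of "\<lambda>k. 1 / real (Suc k)" "- x"] LIMSEQ_inverse_real_of_nat
        by (simp add: inverse_eq_divide)
    qed
  qed
  moreover have "fourier (fourier f) = fourier (fourier_integral f)"
    using fourier_eq_integral_AE[OF fL f(3)] fourier_L2(1)[OF fL] FL
    by (intro fourier_cong_AE) (auto dest: L2_measurable)
  ultimately show ?thesis by simp
qed

text \<open>Measurability yields continuous functions converging to f almost everywhere, but without
  any control on size or support. Truncating both in a continuous way that fixes f makes dominated
  convergence applicable.\<close>

lemma L2_bounded_supp_approx:
  fixes f :: "'a::euclidean_space \<Rightarrow> complex"
  assumes [measurable]: "f \<in> borel_measurable borel" and B: "\<And>x. norm (f x) \<le> B"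
    and supp: "\<And>x. norm x > R \<Longrightarrow> f x = 0" and "0 < e"
  shows "\<exists>g. continuous_on UNIV g \<and> (\<exists>C. \<forall>x. norm (g x) \<le> C) \<and> integrable lborel g \<and> L2_norm (\<lambda>x. g x - f x) < e"
proof -
  define N where "N = max B 1"
  have N: "0 < N" "\<And>x. norm (f x) \<le> N" using B by (auto simp: N_def le_max_iff_disj)
  have "f \<in> borel_measurable lebesgue" by (simp add: measurable_completion)
  then have "f measurable_on UNIV"
    by (simp add: measurable_on_iff_borel_measurable)
  then obtain Z g where Z: "negligible Z" and gc: "\<And>n. continuous_on UNIV (g n)"
    and gl: "\<And>x. x \<notin> Z \<Longrightarrow> (\<lambda>n. g n x) \<longlonglongrightarrow> f x"
    unfolding measurable_on_def by auto
  \<comment> \<open>\<open>T\<close> is the radial retraction onto the disc of radius N, and \<eta>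
    is a continuous cut-off that is 1 for |x| <= R and 0 for |x| >= R + 1. Both leave f
    unchanged.\<close>
  define T where "T w = (1 / max 1 (norm w / N)) *\<^sub>R w" for w :: complex
  define \<eta> where "\<eta> x = max 0 (min 1 (R + 1 - norm x))" for x :: 'a
  define h where "h n x = \<eta> x *\<^sub>R T (g n x)" for n x
  have Tc: "continuous_on UNIV T"
    unfolding T_def using N(1) by (intro continuous_intros) auto
  have Tn: "norm (T w) \<le> N" for w
  proof (cases "norm w \<le> N")
    case True then show ?thesis using N(1) by (simp add: T_def max_absorb1)
  next
    case False then show ?thesis using N(1) by (simp add: T_def max_absorb2 field_simps)
  qed
  have Tf: "T (f x) = f x" for x using N by (simp add: T_def max_absorb1)
  have \<eta>1: "0 \<le> \<eta> x" "\<eta> x \<le> 1" for x by (auto simp: \<eta>_def)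
  have \<eta>f: "\<eta> x *\<^sub>R f x = f x" for x using supp[of x] by (cases "norm x \<le> R") (auto simp: \<eta>_def)
  have hc: "continuous_on UNIV (h n)" for n
    unfolding h_def \<eta>_def
    by (intro continuous_intros continuous_on_compose2[OF Tc gc]) auto
  then have [measurable]: "h n \<in> borel_measurable borel" for n by (rule borel_measurable_continuous_onI)
  have hn: "norm (h n x) \<le> N * indicator (cball 0 (R + 1)) x" for n x
  proof (cases "norm x \<le> R + 1")
    case True
    have "\<eta> x * norm (T (g n x)) \<le> 1 * N" by (intro mult_mono \<eta>1 Tn) auto
    with True show ?thesis using \<eta>1[of x] by (simp add: h_def)
  next
    case False then show ?thesis by (simp add: h_def \<eta>_def)
  qed
  have I: "integrable lborel (\<lambda>x::'a. N * indicator (cball 0 (R + 1)) x)"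
    using emeasure_bounded_finite[of "cball (0::'a) (R+1)"] by (intro integrable_mult_right integrable_real_indicator) auto
  have hi: "integrable lborel (h n)" for n
    by (rule Bochner_Integration.integrable_bound[OF I]) (use hn N(1) in \<open>auto intro!: AE_I2\<close>)
  have "(\<lambda>n. L2_norm (\<lambda>x. h n x - f x)) \<longlonglongrightarrow> 0"
  proof (rule L2_norm_tendsto_dominated[OF _ _ _ L2_cmult(1)[OF indicator_cball_L2, of "of_real (2 * N)" "R + 1"]])
    have "AE x in lborel. x \<notin> Z"
      using AE_not_in[of Z lebesgue] Z by (simp add: negligible_iff_null_sets AE_completion_iff)
    then show "AE x in lborel. (\<lambda>n. h n x) \<longlonglongrightarrow> f x"
    proof eventually_elim
      case (elim x)
      have "(\<lambda>n. h n x) \<longlonglongrightarrow> \<eta> x *\<^sub>R T (f x)"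
        unfolding h_def
        by (intro tendsto_intros continuous_on_tendsto_compose[OF Tc gl]) (use elim in auto)
      then show ?case by (simp add: Tf \<eta>f)
    qed
    show "AE x in lborel. norm (h n x - f x) \<le> norm (of_real (2 * N) * (indicator (cball 0 (R + 1)) x :: complex))" for n
    proof (rule AE_I2)
      fix x
      have "norm (f x) \<le> N * indicator (cball 0 (R + 1)) x"
        using N supp[of x] by (cases "norm x \<le> R + 1") auto
      then have "norm (h n x - f x) \<le> 2 * N * indicator (cball 0 (R + 1)) x"
        using hn[of n x] norm_triangle_ineq4[of "h n x" "f x"] by linarith
      also have "\<dots> = norm (of_real (2 * N) * (indicator (cball 0 (R + 1)) x :: complex))"
        using N(1) by (simp add: norm_mult indicator_def)
      finally show "norm (h n x - f x) \<le> norm (of_real (2 * N) * (indicator (cball 0 (R + 1)) x :: complex))" .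
    qed
  qed auto
  from order_tendstoD(2)[OF this \<open>0 < e\<close>] obtain n where "L2_norm (\<lambda>x. h n x - f x) < e"
    by (auto simp: eventually_sequentially)
  moreover have "norm (h n x) \<le> N" for x using hn[of n x] N(1) by (cases "norm x \<le> R + 1") auto
  ultimately show ?thesis using hc hi by blast
qed

lemma L2_continuous_approx:
  fixes f :: "'a::euclidean_space \<Rightarrow> complex"
  assumes f: "f \<in> L2" and "0 < e"
  shows "\<exists>g. continuous_on UNIV g \<and> (\<exists>C. \<forall>x. norm (g x) \<le> C) \<and> integrable lborel g \<and> L2_norm (\<lambda>x. g x - f x) < e"
proof -
  have [measurable]: "f \<in> borel_measurable borel" using f by measurable
  define t where "t n x = (if norm x \<le> real n \<and> norm (f x) \<le> real n then f x else 0)" for n x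
  have [measurable]: "t n \<in> borel_measurable borel" for n unfolding t_def by measurable
  have "(\<lambda>n. L2_norm (\<lambda>x. t n x - f x)) \<longlonglongrightarrow> 0"
  proof (rule L2_norm_tendsto_dominated[OF _ _ _ f])
    show "AE x in lborel. (\<lambda>n. t n x) \<longlonglongrightarrow> f x"
    proof (intro AE_I2 tendsto_eventually)
      fix x
      have "\<forall>\<^sub>F n in sequentially. max (norm x) (norm (f x)) \<le> real n"
        using filterlim_real_sequentially unfolding filterlim_at_top by blast
      then show "\<forall>\<^sub>F n in sequentially. t n x = f x" by eventually_elim (simp add: t_def)
    qed
  qed (auto simp: t_def)
  from order_tendstoD(2)[OF this, of "e/2"] \<open>0 < e\<close> obtain n where n: "L2_norm (\<lambda>x. t n x - f x) < e/2"
    by (auto simp: eventually_sequentially)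
  have "\<exists>g. continuous_on UNIV g \<and> (\<exists>C. \<forall>x. norm (g x) \<le> C) \<and> integrable lborel g \<and> L2_norm (\<lambda>x. g x - t n x) < e/2"
    by (rule L2_bounded_supp_approx[of _ "real n" "real n"]) (use \<open>0 < e\<close> in \<open>auto simp: t_def\<close>)
  then obtain g C where g: "continuous_on UNIV g" "\<And>x. norm (g x) \<le> C" "integrable lborel g" "L2_norm (\<lambda>x. g x - t n x) < e/2"
    by blast
  have tL: "t n \<in> L2" by (rule L2_dominated(1)[OF f, of _ 1]) (auto simp: t_def)
  have "L2_norm (\<lambda>x. g x - f x) \<le> L2_norm (\<lambda>x. g x - t n x) + L2_norm (\<lambda>x. t n x - f x)"
    by (rule L2_triangle[OF L2_of_bounded_integrable[OF g(3,2)] tL f])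
  then have "L2_norm (\<lambda>x. g x - f x) < e" using n g(4) by linarith
  then show ?thesis using g(1,2,3) by blast
qed

lemma L2_norm_fourier_diff:
  assumes "f \<in> L2" "g \<in> L2"
  shows "L2_norm (\<lambda>x. fourier f x - fourier g x) = L2_norm (fourier (\<lambda>x. f x - g x))"
proof (rule L2_norm_cong_AE)
  show "AE x in lborel. fourier f x - fourier g x = fourier (\<lambda>x. f x - g x) x"
    using fourier_diff[OF assms] by eventually_elim simp
qed (use fourier_L2(1)[OF L2_diff(1)[OF assms]] L2_diff(1)[OF fourier_L2(1)[OF assms(1)] fourier_L2(1)[OF assms(2)]]
      in \<open>auto dest: L2_measurable\<close>)

theorem fourier_fourier:
  fixes f :: "'a::euclidean_space \<Rightarrow> complex"
  assumes f: "f \<in> L2"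
  shows "AE x in lborel. fourier (fourier f) x = f (- x)"
proof -
  note Ff = fourier_L2(1)[OF f]
  have "L2_norm (\<lambda>x. fourier (fourier f) x - f (- x)) \<le> 0"
  proof (rule field_le_epsilon)
    fix e :: real assume "0 < e"
    then obtain g C where g: "continuous_on UNIV g" "\<And>x. norm (g x) \<le> C" "integrable lborel g" "L2_norm (\<lambda>x. g x - f x) < e / 2"
      using L2_continuous_approx[OF f, of "e/2"] by auto
    note gL = L2_of_bounded_integrable[OF g(3,2)]
    note Fg = fourier_L2(1)[OF gL]
    have "L2_norm (\<lambda>x. fourier (fourier f) x - fourier (fourier g) x) \<le> L2_norm (\<lambda>x. fourier f x - fourier g x)"
      unfolding L2_norm_fourier_diff[OF Ff Fg] by (intro fourier_L2 L2_diff Ff Fg)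
    also have "\<dots> \<le> L2_norm (\<lambda>x. f x - g x)"
      unfolding L2_norm_fourier_diff[OF f gL] by (intro fourier_L2 L2_diff f gL)
    finally have 1: "L2_norm (\<lambda>x. fourier (fourier f) x - fourier (fourier g) x) < e / 2"
      using g(4) by (simp add: L2_norm_commute[of f])
    have "L2_norm (\<lambda>x. fourier (fourier g) x - f (- x)) = L2_norm (\<lambda>x. g (- x) - f (- x))"
    proof (rule L2_norm_cong_AE)
      show "AE x in lborel. fourier (fourier g) x - f (- x) = g (- x) - f (- x)"
        using fourier_fourier_continuous[OF g(1,2,3)] by eventually_elim simp
    qed (use L2_diff(1)[OF fourier_L2(1)[OF Fg] L2_reflect[OF f]] L2_diff(1)[OF L2_reflect[OF gL] L2_reflect[OF f]]
        in \<open>auto dest: L2_measurable\<close>)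
    also have "\<dots> < e / 2" using g(4) L2_norm_reflect[of "\<lambda>x. g x - f x"] by simp
    finally show "L2_norm (\<lambda>x. fourier (fourier f) x - f (- x)) \<le> 0 + e"
      using 1 L2_triangle[OF fourier_L2(1)[OF Ff] fourier_L2(1)[OF Fg] L2_reflect[OF f]] by simp
  qed
  then have "L2_norm (\<lambda>x. fourier (fourier f) x - f (- x)) = 0"
    using L2_norm_nonneg[of "\<lambda>x. fourier (fourier f) x - f (- x)"] by linarith
  then have "AE x in lborel. fourier (fourier f) x - f (- x) = 0"
    by (intro L2_norm_eq_0_AE L2_diff fourier_L2 L2_reflect f)
  then show ?thesis by eventually_elim simp
qed

text \<open>The transform does not increase the norm, and applied twice it is a reflection, which
  preserves the norm; so no norm can have been lost.\<close>

theorem Plancherel: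
  assumes f: "f \<in> L2"
  shows "L2_norm (fourier f) = L2_norm f"
proof (rule antisym[OF fourier_L2(2)[OF f]])
  note Ff = fourier_L2(1)[OF f]
  have "L2_norm (fourier (fourier f)) = L2_norm (\<lambda>x. f (- x))"
    using fourier_fourier[OF f] fourier_L2(1)[OF Ff] L2_reflect[OF f]
    by (intro L2_norm_cong_AE) (auto dest: L2_measurable)
  then show "L2_norm f \<le> L2_norm (fourier f)" using fourier_L2(2)[OF Ff] by (simp add: L2_norm_reflect)
qed

lemma inverse_fourier_L2:
  assumes "f \<in> L2"
  shows "inverse_fourier f \<in> L2" "L2_norm (inverse_fourier f) = L2_norm f"
  using L2_reflect[OF fourier_L2(1)[OF assms]] L2_norm_reflect[of "fourier f"] Plancherel[OF assms]
  by (auto simp: inverse_fourier_def[abs_def])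

lemma fourier_inverse_fourier:
  fixes f :: "'a::euclidean_space \<Rightarrow> complex"
  assumes "f \<in> L2"
  shows "AE x in lborel. fourier (inverse_fourier f) x = f x"
  using fourier_reflect[OF fourier_L2(1)[OF assms]] AE_lborel_uminus[OF fourier_fourier[OF assms]]
  unfolding inverse_fourier_def[abs_def] by eventually_elim simp

text \<open>The kernel is symmetric in x and \<xi>, so Fubini gives the identity for truncations,
  where everything is absolutely integrable. The form is bilinear, like all the pairings used for
  the weak equation.\<close>

theorem Parseval:
  fixes f g :: "'a::euclidean_space \<Rightarrow> complex"
  assumes f: "f \<in> L2" and g: "g \<in> L2"
  shows "(\<integral>x. fourier f x * g x \<partial>lborel) = (\<integral>x. f x * fourier g x \<partial>lborel)"
proof -
  define t where "t h R x = indicator (cball 0 R) x *\<^sub>R h x" for h :: "'a \<Rightarrow> complex" and R :: real and x :: 'a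
  have te: "(\<lambda>x. indicator (cball 0 R) x *\<^sub>R h x) = t h R" for h R by (simp add: t_def fun_eq_iff)
  have te': "(\<lambda>x. indicator (cball 0 R) x *\<^sub>R h x - h x) = (\<lambda>x. t h R x - h x)" for h R by (simp add: t_def fun_eq_iff)
  note t = L2_trunc[where 'a='a, unfolded te] L2_trunc_integrable[where 'a='a, unfolded te] L2_trunc_tendsto[where 'a='a, unfolded te'] fourier_L2_limit[where 'a='a, unfolded te]
  have eq: "(\<integral>x. fourier_integral (t f R) x * t g R x \<partial>lborel) = (\<integral>x. t f R x * fourier_integral (t g R) x \<partial>lborel)" for R
  proof -
    let ?K = "\<lambda>\<xi> x. cis (- (x \<bullet> \<xi>)) * t f R x * t g R \<xi>"
    have [measurable]: "t f R \<in> borel_measurable borel" "t g R \<in> borel_measurable borel"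
      using t(1)[OF f, of R] t(1)[OF g, of R] by (auto dest: L2_measurable)
    have "(\<integral>\<xi>. (\<integral>x. ?K \<xi> x \<partial>lborel) \<partial>lborel) = (\<integral>x. (\<integral>\<xi>. ?K \<xi> x \<partial>lborel) \<partial>lborel)"
      by (rule lborel_Fubini_dominated[of _ "\<lambda>\<xi>. norm (t g R \<xi>)" "\<lambda>x. norm (t f R x)"])
         (use t(2)[OF f, of R] t(2)[OF g, of R] in \<open>auto simp: norm_mult\<close>)
    moreover have "(\<integral>\<xi>. ?K \<xi> x \<partial>lborel) = t f R x * (\<integral>\<xi>. cis (- (\<xi> \<bullet> x)) * t g R \<xi> \<partial>lborel)" for x
    proof -
      have "?K \<xi> x = t f R x * (cis (- (\<xi> \<bullet> x)) * t g R \<xi>)" for \<xi> by (simp add: inner_commute)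
      then show ?thesis by (simp only: integral_mult_right_zero)
    qed
    ultimately have *: "(\<integral>\<xi>. (\<integral>x. cis (- (x \<bullet> \<xi>)) * t f R x \<partial>lborel) * t g R \<xi> \<partial>lborel)
       = (\<integral>x. t f R x * (\<integral>\<xi>. cis (- (\<xi> \<bullet> x)) * t g R \<xi> \<partial>lborel) \<partial>lborel)"
      by simp
    show ?thesis
      unfolding fourier_integral_def mult.assoc mult.left_commute[of _ "of_real _"] integral_mult_right_zero *
      by (rule refl)
  qed
  note lf = t(4)[OF f, unfolded L2_limit_iff] and lg = t(4)[OF g, unfolded L2_limit_iff]
  have "((\<lambda>R. \<integral>x. fourier_integral (t f R) x * t g R x \<partial>lborel) \<longlongrightarrow> (\<integral>x. fourier f x * g x \<partial>lborel)) at_top"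
    by (rule L2_pairing_tendsto) (use lf t(1)[OF g] t(3)[OF g] fourier_L2(1)[OF f] g in auto)
  moreover have "((\<lambda>R. \<integral>x. t f R x * fourier_integral (t g R) x \<partial>lborel) \<longlongrightarrow> (\<integral>x. f x * fourier g x \<partial>lborel)) at_top"
    by (rule L2_pairing_tendsto) (use lg t(1)[OF f] t(3)[OF f] fourier_L2(1)[OF g] f in auto)
  ultimately show ?thesis unfolding eq by (intro tendsto_unique[of at_top]) auto
qed

section \<open>Fourier multipliers\<close>

lemma
  assumes "(\<lambda>\<xi>. m \<xi> *\<^sub>R fourier f \<xi>) \<in> L2"
  shows fourier_mult_L2: "fourier_mult m f \<in> L2"
    and L2_norm_fourier_mult: "L2_norm (fourier_mult m f) = L2_norm (\<lambda>\<xi>. m \<xi> *\<^sub>R fourier f \<xi>)"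
    and fourier_fourier_mult: "AE \<xi> in lborel. fourier (fourier_mult m f) \<xi> = m \<xi> *\<^sub>R fourier f \<xi>"
  using inverse_fourier_L2[OF assms] fourier_inverse_fourier[OF assms] unfolding fourier_mult_def[abs_def] by auto

lemma fourier_mult_bounded:
  assumes f: "f \<in> L2" and m: "m \<in> borel_measurable borel" "\<And>x. \<bar>m x\<bar> \<le> C"
  shows "(\<lambda>\<xi>. m \<xi> *\<^sub>R fourier f \<xi>) \<in> L2"
  by (rule L2_scaleR_bounded(1)[OF fourier_L2(1)[OF f] m])

text \<open>Compact support of m makes the inverse transform an honest integral at almost every x;
  pairings of transforms thereby become pointwise values, to which the supremum bound
  applies.\<close>

lemma fourier_mult_eq_integral:
  fixes f :: "'a::euclidean_space \<Rightarrow> complex"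
  assumes f: "f \<in> L2" and [measurable]: "m \<in> borel_measurable borel" and m: "\<And>x. \<bar>m x\<bar> \<le> C"
    and supp: "\<And>x. norm x > R \<Longrightarrow> m x = 0"
  shows "AE x in lborel. fourier_mult m f x
      = of_real ((2 * pi) powr (- real DIM('a) / 2)) * (\<integral>\<xi>. cis (x \<bullet> \<xi>) * (m \<xi> *\<^sub>R fourier f \<xi>) \<partial>lborel)"
proof -
  note L = fourier_mult_bounded[OF f assms(2) m]
  have "(\<lambda>\<xi>. indicator (cball 0 R) \<xi> *\<^sub>R (m \<xi> *\<^sub>R fourier f \<xi>)) = (\<lambda>\<xi>. m \<xi> *\<^sub>R fourier f \<xi>)"
    using supp by (force simp: fun_eq_iff indicator_def)
  then have i: "integrable lborel (\<lambda>\<xi>. m \<xi> *\<^sub>R fourier f \<xi>)" using L2_trunc_integrable[OF L, of R] by simp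
  show ?thesis
    using AE_lborel_uminus[OF fourier_eq_integral_AE[OF L i]]
    by eventually_elim (simp add: fourier_mult_def inverse_fourier_def fourier_integral_def inner_commute)
qed

section \<open>The kernel of the Klein-Gordon semigroup\<close>

text \<open>Only the values of the integrand are dominated, locally in z. Cauchy's inequality
  upgrades this to a bound for the difference quotients, and dominated convergence then produces a
  complex derivative.\<close>

lemma holomorphic_parametric_integral:
  fixes f :: "complex \<Rightarrow> 'x \<Rightarrow> complex"
  assumes S: "open S"
    and hol: "\<And>x. (\<lambda>z. f z x) holomorphic_on S"
    and meas: "\<And>z. z \<in> S \<Longrightarrow> f z \<in> borel_measurable M"
    and dom: "\<And>z. z \<in> S \<Longrightarrow> \<exists>r>0. \<exists>g. integrable M g \<and> cball z r \<subseteq> S \<and> (\<forall>w\<in>cball z r. \<forall>x. norm (f w x) \<le> g x)"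
  shows "(\<lambda>z. \<integral>x. f z x \<partial>M) holomorphic_on S"
proof -
  have "\<exists>D. ((\<lambda>z. \<integral>x. f z x \<partial>M) has_field_derivative D) (at z)" if z: "z \<in> S" for z
  proof -
    obtain r g where r: "0 < r" and g: "integrable M g" and sub: "cball z r \<subseteq> S"
      and le: "\<And>w x. w \<in> cball z r \<Longrightarrow> norm (f w x) \<le> g x"
      using dom[OF z] by blast
    define d where "d x = deriv (\<lambda>z. f z x) z" for x
    have half: "cball z (r / 2) \<subseteq> S"
      by (rule order_trans[OF subset_cball sub]) (use r in simp)
    have der: "((\<lambda>z. f z x) has_field_derivative deriv (\<lambda>z. f z x) w) (at w)" if "w \<in> S" for w x
      using holomorphic_derivI[OF hol S that] .
    have g0: "0 \<le> g x" for x using order_trans[OF norm_ge_zero le[of z x]] r by simp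
    \<comment> \<open>On the disc of half the radius Cauchy's inequality bounds the derivative by g
      x / (r / 2), and the mean value inequality passes this to the quotients.\<close>
    have dq: "norm ((f y x - f z x) / (y - z)) \<le> g x / (r / 2)" if y: "y \<in> cball z (r / 2)" "y \<noteq> z" for y x
    proof -
      have "norm (f y x - f z x) \<le> (g x / (r / 2)) * norm (y - z)"
      proof (rule field_differentiable_bound[of "cball z (r/2)" "\<lambda>z. f z x" "\<lambda>w. deriv (\<lambda>z. f z x) w" "g x / (r / 2)" y z])
        show "((\<lambda>z. f z x) has_field_derivative deriv (\<lambda>z. f z x) w) (at w within cball z (r / 2))"
          if "w \<in> cball z (r / 2)" for w
          by (rule has_field_derivative_at_within[OF der]) (use that half in blast)
        show "norm (deriv (\<lambda>z. f z x) w) \<le> g x / (r / 2)" if w: "w \<in> cball z (r / 2)" for w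
        proof -
          have s: "cball w (r / 2) \<subseteq> cball z r"
          proof
            fix u assume u: "u \<in> cball w (r / 2)"
            have "dist z w \<le> r / 2" "dist w u \<le> r / 2" using w u by (simp_all only: mem_cball)
            then have "dist z u \<le> r" using dist_triangle[of z u w] by linarith
            then show "u \<in> cball z r" by (simp only: mem_cball)
          qed
          have hw: "(\<lambda>z. f z x) holomorphic_on cball w (r / 2)"
            using hol s sub holomorphic_on_subset by blast
          have "norm ((deriv ^^ 1) (\<lambda>z. f z x) w) \<le> fact 1 * g x / (r / 2) ^ 1"
          proof (rule Cauchy_inequality)
            show "(\<lambda>z. f z x) holomorphic_on ball w (r / 2)"
              by (rule holomorphic_on_subset[OF hw ball_subset_cball])
            show "continuous_on (cball w (r / 2)) (\<lambda>z. f z x)" by (rule holomorphic_on_imp_continuous_on[OF hw])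
            show "norm (f u x) \<le> g x" if "norm (w - u) = r / 2" for u
            proof -
              have "u \<in> cball w (r / 2)" using that by (simp add: dist_norm)
              then show ?thesis using le[of u x] s by blast
            qed
          qed (use r in auto)
          then show ?thesis by simp
        qed
      qed (use y r in auto)
      then show ?thesis using y(2) by (simp add: norm_divide pos_divide_le_eq)
    qed
    have "((\<lambda>y. ((\<integral>x. f y x \<partial>M) - (\<integral>x. f z x \<partial>M)) / (y - z)) \<longlongrightarrow> (\<integral>x. d x \<partial>M)) (at z)"
      unfolding tendsto_at_iff_sequentially
    proof (intro allI impI)
      fix X :: "nat \<Rightarrow> complex" assume X: "\<forall>i. X i \<in> UNIV - {z}" "X \<longlonglongrightarrow> z"
      have "\<forall>\<^sub>F i in sequentially. dist (X i) z < r / 2"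
        using tendstoD[OF X(2), of "r / 2"] r by simp
      then obtain N where N: "\<And>i. i \<ge> N \<Longrightarrow> dist (X i) z < r / 2" by (auto simp: eventually_sequentially)
      \<comment> \<open>Dropping N terms places the entire sequence in the smaller disc, where the
        dominating function is available for every index.\<close>
      define Y where "Y i = X (i + N)" for i
      have Y1: "Y i \<in> cball z (r / 2)" for i
        using N[of "i + N"] by (simp add: Y_def dist_commute less_imp_le)
      have Y: "Y i \<in> cball z (r / 2)" "Y i \<noteq> z" "Y i \<in> S" for i
        using Y1[of i] half X(1) by (auto simp: Y_def)
      have Yl: "Y \<longlonglongrightarrow> z" unfolding Y_def by (rule LIMSEQ_ignore_initial_segment[OF X(2)])
      have pt: "(\<lambda>i. (f (Y i) x - f z x) / (Y i - z)) \<longlonglongrightarrow> d x" for x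
      proof -
        have "((\<lambda>y. (f y x - f z x) / (y - z)) \<longlongrightarrow> d x) (at z)"
          using der[OF z, of x] unfolding d_def has_field_derivative_iff .
        then show ?thesis using Y(2) Yl unfolding tendsto_at_iff_sequentially by (auto simp: comp_def)
      qed
      have m: "(\<lambda>x. (f (Y i) x - f z x) / (Y i - z)) \<in> borel_measurable M" for i
        using meas[OF Y(3)] meas[OF z] by measurable
      have int: "integrable M (f w)" if "w \<in> cball z r" for w
      proof -
        have "w \<in> S" using that sub by blast
        then show ?thesis
          by (intro Bochner_Integration.integrable_bound[OF g meas])
             (use le[OF that] in \<open>auto intro!: AE_I2 order_trans[OF _ abs_ge_self]\<close>)
      qed
      have "(\<lambda>i. \<integral>x. (f (Y i) x - f z x) / (Y i - z) \<partial>M) \<longlonglongrightarrow> (\<integral>x. d x \<partial>M)"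
      proof (rule integral_dominated_convergence[where w="\<lambda>x. g x / (r / 2)"])
        show "d \<in> borel_measurable M" by (rule borel_measurable_LIMSEQ_metric[OF m pt])
        show "integrable M (\<lambda>x. g x / (r / 2))" using g by simp
        show "AE x in M. (\<lambda>i. (f (Y i) x - f z x) / (Y i - z)) \<longlonglongrightarrow> d x" using pt by simp
        show "AE x in M. norm ((f (Y i) x - f z x) / (Y i - z)) \<le> g x / (r / 2)" for i
          using dq[OF Y(1,2)] by (intro AE_I2)
      qed (rule m)
      moreover have "(\<integral>x. (f (Y i) x - f z x) / (Y i - z) \<partial>M) = ((\<integral>x. f (Y i) x \<partial>M) - (\<integral>x. f z x \<partial>M)) / (Y i - z)" for i
      proof -
        have "Y i \<in> cball z r" using Y1[of i] r by simp
        then show ?thesis using int[of "Y i"] int[of z] r by simp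
      qed
      ultimately have "(\<lambda>i. ((\<integral>x. f (X (i + N)) x \<partial>M) - (\<integral>x. f z x \<partial>M)) / (X (i + N) - z)) \<longlonglongrightarrow> (\<integral>x. d x \<partial>M)"
        unfolding Y_def by (simp only:)
      then show "((\<lambda>y. ((\<integral>x. f y x \<partial>M) - (\<integral>x. f z x \<partial>M)) / (y - z)) \<circ> X) \<longlonglongrightarrow> (\<integral>x. d x \<partial>M)"
        unfolding comp_def by (rule LIMSEQ_offset)
    qed
    then show ?thesis unfolding has_field_derivative_iff by blast
  qed
  note ex = this
  show ?thesis
    unfolding holomorphic_on_def field_differentiable_def
  proof
    fix z assume "z \<in> S"
    from ex[OF this] obtain D where "((\<lambda>z. \<integral>x. f z x \<partial>M) has_field_derivative D) (at z)" by blast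
    from has_field_derivative_at_within[OF this]
    show "\<exists>D. ((\<lambda>z. \<integral>x. f z x \<partial>M) has_field_derivative D) (at z within S)" by blast
  qed
qed

section \<open>Substitutions for the subordination and Bessel integrals\<close>

lemma lborel_integral_substitution_UNIV:
  fixes f g g' :: "real \<Rightarrow> real"
  assumes der: "\<And>x. (g has_field_derivative g' x) (at x)" and pos: "\<And>x. 0 \<le> g' x"
    and bij: "inj g" "surj g" and [measurable]: "g' \<in> borel_measurable borel" and f: "integrable lborel f"
  shows "integrable lborel (\<lambda>x. g' x * f (g x))" "(\<integral>x. g' x * f (g x) \<partial>lborel) = (\<integral>x. f x \<partial>lborel)"
proof -
  have "continuous_on UNIV g" using der by (meson DERIV_isCont continuous_at_imp_continuous_on)
  then have [measurable]: "g \<in> borel_measurable borel" by (rule borel_measurable_continuous_onI)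
  have [measurable]: "f \<in> borel_measurable borel" using f by auto
  have "f absolutely_integrable_on UNIV"
    using f integrable_completion[of f lborel] by (simp add: set_integrable_def)
  then have *: "(\<lambda>x. \<bar>g' x\<bar> * f (g x)) absolutely_integrable_on UNIV \<and> integral UNIV (\<lambda>x. \<bar>g' x\<bar> * f (g x)) = integral UNIV f"
    using has_absolute_integral_change_of_variables_1'[of UNIV g g' f "integral UNIV f"] der bij by auto
  then show i: "integrable lborel (\<lambda>x. g' x * f (g x))"
    using pos integrable_completion[of "\<lambda>x. g' x * f (g x)" lborel] by (simp add: set_integrable_def)
  show "(\<integral>x. g' x * f (g x) \<partial>lborel) = (\<integral>x. f x \<partial>lborel)"
    using * pos integral_lborel[OF f] integral_lborel[OF i] by simp
qed

text \<open>The substitution p = A e^y - B e^(-y) completes the square: the exponent is p^2 + 2 A B,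
  the derivative of p is s = A e^y + B e^(-y), and s^2 = p^2 + 4 A B. A factor exp (- 2 A B) splits
  off and a Gaussian integral remains.\<close>

lemma exp_substitution:
  fixes h :: "real \<Rightarrow> real"
  assumes AB: "0 < A" "0 < B" and i: "integrable lborel (\<lambda>p. h p * exp (- p\<^sup>2))"
  defines "p \<equiv> \<lambda>y. A * exp y - B * exp (- y)" and "s \<equiv> \<lambda>y. A * exp y + B * exp (- y)"
  shows "integrable lborel (\<lambda>y. s y * h (p y) * exp (- (A\<^sup>2 * exp (2 * y) + B\<^sup>2 * exp (- (2 * y)))))"
    and "(\<integral>y. s y * h (p y) * exp (- (A\<^sup>2 * exp (2 * y) + B\<^sup>2 * exp (- (2 * y)))) \<partial>lborel)
      = exp (- (2 * A * B)) * (\<integral>p. h p * exp (- p\<^sup>2) \<partial>lborel)"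
    and "(s y)\<^sup>2 = (p y)\<^sup>2 + 4 * A * B"
proof -
  have ee: "exp y * exp (- y) = 1" for y :: real by (simp flip: exp_add)
  have e2: "exp (2 * y) = (exp y)\<^sup>2" "exp (- (2 * y)) = (exp (- y))\<^sup>2" for y :: real
    by (simp_all flip: exp_of_nat_mult)
  have spos: "0 < s y" for y unfolding s_def using AB by (intro add_pos_pos mult_pos_pos) auto
  have sq: "(s y)\<^sup>2 = (p y)\<^sup>2 + 4 * A * B" for y
  proof -
    have "(s y)\<^sup>2 = (p y)\<^sup>2 + 4 * A * B * (exp y * exp (- y))"
      unfolding s_def p_def by (simp only: power2_eq_square) (simp add: algebra_simps del: mult_exp_exp)
    then show ?thesis by (simp only: ee)
  qed
  then show "(s y)\<^sup>2 = (p y)\<^sup>2 + 4 * A * B" .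
  have der: "(p has_field_derivative s y) (at y)" for y
    unfolding p_def s_def by (auto intro!: derivative_eq_intros)
  have "strict_mono p" by (rule strict_monoI, rule DERIV_pos_imp_increasing) (use der spos in blast)+
  then have inj: "inj p" by (rule strict_mono_imp_inj_on)
  have surj: "surj p"
  proof (rule surjI)
    fix q
    define t where "t = sqrt (q\<^sup>2 + 4 * A * B)"
    have t2: "t\<^sup>2 = q\<^sup>2 + 4 * A * B" unfolding t_def using AB by simp
    have "\<bar>q\<bar> < t" unfolding t_def by (rule real_less_rsqrt) (use AB in simp)
    then have tq: "0 < t + q" by linarith
    \<comment> \<open>A e^y is the positive root (q + t) / 2 of X^2 - q X - A B = 0.\<close>
    define y where "y = ln ((t + q) / (2 * A))"
    have ey: "exp y = (t + q) / (2 * A)" unfolding y_def using tq AB by simp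
    then have "exp (- y) = 2 * A / (t + q)" by (simp add: exp_minus)
    also have "\<dots> = (t - q) / (2 * B)"
    proof -
      have "(t - q) * (t + q) = 4 * A * B" using t2 by (simp add: power2_eq_square algebra_simps)
      then show ?thesis using tq AB by (simp add: divide_eq_eq eq_divide_eq) 
    qed
    finally have "p y = (t + q) / 2 - (t - q) / 2" unfolding p_def ey using AB by simp
    then have "p y = q" by argo
    then show "p (ln ((sqrt (q\<^sup>2 + 4 * A * B) + q) / (2 * A))) = q" by (simp add: y_def t_def)
  qed
  have [measurable]: "s \<in> borel_measurable borel" unfolding s_def by measurable
  have eq: "s y * (h (p y) * exp (- (p y)\<^sup>2))
     = exp (2 * A * B) * (s y * h (p y) * exp (- (A\<^sup>2 * exp (2 * y) + B\<^sup>2 * exp (- (2 * y)))))" for y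
  proof -
    have "- (p y)\<^sup>2 = 2 * A * B + - (A\<^sup>2 * exp (2 * y) + B\<^sup>2 * exp (- (2 * y)))"
    proof -
      have "(p y)\<^sup>2 = A\<^sup>2 * (exp y)\<^sup>2 + B\<^sup>2 * (exp (- y))\<^sup>2 - 2 * A * B * (exp y * exp (- y))"
        unfolding p_def power2_diff power_mult_distrib by (simp only: mult_ac)
      then show ?thesis unfolding e2 ee by linarith
    qed
    then show ?thesis by (simp only: exp_add) (simp add: mult_ac)
  qed
  note sub = lborel_integral_substitution_UNIV[OF der less_imp_le[OF spos] inj surj _ i, unfolded eq]
  show "integrable lborel (\<lambda>y. s y * h (p y) * exp (- (A\<^sup>2 * exp (2 * y) + B\<^sup>2 * exp (- (2 * y)))))"
    using sub(1) by simp
  have "exp (2 * A * B) * (\<integral>y. s y * h (p y) * exp (- (A\<^sup>2 * exp (2 * y) + B\<^sup>2 * exp (- (2 * y)))) \<partial>lborel)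
     = (\<integral>p. h p * exp (- p\<^sup>2) \<partial>lborel)"
    using sub(2) by simp
  then show "(\<integral>y. s y * h (p y) * exp (- (A\<^sup>2 * exp (2 * y) + B\<^sup>2 * exp (- (2 * y)))) \<partial>lborel)
      = exp (- (2 * A * B)) * (\<integral>p. h p * exp (- p\<^sup>2) \<partial>lborel)"
    by (simp add: exp_minus field_simps)
qed

lemma gaussian_sq:
  "integrable lborel (\<lambda>p::real. exp (- p\<^sup>2))" "(\<integral>p. exp (- p\<^sup>2) \<partial>(lborel :: real measure)) = sqrt pi"
  using gaussian_integrable[of 2, where 'a=real] gaussian_integral[of 2, where 'a=real] by auto

lemma poly_gaussian_integrable:
  "integrable lborel (\<lambda>p::real. (a + 2 * \<bar>p\<bar>) ^ k * exp (- p\<^sup>2))" if "0 \<le> a"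
proof (rule Bochner_Integration.integrable_bound)
  \<comment> \<open>The factor (2 + a)^k comes from a + 2 |p| <= (2 + a) (1 + p^2 / 2), the rest
    from (1 + x)^k <= (k + 1)^(k + 1) exp (1 + x) at x = p^2 / 2; this spends half of the
    Gaussian.\<close>
  define c where "c = (2 + a) ^ k * (real (Suc k) ^ Suc k * exp 1)"
  show "integrable lborel (\<lambda>p::real. c * 1 * exp (- (1) * (norm p)\<^sup>2 / 2))"
    using gaussian_integrable[of 1, where 'a=real] by simp
  show "AE p in lborel. norm ((a + 2 * \<bar>p\<bar>) ^ k * exp (- p\<^sup>2)) \<le> norm (c * 1 * exp (- (1) * (norm p)\<^sup>2 / 2))"
  proof (rule AE_I2)
    fix p :: real
    define x where "x = p\<^sup>2 / 2"
    have x0: "0 \<le> x" by (simp add: x_def)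
    have "\<bar>p\<bar> \<le> 1 + x" using zero_le_power2[of "\<bar>p\<bar> - 1"] by (simp add: x_def power2_diff)
    moreover have "(2 + a) * (1 + x) = 2 + 2 * x + a + a * x" by (simp add: algebra_simps)
    moreover have "0 \<le> a * x" using x0 that by simp
    ultimately have "a + 2 * \<bar>p\<bar> \<le> (2 + a) * (1 + x)" by linarith
    then have "(a + 2 * \<bar>p\<bar>) ^ k \<le> ((2 + a) * (1 + x)) ^ k" by (rule power_mono) (use that in simp)
    then have 1: "(a + 2 * \<bar>p\<bar>) ^ k \<le> (2 + a) ^ k * (1 + x) ^ k" unfolding power_mult_distrib .
    have "(1 + x) ^ k \<le> (1 + x) ^ Suc k" using x0 by (intro power_increasing) auto
    also have "\<dots> = real (Suc k) ^ Suc k * ((1 + x) / real (Suc k)) ^ Suc k"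
      unfolding power_divide by simp
    also have "((1 + x) / real (Suc k)) ^ Suc k \<le> (1 + (1 + x) / real (Suc k)) ^ Suc k"
      using x0 by (intro power_mono) auto
    also have "\<dots> \<le> exp (1 + x)"
      using x0 by (intro exp_ge_one_plus_x_over_n_power_n) auto
    finally have "(1 + x) ^ k \<le> real (Suc k) ^ Suc k * exp (1 + x)" by (simp add: mult_left_mono)
    then have "(2 + a) ^ k * (1 + x) ^ k \<le> (2 + a) ^ k * (real (Suc k) ^ Suc k * exp (1 + x))"
      by (rule mult_left_mono) (use that in simp)
    then have "(a + 2 * \<bar>p\<bar>) ^ k \<le> (2 + a) ^ k * (real (Suc k) ^ Suc k * exp (1 + x))"
      by (rule order_trans[OF 1])
    then have "(a + 2 * \<bar>p\<bar>) ^ k \<le> c * exp x" by (simp add: c_def exp_add mult_ac)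
    then have "(a + 2 * \<bar>p\<bar>) ^ k * exp (- p\<^sup>2) \<le> c * exp x * exp (- p\<^sup>2)" by (intro mult_right_mono) auto
    also have "\<dots> = c * exp (- x)" by (simp add: x_def mult.assoc flip: exp_add)
    finally show "norm ((a + 2 * \<bar>p\<bar>) ^ k * exp (- p\<^sup>2)) \<le> norm (c * 1 * exp (- (1) * (norm p)\<^sup>2 / 2))"
      using that by (simp add: x_def abs_mult c_def)
  qed
qed simp

text \<open>With r = e^y this is the integral of exp (- L^2 r^2 - a^2 / (4 r^2)) over r > 0. For L =
  \<open>jbr \<xi>\<close> the integrand is a Gaussian in \<xi>, so its Fourier transform is
  explicit.\<close>

lemma subordination:
  assumes "0 < a" "0 < (L::real)"
  shows "integrable lborel (\<lambda>y. exp y * exp (- (L\<^sup>2 * exp (2 * y) + (a / 2)\<^sup>2 * exp (- (2 * y)))))"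
    and "(\<integral>y. exp y * exp (- (L\<^sup>2 * exp (2 * y) + (a / 2)\<^sup>2 * exp (- (2 * y)))) \<partial>lborel)
      = sqrt pi / 2 * (exp (- (a * L)) / L)"
proof -
  \<comment> \<open>Since e^y = (s + p) / (2 L) and s is the square root of p^2 + 4 L (a / 2), this
    h satisfies s * h p = e^y. Its non-constant part gives the odd function \<open>od\<close>, whose
    integral vanishes.\<close>
  define h where "h q = (1 + q / sqrt (q\<^sup>2 + 4 * L * (a/2))) / (2 * L)" for q
  define od where "od q = q / sqrt (q\<^sup>2 + 4 * L * (a/2)) * exp (- q\<^sup>2)" for q
  have le1: "\<bar>q / sqrt (q\<^sup>2 + 4 * L * (a/2))\<bar> \<le> 1" for q
  proof -
    have "\<bar>q\<bar> \<le> sqrt (q\<^sup>2 + 4 * L * (a/2))" by (rule real_le_rsqrt) (use assms in simp)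
    moreover have s: "0 < sqrt (q\<^sup>2 + 4 * L * (a/2))" using assms by (simp add: add_nonneg_pos)
    ultimately show ?thesis by (simp only: abs_divide abs_of_pos[OF s] divide_le_eq_1_pos[OF s])
  qed
  have io: "integrable lborel od"
  proof (rule Bochner_Integration.integrable_bound[OF gaussian_sq(1)])
    have "\<bar>od q\<bar> \<le> 1 * exp (- q\<^sup>2)" for q
      unfolding od_def abs_mult by (intro mult_mono le1) auto
    then show "AE q in lborel. norm (od q) \<le> norm (exp (- q\<^sup>2))" by (intro AE_I2) simp
  qed (simp add: od_def[abs_def])
  have "(\<integral>q. od q \<partial>lborel) = (\<integral>q. od (0 - q) \<partial>lborel)" by (rule integral_lborel_reflect[symmetric])
  also have "\<dots> = - (\<integral>q. od q \<partial>lborel)" by (simp add: od_def)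
  finally have o0: "(\<integral>q. od q \<partial>lborel) = 0" by simp
  have hq: "h q * exp (- q\<^sup>2) = (exp (- q\<^sup>2) + od q) / (2 * L)" for q by (simp add: h_def od_def field_simps)
  have ih: "integrable lborel (\<lambda>q. h q * exp (- q\<^sup>2))" unfolding hq using gaussian_sq(1) io by simp
  have vh: "(\<integral>q. h q * exp (- q\<^sup>2) \<partial>lborel) = sqrt pi / (2 * L)"
    unfolding hq using gaussian_sq io o0 by simp
  note E = exp_substitution[OF assms(2) half_gt_zero[OF assms(1)] ih]
  have "(L * exp y + a / 2 * exp (- y)) * h (L * exp y - a / 2 * exp (- y)) = exp y" for y
  proof -
    let ?s = "L * exp y + a / 2 * exp (- y)"
    have "0 < ?s" using assms by (intro add_pos_pos mult_pos_pos) auto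
    then have "sqrt ((L * exp y - a / 2 * exp (- y))\<^sup>2 + 4 * L * (a/2)) = ?s"
      using E(3)[of y] real_sqrt_unique by (metis less_imp_le)
    then have sq: "sqrt ((L * exp y - a / 2 * exp (- y))\<^sup>2 + 4 * L * (a/2)) = ?s" .
    have gen: "s * ((1 + p / s) / c) = (s + p) / c" if "s \<noteq> 0" for s p c :: real
    proof -
      have "s * (1 + p / s) = s + p" using that by (simp add: distrib_left)
      then show ?thesis by (simp only: times_divide_eq_right)
    qed
    have "?s + (L * exp y - a / 2 * exp (- y)) = exp y * (2 * L)" by simp
    then have "(?s + (L * exp y - a / 2 * exp (- y))) / (2 * L) = exp y" using assms by simp
    then show ?thesis unfolding h_def sq using gen[of ?s "L * exp y - a / 2 * exp (- y)" "2 * L"] \<open>0 < ?s\<close>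
      by (simp only: less_irrefl not_False_eq_True)
  qed
  note E' = E(1,2)[unfolded this]
  show "integrable lborel (\<lambda>y. exp y * exp (- (L\<^sup>2 * exp (2 * y) + (a / 2)\<^sup>2 * exp (- (2 * y)))))" by (rule E'(1))
  show "(\<integral>y. exp y * exp (- (L\<^sup>2 * exp (2 * y) + (a / 2)\<^sup>2 * exp (- (2 * y)))) \<partial>lborel)
      = sqrt pi / 2 * (exp (- (a * L)) / L)"
    unfolding E'(2) vh by (simp add: mult.commute)
qed

text \<open>The left side is (w / 2)^(-k/2) K_(k/2) (w), with K the modified Bessel function of the
  second kind. The substitution with A = 1 and B = w / 2, where s - p = w e^(-y), exhibits the
  decaying factor and leaves an integral that extends to complex w.\<close>

lemma bessel_substitution:
  assumes "0 < (w::real)"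
  shows "integrable lborel (\<lambda>y. exp (- (real k * y)) * exp (- (exp (2 * y) + (w / 2)\<^sup>2 * exp (- (2 * y)))))"
    and "(\<integral>y. exp (- (real k * y)) * exp (- (exp (2 * y) + (w / 2)\<^sup>2 * exp (- (2 * y)))) \<partial>lborel)
      = exp (- w) / w ^ k * (\<integral>p. (sqrt (p\<^sup>2 + 2 * w) - p) ^ k / sqrt (p\<^sup>2 + 2 * w) * exp (- p\<^sup>2) \<partial>lborel)"
proof -
  define h where "h q = (sqrt (q\<^sup>2 + 4 * 1 * (w/2)) - q) ^ k / sqrt (q\<^sup>2 + 4 * 1 * (w/2))" for q
  have ih: "integrable lborel (\<lambda>q. h q * exp (- q\<^sup>2))"
  proof (rule Bochner_Integration.integrable_bound)
    show "integrable lborel (\<lambda>q::real. 1 / sqrt (2 * w) * ((sqrt (2 * w) + 2 * \<bar>q\<bar>) ^ k * exp (- q\<^sup>2)))"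
      using poly_gaussian_integrable[of "sqrt (2 * w)" k] assms by simp
    show "AE q in lborel. norm (h q * exp (- q\<^sup>2)) \<le> norm (1 / sqrt (2 * w) * ((sqrt (2 * w) + 2 * \<bar>q\<bar>) ^ k * exp (- q\<^sup>2)))"
    proof (rule AE_I2)
      fix q :: real
      let ?s = "sqrt (q\<^sup>2 + 2 * w)"
      have s: "\<bar>q\<bar> \<le> ?s" "sqrt (2 * w) \<le> ?s" by (auto intro: real_le_rsqrt simp: assms less_imp_le)
      have "?s \<le> \<bar>q\<bar> + sqrt (2 * w)" using sqrt_add_le_add_sqrt[of "q\<^sup>2" "2 * w"] assms by simp
      then have "\<bar>?s - q\<bar> ^ k \<le> (sqrt (2 * w) + 2 * \<bar>q\<bar>) ^ k" using s by (intro power_mono) auto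
      then have "\<bar>?s - q\<bar> ^ k / ?s \<le> (sqrt (2 * w) + 2 * \<bar>q\<bar>) ^ k / sqrt (2 * w)"
        using s assms by (intro frac_le) auto
      then have "\<bar>?s - q\<bar> ^ k / ?s * exp (- q\<^sup>2) \<le> (sqrt (2 * w) + 2 * \<bar>q\<bar>) ^ k / sqrt (2 * w) * exp (- q\<^sup>2)"
        by (intro mult_right_mono) auto
      then show "norm (h q * exp (- q\<^sup>2)) \<le> norm (1 / sqrt (2 * w) * ((sqrt (2 * w) + 2 * \<bar>q\<bar>) ^ k * exp (- q\<^sup>2)))"
        using assms by (simp add: h_def abs_mult power_abs)
    qed
  qed (simp add: h_def[abs_def])
  note E = exp_substitution[OF zero_less_one half_gt_zero[OF assms] ih]
  have "(1 * exp y + w / 2 * exp (- y)) * h (1 * exp y - w / 2 * exp (- y)) = w ^ k * exp (- (real k * y))" for y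
  proof -
    let ?s = "1 * exp y + w / 2 * exp (- y)"
    have s: "0 < ?s" using assms by (intro add_pos_pos mult_pos_pos) auto
    have sq: "sqrt ((1 * exp y - w / 2 * exp (- y))\<^sup>2 + 4 * 1 * (w/2)) = ?s"
      using E(3)[of y] s real_sqrt_unique by (metis less_imp_le)
    have "?s - (1 * exp y - w / 2 * exp (- y)) = w * exp (- y)" by simp
    then show ?thesis unfolding h_def sq using s
      by (simp add: power_mult_distrib flip: exp_of_nat_mult)
  qed
  note E' = E(1,2)[unfolded this]
  have "integrable lborel (\<lambda>y. 1 / w ^ k * (w ^ k * exp (- (real k * y)) * exp (- (1\<^sup>2 * exp (2 * y) + (w / 2)\<^sup>2 * exp (- (2 * y))))))"
    by (intro integrable_mult_right E'(1))
  then show "integrable lborel (\<lambda>y. exp (- (real k * y)) * exp (- (exp (2 * y) + (w / 2)\<^sup>2 * exp (- (2 * y)))))"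
    using assms by simp
  have "w ^ k * (\<integral>y. exp (- (real k * y)) * exp (- (exp (2 * y) + (w / 2)\<^sup>2 * exp (- (2 * y)))) \<partial>lborel)
     = (\<integral>y. w ^ k * exp (- (real k * y)) * exp (- (1\<^sup>2 * exp (2 * y) + (w / 2)\<^sup>2 * exp (- (2 * y)))) \<partial>lborel)"
    by (subst integral_mult_right_zero[symmetric]) (simp add: mult.assoc)
  also have "\<dots> = exp (- w) * (\<integral>p. h p * exp (- p\<^sup>2) \<partial>lborel)" unfolding E'(2) by simp
  finally show "(\<integral>y. exp (- (real k * y)) * exp (- (exp (2 * y) + (w / 2)\<^sup>2 * exp (- (2 * y)))) \<partial>lborel)
      = exp (- w) / w ^ k * (\<integral>p. (sqrt (p\<^sup>2 + 2 * w) - p) ^ k / sqrt (p\<^sup>2 + 2 * w) * exp (- p\<^sup>2) \<partial>lborel)"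
    using assms by (simp add: h_def eq_divide_eq mult.commute)
qed

section \<open>The kernel at positive real parameter\<close>

lemma jbr_ge_1: "1 \<le> jbr \<xi>" by (simp add: jbr_def)

lemma jbr_pos: "0 < jbr \<xi>" using jbr_ge_1[of \<xi>] by linarith

lemma jbr_sq: "(jbr \<xi>)\<^sup>2 = 1 + (norm \<xi>)\<^sup>2" by (simp add: jbr_def add_nonneg_nonneg)

lemma jbr_measurable [measurable]: "jbr \<in> borel_measurable borel"
  unfolding jbr_def[abs_def] by measurable

text \<open>For z = d - i s this is the unnormalised kernel of the half-wave exp (i s
  \<open>jbr\<close>) with damping exp (- d \<open>jbr\<close>). The division by \<open>jbr\<close>
  is dictated by the subordination formula, which represents exp (- a L) / L.\<close>

definition kg_kernel :: "complex \<Rightarrow> 'a::euclidean_space \<Rightarrow> complex" where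
  "kg_kernel z x = (\<integral>\<xi>. cis (x \<bullet> \<xi>) * (exp (- z * of_real (jbr \<xi>)) / of_real (jbr \<xi>)) \<partial>lborel)"

text \<open>Subordination and Fubini: the Gaussian transform contributes |x|^2 / 4, which joins (a /
  2)^2 in the exponent, so that x and a enter only through w. The n factors e^(-y) from the Gaussian
  integral against the single e^y of the subordination formula leave the weight e^(- k y) with k = n
  - 1.\<close>

lemma
  fixes x :: "'a::euclidean_space"
  assumes a: "0 < a" and n: "DIM('a) = Suc k"
  defines "w \<equiv> sqrt (a\<^sup>2 + (norm x)\<^sup>2)"
  shows exp_jbr_integrable: "integrable lborel (\<lambda>\<xi>::'a. exp (- (a * jbr \<xi>)) / jbr \<xi>)"
    and kg_kernel_real: "kg_kernel (of_real a) x
      = of_real (2 * sqrt pi ^ k * (exp (- w) / w ^ k * (\<integral>p. (sqrt (p\<^sup>2 + 2 * w) - p) ^ k / sqrt (p\<^sup>2 + 2 * w) * exp (- p\<^sup>2) \<partial>lborel)))"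
proof -
  have w: "0 < w" unfolding w_def using a by (simp add: add_pos_nonneg)
  have w2: "w\<^sup>2 = a\<^sup>2 + (norm x)\<^sup>2" unfolding w_def by simp
  define g where "g y = exp y * exp (- (exp (2 * y) + (a / 2)\<^sup>2 * exp (- (2 * y))))" for y :: real
  define gs where "gs y \<xi> = exp (- (2 * exp (2 * y)) * (norm \<xi>)\<^sup>2 / 2)" for y :: real and \<xi> :: 'a
  have kap: "0 < 2 * exp (2 * y)" for y :: real by simp
  have split: "exp y * exp (- ((jbr \<xi>)\<^sup>2 * exp (2 * y) + (a / 2)\<^sup>2 * exp (- (2 * y)))) = g y * gs y \<xi>" for y and \<xi> :: 'a
  proof -
    have "- ((jbr \<xi>)\<^sup>2 * exp (2 * y) + (a / 2)\<^sup>2 * exp (- (2 * y)))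
      = - (exp (2 * y) + (a / 2)\<^sup>2 * exp (- (2 * y))) + - (2 * exp (2 * y)) * (norm \<xi>)\<^sup>2 / 2"
      unfolding jbr_sq by (simp add: distrib_right)
    then show ?thesis unfolding g_def gs_def by (simp only: exp_add mult.assoc)
  qed
  have sq: "sqrt (2 * pi / (2 * exp (2 * y))) = sqrt pi * exp (- y)" for y :: real
  proof -
    have e: "(exp (- y))\<^sup>2 = exp (- (2 * y))" by (simp flip: exp_of_nat_mult)
    have "2 * pi / (2 * exp (2 * y)) = pi * (exp (- y))\<^sup>2"
      unfolding e by (simp add: exp_minus inverse_eq_divide)
    then show ?thesis by (simp only: real_sqrt_mult real_sqrt_abs abs_exp_cancel)
  qed
  have pw: "(sqrt pi * exp (- y)) ^ DIM('a) * exp y = sqrt pi ^ Suc k * exp (- (real k * y))" for y :: real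
  proof -
    have "exp (- y) ^ Suc k * exp y = exp (real (Suc k) * (- y) + y)"
      by (simp only: exp_of_nat_mult exp_add)
    also have "real (Suc k) * (- y) + y = - (real k * y)" by (simp add: algebra_simps)
    finally have "exp (- y) ^ Suc k * exp y = exp (- (real k * y))" .
    then show ?thesis unfolding n power_mult_distrib by (simp only: mult.assoc)
  qed
  have gint: "(\<integral>\<xi>. gs y \<xi> \<partial>lborel) = (sqrt pi * exp (- y)) ^ DIM('a)" and gi: "integrable lborel (gs y)" for y
    unfolding gs_def[abs_def] using gaussian_integral[OF kap[of y], where 'a='a] gaussian_integrable[OF kap[of y], where 'a='a]
    by (simp_all only: sq)
  have gsn: "0 \<le> gs y \<xi>" "0 \<le> g y" for y \<xi> by (auto simp: gs_def g_def)
  have [measurable]: "g \<in> borel_measurable borel" unfolding g_def by measurable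
  have [measurable]: "(\<lambda>(y, \<xi>). gs y \<xi>) \<in> borel_measurable (borel \<Otimes>\<^sub>M borel)" unfolding gs_def by measurable
  have yint: "integrable lborel (\<lambda>y. g y * (\<integral>\<xi>. gs y \<xi> \<partial>lborel))"
  proof -
    have "g y * (\<integral>\<xi>. gs y \<xi> \<partial>lborel) = sqrt pi ^ Suc k * (exp (- (real k * y)) * exp (- (exp (2 * y) + (a / 2)\<^sup>2 * exp (- (2 * y)))))" for y
    proof -
      have "g y * (\<integral>\<xi>. gs y \<xi> \<partial>lborel) = ((sqrt pi * exp (- y)) ^ DIM('a) * exp y) * exp (- (exp (2 * y) + (a / 2)\<^sup>2 * exp (- (2 * y))))"
        unfolding gint g_def by (simp only: mult_ac)
      then show ?thesis unfolding pw by (simp only: mult.assoc)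
    qed
    then show ?thesis using bessel_substitution(1)[OF a, of k] by simp
  qed
  define K where "K y \<xi> = cis (x \<bullet> \<xi>) * of_real (g y * gs y \<xi>)" for y :: real and \<xi> :: 'a
  have [measurable]: "(\<lambda>(y, \<xi>). K y \<xi>) \<in> borel_measurable (borel \<Otimes>\<^sub>M borel)" unfolding K_def by measurable
  have nK: "norm (K y \<xi>) = g y * gs y \<xi>" for y \<xi> using gsn by (simp add: K_def norm_mult)
  have KI: "integrable (lborel \<Otimes>\<^sub>M lborel) (\<lambda>(y, \<xi>). K y \<xi>)"
  proof (rule lborel_pair.Fubini_integrable)
    show "integrable lborel (\<lambda>y. \<integral>\<xi>. norm (case (y, \<xi>) of (y, \<xi>) \<Rightarrow> K y \<xi>) \<partial>lborel)"
      using yint by (simp add: nK)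
    show "AE y in lborel. integrable lborel (\<lambda>\<xi>. case (y, \<xi>) of (y, \<xi>) \<Rightarrow> K y \<xi>)"
    proof (rule AE_I2)
      fix y
      have "(\<lambda>\<xi>. K y \<xi>) \<in> borel_measurable borel" unfolding K_def gs_def by measurable
      then have "integrable lborel (\<lambda>\<xi>. K y \<xi>)"
        by (intro Bochner_Integration.integrable_bound[OF integrable_mult_right[OF gi[of y], of "g y"]])
           (use gsn in \<open>auto simp: nK intro!: AE_I2\<close>)
      then show "integrable lborel (\<lambda>\<xi>. case (y, \<xi>) of (y, \<xi>) \<Rightarrow> K y \<xi>)" by simp
    qed
  qed simp
  have inner1: "(\<integral>y. K y \<xi> \<partial>lborel) = of_real (sqrt pi / 2) * (cis (x \<bullet> \<xi>) * of_real (exp (- (a * jbr \<xi>)) / jbr \<xi>))" for \<xi>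
  proof -
    have "(\<integral>y. K y \<xi> \<partial>lborel) = cis (x \<bullet> \<xi>) * of_real (\<integral>y. g y * gs y \<xi> \<partial>lborel)"
      unfolding K_def integral_mult_right_zero integral_complex_of_real ..
    also have "(\<integral>y. g y * gs y \<xi> \<partial>lborel) = sqrt pi / 2 * (exp (- (a * jbr \<xi>)) / jbr \<xi>)"
      using subordination(2)[OF a jbr_pos[of \<xi>]] unfolding split .
    finally show ?thesis by (simp only: of_real_mult mult.left_commute)
  qed
  have inner2: "(\<integral>\<xi>. K y \<xi> \<partial>lborel)
      = of_real (sqrt pi ^ Suc k * (exp (- (real k * y)) * exp (- (exp (2 * y) + (w / 2)\<^sup>2 * exp (- (2 * y))))))" for y
  proof -
    have "K y \<xi> = of_real (g y) * (cis (- (\<xi> \<bullet> (- x))) * of_real (exp (- (2 * exp (2 * y)) * (norm \<xi>)\<^sup>2 / 2)))" for \<xi>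
      by (simp add: K_def gs_def inner_commute mult_ac)
    then have "(\<integral>\<xi>. K y \<xi> \<partial>lborel) = of_real (g y) * of_real ((sqrt pi * exp (- y)) ^ DIM('a) * exp (- (norm (- x))\<^sup>2 / (2 * (2 * exp (2 * y)))))"
      by (simp only: integral_mult_right_zero gaussian_fourier[OF kap] sq)
    also have "\<dots> = of_real (((sqrt pi * exp (- y)) ^ DIM('a) * exp y) * (exp (- (exp (2 * y) + (a / 2)\<^sup>2 * exp (- (2 * y)))) * exp (- (norm (- x))\<^sup>2 / (2 * (2 * exp (2 * y))))))"
      unfolding g_def of_real_mult[symmetric] by (simp only: mult_ac)
    also have "exp (- (exp (2 * y) + (a / 2)\<^sup>2 * exp (- (2 * y)))) * exp (- (norm (- x))\<^sup>2 / (2 * (2 * exp (2 * y))))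
       = exp (- (exp (2 * y) + (w / 2)\<^sup>2 * exp (- (2 * y))))"
    proof -
      have "- (norm (- x))\<^sup>2 / (2 * (2 * exp (2 * y))) = - ((norm x)\<^sup>2 / 4 * exp (- (2 * y)))"
      proof -
        have "exp (- (2 * y)) = 1 / exp (2 * y)" by (simp add: exp_minus inverse_eq_divide)
        then show ?thesis by simp
      qed
      moreover have "(w / 2)\<^sup>2 = (a / 2)\<^sup>2 + (norm x)\<^sup>2 / 4" by (simp add: power_divide w2 add_divide_distrib)
      ultimately show ?thesis unfolding exp_add[symmetric] by (simp add: distrib_right)
    qed
    finally show ?thesis unfolding pw by (simp only: mult.assoc)
  qed
  have "integrable lborel (\<lambda>\<xi>. \<integral>y. K y \<xi> \<partial>lborel)" using lborel_pair.integrable_snd[OF KI] .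
  then have "integrable lborel (\<lambda>\<xi>. of_real (2 / sqrt pi) * (of_real (sqrt pi / 2) * (cis (x \<bullet> \<xi>) * of_real (exp (- (a * jbr \<xi>)) / jbr \<xi>))))"
    unfolding inner1 by (rule integrable_mult_right)
  then have "integrable lborel (\<lambda>\<xi>. cis (x \<bullet> \<xi>) * complex_of_real (exp (- (a * jbr \<xi>)) / jbr \<xi>))"
    by (simp add: mult.assoc[symmetric] flip: of_real_mult)
  from integrable_norm[OF this] show "integrable lborel (\<lambda>\<xi>::'a. exp (- (a * jbr \<xi>)) / jbr \<xi>)"
    by (simp add: norm_mult norm_divide abs_of_pos[OF jbr_pos])
  have eq: "exp (- complex_of_real a * of_real (jbr \<xi>)) / of_real (jbr \<xi>) = of_real (exp (- (a * jbr \<xi>)) / jbr \<xi>)" for \<xi> :: 'a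
    by (simp flip: exp_of_real)
  have "of_real (sqrt pi / 2) * kg_kernel (of_real a) x = (\<integral>\<xi>. (\<integral>y. K y \<xi> \<partial>lborel) \<partial>lborel)"
    unfolding kg_kernel_def eq inner1 integral_mult_right_zero ..
  also have "\<dots> = (\<integral>y. (\<integral>\<xi>. K y \<xi> \<partial>lborel) \<partial>lborel)"
    by (rule lborel_pair.Fubini_integral[OF KI])
  also have "\<dots> = of_real (sqrt pi ^ Suc k * (exp (- w) / w ^ k * (\<integral>p. (sqrt (p\<^sup>2 + 2 * w) - p) ^ k / sqrt (p\<^sup>2 + 2 * w) * exp (- p\<^sup>2) \<partial>lborel)))"
    unfolding inner2 integral_complex_of_real integral_mult_right_zero bessel_substitution(2)[OF w] ..
  finally have "of_real (2 / sqrt pi) * (of_real (sqrt pi / 2) * kg_kernel (of_real a) x)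
     = of_real (2 / sqrt pi) * of_real (sqrt pi ^ Suc k * (exp (- w) / w ^ k * (\<integral>p. (sqrt (p\<^sup>2 + 2 * w) - p) ^ k / sqrt (p\<^sup>2 + 2 * w) * exp (- p\<^sup>2) \<partial>lborel)))"
    by (simp only:)
  moreover have "of_real (2 / sqrt pi) * (of_real (sqrt pi / 2) * u) = u" for u :: complex
    by (simp add: mult.assoc[symmetric] flip: of_real_mult)
  moreover have "2 / sqrt pi * (sqrt pi ^ Suc k * u) = 2 * sqrt pi ^ k * u" for u :: real by simp
  ultimately show "kg_kernel (of_real a) x
      = of_real (2 * sqrt pi ^ k * (exp (- w) / w ^ k * (\<integral>p. (sqrt (p\<^sup>2 + 2 * w) - p) ^ k / sqrt (p\<^sup>2 + 2 * w) * exp (- p\<^sup>2) \<partial>lborel)))"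
    by (simp only: of_real_mult[symmetric])
qed

text \<open>The p-integral of \<open>bessel_substitution\<close> with the principal root in place of
  the real one. For Re w > 0 the argument p^2 + 2 w stays in the right half plane, away from the
  branch cut, so this is the analytic extension. The factor exp (- w) / w^k is kept apart because it
  carries the decay.\<close>

definition bessel_amp :: "nat \<Rightarrow> complex \<Rightarrow> complex" where
  "bessel_amp k w = (\<integral>p. (csqrt (of_real (p\<^sup>2) + 2 * w) - of_real p) ^ k / csqrt (of_real (p\<^sup>2) + 2 * w) * of_real (exp (- p\<^sup>2)) \<partial>lborel)"

lemma bessel_amp_integrand_bound:
  assumes "0 < Re w" "m \<le> norm w" "norm w \<le> M" "0 < m"
  shows "norm ((csqrt (of_real (p\<^sup>2) + 2 * w) - of_real p) ^ k / csqrt (of_real (p\<^sup>2) + 2 * w) * of_real (exp (- p\<^sup>2)))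
    \<le> 1 / sqrt (2 * m) * ((sqrt (2 * M) + 2 * \<bar>p\<bar>) ^ k * exp (- p\<^sup>2))"
proof -
  let ?u = "of_real (p\<^sup>2) + 2 * w"
  \<comment> \<open>As Re w > 0, adding p^2 to 2 w can only increase the modulus; the root in the
    denominator thus stays away from 0 uniformly in p.\<close>
  have "(norm (2 * w))\<^sup>2 \<le> (norm ?u)\<^sup>2"
    unfolding cmod_power2 using assms(1) by (simp add: power2_sum)
  then have "norm (2 * w) \<le> norm ?u" by (rule power2_le_imp_le) simp
  then have lo: "sqrt (2 * m) \<le> norm (csqrt ?u)"
    using assms(2) unfolding norm_csqrt by (intro real_sqrt_le_mono) (simp add: norm_mult)
  have "norm ?u \<le> p\<^sup>2 + 2 * M"
    using norm_triangle_ineq[of "of_real (p\<^sup>2)" "2 * w"] assms(3) by (simp add: norm_mult norm_power)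
  then have "norm (csqrt ?u) \<le> sqrt (p\<^sup>2 + 2 * M)" unfolding norm_csqrt by (rule real_sqrt_le_mono)
  also have "\<dots> \<le> sqrt (p\<^sup>2) + sqrt (2 * M)"
    using assms by (intro sqrt_add_le_add_sqrt) auto
  finally have hi: "norm (csqrt ?u - of_real p) \<le> sqrt (2 * M) + 2 * \<bar>p\<bar>"
    using norm_triangle_ineq4[of "csqrt ?u" "of_real p"] by simp
  have "norm ((csqrt ?u - of_real p) ^ k / csqrt ?u) \<le> (sqrt (2 * M) + 2 * \<bar>p\<bar>) ^ k / sqrt (2 * m)"
    unfolding norm_divide norm_power
    by (intro frac_le power_mono hi lo) (use assms in auto)
  then have "norm ((csqrt ?u - of_real p) ^ k / csqrt ?u) * exp (- p\<^sup>2) \<le> (sqrt (2 * M) + 2 * \<bar>p\<bar>) ^ k / sqrt (2 * m) * exp (- p\<^sup>2)"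
    by (rule mult_right_mono) simp
  moreover have "norm (c * complex_of_real (exp (- p\<^sup>2))) = norm c * exp (- p\<^sup>2)" for c
    by (simp only: norm_mult norm_of_real abs_exp_cancel)
  moreover have "1 / sqrt (2 * m) * (b * exp (- p\<^sup>2)) = b / sqrt (2 * m) * exp (- p\<^sup>2)" for b by simp
  ultimately show ?thesis by (simp only:)
qed

lemma csqrt_borel_measurable [measurable]: "csqrt \<in> borel_measurable borel"
proof -
  have "csqrt = (\<lambda>z. Complex (sqrt ((cmod z + Re z) / 2)) ((if Im z = 0 then 1 else sgn (Im z)) * sqrt ((cmod z - Re z) / 2)))"
    by (intro ext complex_eqI) (auto simp: csqrt.code)
  moreover have "(\<lambda>z::complex. of_real (sqrt ((cmod z + Re z) / 2)) + \<i> * of_real ((if Im z = 0 then 1 else sgn (Im z)) * sqrt ((cmod z - Re z) / 2))) \<in> borel_measurable borel"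
    by measurable
  ultimately show ?thesis by (simp only: complex_eq_iff Complex_eq)
qed

lemma bessel_amp_bound:
  assumes "0 < Re w"
  shows "norm (bessel_amp k w) \<le> 1 / sqrt (2 * norm w) * (\<integral>p. (sqrt (2 * norm w) + 2 * \<bar>p\<bar>) ^ k * exp (- p\<^sup>2) \<partial>lborel)"
proof -
  have w: "0 < norm w" using assms complex_Re_le_cmod[of w] by linarith
  have i: "integrable lborel (\<lambda>p. 1 / sqrt (2 * norm w) * ((sqrt (2 * norm w) + 2 * \<bar>p\<bar>) ^ k * exp (- p\<^sup>2)))"
    by (intro integrable_mult_right poly_gaussian_integrable) simp
  have "norm (bessel_amp k w) \<le> (\<integral>p. 1 / sqrt (2 * norm w) * ((sqrt (2 * norm w) + 2 * \<bar>p\<bar>) ^ k * exp (- p\<^sup>2)) \<partial>lborel)"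
    unfolding bessel_amp_def
    by (rule order_trans[OF integral_norm_bound], rule integral_mono_AE', rule i)
       (use bessel_amp_integrand_bound[OF assms order_refl order_refl w] in \<open>auto intro!: AE_I2\<close>)
  then show ?thesis by (simp only: integral_mult_right_zero)
qed

lemma bessel_amp_of_real:
  assumes "0 < w"
  shows "bessel_amp k (of_real w) = of_real (\<integral>p. (sqrt (p\<^sup>2 + 2 * w) - p) ^ k / sqrt (p\<^sup>2 + 2 * w) * exp (- p\<^sup>2) \<partial>lborel)"
proof -
  have "csqrt (of_real (p\<^sup>2) + 2 * of_real w) = of_real (sqrt (p\<^sup>2 + 2 * w))" for p :: real
    using of_real_sqrt[of "p\<^sup>2 + 2 * w"] assms by simp
  then have "(csqrt (of_real (p\<^sup>2) + 2 * of_real w) - of_real p) ^ k / csqrt (of_real (p\<^sup>2) + 2 * of_real w) * of_real (exp (- p\<^sup>2))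
     = complex_of_real ((sqrt (p\<^sup>2 + 2 * w) - p) ^ k / sqrt (p\<^sup>2 + 2 * w) * exp (- p\<^sup>2))" for p :: real
    by (simp only: of_real_mult of_real_divide of_real_power of_real_diff)
  then show ?thesis unfolding bessel_amp_def by (simp only: integral_complex_of_real)
qed

lemma not_nonpos_Reals_if_Re_pos: "0 < Re u \<Longrightarrow> u \<notin> \<real>\<^sub>\<le>\<^sub>0"
  by (auto simp: complex_nonpos_Reals_iff)

lemma bessel_amp_holomorphic: "bessel_amp k holomorphic_on {w. 0 < Re w}"
proof -
  let ?f = "\<lambda>w p. (csqrt (of_real (p\<^sup>2) + 2 * w) - of_real p) ^ k / csqrt (of_real (p\<^sup>2) + 2 * w) * of_real (exp (- p\<^sup>2))"
  have "(\<lambda>w. \<integral>p. ?f w p \<partial>lborel) holomorphic_on {w. 0 < Re w}"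
  proof (rule holomorphic_parametric_integral)
    show "open {w. 0 < Re w}" by (rule open_halfspace_Re_gt)
    fix p :: real
    have "of_real (p\<^sup>2) + 2 * w \<notin> \<real>\<^sub>\<le>\<^sub>0" "csqrt (of_real (p\<^sup>2) + 2 * w) \<noteq> 0" if "0 < Re w" for w
    proof -
      have "0 < Re (of_real (p\<^sup>2) + 2 * w)" using that by (simp add: add_nonneg_pos)
      then show "of_real (p\<^sup>2) + 2 * w \<notin> \<real>\<^sub>\<le>\<^sub>0" by (rule not_nonpos_Reals_if_Re_pos)
      have "of_real (p\<^sup>2) + 2 * w \<noteq> 0"
        using \<open>0 < Re (of_real (p\<^sup>2) + 2 * w)\<close> by (metis less_irrefl zero_complex.sel(1))
      then show "csqrt (of_real (p\<^sup>2) + 2 * w) \<noteq> 0" by (simp only: csqrt_eq_0 not_False_eq_True)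
    qed
    then show "(\<lambda>w. ?f w p) holomorphic_on {w. 0 < Re w}"
      by (intro holomorphic_intros) auto
  next
    fix w :: complex assume w: "w \<in> {w. 0 < Re w}"
    show "?f w \<in> borel_measurable lborel" by measurable
    define m where "m = Re w / 2"
    have m: "0 < m" using w by (simp add: m_def)
    have ball: "m \<le> Re u \<and> norm u \<le> norm w + m" if "u \<in> cball w m" for u
    proof -
      have d: "norm (w - u) \<le> m" using that by (simp add: dist_norm)
      have "Re w - Re u \<le> m" using d complex_Re_le_cmod[of "w - u"] by simp
      moreover have "norm u \<le> norm w + norm (w - u)" using norm_triangle_ineq4[of w "w - u"] by simp
      ultimately show ?thesis using d unfolding m_def by argo
    qed
    show "\<exists>r>0. \<exists>g. integrable lborel g \<and> cball w r \<subseteq> {w. 0 < Re w} \<and> (\<forall>u\<in>cball w r. \<forall>p. norm (?f u p) \<le> g p)"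
    proof (intro exI conjI)
      show "0 < m" by (rule m)
      show "integrable lborel (\<lambda>p. 1 / sqrt (2 * m) * ((sqrt (2 * (norm w + m)) + 2 * \<bar>p\<bar>) ^ k * exp (- p\<^sup>2)))"
        using m by (intro integrable_mult_right poly_gaussian_integrable) simp
      show "cball w m \<subseteq> {w. 0 < Re w}" using ball m by fastforce
      show "\<forall>u\<in>cball w m. \<forall>p. norm (?f u p) \<le> 1 / sqrt (2 * m) * ((sqrt (2 * (norm w + m)) + 2 * \<bar>p\<bar>) ^ k * exp (- p\<^sup>2))"
      proof (intro ballI allI)
        fix u p assume "u \<in> cball w m"
        from ball[OF this] m complex_Re_le_cmod[of u]
        show "norm (?f u p) \<le> 1 / sqrt (2 * m) * ((sqrt (2 * (norm w + m)) + 2 * \<bar>p\<bar>) ^ k * exp (- p\<^sup>2))"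
          by (intro bessel_amp_integrand_bound) linarith+
      qed
    qed
  qed
  then show ?thesis unfolding bessel_amp_def[abs_def] .
qed

lemma kg_kernel_norm_bound:
  fixes x :: "'a::euclidean_space"
  assumes "0 < Re z"
  shows "norm (kg_kernel z x) \<le> (\<integral>\<xi>. exp (- (Re z * jbr \<xi>)) / jbr \<xi> \<partial>(lborel :: 'a measure))"
proof -
  obtain k where k: "DIM('a) = Suc k" using DIM_positive[where 'a='a] gr0_conv_Suc by blast
  show ?thesis
    unfolding kg_kernel_def
    by (rule order_trans[OF integral_norm_bound], rule integral_mono_AE', rule exp_jbr_integrable[OF assms k])
       (auto simp: norm_mult norm_divide abs_of_pos[OF jbr_pos] less_imp_le[OF jbr_pos])
qed

lemma kg_kernel_holomorphic:
  fixes x :: "'a::euclidean_space"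
  shows "(\<lambda>z. kg_kernel z x) holomorphic_on {z. 0 < Re z}"
  unfolding kg_kernel_def
proof (rule holomorphic_parametric_integral)
  let ?f = "\<lambda>z (\<xi>::'a). cis (x \<bullet> \<xi>) * (exp (- z * of_real (jbr \<xi>)) / of_real (jbr \<xi>))"
  obtain k where k: "DIM('a) = Suc k" using DIM_positive[where 'a='a] gr0_conv_Suc by blast
  show "open {w. 0 < Re w}" by (rule open_halfspace_Re_gt)
  show "(\<lambda>z. ?f z \<xi>) holomorphic_on {z. 0 < Re z}" for \<xi>
    using jbr_pos[of \<xi>] by (intro holomorphic_intros) auto
  fix z :: complex assume z: "z \<in> {z. 0 < Re z}"
  show "?f z \<in> borel_measurable lborel" by measurable
  define m where "m = Re z / 2"
  have m: "0 < m" using z by (simp add: m_def)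
  have ball: "m \<le> Re u" if "u \<in> cball z m" for u
  proof -
    have "Re z - Re u \<le> m" using that complex_Re_le_cmod[of "z - u"] by (simp add: dist_norm)
    then show ?thesis unfolding m_def by argo
  qed
  show "\<exists>r>0. \<exists>g. integrable lborel g \<and> cball z r \<subseteq> {w. 0 < Re w} \<and> (\<forall>u\<in>cball z r. \<forall>\<xi>. norm (?f u \<xi>) \<le> g \<xi>)"
  proof (intro exI conjI)
    show "0 < m" by (rule m)
    show "integrable lborel (\<lambda>\<xi>::'a. exp (- (m * jbr \<xi>)) / jbr \<xi>)" by (rule exp_jbr_integrable[OF m k])
    show "cball z m \<subseteq> {w. 0 < Re w}" using ball m by fastforce
    show "\<forall>u\<in>cball z m. \<forall>\<xi>. norm (?f u \<xi>) \<le> exp (- (m * jbr \<xi>)) / jbr \<xi>"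
    proof (intro ballI allI)
      fix u and \<xi> :: 'a assume "u \<in> cball z m"
      from ball[OF this] have "exp (- (Re u * jbr \<xi>)) / jbr \<xi> \<le> exp (- (m * jbr \<xi>)) / jbr \<xi>"
        using jbr_pos[of \<xi>] by (intro divide_right_mono) (auto intro!: mult_right_mono)
      then show "norm (?f u \<xi>) \<le> exp (- (m * jbr \<xi>)) / jbr \<xi>"
        using jbr_pos[of \<xi>] by (simp add: norm_mult norm_divide)
    qed
  qed
qed

lemma csqrt_Re_pos:
  assumes "u \<notin> \<real>\<^sub>\<le>\<^sub>0"
  shows "0 < Re (csqrt u)"
proof (rule ccontr)
  assume "\<not> 0 < Re (csqrt u)"
  then have r: "Re (csqrt u) = 0" using Re_csqrt[of u] by simp
  have "u = (csqrt u)\<^sup>2" by simp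
  also have "\<dots> = - of_real ((Im (csqrt u))\<^sup>2)" using r by (simp add: complex_eq_iff power2_eq_square)
  finally have "u \<in> \<real>\<^sub>\<le>\<^sub>0" by (metis Im_complex_of_real Re_complex_of_real complex_nonpos_Reals_iff neg_le_0_iff_le uminus_complex.sel zero_le_power2 minus_zero)
  then show False using assms by simp
qed

lemma sq_plus_not_nonpos:
  assumes "0 < Re z"
  shows "z\<^sup>2 + of_real (r\<^sup>2) \<notin> \<real>\<^sub>\<le>\<^sub>0"
proof
  assume "z\<^sup>2 + of_real (r\<^sup>2) \<in> \<real>\<^sub>\<le>\<^sub>0"
  then have "Im (z\<^sup>2) = 0" "Re (z\<^sup>2) + r\<^sup>2 \<le> 0" by (auto simp: complex_nonpos_Reals_iff)
  then have "Im z = 0" "(Re z)\<^sup>2 + r\<^sup>2 \<le> 0" using assms by (auto simp: power2_eq_square)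
  moreover have "0 < (Re z)\<^sup>2" using assms by simp
  ultimately show False using zero_le_power2[of r] by linarith
qed

text \<open>Both sides are holomorphic for Re z > 0 and agree on the positive reals. In this half
  plane z^2 + |x|^2 never meets the branch cut, so W is holomorphic with positive real part and
  \<open>bessel_amp\<close> can be evaluated at it.\<close>

theorem kg_kernel_eq:
  fixes x :: "'a::euclidean_space"
  assumes z: "0 < Re z" and k: "DIM('a) = Suc k"
  defines "W \<equiv> \<lambda>z. csqrt (z\<^sup>2 + of_real ((norm x)\<^sup>2))"
  shows "kg_kernel z x = of_real (2 * sqrt pi ^ k) * (exp (- W z) / W z ^ k * bessel_amp k (W z))"
proof -
  let ?S = "{z. 0 < Re z}"
  let ?g = "\<lambda>z. of_real (2 * sqrt pi ^ k) * (exp (- W z) / W z ^ k * bessel_amp k (W z))"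
  have Wp: "0 < Re (W z)" if "0 < Re z" for z unfolding W_def by (rule csqrt_Re_pos[OF sq_plus_not_nonpos[OF that]])
  have W0: "W z \<noteq> 0" if "0 < Re z" for z using Wp[OF that] by auto
  have Wh: "W holomorphic_on ?S" unfolding W_def using sq_plus_not_nonpos by (intro holomorphic_intros) auto
  have Bh: "(\<lambda>z. bessel_amp k (W z)) holomorphic_on ?S"
    using holomorphic_on_compose_gen[OF Wh bessel_amp_holomorphic[of k]] Wp by (auto simp: comp_def)
  have "kg_kernel z x - ?g z = 0"
  proof (rule analytic_continuation[where f="\<lambda>z. kg_kernel z x - ?g z" and S="?S" and U="of_real ` {0<..}" and \<xi>=1])
    show "(\<lambda>z. kg_kernel z x - ?g z) holomorphic_on ?S"
      using W0 by (intro holomorphic_intros kg_kernel_holomorphic Wh Bh) auto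
    show "open ?S" by (rule open_halfspace_Re_gt)
    show "connected ?S" by (rule convex_connected[OF convex_halfspace_Re_gt])
    show "(1::complex) islimpt of_real ` {0<..}"
      unfolding islimpt_sequential
    proof (intro exI conjI allI)
      show "complex_of_real (1 + inverse (real (Suc n))) \<in> of_real ` {0<..} - {1}" for n
      proof -
        have p: "0 < inverse (real (Suc n))" by simp
        then have "1 + inverse (real (Suc n)) \<in> {0<..}" unfolding greaterThan_iff by linarith
        moreover have "complex_of_real (1 + inverse (real (Suc n))) \<noteq> 1"
          unfolding of_real_eq_1_iff using p by linarith
        ultimately show ?thesis by blast
      qed
      have "(\<lambda>n. complex_of_real (1 + inverse (real (Suc n)))) \<longlonglongrightarrow> of_real (1 + 0)"
        by (intro tendsto_of_real tendsto_add tendsto_const LIMSEQ_inverse_real_of_nat)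
      then show "(\<lambda>n. complex_of_real (1 + inverse (real (Suc n)))) \<longlonglongrightarrow> 1" by simp
    qed
    fix u :: complex assume "u \<in> of_real ` {0<..}"
    then obtain a where a: "0 < a" "u = of_real a" by auto
    let ?w = "sqrt (a\<^sup>2 + (norm x)\<^sup>2)"
    have w: "0 < ?w" using a by (simp add: add_pos_nonneg)
    have "W u = csqrt (of_real (a\<^sup>2 + (norm x)\<^sup>2))" by (simp add: W_def a)
    also have "\<dots> = of_real ?w" by (rule of_real_sqrt[symmetric]) simp
    finally have Wu: "W u = of_real ?w" .
    have e: "exp (- complex_of_real ?w) = of_real (exp (- ?w))" by (simp flip: exp_of_real)
    show "kg_kernel u x - ?g u = 0"
      unfolding Wu bessel_amp_of_real[OF w] e unfolding a(2) kg_kernel_real[OF a(1) k]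
      by (simp only: of_real_mult of_real_divide of_real_power diff_self)
  qed (use z in auto)
  then show ?thesis by simp
qed

section \<open>The dispersive estimate\<close>

text \<open>Trades the damping exp (- Re W) for n/2 negative powers of Re W.\<close>

lemma exp_minus_le_inverse_power:
  assumes "0 < (\<rho>::real)"
  shows "exp (- \<rho>) \<le> real (Suc n) ^ Suc n * exp 1 / sqrt \<rho> ^ n"
proof -
  have "sqrt \<rho> \<le> 1 + \<rho>"
    using zero_le_power2[of "sqrt \<rho> - 1"] assms by (simp add: power2_diff)
  then have "sqrt \<rho> ^ n \<le> (1 + \<rho>) ^ n" by (intro power_mono) (use assms in auto)
  also have "\<dots> \<le> (1 + \<rho>) ^ Suc n" using assms by (intro power_increasing) auto
  also have "\<dots> = real (Suc n) ^ Suc n * ((1 + \<rho>) / real (Suc n)) ^ Suc n" unfolding power_divide by simp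
  also have "\<dots> \<le> real (Suc n) ^ Suc n * exp (1 + \<rho>)"
  proof (intro mult_left_mono)
    have "((1 + \<rho>) / real (Suc n)) ^ Suc n \<le> (1 + (1 + \<rho>) / real (Suc n)) ^ Suc n"
      using assms by (intro power_mono) auto
    also have "\<dots> \<le> exp (1 + \<rho>)"
      using assms by (intro exp_ge_one_plus_x_over_n_power_n) auto
    finally show "((1 + \<rho>) / real (Suc n)) ^ Suc n \<le> exp (1 + \<rho>)" .
  qed simp
  finally have "sqrt \<rho> ^ n * exp (- \<rho>) \<le> real (Suc n) ^ Suc n * exp (1 + \<rho>) * exp (- \<rho>)"
    by (rule mult_right_mono) simp
  also have "\<dots> = real (Suc n) ^ Suc n * exp 1" by (simp only: mult.assoc exp_add[symmetric]) simp
  finally show ?thesis using assms by (simp add: pos_le_divide_eq mult.commute)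
qed

text \<open>W^2 - z^2 is real, so Re W |Im W| equals m = Re z |Im z| for every x. Once |W| >= 1, the
  explicit kernel has size exp (- Re W) |W|^(-n/2), and trading the exponential for (Re W)^(-n/2)
  leaves (Re W |W|)^(-n/2) <= m^(-n/2). The assumption 2 m >= 1 yields |W| >= 1, since 2 m = |Im
  (W^2)| <= |W|^2.\<close>

lemma kg_kernel_dispersive:
  "\<exists>C>0. \<forall>z (x::'a::euclidean_space). 0 < Re z \<longrightarrow> 1 \<le> 2 * (Re z * \<bar>Im z\<bar>) \<longrightarrow>
     norm (kg_kernel z x) \<le> C / sqrt (Re z * \<bar>Im z\<bar>) ^ DIM('a)"
proof -
  obtain k where k: "DIM('a) = Suc k" using DIM_positive[where 'a='a] gr0_conv_Suc by blast
  define M where "M = (\<integral>p. (1 + 2 * \<bar>p\<bar>) ^ k * exp (- p\<^sup>2) \<partial>(lborel :: real measure))"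
  have M: "0 \<le> M" unfolding M_def by (intro Bochner_Integration.integral_nonneg) auto
  define E where "E = real (Suc (Suc k)) ^ Suc (Suc k) * exp (1::real)"
  have E: "0 < E" unfolding E_def by simp
  define C where "C = 2 * sqrt pi ^ k * (2 ^ k * (M + 1) * E)"
  have "norm (kg_kernel z x) \<le> C / sqrt (Re z * \<bar>Im z\<bar>) ^ DIM('a)"
    if z: "0 < Re z" "1 \<le> 2 * (Re z * \<bar>Im z\<bar>)" for z and x :: 'a
  proof -
    define W where "W = csqrt (z\<^sup>2 + of_real ((norm x)\<^sup>2))"
    define m where "m = Re z * \<bar>Im z\<bar>"
    define r where "r = sqrt (2 * norm W)"
    have m: "1/2 \<le> m" using z by (simp add: m_def)
    have ReW: "0 < Re W" unfolding W_def by (rule csqrt_Re_pos[OF sq_plus_not_nonpos[OF z(1)]])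
    have W2: "W\<^sup>2 = z\<^sup>2 + of_real ((norm x)\<^sup>2)" by (simp add: W_def)
    have "Im (W\<^sup>2) = Im (z\<^sup>2)" unfolding W2 by (simp add: power2_eq_square)
    then have im: "Re W * Im W = Re z * Im z" by (simp add: power2_eq_square mult.commute)
    then have "Re W * \<bar>Im W\<bar> = m" using ReW z(1) by (metis abs_mult abs_of_pos m_def)
    moreover have "Re W * \<bar>Im W\<bar> \<le> Re W * norm W" using ReW abs_Im_le_cmod[of W] by (intro mult_left_mono) auto
    ultimately have mW: "m \<le> Re W * norm W" by simp
    have "Re W * norm W \<le> norm W * norm W" using complex_Re_le_cmod[of W] by (intro mult_right_mono) auto
    moreover have "\<bar>Im (W\<^sup>2)\<bar> = 2 * m" using \<open>Re W * \<bar>Im W\<bar> = m\<close> ReW by (simp add: power2_eq_square abs_mult mult.commute)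
    moreover have "norm (W\<^sup>2) = norm W * norm W" by (simp add: norm_mult power2_eq_square)
    ultimately have "2 * m \<le> norm W * norm W" using abs_Im_le_cmod[of "W\<^sup>2"] by linarith
    then have "1\<^sup>2 \<le> (norm W)\<^sup>2" using m by (simp add: power2_eq_square)
    then have W1: "1 \<le> norm W" by (rule power2_le_imp_le) simp
    have r1: "1 \<le> r" unfolding r_def using W1 by simp
    have r2: "r\<^sup>2 = 2 * norm W" unfolding r_def by simp
    have amp: "norm (bessel_amp k W) \<le> 1 / r * (r ^ k * M)"
    proof -
      have "(\<integral>p. (r + 2 * \<bar>p\<bar>) ^ k * exp (- p\<^sup>2) \<partial>lborel) \<le> (\<integral>p. r ^ k * ((1 + 2 * \<bar>p\<bar>) ^ k * exp (- p\<^sup>2)) \<partial>lborel)"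
      proof (rule integral_mono)
        show "integrable lborel (\<lambda>p. (r + 2 * \<bar>p\<bar>) ^ k * exp (- p\<^sup>2))" using r1 by (intro poly_gaussian_integrable) simp
        show "integrable lborel (\<lambda>p. r ^ k * ((1 + 2 * \<bar>p\<bar>) ^ k * exp (- p\<^sup>2)))"
          by (intro integrable_mult_right poly_gaussian_integrable) simp
        fix p :: real
        have "r + 2 * \<bar>p\<bar> \<le> r * (1 + 2 * \<bar>p\<bar>)" using r1 mult_right_mono[OF r1, of "\<bar>p\<bar>"] by (simp add: distrib_left)
        then have "(r + 2 * \<bar>p\<bar>) ^ k \<le> (r * (1 + 2 * \<bar>p\<bar>)) ^ k" using r1 by (intro power_mono) auto
        from mult_right_mono[OF this, of "exp (- p\<^sup>2)"]
        show "(r + 2 * \<bar>p\<bar>) ^ k * exp (- p\<^sup>2) \<le> r ^ k * ((1 + 2 * \<bar>p\<bar>) ^ k * exp (- p\<^sup>2))"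
          by (simp only: power_mult_distrib mult.assoc) simp
      qed
      also have "\<dots> = r ^ k * M" unfolding M_def by (rule integral_mult_right_zero)
      finally have "1 / r * (\<integral>p. (r + 2 * \<bar>p\<bar>) ^ k * exp (- p\<^sup>2) \<partial>lborel) \<le> 1 / r * (r ^ k * M)"
        using r1 by (intro mult_left_mono) auto
      then show ?thesis using bessel_amp_bound[OF ReW, of k] unfolding r_def[symmetric] by linarith
    qed
    have W0: "0 < norm W" and r0: "0 < r" using W1 r1 by auto
    have "norm (kg_kernel z x) = 2 * sqrt pi ^ k * (exp (- Re W) / norm W ^ k * norm (bessel_amp k W))"
      unfolding kg_kernel_eq[OF z(1) k] W_def[symmetric] by (simp add: norm_mult norm_divide norm_power)
    also have "\<dots> \<le> 2 * sqrt pi ^ k * (exp (- Re W) / norm W ^ k * (1 / r * (r ^ k * M)))"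
      by (intro mult_left_mono amp) auto
    also have "\<dots> = 2 * sqrt pi ^ k * (2 ^ k * M * (exp (- Re W) / r ^ Suc k))"
    proof -
      have "norm W = r * r / 2" using r2 by (simp add: power2_eq_square)
      then have "norm W ^ k = r ^ k * r ^ k / 2 ^ k" by (simp only: power_divide power_mult_distrib)
      moreover have "e / (A * A / T) * (1 / r * (A * M)) = T * M * (e / (r * A))" if "0 < A" "0 < T" for e A T
        using that r0 by (simp add: field_simps)
      ultimately show ?thesis using r0 by (simp only: power_Suc zero_less_power zero_less_numeral)
    qed
    also have "\<dots> \<le> 2 * sqrt pi ^ k * (2 ^ k * (M + 1) * (E / sqrt m ^ Suc k))"
    proof (intro mult_left_mono mult_mono)
      have "exp (- Re W) / r ^ Suc k \<le> E / sqrt (Re W) ^ Suc k / r ^ Suc k"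
        unfolding E_def using r0 by (intro divide_right_mono exp_minus_le_inverse_power ReW) auto
      also have "\<dots> = E / sqrt (2 * (Re W * norm W)) ^ Suc k"
        unfolding divide_divide_eq_left power_mult_distrib[symmetric] r_def real_sqrt_mult[symmetric] by (simp only: mult_ac)
      also have "\<dots> \<le> E / sqrt m ^ Suc k"
        using m mW E by (intro divide_left_mono power_mono real_sqrt_le_mono mult_pos_pos zero_less_power) auto
      finally show "exp (- Re W) / r ^ Suc k \<le> E / sqrt m ^ Suc k" .
    qed (use M E r0 in auto)
    also have "\<dots> = C / sqrt m ^ Suc k" by (simp add: C_def)
    finally show ?thesis unfolding k m_def .
  qed
  moreover have "0 < C" unfolding C_def using M E by (intro mult_pos_pos) auto
  ultimately show ?thesis by blast
qed

text \<open>Taking absolute values leads to the kernel at x = 0 and real parameter Re z, where the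
  explicit formula applies. This serves for parameters whose imaginary part may be small.\<close>

lemma kg_kernel_crude:
  "\<exists>C>0. \<forall>z (x::'a::euclidean_space). 0 < Re z \<longrightarrow> Re z \<le> 1 \<longrightarrow> norm (kg_kernel z x) \<le> C / Re z ^ DIM('a)"
proof -
  obtain k where k: "DIM('a) = Suc k" using DIM_positive[where 'a='a] gr0_conv_Suc by blast
  define M where "M = (\<integral>p. (2 + 2 * \<bar>p\<bar>) ^ k * exp (- p\<^sup>2) \<partial>(lborel :: real measure))"
  have M: "0 \<le> M" unfolding M_def by (intro Bochner_Integration.integral_nonneg) auto
  define C where "C = 2 * sqrt pi ^ k * (M + 1)"
  have "norm (kg_kernel z x) \<le> C / Re z ^ DIM('a)" if z: "0 < Re z" "Re z \<le> 1" for z and x :: 'a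
  proof -
    define a where "a = Re z"
    have a: "0 < a" "a \<le> 1" using z by (auto simp: a_def)
    have s2: "a \<le> sqrt (2 * a)"
      using a mult_left_le_one_le[of a a] by (intro real_le_rsqrt) (simp add: power2_eq_square)
    have "sqrt (2 * a) \<le> sqrt (2\<^sup>2)" using a by (intro real_sqrt_le_mono) simp
    then have s3: "sqrt (2 * a) \<le> 2" by simp
    have eq: "cis (0 \<bullet> \<xi>) * (exp (- complex_of_real a * of_real (jbr \<xi>)) / of_real (jbr \<xi>)) = of_real (exp (- (a * jbr \<xi>)) / jbr \<xi>)" for \<xi> :: 'a
      by (simp flip: exp_of_real)
    have "norm (kg_kernel z x) \<le> (\<integral>\<xi>. exp (- (a * jbr \<xi>)) / jbr \<xi> \<partial>(lborel :: 'a measure))"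
      unfolding a_def by (rule kg_kernel_norm_bound[OF z(1)])
    also have "\<dots> \<le> norm (kg_kernel (of_real a) (0::'a))"
      unfolding kg_kernel_def eq integral_complex_of_real norm_of_real by (rule abs_ge_self)
    also have "kg_kernel (of_real a) (0::'a) = of_real (2 * sqrt pi ^ k * (exp (- a) / a ^ k)) * bessel_amp k (of_real a)"
      using kg_kernel_real[OF a(1) k, of 0] a unfolding bessel_amp_of_real[OF a(1)] of_real_mult[symmetric]
      by (simp add: mult.assoc)
    also have "norm \<dots> = 2 * sqrt pi ^ k * (exp (- a) / a ^ k) * norm (bessel_amp k (of_real a))"
      using a by (simp add: norm_mult norm_divide norm_power)
    also have "\<dots> \<le> 2 * sqrt pi ^ k * (1 / a ^ k) * (1 / a * (M + 1))"
    proof (intro mult_mono mult_left_mono divide_right_mono)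
      have "norm (bessel_amp k (of_real a)) \<le> 1 / sqrt (2 * a) * (\<integral>p. (sqrt (2 * a) + 2 * \<bar>p\<bar>) ^ k * exp (- p\<^sup>2) \<partial>lborel)"
        using bessel_amp_bound[of "of_real a" k] a by simp
      also have "\<dots> \<le> 1 / a * (M + 1)"
      proof (intro mult_mono)
        show "1 / sqrt (2 * a) \<le> 1 / a" using s2 a by (intro divide_left_mono) auto
        have "(\<integral>p. (sqrt (2 * a) + 2 * \<bar>p\<bar>) ^ k * exp (- p\<^sup>2) \<partial>lborel) \<le> M"
          unfolding M_def using a s3
          by (intro integral_mono poly_gaussian_integrable mult_right_mono power_mono) auto
        then show "(\<integral>p. (sqrt (2 * a) + 2 * \<bar>p\<bar>) ^ k * exp (- p\<^sup>2) \<partial>lborel) \<le> M + 1" by simp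
      qed (use a in \<open>auto intro!: Bochner_Integration.integral_nonneg\<close>)
      finally show "norm (bessel_amp k (of_real a)) \<le> 1 / a * (M + 1)" .
    qed (use a M in auto)
    also have "\<dots> = C / Re z ^ DIM('a)" unfolding C_def k a_def[symmetric] by simp
    finally show ?thesis .
  qed
  moreover have "0 < C" unfolding C_def using M by (intro mult_pos_pos) auto
  ultimately show ?thesis by blast
qed

subsection \<open>Smooth cut-offs on the line\<close>

lemma smooth_real_derivatives:
  fixes F :: "real \<Rightarrow> real"
  assumes "smooth F"
  obtains D where "D 0 = F" "\<And>i x. (D i has_real_derivative D (Suc i) x) (at x)"
proof
  define D where "D i = (pderiv_along 1 ^^ i) F" for i
  show "D 0 = F" by (simp add: D_def)
  have s: "smooth (D i)" for i
  proof (induction i)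
    case 0 show ?case using assms by (simp add: D_def)
  next
    case (Suc i)
    have "C_k k (D (Suc i))" for k
    proof -
      have "C_k (Suc k) (D i)" using Suc by (simp only: smooth_def)
      then show ?thesis by (simp add: D_def)
    qed
    then show ?case by (simp add: smooth_def)
  qed
  show "(D i has_real_derivative D (Suc i) x) (at x)" for i x
  proof -
    have "C_k (Suc 0) (D i)" using s[of i] by (simp only: smooth_def)
    then have "(\<lambda>h. D i (x + h)) differentiable (at 0)" by simp
    then have "((\<lambda>h. D i (x + h)) has_vector_derivative D (Suc i) x) (at 0)"
      unfolding vector_derivative_works D_def by (simp add: pderiv_along_def)
    then have "((\<lambda>h. D i (h + x)) has_real_derivative D (Suc i) x) (at 0)"
      by (simp add: has_real_derivative_iff_has_vector_derivative add.commute)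
    then show ?thesis using DERIV_shift[of "D i" "D (Suc i) x" 0 x] by simp
  qed
qed

lemma has_real_derivative_zero_locally_const:
  assumes "(f has_real_derivative d) (at x)" "open S" "x \<in> S" "\<And>y. y \<in> S \<Longrightarrow> f y = (c::real)"
  shows "d = 0"
proof -
  have "((\<lambda>y. c) has_real_derivative d) (at x)"
    by (rule has_field_derivative_transform_within_open[OF assms(1,2,3)]) (rule assms(4))
  then show ?thesis using DERIV_unique[OF _ DERIV_const] by blast
qed

locale cutoff_derivatives =
  fixes D :: "nat \<Rightarrow> real \<Rightarrow> real"
  assumes cutoff: "smooth_cutoff (D 0)" and der: "\<And>i x. (D i has_real_derivative D (Suc i) x) (at x)"
begin

lemma D0: "1 \<le> l \<Longrightarrow> D 0 l = 1" "l < 1/2 \<Longrightarrow> D 0 l = 0"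
  using cutoff by (auto simp: smooth_cutoff_def)

lemma D_zero: "l < 1/2 \<or> 1 < l \<Longrightarrow> D (Suc i) l = 0"
proof (induction i arbitrary: l)
  case 0
  then show ?case
  proof
    assume l: "l < 1/2"
    show ?thesis
      by (rule has_real_derivative_zero_locally_const[where f="D 0" and S="{..<1/2}" and x=l and c=0, OF der open_lessThan])
         (use l D0(2) in auto)
  next
    assume l: "1 < l"
    show ?thesis
      by (rule has_real_derivative_zero_locally_const[where f="D 0" and S="{1<..}" and x=l and c=1, OF der open_greaterThan])
         (use l D0(1) in auto)
  qed
next
  case (Suc i)
  from Suc.prems show ?case
  proof
    assume l: "l < 1/2"
    show ?thesis
      by (rule has_real_derivative_zero_locally_const[where f="D (Suc i)" and S="{..<1/2}" and x=l and c=0, OF der open_lessThan])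
         (use l Suc.IH in auto)
  next
    assume l: "1 < l"
    show ?thesis
      by (rule has_real_derivative_zero_locally_const[where f="D (Suc i)" and S="{1<..}" and x=l and c=0, OF der open_greaterThan])
         (use l Suc.IH in auto)
  qed
qed

lemma D_bounded: "\<exists>B\<ge>0. \<forall>l. \<bar>D i l\<bar> \<le> B"
proof -
  have "continuous_on {1/2..1} (D i)" using der by (meson DERIV_isCont continuous_at_imp_continuous_on)
  then have "bounded (D i ` {1/2..1})" by (intro compact_imp_bounded compact_continuous_image) auto
  then obtain B where "\<forall>x\<in>D i ` {1/2..1}. norm x \<le> B" unfolding bounded_iff by blast
  then have B: "\<And>l. l \<in> {1/2..1} \<Longrightarrow> \<bar>D i l\<bar> \<le> B" by (metis imageI real_norm_def)
  have "\<bar>D i l\<bar> \<le> max B 1" for l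
  proof (cases "l \<in> {1/2..1}")
    case True then show ?thesis using B[of l] by simp
  next
    case False
    then have "l < 1/2 \<or> 1 < l" by auto
    then show ?thesis using D0[of l] D_zero[of l "i - 1"] by (cases i) auto
  qed
  moreover have "0 \<le> max B 1" by simp
  ultimately show ?thesis by blast
qed

text \<open>The families below arise from \<open>exp m * m * (1 - D 0 (sqrt (m\<^sup>2 - d\<^sup>2)))\<close> by differentiating in \<open>m\<close>;
  the point is that all bounds are uniform in \<open>d\<close>.\<close>

inductive symb :: "(real \<Rightarrow> real \<Rightarrow> real) \<Rightarrow> bool" where
  symb0: "symb (\<lambda>d m. exp m * m ^ a * (1 - D 0 (sqrt (m\<^sup>2 - d\<^sup>2))))"
| symb1: "symb (\<lambda>d m. exp m * m ^ a * (D (Suc i) (sqrt (m\<^sup>2 - d\<^sup>2)) / sqrt (m\<^sup>2 - d\<^sup>2) ^ j))"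
| symb_add: "symb f \<Longrightarrow> symb g \<Longrightarrow> symb (\<lambda>d m. f d m + g d m)"
| symb_cmult: "symb f \<Longrightarrow> symb (\<lambda>d m. c * f d m)"

lemma symb_bounded:
  assumes "symb h"
  shows "\<exists>C. \<forall>d m. 0 \<le> d \<longrightarrow> d \<le> 1 \<longrightarrow> \<bar>h d m\<bar> \<le> C \<and> (2 < \<bar>m\<bar> \<longrightarrow> h d m = 0)"
  using assms
proof (induction rule: symb.induct)
  case (symb0 a)
  obtain B where B: "0 \<le> B" "\<And>l. \<bar>D 0 l\<bar> \<le> B" using D_bounded by blast
  \<comment> \<open>For |m| > 2 and d <= 1 one has m^2 - d^2 > 3, beyond the point where the cut-off
    becomes 1; the support in m is thus bounded independently of d.\<close>
  have far: "1 < sqrt (m\<^sup>2 - d\<^sup>2)" if "2 < \<bar>m\<bar>" "0 \<le> d" "d \<le> 1" for m d :: real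
  proof (rule real_less_rsqrt)
    have "2\<^sup>2 < m\<^sup>2" using that power_strict_mono[of 2 "\<bar>m\<bar>" 2] by simp
    moreover have "d\<^sup>2 \<le> 1" using that by (simp add: power_le_one)
    ultimately show "1\<^sup>2 < m\<^sup>2 - d\<^sup>2" by simp
  qed
  have "\<bar>exp m * m ^ a * (1 - D 0 (sqrt (m\<^sup>2 - d\<^sup>2)))\<bar> \<le> exp 2 * 2 ^ a * (1 + B)
     \<and> (2 < \<bar>m\<bar> \<longrightarrow> exp m * m ^ a * (1 - D 0 (sqrt (m\<^sup>2 - d\<^sup>2))) = 0)" if d: "0 \<le> d" "d \<le> 1" for d m :: real
  proof (cases "2 < \<bar>m\<bar>")
    case True
    then show ?thesis using D0(1)[of "sqrt (m\<^sup>2 - d\<^sup>2)"] far[OF True d] B(1) by simp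
  next
    case False
    have "\<bar>1 - D 0 (sqrt (m\<^sup>2 - d\<^sup>2))\<bar> \<le> 1 + B" using B(2)[of "sqrt (m\<^sup>2 - d\<^sup>2)"] by linarith
    then have "\<bar>exp m\<bar> * \<bar>m\<bar> ^ a * \<bar>1 - D 0 (sqrt (m\<^sup>2 - d\<^sup>2))\<bar> \<le> exp 2 * 2 ^ a * (1 + B)"
      using False by (intro mult_mono power_mono) auto
    then show ?thesis using False by (simp only: abs_mult power_abs simp_thms)
  qed
  then show ?case by blast
next
  case (symb1 a i j)
  obtain B where B: "0 \<le> B" "\<And>l. \<bar>D (Suc i) l\<bar> \<le> B" using D_bounded by blast
  have far: "1 < sqrt (m\<^sup>2 - d\<^sup>2)" if "2 < \<bar>m\<bar>" "0 \<le> d" "d \<le> 1" for m d :: real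
  proof (rule real_less_rsqrt)
    have "2\<^sup>2 < m\<^sup>2" using that power_strict_mono[of 2 "\<bar>m\<bar>" 2] by simp
    moreover have "d\<^sup>2 \<le> 1" using that by (simp add: power_le_one)
    ultimately show "1\<^sup>2 < m\<^sup>2 - d\<^sup>2" by simp
  qed
  have "\<bar>exp m * m ^ a * (D (Suc i) (sqrt (m\<^sup>2 - d\<^sup>2)) / sqrt (m\<^sup>2 - d\<^sup>2) ^ j)\<bar> \<le> exp 2 * 2 ^ a * (B * 2 ^ j)
     \<and> (2 < \<bar>m\<bar> \<longrightarrow> exp m * m ^ a * (D (Suc i) (sqrt (m\<^sup>2 - d\<^sup>2)) / sqrt (m\<^sup>2 - d\<^sup>2) ^ j) = 0)" if d: "0 \<le> d" "d \<le> 1" for d m :: real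
  proof (cases "2 < \<bar>m\<bar>")
    case True
    then show ?thesis using D_zero[of "sqrt (m\<^sup>2 - d\<^sup>2)" i] far[OF True d] B(1) by simp
  next
    case False
    let ?s = "sqrt (m\<^sup>2 - d\<^sup>2)"
    \<comment> \<open>The derivatives of the cut-off vanish for arguments below 1/2, so a negative
      power of the root costs at most 2^j.\<close>
    have "\<bar>D (Suc i) ?s / ?s ^ j\<bar> \<le> B * 2 ^ j"
    proof (cases "?s < 1/2")
      case True then show ?thesis using D_zero[of ?s i] B(1) by simp
    next
      case False
      then have s: "1/2 \<le> ?s" by simp
      have "\<bar>D (Suc i) ?s / ?s ^ j\<bar> = \<bar>D (Suc i) ?s\<bar> / ?s ^ j" 
      proof -
        have "\<bar>?s ^ j\<bar> = ?s ^ j" by (intro abs_of_nonneg zero_le_power) (use s in linarith)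
        then show ?thesis by (simp only: abs_divide)
      qed
      also have "\<dots> \<le> B / (1/2) ^ j"
        using s B by (intro frac_le power_mono) auto
      also have "\<dots> = B * 2 ^ j" by (simp add: power_divide)
      finally show ?thesis .
    qed
    then have "\<bar>exp m\<bar> * \<bar>m\<bar> ^ a * \<bar>D (Suc i) ?s / ?s ^ j\<bar> \<le> exp 2 * 2 ^ a * (B * 2 ^ j)"
      using False B(1) by (intro mult_mono power_mono) auto
    then show ?thesis using False by (simp only: abs_mult power_abs simp_thms)
  qed
  then show ?case by blast
next
  case (symb_add f g)
  then obtain C C' where C: "\<And>d m. 0 \<le> d \<Longrightarrow> d \<le> 1 \<Longrightarrow> \<bar>f d m\<bar> \<le> C \<and> (2 < \<bar>m\<bar> \<longrightarrow> f d m = 0)"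
     and C': "\<And>d m. 0 \<le> d \<Longrightarrow> d \<le> 1 \<Longrightarrow> \<bar>g d m\<bar> \<le> C' \<and> (2 < \<bar>m\<bar> \<longrightarrow> g d m = 0)" by blast
  have "\<bar>f d m + g d m\<bar> \<le> C + C' \<and> (2 < \<bar>m\<bar> \<longrightarrow> f d m + g d m = 0)" if "0 \<le> d" "d \<le> 1" for d m
    using C[OF that, of m] C'[OF that, of m] by auto
  then show ?case by blast
next
  case (symb_cmult f c)
  then obtain C where C: "\<And>d m. 0 \<le> d \<Longrightarrow> d \<le> 1 \<Longrightarrow> \<bar>f d m\<bar> \<le> C \<and> (2 < \<bar>m\<bar> \<longrightarrow> f d m = 0)" by blast
  have "\<bar>c * f d m\<bar> \<le> \<bar>c\<bar> * C \<and> (2 < \<bar>m\<bar> \<longrightarrow> c * f d m = 0)" if "0 \<le> d" "d \<le> 1" for d m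
    using C[OF that, of m] by (auto simp: abs_mult mult_left_mono)
  then show ?case by blast
qed

text \<open>The derivative of the root is m divided by the root, so each differentiation stays
  within the two generating families. The root is not smooth where m^2 = d^2, but for m^2 - d^2 <
  1/4 it is below 1/2 (also at negative arguments, where \<open>sqrt\<close> is negative), and there
  the cut-off is constant.\<close>

lemma symb_deriv:
  assumes "symb h"
  shows "\<exists>h'. symb h' \<and> (\<forall>d m. (h d has_real_derivative h' d m) (at m))"
  using assms
proof (induction rule: symb.induct)
  case (symb0 a)
  let ?s = "\<lambda>d m. sqrt (m\<^sup>2 - d\<^sup>2)"
  let ?h' = "\<lambda>d m. (exp m * m ^ a * (1 - D 0 (?s d m)) + real a * (exp m * m ^ (a - 1) * (1 - D 0 (?s d m))))
      + (-1) * (exp m * m ^ Suc a * (D (Suc 0) (?s d m) / ?s d m ^ 1))"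
  have "symb ?h'" by (intro symb.intros)
  moreover have "((\<lambda>m. exp m * m ^ a * (1 - D 0 (?s d m))) has_real_derivative ?h' d m) (at m)" for d m
  proof (cases "m\<^sup>2 - d\<^sup>2 < 1/4")
    case True
    have small: "?s d y < 1/2" if "y\<^sup>2 - d\<^sup>2 < 1/4" for y
      using that by (intro real_less_lsqrt) (auto simp: power2_eq_square)
    have op: "open {y. y\<^sup>2 - d\<^sup>2 < (1/4::real)}" by (intro open_Collect_less continuous_intros)
    have "((\<lambda>m. exp m * m ^ a) has_real_derivative exp m * m ^ a + real a * (exp m * m ^ (a - 1))) (at m)"
      by (auto intro!: derivative_eq_intros)
    then have "((\<lambda>m. exp m * m ^ a * (1 - D 0 (?s d m))) has_real_derivative exp m * m ^ a + real a * (exp m * m ^ (a - 1))) (at m)"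
      by (rule has_field_derivative_transform_within_open[OF _ op]) (use True small D0(2) in auto)
    then show ?thesis using D0(2)[OF small[OF True]] D_zero[of "?s d m" 0] small[OF True] by simp
  next
    case False
    then have p: "0 < m\<^sup>2 - d\<^sup>2" by simp
    have ds: "((\<lambda>m. ?s d m) has_real_derivative m / ?s d m) (at m)"
      using p by (auto intro!: derivative_eq_intros simp: field_simps)
    have "((\<lambda>m. D 0 (?s d m)) has_real_derivative D (Suc 0) (?s d m) * (m / ?s d m)) (at m)"
      by (rule DERIV_chain2[OF der ds])
    then show ?thesis using p by (auto intro!: derivative_eq_intros simp: algebra_simps)
  qed
  ultimately show ?case by blast
next
  case (symb1 a i j)
  let ?s = "\<lambda>d m. sqrt (m\<^sup>2 - d\<^sup>2)"
  let ?t = "\<lambda>a i j d m. exp m * m ^ a * (D (Suc i) (?s d m) / ?s d m ^ j)"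
  let ?h' = "\<lambda>d m. (?t a i j d m + real a * ?t (a - 1) i j d m) + (?t (Suc a) (Suc i) (Suc j) d m + (- real j) * ?t (Suc a) i (j + 2) d m)"
  have "symb ?h'" by (intro symb.intros)
  moreover have "((\<lambda>m. ?t a i j d m) has_real_derivative ?h' d m) (at m)" for d m
  proof (cases "m\<^sup>2 - d\<^sup>2 < 1/4")
    case True
    have small: "?s d y < 1/2" if "y\<^sup>2 - d\<^sup>2 < 1/4" for y
      using that by (intro real_less_lsqrt) (auto simp: power2_eq_square)
    have op: "open {y. y\<^sup>2 - d\<^sup>2 < (1/4::real)}" by (intro open_Collect_less continuous_intros)
    have z: "D (Suc i) (?s d y) = 0" if "y\<^sup>2 - d\<^sup>2 < 1/4" for y i using D_zero small[OF that] by blast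
    have "((\<lambda>m. ?t a i j d m) has_real_derivative 0) (at m)"
      by (rule has_field_derivative_transform_within_open[OF DERIV_const op]) (use True z in auto)
    then show ?thesis using z[OF True] by simp
  next
    case False
    then have p: "0 < m\<^sup>2 - d\<^sup>2" by simp
    then have s0: "0 < ?s d m" by simp
    have ds: "((\<lambda>m. ?s d m) has_real_derivative m / ?s d m) (at m)"
      using p by (auto intro!: derivative_eq_intros simp: field_simps)
    have dD: "((\<lambda>m. D (Suc i) (?s d m)) has_real_derivative D (Suc (Suc i)) (?s d m) * (m / ?s d m)) (at m)"
      by (rule DERIV_chain2[OF der ds])
    define u where "u = inverse (?s d m)"
    have "((\<lambda>m. inverse (?s d m)) has_real_derivative - (inverse (?s d m) * (m / ?s d m) * inverse (?s d m))) (at m)"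
      by (rule DERIV_inverse'[OF ds]) (use s0 in simp)
    from DERIV_power[OF this, of j]
    have dp: "((\<lambda>m. inverse (?s d m) ^ j) has_real_derivative real j * (- (u * (m * u) * u) * u ^ (j - Suc 0))) (at m)"
      by (simp only: u_def divide_inverse)
    have dE: "((\<lambda>m. exp m * m ^ a) has_real_derivative exp m * m ^ a + real a * (exp m * m ^ (a - 1))) (at m)"
      by (auto intro!: derivative_eq_intros)
    have alg: "(P + real a * Q) * (A * u ^ j) + (B * (m * u) * u ^ j + real j * (- (u * (m * u) * u) * u ^ (j - Suc 0)) * A) * P
      = (P * (A * u ^ j) + real a * (Q * (A * u ^ j))) + ((m * P) * (B * u ^ Suc j) + (- real j) * ((m * P) * (A * u ^ (j + 2))))"
      for P Q A B :: real
      by (cases j) (simp_all add: algebra_simps)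
    have V: "((\<lambda>m. exp m * m ^ a * (D (Suc i) (?s d m) * inverse (?s d m) ^ j)) has_real_derivative
       (exp m * m ^ a + real a * (exp m * m ^ (a - 1))) * (D (Suc i) (?s d m) * u ^ j)
       + (D (Suc (Suc i)) (?s d m) * (m * u) * u ^ j + real j * (- (u * (m * u) * u) * u ^ (j - Suc 0)) * D (Suc i) (?s d m)) * (exp m * m ^ a)) (at m)"
      using DERIV_mult[OF dE DERIV_mult[OF dD[unfolded divide_inverse, folded u_def] dp], folded u_def] .
    have q: "X / ?s d m ^ l = X * u ^ l" for X l by (simp add: u_def divide_inverse power_inverse)
    have mS: "exp m * m ^ Suc a = m * (exp m * m ^ a)" by simp
    have fn: "(\<lambda>m. ?t a i j d m) = (\<lambda>m. exp m * m ^ a * (D (Suc i) (?s d m) * inverse (?s d m) ^ j))"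
      by (simp only: divide_inverse power_inverse)
    show ?thesis unfolding fn q mS using V unfolding alg .
  qed
  ultimately show ?case by blast
next
  case (symb_add f g)
  then obtain f' g' where f: "symb f'" "\<And>d m. (f d has_real_derivative f' d m) (at m)"
    and g: "symb g'" "\<And>d m. (g d has_real_derivative g' d m) (at m)" by blast
  have "symb (\<lambda>d m. f' d m + g' d m)" by (rule symb.symb_add[OF f(1) g(1)])
  moreover have "((\<lambda>m. f d m + g d m) has_real_derivative f' d m + g' d m) (at m)" for d m
    by (rule DERIV_add[OF f(2) g(2)])
  ultimately show ?case by blast
next
  case (symb_cmult f c)
  then obtain f' where f: "symb f'" "\<And>d m. (f d has_real_derivative f' d m) (at m)" by blast
  have "symb (\<lambda>d m. c * f' d m)" by (rule symb.symb_cmult[OF f(1)])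
  moreover have "((\<lambda>m. c * f d m) has_real_derivative c * f' d m) (at m)" for d m
    by (rule DERIV_cmult[OF f(2)])
  ultimately show ?case by blast
qed

end

section \<open>Rapid decay of the transformed symbols\<close>

lemma integral_derivative_zero:
  fixes f :: "real \<Rightarrow> complex"
  assumes f: "\<And>x. (f has_vector_derivative f' x) (at x)" and i: "integrable lborel f'"
    and z: "\<And>x. 2 < \<bar>x\<bar> \<Longrightarrow> f x = 0" "\<And>x. 2 < \<bar>x\<bar> \<Longrightarrow> f' x = 0"
  shows "(\<integral>x. f' x \<partial>lborel) = 0"
proof -
  have "(f' has_integral (f 3 - f (- 3))) {-3..3}"
    by (rule fundamental_theorem_of_calculus) (auto intro: has_vector_derivative_at_within f)
  then have "(f' has_integral 0) {-3..3}" using z(1)[of 3] z(1)[of "-3"] by simp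
  then have "(f' has_integral 0) UNIV"
    by (rule has_integral_on_superset) (auto intro: z(2))
  with has_integral_integral_lborel[OF i] show ?thesis by (rule has_integral_unique)
qed

context cutoff_derivatives
begin

lemma symb_integrable:
  assumes "symb h" "0 \<le> d" "d \<le> 1"
  shows "integrable lborel (\<lambda>m. complex_of_real (h d m))" "continuous_on UNIV (\<lambda>m. complex_of_real (h d m))"
proof -
  obtain C where C: "\<And>m. \<bar>h d m\<bar> \<le> C \<and> (2 < \<bar>m\<bar> \<longrightarrow> h d m = 0)" using symb_bounded[OF assms(1)] assms(2,3) by blast
  obtain h' where h': "\<And>m. (h d has_real_derivative h' d m) (at m)" using symb_deriv[OF assms(1)] by blast
  have "continuous_on UNIV (h d)" using h' by (meson DERIV_isCont continuous_at_imp_continuous_on)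
  then show c: "continuous_on UNIV (\<lambda>m. complex_of_real (h d m))" by (intro continuous_intros)
  have m: "(\<lambda>m. complex_of_real (h d m)) \<in> borel_measurable lborel"
    using borel_measurable_continuous_onI[OF c] by simp
  have I: "integrable lborel (\<lambda>x::real. C * indicator (cball 0 2) x)"
    using emeasure_bounded_finite[of "cball (0::real) 2"] by (intro integrable_mult_right integrable_real_indicator) auto
  have le: "norm (complex_of_real (h d x)) \<le> norm (C * indicator (cball 0 2) x)" for x
    using C[of x] by (cases "2 < \<bar>x\<bar>") (auto simp: indicator_def)
  show "integrable lborel (\<lambda>m. complex_of_real (h d m))"
    by (rule Bochner_Integration.integrable_bound[OF I m]) (rule AE_I2, rule le)
qed

lemma symb_fourier_bound:
  assumes "symb h"
  shows "\<exists>A. \<forall>d \<sigma>. 0 \<le> d \<longrightarrow> d \<le> 1 \<longrightarrow> norm (fourier_integral (\<lambda>m. complex_of_real (h d m)) \<sigma>) \<le> A"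
proof -
  obtain C where C: "\<And>d m. 0 \<le> d \<Longrightarrow> d \<le> 1 \<Longrightarrow> \<bar>h d m\<bar> \<le> C \<and> (2 < \<bar>m\<bar> \<longrightarrow> h d m = 0)" using symb_bounded[OF assms] by blast
  define c where "c = (2 * pi) powr (- real DIM(real) / 2)"
  have I: "integrable lborel (\<lambda>x::real. C * indicator (cball 0 2) x)"
    using emeasure_bounded_finite[of "cball (0::real) 2"] by (intro integrable_mult_right integrable_real_indicator) auto
  have "norm (fourier_integral (\<lambda>m. complex_of_real (h d m)) \<sigma>) \<le> c * (\<integral>x. C * indicator (cball 0 2) x \<partial>(lborel :: real measure))"
    if d: "0 \<le> d" "d \<le> 1" for d \<sigma>
  proof -
    have "(\<integral>m. norm (complex_of_real (h d m)) \<partial>lborel) \<le> (\<integral>x. C * indicator (cball 0 2) x \<partial>(lborel :: real measure))"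
    proof (rule integral_mono[OF integrable_norm[OF symb_integrable(1)[OF assms d]] I])
      show "norm (complex_of_real (h d x)) \<le> C * indicator (cball 0 2) x" for x
        using C[OF d, of x] by (cases "2 < \<bar>x\<bar>") (auto simp: indicator_def)
    qed
    then have "c * (\<integral>m. norm (complex_of_real (h d m)) \<partial>lborel) \<le> c * (\<integral>x. C * indicator (cball 0 2) x \<partial>(lborel :: real measure))"
      by (rule mult_left_mono) (simp add: c_def)
    then show ?thesis using fourier_integral_bound[of "\<lambda>m. complex_of_real (h d m)" \<sigma>] unfolding c_def by linarith
  qed
  then show ?thesis by blast
qed

lemma symb_fourier_deriv:
  assumes "symb h" "symb h'" "\<And>m. (h d has_real_derivative h' d m) (at m)" and d: "0 \<le> d" "d \<le> 1"
  shows "fourier_integral (\<lambda>m. complex_of_real (h' d m)) \<sigma> = \<i> * of_real \<sigma> * fourier_integral (\<lambda>m. complex_of_real (h d m)) \<sigma>"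
proof -
  let ?f = "\<lambda>m. cis (- (m * \<sigma>)) * complex_of_real (h d m)"
  let ?f' = "\<lambda>m. cis (- (m * \<sigma>)) * complex_of_real (h' d m) - \<i> * of_real \<sigma> * (cis (- (m * \<sigma>)) * complex_of_real (h d m))"
  have z: "h d m = 0" "h' d m = 0" if "2 < \<bar>m\<bar>" for m
    using symb_bounded[OF assms(1)] symb_bounded[OF assms(2)] d that by blast+
  have i: "integrable lborel (\<lambda>m. cis (- (m * \<sigma>)) * complex_of_real (h' d m))"
     "integrable lborel (\<lambda>m. cis (- (m * \<sigma>)) * complex_of_real (h d m))"
    using fourier_integrand_integrable(1)[OF symb_integrable(1)[OF assms(2) d], of \<sigma>]
      fourier_integrand_integrable(1)[OF symb_integrable(1)[OF assms(1) d], of \<sigma>] by simp_all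
  have der: "(?f has_vector_derivative ?f' m) (at m)" for m
  proof -
    have 1: "((\<lambda>m. cis (- (m * \<sigma>))) has_vector_derivative (- \<sigma>) *\<^sub>R (\<i> * cis (- (m * \<sigma>)))) (at m)"
    proof -
      have "((\<lambda>m. exp (of_real m * (- \<i> * of_real \<sigma>))) has_vector_derivative (- \<i> * of_real \<sigma>) * exp (of_real m * (- \<i> * of_real \<sigma>))) (at m)"
        by (rule has_vector_derivative_real_field) (auto intro!: derivative_eq_intros)
      note d = this
      have e: "exp (of_real m * (- \<i> * of_real \<sigma>)) = cis (- (m * \<sigma>))" for m
        by (simp add: cis_conv_exp mult_ac)
      have "(- \<i> * of_real \<sigma>) * cis (- (m * \<sigma>)) = (- \<sigma>) *\<^sub>R (\<i> * cis (- (m * \<sigma>)))"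
        by (simp add: scaleR_conv_of_real)
      then show ?thesis using d unfolding e by (simp only:)
    qed
    have 2: "((\<lambda>m. complex_of_real (h d m)) has_vector_derivative complex_of_real (h' d m)) (at m)"
      using assms(3)[of m] by (intro has_vector_derivative_of_real) (simp add: has_real_derivative_iff_has_vector_derivative)
    from has_vector_derivative_mult[OF 1 2] show ?thesis
      by (simp add: scaleR_conv_of_real algebra_simps)
  qed
  have "(\<integral>m. ?f' m \<partial>lborel) = 0"
    by (rule integral_derivative_zero[OF der]) (use i z in auto)
  then have "(\<integral>m. cis (- (m * \<sigma>)) * complex_of_real (h' d m) \<partial>lborel)
     = \<i> * of_real \<sigma> * (\<integral>m. cis (- (m * \<sigma>)) * complex_of_real (h d m) \<partial>lborel)"
    using i by simp
  then show ?thesis by (simp add: fourier_integral_def)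
qed

text \<open>Integration by parts k times. Derivatives of symbols are symbols again, so the bound
  remains uniform in d.\<close>

lemma symb_fourier_decay:
  assumes "symb h"
  shows "\<exists>A. \<forall>d \<sigma>. 0 \<le> d \<longrightarrow> d \<le> 1 \<longrightarrow> \<bar>\<sigma>\<bar> ^ k * norm (fourier_integral (\<lambda>m. complex_of_real (h d m)) \<sigma>) \<le> A"
  using assms
proof (induction k arbitrary: h)
  case 0
  then show ?case using symb_fourier_bound by simp
next
  case (Suc k)
  obtain h' where h': "symb h'" "\<And>d m. (h d has_real_derivative h' d m) (at m)" using symb_deriv[OF Suc.prems] by blast
  obtain A where A: "\<And>d \<sigma>. 0 \<le> d \<Longrightarrow> d \<le> 1 \<Longrightarrow> \<bar>\<sigma>\<bar> ^ k * norm (fourier_integral (\<lambda>m. complex_of_real (h' d m)) \<sigma>) \<le> A"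
    using Suc.IH[OF h'(1)] by blast
  have "\<bar>\<sigma>\<bar> ^ Suc k * norm (fourier_integral (\<lambda>m. complex_of_real (h d m)) \<sigma>) \<le> A" if d: "0 \<le> d" "d \<le> 1" for d \<sigma>
    using A[OF d, of \<sigma>] unfolding symb_fourier_deriv[OF Suc.prems h'(1) h'(2) d] by (simp add: norm_mult mult_ac)
  then show ?case by blast
qed

lemma symb_fourier_decay2:
  assumes "symb h"
  shows "\<exists>A\<ge>0. \<forall>d \<sigma>. 0 \<le> d \<longrightarrow> d \<le> 1 \<longrightarrow> norm (fourier_integral (\<lambda>m. complex_of_real (h d m)) \<sigma>) \<le> A / (1 + \<sigma>\<^sup>2) ^ N"
proof -
  obtain A where A: "\<And>d \<sigma>. 0 \<le> d \<Longrightarrow> d \<le> 1 \<Longrightarrow> norm (fourier_integral (\<lambda>m. complex_of_real (h d m)) \<sigma>) \<le> A"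
    using symb_fourier_bound[OF assms] by blast
  obtain B where B: "\<And>d \<sigma>. 0 \<le> d \<Longrightarrow> d \<le> 1 \<Longrightarrow> \<bar>\<sigma>\<bar> ^ (2 * N) * norm (fourier_integral (\<lambda>m. complex_of_real (h d m)) \<sigma>) \<le> B"
    using symb_fourier_decay[OF assms, of "2 * N"] by blast
  have "norm (fourier_integral (\<lambda>m. complex_of_real (h d m)) \<sigma>) \<le> 2 ^ N * (\<bar>A\<bar> + \<bar>B\<bar>) / (1 + \<sigma>\<^sup>2) ^ N" if d: "0 \<le> d" "d \<le> 1" for d \<sigma>
  proof -
    let ?n = "norm (fourier_integral (\<lambda>m. complex_of_real (h d m)) \<sigma>)"
    have s: "0 \<le> \<sigma>\<^sup>2" by simp
    have "(1 + \<sigma>\<^sup>2) ^ N * ?n \<le> 2 ^ N * (\<bar>A\<bar> + \<bar>B\<bar>)"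
    proof (cases "\<sigma>\<^sup>2 \<le> 1")
      case True
      have "(1 + \<sigma>\<^sup>2) ^ N * ?n \<le> 2 ^ N * A"
        using True A[OF d, of \<sigma>] s by (intro mult_mono power_mono) auto
      also have "\<dots> \<le> 2 ^ N * (\<bar>A\<bar> + \<bar>B\<bar>)" by (intro mult_left_mono) auto
      finally show ?thesis .
    next
      case False
      have "(1 + \<sigma>\<^sup>2) ^ N * ?n \<le> (2 * \<sigma>\<^sup>2) ^ N * ?n"
        using False by (intro mult_right_mono power_mono) auto
      also have "\<dots> = 2 ^ N * (\<bar>\<sigma>\<bar> ^ (2 * N) * ?n)" by (simp add: power_mult_distrib power_mult)
      also have "\<dots> \<le> 2 ^ N * B" using B[OF d, of \<sigma>] by (intro mult_left_mono) auto
      also have "\<dots> \<le> 2 ^ N * (\<bar>A\<bar> + \<bar>B\<bar>)" by (intro mult_left_mono) auto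
      finally show ?thesis .
    qed
    moreover have "0 < (1 + \<sigma>\<^sup>2) ^ N" using s by (intro zero_less_power) linarith
    ultimately show ?thesis by (simp add: pos_le_divide_eq mult.commute)
  qed
  moreover have "0 \<le> 2 ^ N * (\<bar>A\<bar> + \<bar>B\<bar>)" by simp
  ultimately show ?thesis by blast
qed

end

section \<open>Frequency-localised dispersion\<close>

lemma inverse_1_plus_square_integrable: "integrable lborel (\<lambda>x::real. 1 / (1 + x\<^sup>2))"
proof -
  have "einterval (-\<infinity>) \<infinity> = UNIV" by (auto simp: einterval_def)
  then show ?thesis using integrable_inverse_1_plus_square by (simp add: set_integrable_def inverse_eq_divide)
qed

text \<open>With d = 1 / R the cut-off equals R exp (- d \<open>jbr\<close>) / \<open>jbr\<close>
  times \<Psi> evaluated at d \<open>jbr\<close>. Fourier inversion of \<Psi> expands it into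
  exponentials, and frequency \<sigma> merely shifts the kernel parameter to z = d - i (s + \<sigma>
  d). Moderate \<sigma> fall under the dispersive bound; for the others the crude bound is paid for
  by the decay of the transform of \<Psi>, uniformly in d.\<close>

theorem dispersive_estimate:
  fixes F :: "real \<Rightarrow> real"
  assumes F: "smooth_cutoff F"
  shows "\<exists>C\<ge>0. \<forall>R s. \<forall>y::'a::euclidean_space. 1 \<le> R \<longrightarrow> R \<le> \<bar>s\<bar> \<longrightarrow>
    norm (\<integral>\<xi>. cis (y \<bullet> \<xi>) * (cis (s * jbr \<xi>) * of_real (1 - F (norm \<xi> / R))) \<partial>lborel)
      \<le> C * R * sqrt (R / \<bar>s\<bar>) ^ DIM('a)"
proof -
  obtain D where D: "D 0 = F" "\<And>i x. (D i has_real_derivative D (Suc i) x) (at x)"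
    using smooth_real_derivatives[of F] F unfolding smooth_cutoff_def by blast
  interpret cutoff_derivatives D by standard (use D F in auto)
  let ?n = "DIM('a)"
  \<comment> \<open>The factor exp m cancels the damping and the factor m the division by
    \<open>jbr\<close>; at m = d \<open>jbr\<close> the root is |\<xi>| / R.\<close>
  define \<Psi> where "\<Psi> d m = exp m * m ^ 1 * (1 - D 0 (sqrt (m\<^sup>2 - d\<^sup>2)))" for d m :: real
  have \<Psi>: "symb \<Psi>" unfolding \<Psi>_def[abs_def] by (rule symb0)
  let ?FP = "\<lambda>d. fourier_integral (\<lambda>m. complex_of_real (\<Psi> d m))"
  \<comment> \<open>Of the n + 1 powers, n absorb the factor (1 + \<sigma>^2)^n in the kernel bound
    below, and the last makes the \<sigma>-integral converge.\<close>
  obtain A where A: "0 \<le> A" "\<And>d \<sigma>. 0 \<le> d \<Longrightarrow> d \<le> 1 \<Longrightarrow> norm (?FP d \<sigma>) \<le> A / (1 + \<sigma>\<^sup>2) ^ Suc ?n"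
    using symb_fourier_decay2[OF \<Psi>, of "Suc ?n"] by blast
  obtain C1 where C1: "0 < C1" "\<And>z (x::'a). 0 < Re z \<Longrightarrow> 1 \<le> 2 * (Re z * \<bar>Im z\<bar>) \<Longrightarrow>
     norm (kg_kernel z x) \<le> C1 / sqrt (Re z * \<bar>Im z\<bar>) ^ ?n" using kg_kernel_dispersive by blast
  obtain C2 where C2: "0 < C2" "\<And>z (x::'a). 0 < Re z \<Longrightarrow> Re z \<le> 1 \<Longrightarrow> norm (kg_kernel z x) \<le> C2 / Re z ^ ?n"
    using kg_kernel_crude by blast
  obtain k where k: "DIM('a) = Suc k" using DIM_positive[where 'a='a] gr0_conv_Suc by blast
  define c where "c = (2 * pi) powr (- real DIM(real) / 2)"
  have c0: "0 \<le> c" by (simp add: c_def)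
  \<comment> \<open>The powers of 2 and 4 stem from the halved time in the two ranges of \<sigma>:
    sqrt 2 <= 2 in the moderate one, R <= 4 sqrt (R / |s|) (1 + \<sigma>^2) in the other.\<close>
  define C3 where "C3 = C1 * 2 ^ ?n + C2 * 4 ^ ?n"
  have C3: "0 \<le> C3" unfolding C3_def using C1(1) C2(1) by simp
  define C where "C = c * (A * C3 * (\<integral>\<sigma>. 1 / (1 + \<sigma>\<^sup>2) \<partial>(lborel :: real measure)))"
  have C: "0 \<le> C" unfolding C_def using c0 A(1) C3 by (intro mult_nonneg_nonneg Bochner_Integration.integral_nonneg) auto
  have main: "norm (\<integral>\<xi>. cis (y \<bullet> \<xi>) * (cis (s * jbr \<xi>) * of_real (1 - F (norm \<xi> / R))) \<partial>lborel)
      \<le> C * R * sqrt (R / \<bar>s\<bar>) ^ ?n" if R: "1 \<le> R" "R \<le> \<bar>s\<bar>" for R s and y :: 'a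
  proof -
    define d where "d = 1 / R"
    have d: "0 < d" "0 \<le> d" "d \<le> 1" using R by (auto simp: d_def)
    have s1: "1 \<le> \<bar>s\<bar>" using R by linarith
    have fi: "integrable lborel (?FP d)"
    proof (rule Bochner_Integration.integrable_bound[OF integrable_mult_right[OF inverse_1_plus_square_integrable, of A]])
      show "?FP d \<in> borel_measurable lborel"
        using fourier_integral_measurable[of "\<lambda>m. complex_of_real (\<Psi> d m)"] symb_integrable(1)[OF \<Psi> d(2,3)] by auto
      show "AE \<sigma> in lborel. norm (?FP d \<sigma>) \<le> norm (A * (1 / (1 + \<sigma>\<^sup>2)))"
      proof (rule AE_I2)
        fix \<sigma> :: real
        have "1 + \<sigma>\<^sup>2 \<le> (1 + \<sigma>\<^sup>2) ^ Suc ?n" using self_le_power[of "1 + \<sigma>\<^sup>2" "Suc ?n"] by simp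
        then have "A / (1 + \<sigma>\<^sup>2) ^ Suc ?n \<le> A / (1 + \<sigma>\<^sup>2)"
          using A(1) by (intro divide_left_mono mult_pos_pos zero_less_power) (auto simp: add_pos_nonneg)
        then show "norm (?FP d \<sigma>) \<le> norm (A * (1 / (1 + \<sigma>\<^sup>2)))"
          using A(2)[OF d(2,3), of \<sigma>] A(1) by (simp add: abs_mult)
      qed
    qed
    obtain CB where CB: "\<And>m. \<bar>\<Psi> d m\<bar> \<le> CB" using symb_bounded[OF \<Psi>] d by blast
    have inv: "complex_of_real (\<Psi> d m) = of_real c * (\<integral>\<sigma>. cis (m * \<sigma>) * ?FP d \<sigma> \<partial>lborel)" for m
    proof -
      have "fourier_integral (?FP d) (- m) = complex_of_real (\<Psi> d m)"
        using CB by (intro fourier_inversion_pointwise[where B=CB] symb_integrable[OF \<Psi> d(2,3)] fi) simp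
      then show ?thesis by (simp add: fourier_integral_def[of "?FP d"] c_def mult.commute)
    qed
    have chi: "complex_of_real (1 - F (norm \<xi> / R)) = of_real R * (of_real (exp (- (d * jbr \<xi>)) / jbr \<xi>) * of_real (\<Psi> d (d * jbr \<xi>)))" for \<xi> :: 'a
    proof -
      have "(d * jbr \<xi>)\<^sup>2 - d\<^sup>2 = (norm \<xi> / R)\<^sup>2"
        unfolding power_mult_distrib jbr_sq by (simp add: d_def power_divide add_divide_distrib)
      then have "sqrt ((d * jbr \<xi>)\<^sup>2 - d\<^sup>2) = norm \<xi> / R" using R by simp
      then have "\<Psi> d (d * jbr \<xi>) = exp (d * jbr \<xi>) * (d * jbr \<xi>) * (1 - F (norm \<xi> / R))"
        unfolding \<Psi>_def D(1) by simp
      moreover have "exp (- (d * jbr \<xi>)) * exp (d * jbr \<xi>) = 1" by (simp flip: exp_add)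
      moreover have "R * d = 1" using R by (simp add: d_def)
      ultimately have "R * (exp (- (d * jbr \<xi>)) / jbr \<xi> * \<Psi> d (d * jbr \<xi>)) = 1 - F (norm \<xi> / R)"
      proof -
        assume *: "\<Psi> d (d * jbr \<xi>) = exp (d * jbr \<xi>) * (d * jbr \<xi>) * (1 - F (norm \<xi> / R))"
          "exp (- (d * jbr \<xi>)) * exp (d * jbr \<xi>) = 1" "R * d = 1"
        have "R * (e / j * (E * (d * j) * X)) = (R * d) * (e * E) * X" if "j \<noteq> 0" for e E j X :: real
          using that by (simp add: field_simps)
        moreover have "jbr \<xi> \<noteq> 0" using jbr_pos[of \<xi>] by simp
        ultimately have eq: "R * (e / jbr \<xi> * (E * (d * jbr \<xi>) * X)) = (R * d) * (e * E) * X" for e E X :: real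
          by blast
        show ?thesis unfolding *(1) eq *(2,3) by simp
      qed
      then show ?thesis unfolding of_real_mult[symmetric] by (simp only:)
    qed
    define z where "z \<sigma> = Complex d (- (s + \<sigma> * d))" for \<sigma>
    define K where "K \<xi> \<sigma> = ?FP d \<sigma> * (cis (y \<bullet> \<xi>) * (exp (- z \<sigma> * of_real (jbr \<xi>)) / of_real (jbr \<xi>)))" for \<xi> \<sigma>
    have ez: "exp (- z \<sigma> * of_real (jbr \<xi>)) = of_real (exp (- (d * jbr \<xi>))) * (cis (s * jbr \<xi>) * cis (d * jbr \<xi> * \<sigma>))" for \<sigma> and \<xi> :: 'a
      unfolding cis_mult by (subst exp_eq_polar) (simp add: z_def algebra_simps)
    have "cis (y \<bullet> \<xi>) * (cis (s * jbr \<xi>) * of_real (1 - F (norm \<xi> / R))) = of_real (R * c) * (\<integral>\<sigma>. K \<xi> \<sigma> \<partial>lborel)" for \<xi> :: 'a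
    proof -
      have "(\<integral>\<sigma>. K \<xi> \<sigma> \<partial>lborel) = (\<integral>\<sigma>. cis (y \<bullet> \<xi>) * (cis (s * jbr \<xi>) * of_real (exp (- (d * jbr \<xi>)) / jbr \<xi>)) * (cis (d * jbr \<xi> * \<sigma>) * ?FP d \<sigma>) \<partial>lborel)"
        unfolding K_def ez by (rule Bochner_Integration.integral_cong) (simp_all add: mult_ac)
      also have "\<dots> = cis (y \<bullet> \<xi>) * (cis (s * jbr \<xi>) * of_real (exp (- (d * jbr \<xi>)) / jbr \<xi>)) * (\<integral>\<sigma>. cis (d * jbr \<xi> * \<sigma>) * ?FP d \<sigma> \<partial>lborel)"
        by (rule integral_mult_right_zero)
      finally have "of_real (R * c) * (\<integral>\<sigma>. K \<xi> \<sigma> \<partial>lborel)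
        = cis (y \<bullet> \<xi>) * (cis (s * jbr \<xi>) * (of_real R * (of_real (exp (- (d * jbr \<xi>)) / jbr \<xi>) * (of_real c * (\<integral>\<sigma>. cis (d * jbr \<xi> * \<sigma>) * ?FP d \<sigma> \<partial>lborel)))))"
        by (simp only: of_real_mult mult_ac)
      then show ?thesis unfolding inv[symmetric] chi by (simp only:)
    qed
    then have "(\<integral>\<xi>. cis (y \<bullet> \<xi>) * (cis (s * jbr \<xi>) * of_real (1 - F (norm \<xi> / R))) \<partial>lborel)
      = of_real (R * c) * (\<integral>\<xi>. (\<integral>\<sigma>. K \<xi> \<sigma> \<partial>lborel) \<partial>lborel)"
      by (simp only: integral_mult_right_zero)
    also have "(\<integral>\<xi>. (\<integral>\<sigma>. K \<xi> \<sigma> \<partial>lborel) \<partial>lborel) = (\<integral>\<sigma>. (\<integral>\<xi>. K \<xi> \<sigma> \<partial>lborel) \<partial>lborel)"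
    proof (rule lborel_Fubini_dominated)
      have [measurable]: "?FP d \<in> borel_measurable borel" using fi by auto
      have "z = (\<lambda>\<sigma>. of_real d - \<i> * of_real (s + \<sigma> * d))" by (auto simp: z_def complex_eq_iff)
      then have [measurable]: "z \<in> borel_measurable borel" by simp
      show "(\<lambda>(\<xi>, \<sigma>). K \<xi> \<sigma>) \<in> borel_measurable (borel \<Otimes>\<^sub>M borel)" unfolding K_def by measurable
      show "integrable lborel (\<lambda>\<xi>::'a. exp (- (d * jbr \<xi>)) / jbr \<xi>)" by (rule exp_jbr_integrable[OF d(1) k])
      show "integrable lborel (\<lambda>\<sigma>. norm (?FP d \<sigma>))" using fi by simp
      show "norm (K \<xi> \<sigma>) \<le> exp (- (d * jbr \<xi>)) / jbr \<xi> * norm (?FP d \<sigma>)" for \<xi> \<sigma>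
        using jbr_pos[of \<xi>] by (simp add: K_def norm_mult norm_divide z_def mult.commute)
    qed
    also have "\<dots> = (\<integral>\<sigma>. ?FP d \<sigma> * kg_kernel (z \<sigma>) y \<partial>lborel)"
      unfolding K_def integral_mult_right_zero kg_kernel_def ..
    finally have eq: "(\<integral>\<xi>. cis (y \<bullet> \<xi>) * (cis (s * jbr \<xi>) * of_real (1 - F (norm \<xi> / R))) \<partial>lborel)
      = of_real (R * c) * (\<integral>\<sigma>. ?FP d \<sigma> * kg_kernel (z \<sigma>) y \<partial>lborel)" .
    let ?q = "sqrt (R / \<bar>s\<bar>)"
    have q0: "0 \<le> ?q" using R by simp
    have ptw: "norm (?FP d \<sigma> * kg_kernel (z \<sigma>) y) \<le> A * C3 * ?q ^ ?n * (1 / (1 + \<sigma>\<^sup>2))" for \<sigma>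
    proof -
      have S: "1 \<le> 1 + \<sigma>\<^sup>2" by simp
      have zr: "Re (z \<sigma>) = d" "Im (z \<sigma>) = - (s + \<sigma> * d)" by (simp_all add: z_def)
      have "norm (kg_kernel (z \<sigma>) y) \<le> C3 * ?q ^ ?n * (1 + \<sigma>\<^sup>2) ^ ?n"
      \<comment> \<open>Below this threshold the shift \<sigma> d is at most |s| / 2, so |Im z| >=
        |s| / 2 and Re z |Im z| >= |s| / (2 R) >= 1 / 2.\<close>
      proof (cases "\<bar>\<sigma>\<bar> \<le> \<bar>s\<bar> * R / 2")
        case True
        have "\<bar>\<sigma> * d\<bar> \<le> \<bar>s\<bar> / 2"
          using True R by (simp add: d_def abs_divide divide_le_eq mult.commute)
        then have im: "\<bar>s\<bar> / 2 \<le> \<bar>Im (z \<sigma>)\<bar>" unfolding zr by linarith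
        have lo: "\<bar>s\<bar> / (2 * R) \<le> Re (z \<sigma>) * \<bar>Im (z \<sigma>)\<bar>"
          using mult_left_mono[OF im d(2)] unfolding zr(1) by (simp add: d_def)
        have lo2: "1 / 2 \<le> \<bar>s\<bar> / (2 * R)" using R by (simp add: divide_simps)
        have "norm (kg_kernel (z \<sigma>) y) \<le> C1 / sqrt (Re (z \<sigma>) * \<bar>Im (z \<sigma>)\<bar>) ^ ?n"
          using lo lo2 d(1) by (intro C1(2)) (auto simp: zr(1))
        also have "\<dots> \<le> C1 / sqrt (\<bar>s\<bar> / (2 * R)) ^ ?n"
          using lo lo2 C1(1) by (intro divide_left_mono power_mono real_sqrt_le_mono mult_pos_pos zero_less_power) auto
        also have "\<dots> = C1 * (sqrt 2 * ?q) ^ ?n"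
        proof -
          have "sqrt (\<bar>s\<bar> / (2 * R)) * (sqrt 2 * ?q) = 1"
            using R s1 by (simp add: real_sqrt_divide real_sqrt_mult)
          then have "sqrt (\<bar>s\<bar> / (2 * R)) ^ ?n * (sqrt 2 * ?q) ^ ?n = 1" unfolding power_mult_distrib[symmetric] by simp
          moreover have "sqrt (\<bar>s\<bar> / (2 * R)) ^ ?n \<noteq> 0" using R s1 by simp
          moreover have "P * Q = 1 \<Longrightarrow> P \<noteq> 0 \<Longrightarrow> C1 / P = C1 * Q" for P Q :: real
            by (simp add: divide_eq_eq mult.assoc mult.commute[of Q P])
          ultimately show ?thesis by blast
        qed
        also have "\<dots> \<le> C1 * (2 * ?q) ^ ?n"
          using C1(1) q0 sqrt2_less_2 by (intro mult_left_mono power_mono mult_right_mono) auto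
        also have "\<dots> = (C1 * 2 ^ ?n) * ?q ^ ?n" by (simp add: power_mult_distrib)
        also have "\<dots> \<le> C3 * ?q ^ ?n * 1" unfolding C3_def using C1(1) C2(1) q0 by (simp add: distrib_right)
        also have "\<dots> \<le> C3 * ?q ^ ?n * (1 + \<sigma>\<^sup>2) ^ ?n"
          using C3 q0 S by (intro mult_left_mono one_le_power) auto
        finally show ?thesis .
      next
        case False
        have p0: "0 \<le> \<bar>s\<bar> * R / 2" using R by simp
        have "(\<bar>s\<bar> * R / 2)\<^sup>2 \<le> \<bar>\<sigma>\<bar>\<^sup>2" using False p0 by (intro power_mono) auto
        then have big: "(\<bar>s\<bar> * R / 2)\<^sup>2 \<le> 1 + \<sigma>\<^sup>2" by simp
        \<comment> \<open>Here \<sigma>^2 exceeds (|s| R / 2)^2. This inequality turns the R^n of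
          the crude bound into the desired power of sqrt (R / |s|) times (1 + \<sigma>^2)^n.\<close>
        have "R \<le> 4 * ?q * (\<bar>s\<bar> * R / 2)\<^sup>2"
        proof -
          have "(1 / \<bar>s\<bar>)\<^sup>2 \<le> 1 / \<bar>s\<bar>" using s1 unfolding power2_eq_square by (intro mult_left_le) auto
          also have "\<dots> \<le> R / \<bar>s\<bar>" using R s1 by (intro divide_right_mono) auto
          finally have q: "1 / \<bar>s\<bar> \<le> ?q" by (rule real_le_rsqrt)
          have "R \<le> \<bar>s\<bar> * R * R" using R s1 mult_mono[of 1 "\<bar>s\<bar>" 1 R] mult_right_mono[of 1 "\<bar>s\<bar> * R" R] by simp
          also have "\<dots> = 4 * (1 / \<bar>s\<bar>) * (\<bar>s\<bar> * R / 2)\<^sup>2" using s1 by (simp add: power2_eq_square field_simps)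
          also have "\<dots> \<le> 4 * ?q * (\<bar>s\<bar> * R / 2)\<^sup>2" using q by (intro mult_right_mono mult_left_mono) auto
          finally show ?thesis .
        qed
        also have "\<dots> \<le> 4 * ?q * (1 + \<sigma>\<^sup>2)" using big q0 by (intro mult_left_mono) auto
        finally have Rle: "R \<le> 4 * ?q * (1 + \<sigma>\<^sup>2)" .
        have "norm (kg_kernel (z \<sigma>) y) \<le> C2 / d ^ ?n" using C2(2)[of "z \<sigma>" y] d by (simp add: zr)
        also have "\<dots> = C2 * R ^ ?n" by (simp add: d_def power_divide)
        also have "\<dots> \<le> C2 * (4 * ?q * (1 + \<sigma>\<^sup>2)) ^ ?n" using C2(1) R Rle by (intro mult_left_mono power_mono) auto
        also have "\<dots> = (C2 * 4 ^ ?n) * ?q ^ ?n * (1 + \<sigma>\<^sup>2) ^ ?n" by (simp add: power_mult_distrib)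
        also have "\<dots> \<le> C3 * ?q ^ ?n * (1 + \<sigma>\<^sup>2) ^ ?n"
          using C1(1) q0 S by (intro mult_right_mono) (auto simp: C3_def)
        finally show ?thesis .
      qed
      then have "norm (?FP d \<sigma> * kg_kernel (z \<sigma>) y) \<le> A / (1 + \<sigma>\<^sup>2) ^ Suc ?n * (C3 * ?q ^ ?n * (1 + \<sigma>\<^sup>2) ^ ?n)"
        unfolding norm_mult using A(1) S by (intro mult_mono A(2)[OF d(2,3)]) auto
      also have "\<dots> = A * C3 * ?q ^ ?n * (1 / (1 + \<sigma>\<^sup>2))"
      proof -
        have "T \<noteq> 0 \<Longrightarrow> A / (T * P) * (E * P) = A * E * (1 / T)" if "P \<noteq> 0" for T P E :: real using that by simp
        from this[of "(1 + \<sigma>\<^sup>2) ^ ?n" "1 + \<sigma>\<^sup>2" "C3 * ?q ^ ?n"] show ?thesis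
          using S by (simp add: add_nonneg_eq_0_iff mult.assoc)
      qed
      finally show ?thesis .
    qed
    have i1: "integrable lborel (\<lambda>\<sigma>. A * C3 * ?q ^ ?n * (1 / (1 + \<sigma>\<^sup>2)))"
      by (rule integrable_mult_right[OF inverse_1_plus_square_integrable])
    have "norm (\<integral>\<sigma>. ?FP d \<sigma> * kg_kernel (z \<sigma>) y \<partial>lborel) \<le> (\<integral>\<sigma>. A * C3 * ?q ^ ?n * (1 / (1 + \<sigma>\<^sup>2)) \<partial>lborel)"
      by (rule order_trans[OF integral_norm_bound], rule integral_mono_AE', rule i1)
         (use ptw A(1) C3 q0 in \<open>auto intro!: AE_I2 simp: add_nonneg_nonneg\<close>)
    also have "\<dots> = A * C3 * ?q ^ ?n * (\<integral>\<sigma>. 1 / (1 + \<sigma>\<^sup>2) \<partial>(lborel :: real measure))" by (rule integral_mult_right_zero)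
    finally have "R * c * norm (\<integral>\<sigma>. ?FP d \<sigma> * kg_kernel (z \<sigma>) y \<partial>lborel) \<le> R * c * (A * C3 * ?q ^ ?n * (\<integral>\<sigma>. 1 / (1 + \<sigma>\<^sup>2) \<partial>(lborel :: real measure)))"
      using R c0 by (intro mult_left_mono) auto
    also have "\<dots> = C * R * ?q ^ ?n" by (simp only: C_def mult_ac)
    finally show ?thesis unfolding eq norm_mult norm_of_real using R c0 by simp
  qed
  then show ?thesis using C by blast
qed

section \<open>Band-limited functions as limits of test functions\<close>

definition bounded_supp :: "('a::euclidean_space \<Rightarrow> complex) \<Rightarrow> bool" where
  "bounded_supp m \<longleftrightarrow> m \<in> borel_measurable borel \<and> (\<exists>B. \<forall>x. norm (m x) \<le> B) \<and> (\<exists>R. \<forall>x. R < norm x \<longrightarrow> m x = 0)"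

lemma bounded_supp_measurable [measurable_dest]: "bounded_supp m \<Longrightarrow> m \<in> borel_measurable borel"
  by (simp add: bounded_supp_def)

lemma bounded_supp_L2_integrable:
  fixes m :: "'a::euclidean_space \<Rightarrow> complex"
  assumes "bounded_supp m"
  shows "m \<in> L2" "integrable lborel m"
proof -
  obtain B R where m: "m \<in> borel_measurable borel" "\<And>x. norm (m x) \<le> B" "\<And>x. R < norm x \<Longrightarrow> m x = 0"
    using assms unfolding bounded_supp_def by blast
  have B: "0 \<le> B" using m(2) norm_ge_zero order_trans by blast
  show L: "m \<in> L2"
    by (rule L2_dominated(1)[OF indicator_cball_L2[of R] m(1) _ B], rule AE_I2)
       (metis indicator_simps m(2,3) mem_cball_0 mult.right_neutral mult_zero_right norm_one norm_zero not_less order_refl)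
  have "(\<lambda>x. indicator (cball 0 R) x *\<^sub>R m x) = m" using m(3) by (force simp: fun_eq_iff indicator_def)
  then show "integrable lborel m" using L2_trunc_integrable[OF L, of R] by simp
qed

lemma bounded_supp_mult:
  fixes m :: "'a::euclidean_space \<Rightarrow> complex"
  assumes "bounded_supp m" and g: "g \<in> borel_measurable borel" "\<And>r. \<exists>C. \<forall>x. norm x \<le> r \<longrightarrow> norm (g x) \<le> C"
  shows "bounded_supp (\<lambda>x. g x * m x)"
proof -
  obtain B R where m: "m \<in> borel_measurable borel" "\<And>x. norm (m x) \<le> B" "\<And>x. R < norm x \<Longrightarrow> m x = 0"
    using assms unfolding bounded_supp_def by blast
  obtain C where C: "\<And>x. norm x \<le> R \<Longrightarrow> norm (g x) \<le> C" using g(2)[of R] by blast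
  have B: "0 \<le> B" using m(2) norm_ge_zero order_trans by blast
  have "norm (g x * m x) \<le> \<bar>C\<bar> * B" for x
  proof (cases "norm x \<le> R")
    case True
    have "norm (g x) \<le> \<bar>C\<bar>" using C[OF True] by linarith
    then show ?thesis using mult_mono[OF _ m(2)[of x], of "norm (g x)" "\<bar>C\<bar>"]
      by (simp add: norm_mult)
  next
    case False then show ?thesis using m(3)[of x] B by simp
  qed
  moreover have "(\<lambda>x. g x * m x) \<in> borel_measurable borel" using m(1) g(1) by measurable
  moreover have "\<forall>x. R < norm x \<longrightarrow> g x * m x = 0" using m(3) by simp
  ultimately show ?thesis unfolding bounded_supp_def by blast
qed

lemma bounded_supp_inner:
  fixes m :: "'a::euclidean_space \<Rightarrow> complex"
  assumes "bounded_supp m"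
  shows "bounded_supp (\<lambda>\<xi>. c * of_real (b \<bullet> \<xi>) * m \<xi>)"
proof (rule bounded_supp_mult[OF assms])
  fix r
  have "norm (c * of_real (b \<bullet> x)) \<le> norm c * (norm b * r)" if "norm x \<le> r" for x :: 'a
    using that Cauchy_Schwarz_ineq2[of b x] mult_left_mono[OF that, of "norm b"]
    by (auto simp: norm_mult intro!: mult_left_mono)
  then show "\<exists>C. \<forall>x. norm x \<le> r \<longrightarrow> norm (c * of_real (b \<bullet> x)) \<le> C" by blast
qed simp

lemma norm_cis_minus_1: "norm (cis x - 1) \<le> \<bar>x\<bar>"
  using iexp_approx1[of x 0] by (simp add: cis_conv_exp)

lemma norm_cis_minus_linear: "norm (cis x - 1 - \<i> * of_real x) \<le> x\<^sup>2"
proof -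
  have "norm (cis x - 1 - \<i> * of_real x) \<le> \<bar>x\<bar>\<^sup>2 / 2"
    using iexp_approx1[of x 1] by (simp add: cis_conv_exp algebra_simps power2_eq_square)
  then show ?thesis using zero_le_power2[of x] unfolding power2_abs by linarith
qed

lemma fourier_integral_continuous:
  fixes m :: "'a::euclidean_space \<Rightarrow> complex"
  assumes "bounded_supp m"
  shows "continuous_on UNIV (fourier_integral m)"
proof -
  have i: "integrable lborel m" by (rule bounded_supp_L2_integrable[OF assms])
  have "isCont (fourier_integral m) x" for x
    unfolding continuous_at_sequentially comp_def
  proof (intro allI impI)
    fix X :: "nat \<Rightarrow> 'a" assume X: "X \<longlonglongrightarrow> x"
    have "(\<lambda>n. \<integral>\<xi>. cis (- (\<xi> \<bullet> X n)) * m \<xi> \<partial>lborel) \<longlonglongrightarrow> (\<integral>\<xi>. cis (- (\<xi> \<bullet> x)) * m \<xi> \<partial>lborel)"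
    proof (rule integral_dominated_convergence[where w="\<lambda>\<xi>. norm (m \<xi>)"])
      show "AE \<xi> in lborel. (\<lambda>n. cis (- (\<xi> \<bullet> X n)) * m \<xi>) \<longlonglongrightarrow> cis (- (\<xi> \<bullet> x)) * m \<xi>"
      proof (rule AE_I2)
        fix \<xi> :: 'a
        have "isCont cis y" for y by (rule continuous_on_interior[of UNIV]) (auto intro: continuous_intros)
        moreover have "(\<lambda>n. - (\<xi> \<bullet> X n)) \<longlonglongrightarrow> - (\<xi> \<bullet> x)" by (intro tendsto_intros X)
        ultimately have "(\<lambda>n. cis (- (\<xi> \<bullet> X n))) \<longlonglongrightarrow> cis (- (\<xi> \<bullet> x))" by (rule isCont_tendsto_compose)
        then show "(\<lambda>n. cis (- (\<xi> \<bullet> X n)) * m \<xi>) \<longlonglongrightarrow> cis (- (\<xi> \<bullet> x)) * m \<xi>" by (rule tendsto_mult[OF _ tendsto_const])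
      qed
    qed (use i in \<open>auto simp: norm_mult\<close>)
    then show "(\<lambda>n. fourier_integral m (X n)) \<longlonglongrightarrow> fourier_integral m x"
      unfolding fourier_integral_def by (intro tendsto_intros)
  qed
  then show ?thesis by (simp add: continuous_at_imp_continuous_on)
qed

lemma has_vector_derivative_if_quadratic:
  fixes f :: "real \<Rightarrow> complex"
  assumes "\<And>s. norm (f s - f 0 - of_real s * d) \<le> K * s\<^sup>2"
  shows "(f has_vector_derivative d) (at 0)"
  unfolding has_vector_derivative_def has_derivative_iff_norm
proof
  show "bounded_linear (\<lambda>x. x *\<^sub>R d)" by (rule bounded_linear_scaleR_left)
  show "((\<lambda>y. norm (f y - f 0 - (y - 0) *\<^sub>R d) / norm (y - 0)) \<longlongrightarrow> 0) (at 0)"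
  proof (rule Lim_null_comparison)
    show "\<forall>\<^sub>F s in at 0. norm (norm (f s - f 0 - (s - 0) *\<^sub>R d) / norm (s - 0)) \<le> K * \<bar>s\<bar>"
    proof (rule eventually_at_topological[THEN iffD2], intro exI[of _ UNIV] conjI ballI impI)
      fix s :: real assume "s \<noteq> 0"
      then have "norm (f s - f 0 - of_real s * d) / \<bar>s\<bar> \<le> K * s\<^sup>2 / \<bar>s\<bar>"
        by (intro divide_right_mono assms) auto
      also have "\<dots> = K * \<bar>s\<bar>" using \<open>s \<noteq> 0\<close> by (simp add: power2_eq_square abs_if)
      finally show "norm (norm (f s - f 0 - (s - 0) *\<^sub>R d) / norm (s - 0)) \<le> K * \<bar>s\<bar>"
        by (simp add: scaleR_conv_of_real)
    qed auto
    have "((\<lambda>s. K * \<bar>s\<bar>) \<longlongrightarrow> K * \<bar>0\<bar>) (at (0::real))" by (intro tendsto_intros)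
    then show "((\<lambda>s. K * \<bar>s\<bar>) \<longlongrightarrow> 0) (at (0::real))" by simp
  qed
qed

text \<open>The linearisation error of the exponential is quadratic, and the second moment that
  multiplies it is integrable because m is bounded with bounded support.\<close>

lemma fourier_integral_deriv:
  fixes m :: "'a::euclidean_space \<Rightarrow> complex"
  assumes m: "bounded_supp m"
  shows "((\<lambda>s. fourier_integral m (x + s *\<^sub>R b)) has_vector_derivative
      fourier_integral (\<lambda>\<xi>. - \<i> * of_real (b \<bullet> \<xi>) * m \<xi>) x) (at 0)"
proof -
  define c where "c = (2 * pi) powr (- real DIM('a) / 2)"
  let ?m1 = "\<lambda>\<xi>. - \<i> * of_real (b \<bullet> \<xi>) * m \<xi>"
  let ?m2 = "\<lambda>\<xi>. 1 * of_real (b \<bullet> \<xi>) * (1 * of_real (b \<bullet> \<xi>) * m \<xi>)"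
  note i0 = bounded_supp_L2_integrable(2)[OF m]
  note i1 = bounded_supp_L2_integrable(2)[OF bounded_supp_inner[OF m, of "- \<i>" b]]
  note i2 = bounded_supp_L2_integrable(2)[OF bounded_supp_inner[OF bounded_supp_inner[OF m, of 1 b], of 1 b]]
  have "norm (fourier_integral m (x + s *\<^sub>R b) - fourier_integral m (x + 0 *\<^sub>R b) - of_real s * fourier_integral ?m1 x)
     \<le> c * (\<integral>\<xi>. norm (?m2 \<xi>) \<partial>lborel) * s\<^sup>2" for s
  proof -
    let ?I = "\<lambda>y m. \<integral>\<xi>. cis (- (\<xi> \<bullet> y)) * m \<xi> \<partial>lborel"
    let ?r = "\<lambda>\<xi>. cis (- (\<xi> \<bullet> (x + s *\<^sub>R b))) * m \<xi> - cis (- (\<xi> \<bullet> x)) * m \<xi> - of_real s * (cis (- (\<xi> \<bullet> x)) * ?m1 \<xi>)"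
    have ir: "integrable lborel ?r"
      using fourier_integrand_integrable(1)[OF i0] fourier_integrand_integrable(1)[OF i1] by simp
    have bd: "norm (?r \<xi>) \<le> s\<^sup>2 * norm (?m2 \<xi>)" for \<xi>
    proof -
      let ?h = "- (s * (b \<bullet> \<xi>))"
      have "cis (- (\<xi> \<bullet> (x + s *\<^sub>R b))) = cis (- (\<xi> \<bullet> x)) * cis ?h"
        unfolding cis_mult by (simp add: inner_add_right inner_commute)
      then have "?r \<xi> = cis (- (\<xi> \<bullet> x)) * (cis ?h - 1 - \<i> * of_real ?h) * m \<xi>"
        by (simp add: algebra_simps)
      then have "norm (?r \<xi>) = norm (cis ?h - 1 - \<i> * of_real ?h) * norm (m \<xi>)" by (simp only: norm_mult norm_cis mult_1)
      also have "\<dots> \<le> ?h\<^sup>2 * norm (m \<xi>)" by (intro mult_right_mono norm_cis_minus_linear) simp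
      also have "\<dots> = s\<^sup>2 * norm (?m2 \<xi>)" by (simp add: norm_mult power_mult_distrib power2_eq_square)
      finally show ?thesis .
    qed
    have "norm (\<integral>\<xi>. ?r \<xi> \<partial>lborel) \<le> (\<integral>\<xi>. s\<^sup>2 * norm (?m2 \<xi>) \<partial>lborel)"
      by (rule order_trans[OF integral_norm_bound], rule integral_mono[OF integrable_norm[OF ir] _ bd])
         (rule integrable_mult_right[OF integrable_norm[OF i2]])
    moreover have "(\<integral>\<xi>. ?r \<xi> \<partial>lborel) = ?I (x + s *\<^sub>R b) m - ?I x m - of_real s * ?I x ?m1"
      using fourier_integrand_integrable(1)[OF i0] fourier_integrand_integrable(1)[OF i1] by simp
    ultimately have "norm (?I (x + s *\<^sub>R b) m - ?I x m - of_real s * ?I x ?m1) \<le> s\<^sup>2 * (\<integral>\<xi>. norm (?m2 \<xi>) \<partial>lborel)"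
      by (simp only: integral_mult_right_zero)
    then have "c * norm (?I (x + s *\<^sub>R b) m - ?I x m - of_real s * ?I x ?m1) \<le> c * (s\<^sup>2 * (\<integral>\<xi>. norm (?m2 \<xi>) \<partial>lborel))"
      by (rule mult_left_mono) (simp add: c_def)
    moreover have "norm (fourier_integral m (x + s *\<^sub>R b) - fourier_integral m (x + 0 *\<^sub>R b) - of_real s * fourier_integral ?m1 x)
      = norm (of_real c * (?I (x + s *\<^sub>R b) m - ?I x m - of_real s * ?I x ?m1))"
      unfolding fourier_integral_def c_def[symmetric] by (simp add: algebra_simps)
    moreover have "\<dots> = c * norm (?I (x + s *\<^sub>R b) m - ?I x m - of_real s * ?I x ?m1)"
      by (simp only: norm_mult norm_of_real) (simp add: c_def)
    ultimately show ?thesis by (simp only: mult_ac)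
  qed
  then show ?thesis by (rule has_vector_derivative_if_quadratic)
qed

text \<open>\<open>smooth\<close> is defined through iterated directional derivatives, so a class
  closed under them gives every \<open>C_k\<close> by one induction. It contains the band-limited
  functions and the radial cut-offs. The rule \<open>radial\<close> is stated for an entire sequence
  of derivatives, to contain the next one, and in terms of x . x rather than the norm, to be smooth
  at the origin.\<close>

inductive smooth_class :: "('a::euclidean_space \<Rightarrow> complex) \<Rightarrow> bool" where
  fourier: "bounded_supp m \<Longrightarrow> smooth_class (fourier_integral m)"
| radial: "(\<And>i x. (D i has_real_derivative D (Suc i) x) (at x)) \<Longrightarrow> smooth_class (\<lambda>x. of_real (D i (c * (x \<bullet> x))))"
| coord: "smooth_class (\<lambda>x. of_real (x \<bullet> b))"
| const: "smooth_class (\<lambda>x. k)"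
| add: "smooth_class f \<Longrightarrow> smooth_class g \<Longrightarrow> smooth_class (\<lambda>x. f x + g x)"
| mult: "smooth_class f \<Longrightarrow> smooth_class g \<Longrightarrow> smooth_class (\<lambda>x. f x * g x)"

lemma smooth_class_continuous: "smooth_class f \<Longrightarrow> continuous_on UNIV f"
proof (induction rule: smooth_class.induct)
  case (fourier m) then show ?case by (rule fourier_integral_continuous)
next
  case (radial D i c)
  then have "continuous_on UNIV (D i)" by (meson DERIV_isCont continuous_at_imp_continuous_on)
  then have "continuous_on UNIV (\<lambda>x::'a. D i (c * (x \<bullet> x)))"
    by (rule continuous_on_compose2) (auto intro!: continuous_intros)
  then show ?case by (intro continuous_intros)
qed (auto intro!: continuous_intros)

lemma radial_deriv:
  assumes "(G has_real_derivative G') (at (c * (x \<bullet> x)))"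
  shows "((\<lambda>s. G (c * ((x + s *\<^sub>R b) \<bullet> (x + s *\<^sub>R b)))) has_real_derivative 2 * c * (x \<bullet> b) * G') (at 0)"
proof -
  have "((\<lambda>s. c * ((x + s *\<^sub>R b) \<bullet> (x + s *\<^sub>R b))) has_real_derivative 2 * c * (x \<bullet> b)) (at 0)"
    (is "(?g has_real_derivative _) _")
  proof -
    have "(\<lambda>s. c * ((x + s *\<^sub>R b) \<bullet> (x + s *\<^sub>R b))) = (\<lambda>s. c * (x \<bullet> x + 2 * s * (x \<bullet> b) + s\<^sup>2 * (b \<bullet> b)))"
      by (simp add: fun_eq_iff inner_add_left inner_add_right inner_commute power2_eq_square algebra_simps)
    then show ?thesis by (auto intro!: derivative_eq_intros)
  qed
  moreover have "(G has_real_derivative G') (at (?g 0))" using assms by simp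
  ultimately show ?thesis using DERIV_chain2[of G G' ?g 0 "2 * c * (x \<bullet> b)" UNIV] by (simp only: mult.commute[of G'])
qed

lemma smooth_class_deriv:
  "smooth_class f \<Longrightarrow> \<exists>f'. smooth_class f' \<and> (\<forall>x. ((\<lambda>s. f (x + s *\<^sub>R b)) has_vector_derivative f' x) (at 0))"
proof (induction rule: smooth_class.induct)
  case (fourier m)
  then show ?case using smooth_class.fourier[OF bounded_supp_inner[OF fourier, of "- \<i>" b]] fourier_integral_deriv[OF fourier, of _ b] by blast
next
  case (radial D i c)
  have "smooth_class (\<lambda>x::'a. of_real (2 * c) * (of_real (x \<bullet> b) * of_real (D (Suc i) (c * (x \<bullet> x)))))"
    by (intro smooth_class.mult smooth_class.const smooth_class.coord smooth_class.radial radial)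
  moreover have "((\<lambda>s. complex_of_real (D i (c * ((x + s *\<^sub>R b) \<bullet> (x + s *\<^sub>R b))))) has_vector_derivative
      of_real (2 * c) * (of_real (x \<bullet> b) * of_real (D (Suc i) (c * (x \<bullet> x))))) (at 0)" for x :: 'a
  proof -
    have "((\<lambda>s. D i (c * ((x + s *\<^sub>R b) \<bullet> (x + s *\<^sub>R b)))) has_real_derivative 2 * c * (x \<bullet> b) * D (Suc i) (c * (x \<bullet> x))) (at 0)"
      by (rule radial_deriv[OF radial(1)])
    from has_vector_derivative_of_real[OF this] show ?thesis by (simp add: mult.assoc)
  qed
  ultimately show ?case by blast
next
  case (coord c)
  have "((\<lambda>s. complex_of_real ((x + s *\<^sub>R b) \<bullet> c)) has_vector_derivative of_real (b \<bullet> c)) (at 0)" for x :: 'a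
  proof -
    have "((\<lambda>s. (x + s *\<^sub>R b) \<bullet> c) has_real_derivative b \<bullet> c) (at 0)"
      by (auto intro!: derivative_eq_intros simp: inner_add_left)
    from has_vector_derivative_of_real[OF this] show ?thesis .
  qed
  then show ?case using smooth_class.const[of "of_real (b \<bullet> c)"] by blast
next
  case (const k)
  then show ?case using smooth_class.const[of 0] has_vector_derivative_const by blast
next
  case (add f g)
  then obtain f' g' where f: "smooth_class f'" "\<And>x. ((\<lambda>s. f (x + s *\<^sub>R b)) has_vector_derivative f' x) (at 0)"
    and g: "smooth_class g'" "\<And>x. ((\<lambda>s. g (x + s *\<^sub>R b)) has_vector_derivative g' x) (at 0)" by blast
  show ?case using smooth_class.add[OF f(1) g(1)] has_vector_derivative_add[OF f(2) g(2)] by blast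
next
  case (mult f g)
  then obtain f' g' where f: "smooth_class f'" "\<And>x. ((\<lambda>s. f (x + s *\<^sub>R b)) has_vector_derivative f' x) (at 0)"
    and g: "smooth_class g'" "\<And>x. ((\<lambda>s. g (x + s *\<^sub>R b)) has_vector_derivative g' x) (at 0)" by blast
  have "smooth_class (\<lambda>x. f x * g' x + f' x * g x)"
    by (intro smooth_class.add smooth_class.mult mult.hyps f(1) g(1))
  moreover have "((\<lambda>s. f (x + s *\<^sub>R b) * g (x + s *\<^sub>R b)) has_vector_derivative f x * g' x + f' x * g x) (at 0)" for x
    using has_vector_derivative_mult[OF f(2)[of x] g(2)[of x]] by simp
  ultimately show ?case by blast
qed

lemma pderiv_alongI:
  "((\<lambda>s. f (x + s *\<^sub>R b)) has_vector_derivative d) (at 0) \<Longrightarrow> pderiv_along b f x = d"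
  unfolding pderiv_along_def by (rule vector_derivative_at)

lemma smooth_class_smooth: "smooth_class f \<Longrightarrow> smooth f"
proof -
  have "smooth_class f \<Longrightarrow> C_k k f" for k
  proof (induction k arbitrary: f)
    case 0 then show ?case by (simp add: smooth_class_continuous)
  next
    case (Suc k)
    have "(\<forall>x. (\<lambda>s. f (x + s *\<^sub>R b)) differentiable (at 0)) \<and> C_k k (pderiv_along b f)" for b
    proof -
      obtain f' where f: "smooth_class f'" "\<And>x. ((\<lambda>s. f (x + s *\<^sub>R b)) has_vector_derivative f' x) (at 0)"
        using smooth_class_deriv[OF Suc.prems] by blast
      have "pderiv_along b f = f'" using pderiv_alongI[OF f(2)] by (simp add: fun_eq_iff)
      then show ?thesis using Suc.IH[OF f(1)] f(2) by (auto intro: differentiableI_vector)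
    qed
    then show ?case by simp
  qed
  then show "smooth_class f \<Longrightarrow> smooth f" by (simp add: smooth_def)
qed

section \<open>A one-sided mean value inequality\<close>

text \<open>Only right increments of f are estimated, and only to first order. This suits a pairing
  with a moving phase: at time s the weak equation can be tested with the phase frozen at s, which
  says nothing beyond first order.\<close>

lemma one_sided_mean_value_ineq:
  fixes f :: "real \<Rightarrow> complex"
  assumes ab: "a \<le> b" and cont: "continuous_on {a..b} f"
    and \<psi>: "\<And>s. s \<in> {a..b} \<Longrightarrow> (\<psi> has_real_derivative B s) (at s)"
    and dini: "\<And>s e. s \<in> {a..<b} \<Longrightarrow> 0 < e \<Longrightarrow> \<forall>\<^sub>F h in at_right 0. norm (f (s + h) - f s) \<le> (B s + e) * h"
  shows "norm (f b - f a) \<le> \<psi> b - \<psi> a"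
proof -
  have c\<psi>: "continuous_on {a..b} \<psi>" using \<psi> by (meson DERIV_isCont continuous_at_imp_continuous_on)
  have key: "norm (f b - f a) - (\<psi> b - \<psi> a) \<le> e * (b - a)" if e: "0 < e" for e
  proof -
    define g where "g s = norm (f s - f a) - (\<psi> s - \<psi> a) - e * (s - a)" for s
    have cg: "continuous_on {a..b} g" unfolding g_def by (intro continuous_intros cont c\<psi>)
    define S where "S = {s \<in> {a..b}. g s \<le> 0}"
    have aS: "a \<in> S" using ab by (simp add: S_def g_def)
    have "closed S"
    proof -
      have "S = {a..b} \<inter> g -` {..0}" by (auto simp: S_def)
      then show ?thesis using continuous_closed_preimage[OF cg, of "{..0}"] by simp
    qed
    have bd: "bdd_above S" unfolding S_def by (rule bdd_aboveI[of _ b]) auto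
    define s where "s = Sup S"
    \<comment> \<open>By continuity the supremum belongs to S. Were it less than b, the slack e
      would absorb the two errors e/2 in the increments of f and \<psi>, and S would contain a point
      further right.\<close>
    have sS: "s \<in> S" unfolding s_def using aS bd \<open>closed S\<close> by (intro closed_contains_Sup) auto
    have "s = b"
    proof (rule ccontr)
      assume "s \<noteq> b"
      then have s: "s \<in> {a..<b}" using sS by (auto simp: S_def)
      have 1: "\<forall>\<^sub>F h in at_right 0. norm (f (s + h) - f s) \<le> (B s + e / 2) * h" using dini[OF s, of "e / 2"] e by simp
      have 2: "\<forall>\<^sub>F h in at_right 0. (B s - e / 2) * h \<le> \<psi> (s + h) - \<psi> s"
      proof -
        have "((\<lambda>h. (\<psi> (s + h) - \<psi> s) / h) \<longlongrightarrow> B s) (at 0)" using \<psi>[of s] s by (simp add: DERIV_def)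
        then have "((\<lambda>h. (\<psi> (s + h) - \<psi> s) / h) \<longlongrightarrow> B s) (at_right 0)" by (rule filterlim_mono) (auto simp: at_le)
        then have "\<forall>\<^sub>F h in at_right 0. B s - e / 2 < (\<psi> (s + h) - \<psi> s) / h" using e by (intro order_tendstoD) auto
        then show ?thesis using eventually_at_right_less[of 0]
          by eventually_elim (simp add: pos_less_divide_eq less_imp_le)
      qed
      have 3: "\<forall>\<^sub>F h in at_right 0. h < b - s" using s by (intro eventually_at_right_field[THEN iffD2] exI[of _ "b - s"]) auto
      have "\<forall>\<^sub>F h in at_right (0::real). False"
        using 1 2 3 eventually_at_right_less[of 0]
      proof eventually_elim
        case (elim h)
        have "norm (f (s + h) - f a) \<le> norm (f (s + h) - f s) + norm (f s - f a)"
          using norm_triangle_ineq[of "f (s + h) - f s" "f s - f a"] by simp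
        then have "g (s + h) \<le> g s + ((B s + e / 2) * h - (B s - e / 2) * h - e * h)"
          using elim(1,2) unfolding g_def by (simp add: algebra_simps)
        also have "(B s + e / 2) * h - (B s - e / 2) * h - e * h = 0" by (simp add: algebra_simps)
        finally have "g (s + h) \<le> 0" using sS by (simp add: S_def)
        then have "s + h \<in> S" using s elim(3,4) by (simp add: S_def)
        then have "s + h \<le> s" unfolding s_def using bd by (intro cSup_upper)
        then show False using elim(4) by simp
      qed
      then show False by simp
    qed
    then show ?thesis using sS by (simp add: S_def g_def)
  qed
  have "norm (f b - f a) - (\<psi> b - \<psi> a) \<le> 0"
  proof (rule field_le_epsilon)
    fix e :: real assume "0 < e"
    \<comment> \<open>The added 1 keeps the denominator positive when a = b.\<close>
    have "e / (b - a + 1) * (b - a) \<le> e"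
      using ab \<open>0 < e\<close> by (simp add: divide_le_eq) 
    then show "norm (f b - f a) - (\<psi> b - \<psi> a) \<le> 0 + e" using key[of "e / (b - a + 1)"] ab \<open>0 < e\<close> by simp
  qed
  then show ?thesis by simp
qed

section \<open>Test functions approximating a band-limited function\<close>

lemma L2_sum:
  assumes "finite I" "\<And>i. i \<in> I \<Longrightarrow> f i \<in> L2"
  shows "(\<lambda>x. \<Sum>i\<in>I. f i x) \<in> L2"
  using assms
proof (induction I rule: finite_induct)
  case empty then show ?case by (simp add: L2_def)
next
  case (insert i I) then show ?case using L2_add(1)[of "f i" "\<lambda>x. \<Sum>i\<in>I. f i x"] by simp
qed

lemma fourier_integral_sum:
  assumes "finite I" "\<And>i. i \<in> I \<Longrightarrow> integrable lborel (f i)"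
  shows "fourier_integral (\<lambda>x. \<Sum>i\<in>I. f i x) \<xi> = (\<Sum>i\<in>I. fourier_integral (f i) \<xi>)"
  using assms
proof (induction I rule: finite_induct)
  case empty then show ?case by (simp add: fourier_integral_def)
next
  case (insert i I) then show ?case using fourier_integral_add[of "f i" "\<lambda>x. \<Sum>i\<in>I. f i x" \<xi>] by simp
qed

lemma pderiv_along_twice_mult:
  fixes f g :: "'a::euclidean_space \<Rightarrow> complex"
  assumes "\<And>x. ((\<lambda>s. f (x + s *\<^sub>R b)) has_vector_derivative f1 x) (at 0)"
    and "\<And>x. ((\<lambda>s. f1 (x + s *\<^sub>R b)) has_vector_derivative f2 x) (at 0)"
    and "\<And>x. ((\<lambda>s. g (x + s *\<^sub>R b)) has_vector_derivative g1 x) (at 0)"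
    and "\<And>x. ((\<lambda>s. g1 (x + s *\<^sub>R b)) has_vector_derivative g2 x) (at 0)"
  shows "pderiv_along b (pderiv_along b (\<lambda>x. f x * g x)) x = f2 x * g x + 2 * f1 x * g1 x + f x * g2 x"
proof -
  have "pderiv_along b (\<lambda>x. f x * g x) = (\<lambda>x. f x * g1 x + f1 x * g x)"
  proof
    fix x show "pderiv_along b (\<lambda>x. f x * g x) x = f x * g1 x + f1 x * g x"
      using has_vector_derivative_mult[OF assms(1)[of x] assms(3)[of x]] by (intro pderiv_alongI) simp
  qed
  moreover have "pderiv_along b (\<lambda>x. f x * g1 x + f1 x * g x) x = (f x * g2 x + f1 x * g1 x) + (f1 x * g1 x + f2 x * g x)"
    using has_vector_derivative_add[OF has_vector_derivative_mult[OF assms(1)[of x] assms(4)[of x]]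
        has_vector_derivative_mult[OF assms(2)[of x] assms(3)[of x]]] by (intro pderiv_alongI) simp
  ultimately show ?thesis by (simp only: mult_2 distrib_right add_ac)
qed

lemma fourier_integral_bounded_supp_L2: "bounded_supp m \<Longrightarrow> fourier_integral m \<in> L2"
  by (rule fourier_integral_L2(1)[OF bounded_supp_L2_integrable])

text \<open>A band-limited function is smooth but not compactly supported, so it is multiplied by
  cut-offs of growing radius. Two dominations are recorded because two kinds of pairing go to the
  limit: the L2 majorant w is for u and v, the supremum bound K for the source, which is only in
  L1.\<close>

lemma bandlimited_test_approx:
  fixes m :: "'a::euclidean_space \<Rightarrow> complex"
  assumes F: "smooth_cutoff F" and m: "bounded_supp m"
  obtains \<phi> :: "nat \<Rightarrow> 'a \<Rightarrow> complex" and w K where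
    "\<And>j. test_function (\<phi> j)"
    "\<And>j. \<phi> j \<in> borel_measurable borel" "\<And>j. (\<lambda>x. laplacian (\<phi> j) x - \<phi> j x) \<in> borel_measurable borel"
    "\<And>x. (\<lambda>j. \<phi> j x) \<longlonglongrightarrow> fourier_integral m x"
    "\<And>x. (\<lambda>j. laplacian (\<phi> j) x - \<phi> j x) \<longlonglongrightarrow> fourier_integral (\<lambda>\<xi>. - of_real ((jbr \<xi>)\<^sup>2) * m \<xi>) x"
    "w \<in> L2" "\<And>j x. norm (\<phi> j x) \<le> norm (w x)" "\<And>j x. norm (laplacian (\<phi> j) x - \<phi> j x) \<le> norm (w x)"
    "\<And>j x. norm (\<phi> j x) \<le> K"
proof -
  obtain D where D: "D 0 = F" "\<And>i x. (D i has_real_derivative D (Suc i) x) (at x)"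
    using smooth_real_derivatives[of F] F unfolding smooth_cutoff_def by blast
  interpret cutoff_derivatives D by standard (use D F in auto)
  have Dm [measurable]: "D i \<in> borel_measurable borel" for i
    using D(2) by (intro borel_measurable_continuous_onI) (meson DERIV_isCont continuous_at_imp_continuous_on)
  obtain B0 where B0: "0 \<le> B0" "\<And>l. \<bar>D 0 l\<bar> \<le> B0" using D_bounded[of 0] by blast
  obtain B1 where B1: "0 \<le> B1" "\<And>l. \<bar>D (Suc 0) l\<bar> \<le> B1" using D_bounded[of "Suc 0"] by blast
  obtain B2 where B2: "0 \<le> B2" "\<And>l. \<bar>D (Suc (Suc 0)) l\<bar> \<le> B2" using D_bounded[of "Suc (Suc 0)"] by blast
  \<comment> \<open>The square appears because the cut-off acts on x . x; it makes the support of
    radius j + 1.\<close>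
  define \<epsilon> where "\<epsilon> j = 1 / (real j + 1)\<^sup>2" for j
  have \<epsilon>: "0 < \<epsilon> j" "\<epsilon> j \<le> 1" for j by (auto simp: \<epsilon>_def)
  define \<theta> where "\<theta> j x = complex_of_real (1 - D 0 (\<epsilon> j * (x \<bullet> x)))" for j and x :: 'a
  define \<theta>1 where "\<theta>1 j b x = complex_of_real (- (2 * \<epsilon> j) * ((x \<bullet> b) * D (Suc 0) (\<epsilon> j * (x \<bullet> x))))" for j and b x :: 'a
  define \<theta>2 where "\<theta>2 j b x = complex_of_real (- (2 * \<epsilon> j) * ((b \<bullet> b) * D (Suc 0) (\<epsilon> j * (x \<bullet> x))
      + 2 * \<epsilon> j * (x \<bullet> b) * D (Suc (Suc 0)) (\<epsilon> j * (x \<bullet> x)) * (x \<bullet> b)))" for j and b x :: 'a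
  define g where "g = fourier_integral m"
  define m1 where "m1 b = (\<lambda>\<xi>. - \<i> * of_real (b \<bullet> \<xi>) * m \<xi>)" for b
  define m2 where "m2 b = (\<lambda>\<xi>. - \<i> * of_real (b \<bullet> \<xi>) * m1 b \<xi>)" for b
  have ms: "bounded_supp (m1 b)" "bounded_supp (m2 b)" for b
    unfolding m2_def unfolding m1_def by (intro bounded_supp_inner m)+
  define g1 where "g1 b = fourier_integral (m1 b)" for b
  define g2 where "g2 b = fourier_integral (m2 b)" for b
  have gd: "((\<lambda>s. g (x + s *\<^sub>R b)) has_vector_derivative g1 b x) (at 0)" for x b
    unfolding g_def g1_def m1_def by (rule fourier_integral_deriv[OF m])
  have gd1: "((\<lambda>s. g1 b (x + s *\<^sub>R b)) has_vector_derivative g2 b x) (at 0)" for x b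
    unfolding g1_def g2_def m2_def by (rule fourier_integral_deriv[OF ms(1)])
  have r: "((\<lambda>s. D i (\<epsilon> j * ((x + s *\<^sub>R b) \<bullet> (x + s *\<^sub>R b)))) has_real_derivative
      2 * \<epsilon> j * (x \<bullet> b) * D (Suc i) (\<epsilon> j * (x \<bullet> x))) (at 0)" for i j and x b :: 'a
    by (rule radial_deriv[OF D(2)])
  have td: "((\<lambda>s. \<theta> j (x + s *\<^sub>R b)) has_vector_derivative \<theta>1 j b x) (at 0)" for j x b
    unfolding \<theta>_def \<theta>1_def
    by (rule has_vector_derivative_of_real) (use DERIV_diff[OF DERIV_const r[of 0]] in \<open>simp add: mult.assoc\<close>)
  have td1: "((\<lambda>s. \<theta>1 j b (x + s *\<^sub>R b)) has_vector_derivative \<theta>2 j b x) (at 0)" for j x b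
  proof -
    have "((\<lambda>s. (x + s *\<^sub>R b) \<bullet> b) has_real_derivative b \<bullet> b) (at 0)"
      by (auto intro!: derivative_eq_intros simp: inner_add_left)
    from DERIV_cmult[OF DERIV_mult[OF this r[of "Suc 0" j x b]], of "- (2 * \<epsilon> j)"]
    show ?thesis unfolding \<theta>1_def \<theta>2_def by (intro has_vector_derivative_of_real) simp
  qed
  define \<phi> where "\<phi> j x = g x * \<theta> j x" for j x
  have lap: "laplacian (\<phi> j) x = (\<Sum>b\<in>Basis. g2 b x * \<theta> j x + 2 * g1 b x * \<theta>1 j b x + g x * \<theta>2 j b x)" for j x
    unfolding laplacian_def \<phi>_def[abs_def] by (intro sum.cong refl pderiv_along_twice_mult gd gd1 td td1)
  have [measurable]: "g \<in> borel_measurable borel" "g1 b \<in> borel_measurable borel" "g2 b \<in> borel_measurable borel" for b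
    unfolding g_def g1_def g2_def by (intro fourier_integral_measurable bounded_supp_measurable m ms)+
  have [measurable]: "\<theta> j \<in> borel_measurable borel" "\<theta>1 j b \<in> borel_measurable borel" "\<theta>2 j b \<in> borel_measurable borel" for j b
    unfolding \<theta>_def \<theta>1_def \<theta>2_def by measurable
  have test: "test_function (\<phi> j)" for j
  proof -
    have "\<phi> j = (\<lambda>x. g x * (1 + (- 1) * of_real (D 0 (\<epsilon> j * (x \<bullet> x)))))" by (simp add: \<phi>_def \<theta>_def fun_eq_iff)
    moreover have "smooth_class \<dots>" unfolding g_def
      by (intro smooth_class.mult smooth_class.add smooth_class.const smooth_class.fourier smooth_class.radial m D(2))
    moreover have "{x. \<phi> j x \<noteq> 0} \<subseteq> cball 0 (real j + 1)"
    proof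
      fix x assume "x \<in> {x. \<phi> j x \<noteq> 0}"
      then have "\<epsilon> j * (x \<bullet> x) < 1" using D0(1)[of "\<epsilon> j * (x \<bullet> x)"] by (force simp: \<phi>_def \<theta>_def)
      then have "(norm x)\<^sup>2 < (real j + 1)\<^sup>2" by (simp add: \<epsilon>_def power2_norm_eq_inner divide_less_eq)
      then have "norm x < real j + 1" by (rule power2_less_imp_less) simp
      then show "x \<in> cball 0 (real j + 1)" by simp
    qed
    then have "bounded {x. \<phi> j x \<noteq> 0}" using bounded_cball bounded_subset by blast
    ultimately show ?thesis unfolding test_function_def using smooth_class_smooth compact_closure by metis
  qed
  \<comment> \<open>Each derivative of the cut-off brings a factor of the form \<epsilon> |x . b|.
    On the support \<epsilon> |x|^2 <= 1 and \<epsilon> <= 1, hence the bounds are uniform in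
    j.\<close>
  have xb: "\<epsilon> j * \<bar>x \<bullet> b\<bar> \<le> 1" if "b \<in> Basis" "\<epsilon> j * (x \<bullet> x) \<le> 1" for j and x b :: 'a
  proof -
    have "(\<epsilon> j * norm x)\<^sup>2 = \<epsilon> j * (\<epsilon> j * (x \<bullet> x))" by (simp add: power_mult_distrib power2_norm_eq_inner power2_eq_square[of "\<epsilon> j"])
    also have "\<dots> \<le> 1\<^sup>2" using mult_mono[OF \<epsilon>(2)[of j] that(2)] \<epsilon>(1)[of j] by simp
    finally have "\<epsilon> j * norm x \<le> 1" by (rule power2_le_imp_le) simp
    moreover have "\<epsilon> j * \<bar>x \<bullet> b\<bar> \<le> \<epsilon> j * norm x" using Basis_le_norm[OF that(1), of x] \<epsilon>(1)[of j] by (intro mult_left_mono) auto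
    ultimately show ?thesis by linarith
  qed
  have bd0: "norm (\<theta> j x) \<le> 1 + B0" for j x
    unfolding \<theta>_def norm_of_real using B0(2)[of "\<epsilon> j * (x \<bullet> x)"] by linarith
  have bd1: "norm (\<theta>1 j b x) \<le> 2 * B1" if b: "b \<in> Basis" for j b x
  proof (cases "\<epsilon> j * (x \<bullet> x) \<le> 1")
    case True
    have "norm (\<theta>1 j b x) = 2 * ((\<epsilon> j * \<bar>x \<bullet> b\<bar>) * \<bar>D (Suc 0) (\<epsilon> j * (x \<bullet> x))\<bar>)"
      unfolding \<theta>1_def norm_of_real using \<epsilon>(1)[of j] by (simp add: abs_mult)
    also have "\<dots> \<le> 2 * (1 * B1)" using xb[OF b True] B1 by (intro mult_left_mono mult_mono) auto
    finally show ?thesis by simp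
  next
    case False then show ?thesis using D_zero[of "\<epsilon> j * (x \<bullet> x)" 0] B1(1) by (simp add: \<theta>1_def)
  qed
  have bd2: "norm (\<theta>2 j b x) \<le> 2 * B1 + 4 * B2" if b: "b \<in> Basis" for j b x
  proof (cases "\<epsilon> j * (x \<bullet> x) \<le> 1")
    case True
    have "norm (\<theta>2 j b x) = 2 * \<bar>\<epsilon> j * D (Suc 0) (\<epsilon> j * (x \<bullet> x)) + 2 * ((\<epsilon> j * (x \<bullet> b)) * D (Suc (Suc 0)) (\<epsilon> j * (x \<bullet> x)) * (\<epsilon> j * (x \<bullet> b)))\<bar>"
    proof -
      have "- (2 * \<epsilon> j) * ((b \<bullet> b) * D (Suc 0) (\<epsilon> j * (x \<bullet> x)) + 2 * \<epsilon> j * (x \<bullet> b) * D (Suc (Suc 0)) (\<epsilon> j * (x \<bullet> x)) * (x \<bullet> b))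
        = - (2 * (\<epsilon> j * D (Suc 0) (\<epsilon> j * (x \<bullet> x)) + 2 * ((\<epsilon> j * (x \<bullet> b)) * D (Suc (Suc 0)) (\<epsilon> j * (x \<bullet> x)) * (\<epsilon> j * (x \<bullet> b)))))"
        using b by (simp add: algebra_simps inner_same_Basis)
      then show ?thesis unfolding \<theta>2_def norm_of_real by (simp only: abs_minus_cancel abs_mult[of 2] abs_numeral)
    qed
    also have "\<dots> \<le> 2 * (\<epsilon> j * \<bar>D (Suc 0) (\<epsilon> j * (x \<bullet> x))\<bar> + 2 * ((\<epsilon> j * \<bar>x \<bullet> b\<bar>) * \<bar>D (Suc (Suc 0)) (\<epsilon> j * (x \<bullet> x))\<bar> * (\<epsilon> j * \<bar>x \<bullet> b\<bar>)))"
      using \<epsilon>(1)[of j] by (intro mult_left_mono order_trans[OF abs_triangle_ineq]) (auto simp: abs_mult)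
    also have "\<dots> \<le> 2 * (1 * B1 + 2 * (1 * B2 * 1))"
      using xb[OF b True] B1 B2 \<epsilon>(1,2)[of j] by (intro mult_left_mono add_mono mult_mono) auto
    finally show ?thesis by simp
  next
    case False then show ?thesis using D_zero[of "\<epsilon> j * (x \<bullet> x)" 0] D_zero[of "\<epsilon> j * (x \<bullet> x)" "Suc 0"] B1(1) B2(1) by (simp add: \<theta>2_def)
  qed
  define C where "C = 1 + B0 + 4 * B1 + 4 * B2"
  define W where "W x = (\<Sum>b\<in>Basis. of_real (norm (g2 b x)) + of_real (norm (g1 b x)) + of_real (norm (g x))) + complex_of_real (norm (g x))" for x
  have nL: "(\<lambda>x. complex_of_real (norm (h x))) \<in> L2" if "h \<in> L2" for h :: "'a \<Rightarrow> complex"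
    by (rule L2_dominated(1)[OF that, of _ 1]) (use L2_measurable[OF that] in auto)
  have gL: "g \<in> L2" "g1 b \<in> L2" "g2 b \<in> L2" for b
    unfolding g_def g1_def g2_def by (intro fourier_integral_bounded_supp_L2 m ms)+
  have WL: "W \<in> L2" unfolding W_def by (intro L2_add(1) L2_sum nL gL finite_Basis)
  have nW: "norm (W x) = (\<Sum>b\<in>Basis. norm (g2 b x) + norm (g1 b x) + norm (g x)) + norm (g x)" for x
  proof -
    have "W x = of_real ((\<Sum>b\<in>Basis. norm (g2 b x) + norm (g1 b x) + norm (g x)) + norm (g x))" by (simp add: W_def)
    also have "norm \<dots> = (\<Sum>b\<in>Basis. norm (g2 b x) + norm (g1 b x) + norm (g x)) + norm (g x)"
      unfolding norm_of_real by (intro abs_of_nonneg add_nonneg_nonneg sum_nonneg norm_ge_zero)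
    finally show ?thesis .
  qed
  have C: "1 + B0 \<le> C" "4 * B1 \<le> C" "2 * B1 + 4 * B2 \<le> C" "0 \<le> C" using B0(1) B1(1) B2(1) by (auto simp: C_def)
  have p1: "norm (\<phi> j x) \<le> C * norm (g x)" for j x
    unfolding \<phi>_def norm_mult using mult_left_mono[OF order_trans[OF bd0 C(1)], of "norm (g x)"] by (simp add: mult.commute)
  have p2: "norm (laplacian (\<phi> j) x) \<le> C * (\<Sum>b\<in>Basis. norm (g2 b x) + norm (g1 b x) + norm (g x))" for j x
    unfolding lap sum_distrib_left
  proof (rule sum_norm_le)
    fix b :: 'a assume b: "b \<in> Basis"
    have "norm (g2 b x * \<theta> j x + 2 * g1 b x * \<theta>1 j b x + g x * \<theta>2 j b x)
      \<le> norm (g2 b x * \<theta> j x) + norm (2 * g1 b x * \<theta>1 j b x) + norm (g x * \<theta>2 j b x)"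
      by (intro order_trans[OF norm_triangle_ineq] add_mono norm_triangle_ineq order_refl)
    also have "\<dots> = norm (g2 b x) * norm (\<theta> j x) + norm (g1 b x) * (2 * norm (\<theta>1 j b x)) + norm (g x) * norm (\<theta>2 j b x)"
      by (simp add: norm_mult)
    also have "\<dots> \<le> norm (g2 b x) * C + norm (g1 b x) * C + norm (g x) * C"
      using bd0[of j x] bd1[OF b, of j x] bd2[OF b, of j x] C by (intro add_mono mult_left_mono) auto
    finally show "norm (g2 b x * \<theta> j x + 2 * g1 b x * \<theta>1 j b x + g x * \<theta>2 j b x) \<le> C * (norm (g2 b x) + norm (g1 b x) + norm (g x))"
      by (simp add: algebra_simps)
  qed
  have S0: "0 \<le> (\<Sum>b\<in>Basis. norm (g2 b x) + norm (g1 b x) + norm (g x))" for x by (intro sum_nonneg add_nonneg_nonneg norm_ge_zero)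
  \<comment> \<open>At a fixed x the cut-off is eventually 1 and its derivatives vanish, so both
    limits are attained at a finite index.\<close>
  have ev: "\<forall>\<^sub>F j in sequentially. \<epsilon> j * (x \<bullet> x) < 1 / 2" for x :: 'a
  proof (rule order_tendstoD(2))
    show "(\<lambda>j. \<epsilon> j * (x \<bullet> x)) \<longlonglongrightarrow> 0" unfolding \<epsilon>_def by real_asymp
  qed simp
  \<comment> \<open>Second derivatives multiply m by - (b . \<xi>)^2; summed over the basis and with
    the additional - 1 this is the multiplier - \<open>jbr\<close>^2.\<close>
  have lim_eq: "(\<Sum>b\<in>Basis. g2 b x) - g x = fourier_integral (\<lambda>\<xi>. - of_real ((jbr \<xi>)\<^sup>2) * m \<xi>) x" for x
  proof -
    have "(\<lambda>\<xi>. - of_real ((jbr \<xi>)\<^sup>2) * m \<xi>) = (\<lambda>\<xi>. (\<Sum>b\<in>Basis. m2 b \<xi>) - m \<xi>)"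
    proof
      fix \<xi> :: 'a
      have "(jbr \<xi>)\<^sup>2 = 1 + (\<Sum>b\<in>Basis. (b \<bullet> \<xi>) * (b \<bullet> \<xi>))"
        unfolding jbr_sq power2_norm_eq_inner using euclidean_inner[of \<xi> \<xi>] by (simp add: inner_commute)
      moreover have "m2 b \<xi> = - (of_real ((b \<bullet> \<xi>) * (b \<bullet> \<xi>)) * m \<xi>)" for b by (simp add: m2_def m1_def mult_ac)
      ultimately show "- of_real ((jbr \<xi>)\<^sup>2) * m \<xi> = (\<Sum>b\<in>Basis. m2 b \<xi>) - m \<xi>"
        by (simp add: sum_negf sum_distrib_left algebra_simps)
    qed
    moreover have i: "integrable lborel (m2 b)" for b by (rule bounded_supp_L2_integrable(2)[OF ms(2)])
    moreover have "integrable lborel (\<lambda>\<xi>. \<Sum>b\<in>Basis. m2 b \<xi>)" by (intro Bochner_Integration.integrable_sum i)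
    ultimately show ?thesis unfolding g_def g2_def
      by (simp only: fourier_integral_diff bounded_supp_L2_integrable(2)[OF m] fourier_integral_sum finite_Basis)
  qed
  obtain B where B: "\<And>x. norm (g x) \<le> B"
    unfolding g_def using fourier_integral_bound[of m] by blast
  show ?thesis
  proof (rule that[of \<phi> "\<lambda>x. of_real C * W x" "C * B"])
    show "test_function (\<phi> j)" for j by (rule test)
    show "\<phi> j \<in> borel_measurable borel" for j unfolding \<phi>_def by measurable
    show "(\<lambda>x. laplacian (\<phi> j) x - \<phi> j x) \<in> borel_measurable borel" for j unfolding lap \<phi>_def by measurable
    show "(\<lambda>j. \<phi> j x) \<longlonglongrightarrow> fourier_integral m x" for x
      unfolding g_def[symmetric]
      by (rule tendsto_eventually, rule eventually_mono[OF ev[of x]]) (simp add: \<phi>_def \<theta>_def D0(2))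
    show "(\<lambda>j. laplacian (\<phi> j) x - \<phi> j x) \<longlonglongrightarrow> fourier_integral (\<lambda>\<xi>. - of_real ((jbr \<xi>)\<^sup>2) * m \<xi>) x" for x
      unfolding lim_eq[symmetric]
      by (rule tendsto_eventually, rule eventually_mono[OF ev[of x]]) (simp add: lap \<phi>_def \<theta>_def \<theta>1_def \<theta>2_def D0(2) D_zero)
    show "(\<lambda>x. of_real C * W x) \<in> L2" by (rule L2_cmult(1)[OF WL])
    have nCW: "norm (of_real C * W x) = C * norm (W x)" for x using C(4) by (simp add: norm_mult)
    show "norm (\<phi> j x) \<le> norm (of_real C * W x)" for j x
      unfolding nCW nW using p1[of j x] mult_nonneg_nonneg[OF C(4) S0[of x]] by (simp only: distrib_left)
    show "norm (laplacian (\<phi> j) x - \<phi> j x) \<le> norm (of_real C * W x)" for j x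
      unfolding nCW nW using p1[of j x] p2[of j x] norm_triangle_ineq4[of "laplacian (\<phi> j) x" "\<phi> j x"]
      by (simp only: distrib_left)
    show "norm (\<phi> j x) \<le> C * B" for j x
      using p1[of j x] mult_left_mono[OF B[of x] C(4)] by linarith
  qed
qed

lemma L2_norm_le_jbr:
  assumes "f \<in> L2" "(\<lambda>\<xi>. jbr \<xi> *\<^sub>R fourier f \<xi>) \<in> L2"
  shows "L2_norm f \<le> L2_norm (fourier_mult jbr f)"
proof -
  have "L2_norm (fourier f) \<le> 1 * L2_norm (\<lambda>\<xi>. jbr \<xi> *\<^sub>R fourier f \<xi>)"
  proof (rule L2_dominated(2)[OF assms(2)])
    show "AE x in lborel. norm (fourier f x) \<le> 1 * norm (jbr x *\<^sub>R fourier f x)"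
    proof (rule AE_I2)
      fix x show "norm (fourier f x) \<le> 1 * norm (jbr x *\<^sub>R fourier f x)"
        using mult_right_mono[OF jbr_ge_1[of x], of "norm (fourier f x)"] jbr_pos[of x] by simp
    qed
  qed (use fourier_L2(1)[OF assms(1)] in auto)
  then show ?thesis by (simp add: Plancherel[OF assms(1)] L2_norm_fourier_mult[OF assms(2)])
qed

lemma H1_diff:
  assumes "f \<in> H1" "g \<in> H1"
  shows "(\<lambda>x. f x - g x) \<in> H1"
proof -
  have f: "f \<in> L2" "(\<lambda>\<xi>. jbr \<xi> *\<^sub>R fourier f \<xi>) \<in> L2" and g: "g \<in> L2" "(\<lambda>\<xi>. jbr \<xi> *\<^sub>R fourier g \<xi>) \<in> L2"
    using assms by (auto simp: H1_def)
  let ?d = "\<lambda>x. f x - g x"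
  note d = L2_diff(1)[OF f(1) g(1)]
  have "(\<lambda>\<xi>. jbr \<xi> *\<^sub>R fourier ?d \<xi>) \<in> L2"
  proof (rule L2_cong_AE[OF _ L2_diff(1)[OF f(2) g(2)]])
    show "AE \<xi> in lborel. jbr \<xi> *\<^sub>R fourier f \<xi> - jbr \<xi> *\<^sub>R fourier g \<xi> = jbr \<xi> *\<^sub>R fourier ?d \<xi>"
      using fourier_diff[OF f(1) g(1)] by eventually_elim (simp add: scaleR_diff_right)
    show "(\<lambda>\<xi>. jbr \<xi> *\<^sub>R fourier ?d \<xi>) \<in> borel_measurable borel"
      using L2_measurable[OF fourier_L2(1)[OF d]] by measurable
  qed
  with d show ?thesis by (simp add: H1_def)
qed

lemma L2_norm_le_H_norm:
  assumes "fst w \<in> H1"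
  shows "L2_norm (fst w) \<le> H_norm w" "L2_norm (snd w) \<le> H_norm w"
proof -
  have "L2_norm (fst w) \<le> L2_norm (fourier_mult jbr (fst w))" using assms by (intro L2_norm_le_jbr) (auto simp: H1_def)
  then show "L2_norm (fst w) \<le> H_norm w"
    unfolding H_norm_def using real_sqrt_sum_squares_ge1[of "L2_norm (fourier_mult jbr (fst w))" "L2_norm (snd w)"] by linarith
  show "L2_norm (snd w) \<le> H_norm w" unfolding H_norm_def by (rule real_sqrt_sum_squares_ge2)
qed

section \<open>Duhamel's formula for the profile\<close>

locale kg_solution =
  fixes N :: "('a::euclidean_space \<Rightarrow> complex) \<Rightarrow> 'a \<Rightarrow> real \<Rightarrow> complex"
    and u v :: "real \<Rightarrow> 'a \<Rightarrow> complex" and E M :: real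
  assumes sol: "KG_global_solution N u v"
    and energy: "0 \<le> t \<Longrightarrow> H_norm (u t, v t) \<le> E"
    and source_integrable: "0 \<le> t \<Longrightarrow> integrable lborel (\<lambda>x. N (u t) x t * u t x)"
    and source_bound: "0 \<le> t \<Longrightarrow> (\<integral>x. norm (N (u t) x t * u t x) \<partial>lborel) \<le> M"
begin

lemma u_L2: "0 \<le> t \<Longrightarrow> u t \<in> L2" and jbr_u_L2: "0 \<le> t \<Longrightarrow> (\<lambda>\<xi>. jbr \<xi> *\<^sub>R fourier (u t) \<xi>) \<in> L2"
  and v_L2: "0 \<le> t \<Longrightarrow> v t \<in> L2"
  using sol unfolding KG_global_solution_def H_space_def H1_def by auto

lemma u_norm_le: "0 \<le> t \<Longrightarrow> L2_norm (u t) \<le> E"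
  and jbr_u_norm_le: "0 \<le> t \<Longrightarrow> L2_norm (\<lambda>\<xi>. jbr \<xi> *\<^sub>R fourier (u t) \<xi>) \<le> E"
  and v_norm_le: "0 \<le> t \<Longrightarrow> L2_norm (v t) \<le> E"
proof -
  assume t: "0 \<le> t"
  show j: "L2_norm (\<lambda>\<xi>. jbr \<xi> *\<^sub>R fourier (u t) \<xi>) \<le> E"
    using energy[OF t] real_sqrt_sum_squares_ge1[of "L2_norm (fourier_mult jbr (u t))" "L2_norm (v t)"]
    unfolding H_norm_def fst_conv snd_conv L2_norm_fourier_mult[OF jbr_u_L2[OF t]] by linarith
  show "L2_norm (u t) \<le> E"
    using L2_norm_le_jbr[OF u_L2[OF t] jbr_u_L2[OF t]] j unfolding L2_norm_fourier_mult[OF jbr_u_L2[OF t]] by linarith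
  show "L2_norm (v t) \<le> E"
    using energy[OF t] real_sqrt_sum_squares_ge2[of "L2_norm (v t)" "L2_norm (fourier_mult jbr (u t))"]
    unfolding H_norm_def fst_conv snd_conv by linarith
qed

text \<open>Dominated convergence, in x at each time and then in the time integral with the energy
  and source bounds as constant majorant. Parseval moves the pairings with u and v to the Fourier
  side, where \<open>jbr\<close>^2 is carried by the compactly supported m.\<close>

lemma weak_form_bandlimited:
  assumes F: "smooth_cutoff F" and m: "bounded_supp m" and t: "0 \<le> t"
  shows "((\<lambda>s. (\<integral>x. N (u s) x s * u s x * fourier_integral m x \<partial>lborel) - (\<integral>\<xi>. fourier (u s) \<xi> * (of_real ((jbr \<xi>)\<^sup>2) * m \<xi>) \<partial>lborel))
    has_integral ((\<integral>\<xi>. fourier (v t) \<xi> * m \<xi> \<partial>lborel) - (\<integral>\<xi>. fourier (v 0) \<xi> * m \<xi> \<partial>lborel))) {0..t}"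
proof -
  obtain \<phi> w K where test: "\<And>j. test_function (\<phi> j)"
    and mea: "\<And>j. \<phi> j \<in> borel_measurable borel" "\<And>j. (\<lambda>x. laplacian (\<phi> j) x - \<phi> j x) \<in> borel_measurable borel"
    and lim: "\<And>x. (\<lambda>j. \<phi> j x) \<longlonglongrightarrow> fourier_integral m x"
      "\<And>x. (\<lambda>j. laplacian (\<phi> j) x - \<phi> j x) \<longlonglongrightarrow> fourier_integral (\<lambda>\<xi>. - of_real ((jbr \<xi>)\<^sup>2) * m \<xi>) x"
    and w: "w \<in> L2" and le: "\<And>j x. norm (\<phi> j x) \<le> norm (w x)" "\<And>j x. norm (laplacian (\<phi> j) x - \<phi> j x) \<le> norm (w x)"
    and K: "\<And>j x. norm (\<phi> j x) \<le> K"
    by (rule bandlimited_test_approx[OF F m], rule that)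
  have K0: "0 \<le> K" using K norm_ge_zero order_trans by blast
  let ?m' = "\<lambda>\<xi>. - of_real ((jbr \<xi>)\<^sup>2) * m \<xi>"
  have m': "bounded_supp ?m'"
  proof (rule bounded_supp_mult[OF m])
    fix r
    have "norm (- complex_of_real ((jbr x)\<^sup>2)) \<le> 1 + r\<^sup>2" if "norm x \<le> r" for x :: 'a
      unfolding norm_minus_cancel norm_of_real jbr_sq using power_mono[OF that, of 2] by simp
    then show "\<exists>C. \<forall>x::'a. norm x \<le> r \<longrightarrow> norm (- complex_of_real ((jbr x)\<^sup>2)) \<le> C" by blast
  qed measurable
  have FI_pair: "(\<integral>x. f x * fourier_integral k x \<partial>lborel) = (\<integral>\<xi>. fourier f \<xi> * k \<xi> \<partial>lborel)"
    if f: "f \<in> L2" and k: "bounded_supp k" for f k :: "'a \<Rightarrow> complex"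
  proof -
    note kk = bounded_supp_L2_integrable[OF k]
    have "(\<integral>x. f x * fourier_integral k x \<partial>lborel) = (\<integral>x. f x * fourier k x \<partial>lborel)"
      by (rule integral_cong_AE)
         (use fourier_eq_integral_AE[OF kk] L2_measurable[OF f] L2_measurable[OF fourier_L2(1)[OF kk(1)]]
            fourier_integral_measurable[OF L2_measurable[OF kk(1)]] in auto)
    then show ?thesis using Parseval[OF f kk(1)] by simp
  qed
  have DC: "(\<lambda>j. \<integral>x. f x * h j x \<partial>lborel) \<longlonglongrightarrow> (\<integral>x. f x * fourier_integral k x \<partial>lborel)"
    if f: "f \<in> L2" and k: "bounded_supp k" and h: "\<And>j. h j \<in> borel_measurable borel" "\<And>x. (\<lambda>j. h j x) \<longlonglongrightarrow> fourier_integral k x"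
      "\<And>j x. norm (h j x) \<le> norm (w x)" for f k :: "'a \<Rightarrow> complex" and h
  proof (rule integral_dominated_convergence[where w="\<lambda>x. norm (f x * w x)"])
    show "AE x in lborel. (\<lambda>j. f x * h j x) \<longlonglongrightarrow> f x * fourier_integral k x"
      by (rule AE_I2) (rule tendsto_mult[OF tendsto_const h(2)])
    show "AE x in lborel. norm (f x * h j x) \<le> norm (f x * w x)" for j
      by (rule AE_I2) (simp add: norm_mult mult_left_mono[OF h(3)])
    show "integrable lborel (\<lambda>x. norm (f x * w x))" by (rule integrable_norm[OF L2_mult_integrable[OF f w]])
  qed (use L2_measurable[OF f] fourier_integral_measurable[OF bounded_supp_measurable[OF k]] h(1) in auto)
  let ?S = "\<lambda>s x. N (u s) x s * u s x"
  have DCS: "(\<lambda>j. \<integral>x. ?S s x * \<phi> j x \<partial>lborel) \<longlonglongrightarrow> (\<integral>x. ?S s x * fourier_integral m x \<partial>lborel)" if s: "0 \<le> s" for s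
  proof (rule integral_dominated_convergence[where w="\<lambda>x. K * norm (?S s x)"])
    show "AE x in lborel. (\<lambda>j. ?S s x * \<phi> j x) \<longlonglongrightarrow> ?S s x * fourier_integral m x"
      by (rule AE_I2) (rule tendsto_mult[OF tendsto_const lim(1)])
    show "AE x in lborel. norm (?S s x * \<phi> j x) \<le> K * norm (?S s x)" for j
    proof (rule AE_I2)
      fix x show "norm (?S s x * \<phi> j x) \<le> K * norm (?S s x)"
        unfolding norm_mult[of "?S s x"] using mult_left_mono[OF K[of j x] norm_ge_zero[of "?S s x"]] by (simp only: mult.commute)
    qed
    show "integrable lborel (\<lambda>x. K * norm (?S s x))" using source_integrable[OF s] by simp
  qed (use borel_measurable_integrable[OF source_integrable[OF s]] mea(1) fourier_integral_measurable[OF bounded_supp_measurable[OF m]] in auto)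
  have Sb: "norm (\<integral>x. ?S s x * \<phi> j x \<partial>lborel) \<le> K * M" if s: "0 \<le> s" for s j
  proof -
    have "norm (\<integral>x. ?S s x * \<phi> j x \<partial>lborel) \<le> (\<integral>x. K * norm (?S s x) \<partial>lborel)"
    proof (rule Bochner_Integration.integral_norm_bound_integral)
      show le1: "norm (?S s x * \<phi> j x) \<le> K * norm (?S s x)" for x
        unfolding norm_mult[of "?S s x"] using mult_left_mono[OF K[of j x] norm_ge_zero[of "?S s x"]] by (simp only: mult.commute)
      show i1: "integrable lborel (\<lambda>x. K * norm (?S s x))" using source_integrable[OF s] by simp
      show "integrable lborel (\<lambda>x. ?S s x * \<phi> j x)"
      proof (rule Bochner_Integration.integrable_bound[OF i1])
        have [measurable]: "?S s \<in> borel_measurable borel" "\<phi> j \<in> borel_measurable borel"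
          using borel_measurable_integrable[OF source_integrable[OF s]] mea(1) by auto
        show "(\<lambda>x. ?S s x * \<phi> j x) \<in> borel_measurable lborel" by measurable
        show "AE x in lborel. norm (?S s x * \<phi> j x) \<le> norm (K * norm (?S s x))"
          by (intro AE_I2 order_trans[OF le1]) (simp only: real_norm_def abs_ge_self)
      qed
    qed
    also have "\<dots> = K * (\<integral>x. norm (?S s x) \<partial>lborel)" by (rule integral_mult_right_zero)
    also have "\<dots> \<le> K * M" by (rule mult_left_mono[OF source_bound[OF s] K0])
    finally show ?thesis .
  qed
  have ub: "norm (\<integral>x. u s x * (laplacian (\<phi> j) x - \<phi> j x) \<partial>lborel) \<le> E * L2_norm w" if s: "0 \<le> s" for s j
  proof -
    have "AE x in lborel. norm (laplacian (\<phi> j) x - \<phi> j x) \<le> 1 * norm (w x)" by (rule AE_I2) (simp only: mult_1 le(2))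
    note L = L2_dominated[OF w mea(2) this zero_le_one]
    show ?thesis using order_trans[OF L2_pairing_bound[OF u_L2[OF s] L(1)] mult_mono[OF u_norm_le[OF s] L(2)]]
        order_trans[OF L2_norm_nonneg u_norm_le[OF s]] L2_norm_nonneg by simp
  qed
  have "((\<lambda>s. (\<integral>x. u s x * fourier_integral ?m' x \<partial>lborel) + (\<integral>x. ?S s x * fourier_integral m x \<partial>lborel))
    has_integral ((\<integral>x. v t x * fourier_integral m x \<partial>lborel) - (\<integral>x. v 0 x * fourier_integral m x \<partial>lborel))) {0..t}"
  proof (rule has_integral_dominated_convergence)
    show "((\<lambda>s. (\<integral>x. u s x * (laplacian (\<phi> j) x - \<phi> j x) \<partial>lborel) + (\<integral>x. ?S s x * \<phi> j x \<partial>lborel))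
      has_integral ((\<integral>x. v t x * \<phi> j x \<partial>lborel) - (\<integral>x. v 0 x * \<phi> j x \<partial>lborel))) {0..t}" for j
      using sol test[of j] t unfolding KG_global_solution_def by blast
    show "(\<lambda>s. E * L2_norm w + K * M) integrable_on {0..t}" by (rule integrable_const_ivl)
    show "\<forall>s\<in>{0..t}. norm ((\<integral>x. u s x * (laplacian (\<phi> j) x - \<phi> j x) \<partial>lborel) + (\<integral>x. ?S s x * \<phi> j x \<partial>lborel)) \<le> E * L2_norm w + K * M" for j
    proof
      fix s assume "s \<in> {0..t}"
      then have s: "0 \<le> s" by simp
      show "norm ((\<integral>x. u s x * (laplacian (\<phi> j) x - \<phi> j x) \<partial>lborel) + (\<integral>x. ?S s x * \<phi> j x \<partial>lborel)) \<le> E * L2_norm w + K * M"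
        by (rule order_trans[OF norm_triangle_ineq add_mono[OF ub[OF s] Sb[OF s]]])
    qed
    show "\<forall>s\<in>{0..t}. (\<lambda>j. (\<integral>x. u s x * (laplacian (\<phi> j) x - \<phi> j x) \<partial>lborel) + (\<integral>x. ?S s x * \<phi> j x \<partial>lborel))
       \<longlonglongrightarrow> (\<integral>x. u s x * fourier_integral ?m' x \<partial>lborel) + (\<integral>x. ?S s x * fourier_integral m x \<partial>lborel)"
    proof
      fix s assume "s \<in> {0..t}"
      then have s: "0 \<le> s" by simp
      show "(\<lambda>j. (\<integral>x. u s x * (laplacian (\<phi> j) x - \<phi> j x) \<partial>lborel) + (\<integral>x. ?S s x * \<phi> j x \<partial>lborel))
       \<longlonglongrightarrow> (\<integral>x. u s x * fourier_integral ?m' x \<partial>lborel) + (\<integral>x. ?S s x * fourier_integral m x \<partial>lborel)"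
        by (rule tendsto_add[OF DC[OF u_L2[OF s] m' mea(2) lim(2) le(2)] DCS[OF s]])
    qed
    show "(\<lambda>j. (\<integral>x. v t x * \<phi> j x \<partial>lborel) - (\<integral>x. v 0 x * \<phi> j x \<partial>lborel))
      \<longlonglongrightarrow> (\<integral>x. v t x * fourier_integral m x \<partial>lborel) - (\<integral>x. v 0 x * fourier_integral m x \<partial>lborel)"
      using t by (intro tendsto_diff DC v_L2 m mea(1) lim(1) le(1)) auto
  qed
  then have W: "((\<lambda>s. (\<integral>x. u s x * fourier_integral ?m' x \<partial>lborel) + (\<integral>x. ?S s x * fourier_integral m x \<partial>lborel))
    has_integral ((\<integral>\<xi>. fourier (v t) \<xi> * m \<xi> \<partial>lborel) - (\<integral>\<xi>. fourier (v 0) \<xi> * m \<xi> \<partial>lborel))) {0..t}"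
    unfolding FI_pair[OF v_L2[OF t] m] FI_pair[OF v_L2[OF order_refl] m] .
  have U: "(\<integral>x. u s x * fourier_integral ?m' x \<partial>lborel) = - (\<integral>\<xi>. fourier (u s) \<xi> * (of_real ((jbr \<xi>)\<^sup>2) * m \<xi>) \<partial>lborel)" if "0 \<le> s" for s
    unfolding FI_pair[OF u_L2[OF that] m'] by simp
  show ?thesis
  proof (rule has_integral_eq[OF _ W])
    fix s assume "s \<in> {0..t}"
    then have s: "0 \<le> s" by simp
    show "(\<integral>x. u s x * fourier_integral ?m' x \<partial>lborel) + (\<integral>x. ?S s x * fourier_integral m x \<partial>lborel)
      = (\<integral>x. ?S s x * fourier_integral m x \<partial>lborel) - (\<integral>\<xi>. fourier (u s) \<xi> * (of_real ((jbr \<xi>)\<^sup>2) * m \<xi>) \<partial>lborel)"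
      unfolding U[OF s] by (simp only: add.commute diff_conv_add_uminus)
  qed
qed

end

lemma L2_norm_fourier_difference:
  assumes "f \<in> L2" "g \<in> L2"
  shows "L2_norm (\<lambda>\<xi>. fourier f \<xi> - fourier g \<xi>) = L2_norm (\<lambda>x. f x - g x)"
  by (simp only: L2_norm_fourier_diff[OF assms] Plancherel[OF L2_diff(1)[OF assms]])

lemma bounded_supp_jbr:
  assumes "bounded_supp m"
  shows "bounded_supp (\<lambda>\<xi>. of_real (jbr \<xi> ^ k) * m \<xi>)"
proof (rule bounded_supp_mult[OF assms])
  fix r :: real
  have "norm (complex_of_real (jbr x ^ k)) \<le> sqrt (1 + r\<^sup>2) ^ k" if "norm x \<le> r" for x :: 'a
    using power_mono[OF that, of 2] jbr_pos[of x]
    by (simp add: norm_power) (auto intro!: power_mono simp: jbr_def)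
  then show "\<exists>C. \<forall>x::'a. norm x \<le> r \<longrightarrow> norm (complex_of_real (jbr x ^ k)) \<le> C" by blast
qed measurable

lemma bounded_supp_unimodular:
  assumes "bounded_supp m" "g \<in> borel_measurable borel"
  shows "bounded_supp (\<lambda>\<xi>. cis (g \<xi>) * m \<xi>)"
proof (rule bounded_supp_mult[OF assms(1)])
  show "(\<lambda>\<xi>. cis (g \<xi>)) \<in> borel_measurable borel" using assms(2) by measurable
qed (auto intro!: exI[of _ 1])

lemma bounded_supp_cis_jbr:
  "bounded_supp m \<Longrightarrow> bounded_supp (\<lambda>\<xi>. cis (a * jbr \<xi>) * m \<xi>)"
  by (rule bounded_supp_unimodular) measurable

lemma smooth_cutoff_bounded: "smooth_cutoff F \<Longrightarrow> \<exists>B\<ge>0. \<forall>l. \<bar>F l\<bar> \<le> B"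
proof -
  assume F: "smooth_cutoff F"
  obtain D where D: "D 0 = F" "\<And>i x. (D i has_real_derivative D (Suc i) x) (at x)"
    using smooth_real_derivatives[of F] F unfolding smooth_cutoff_def by blast
  interpret cutoff_derivatives D by standard (use D F in auto)
  show ?thesis using D_bounded[of 0] D(1) by simp
qed

lemma smooth_cutoff_measurable: "smooth_cutoff F \<Longrightarrow> F \<in> borel_measurable borel"
proof -
  assume F: "smooth_cutoff F"
  obtain D where D: "D 0 = F" "\<And>i x. (D i has_real_derivative D (Suc i) x) (at x)"
    using smooth_real_derivatives[of F] F unfolding smooth_cutoff_def by blast
  then show ?thesis
    by (intro borel_measurable_continuous_onI) (metis DERIV_isCont continuous_at_imp_continuous_on)
qed

lemma bounded_supp_cutoff:
  assumes F: "smooth_cutoff F" and R: "0 < R"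
  shows "bounded_supp (\<lambda>\<xi>::'a::euclidean_space. cis (x \<bullet> \<xi>) * of_real (1 - F (norm \<xi> / R)))"
proof (rule bounded_supp_unimodular)
  obtain B where B: "\<And>l. \<bar>F l\<bar> \<le> B" using smooth_cutoff_bounded[OF F] by blast
  note [measurable] = smooth_cutoff_measurable[OF F]
  have "norm (complex_of_real (1 - F l)) \<le> 1 + B" for l
    unfolding norm_of_real using B[of l] by linarith
  moreover have "(1 - F (norm \<xi> / R)) = 0" if "R < norm \<xi>" for \<xi> :: 'a
    using that R F by (simp add: smooth_cutoff_def le_divide_eq)
  ultimately show "bounded_supp (\<lambda>\<xi>::'a. complex_of_real (1 - F (norm \<xi> / R)))"
    unfolding bounded_supp_def by (intro conjI) (measurable, blast, metis of_real_0)
qed measurable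

lemma L2_cis_jbr_lipschitz:
  fixes k :: "'a::euclidean_space \<Rightarrow> complex"
  assumes k: "bounded_supp k"
  shows "L2_norm (\<lambda>\<xi>. cis (a * jbr \<xi>) * k \<xi> - cis (b * jbr \<xi>) * k \<xi>) \<le> \<bar>a - b\<bar> * L2_norm (\<lambda>\<xi>. of_real (jbr \<xi> ^ 1) * k \<xi>)"
proof (rule L2_dominated(2))
  show "(\<lambda>\<xi>. of_real (jbr \<xi> ^ 1) * k \<xi>) \<in> L2" by (rule bounded_supp_L2_integrable(1)[OF bounded_supp_jbr[OF k]])
  show "(\<lambda>\<xi>. cis (a * jbr \<xi>) * k \<xi> - cis (b * jbr \<xi>) * k \<xi>) \<in> borel_measurable borel"
    using bounded_supp_measurable[OF k] by measurable
  show "AE \<xi> in lborel. norm (cis (a * jbr \<xi>) * k \<xi> - cis (b * jbr \<xi>) * k \<xi>) \<le> \<bar>a - b\<bar> * norm (of_real (jbr \<xi> ^ 1) * k \<xi>)"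
  proof (rule AE_I2)
    fix \<xi> :: 'a
    have "cis (a * jbr \<xi>) = cis (b * jbr \<xi>) * cis ((a - b) * jbr \<xi>)" unfolding cis_mult by (simp add: algebra_simps)
    then have "cis (a * jbr \<xi>) * k \<xi> - cis (b * jbr \<xi>) * k \<xi> = cis (b * jbr \<xi>) * (cis ((a - b) * jbr \<xi>) - 1) * k \<xi>"
      by (simp add: algebra_simps)
    then have "norm (cis (a * jbr \<xi>) * k \<xi> - cis (b * jbr \<xi>) * k \<xi>) = norm (cis ((a - b) * jbr \<xi>) - 1) * norm (k \<xi>)"
      by (simp only: norm_mult norm_cis mult_1)
    also have "\<dots> \<le> \<bar>(a - b) * jbr \<xi>\<bar> * norm (k \<xi>)" by (intro mult_right_mono norm_cis_minus_1 norm_ge_zero)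
    finally show "norm (cis (a * jbr \<xi>) * k \<xi> - cis (b * jbr \<xi>) * k \<xi>) \<le> \<bar>a - b\<bar> * norm (of_real (jbr \<xi> ^ 1) * k \<xi>)"
      by (simp add: norm_mult abs_mult mult.assoc)
  qed
qed simp

text \<open>The linearisation error of \<open>cis\<close> is quadratic in h \<open>jbr\<close>, and
  bounded support of k keeps \<open>jbr\<close>^2 k in L2. Thus the phase is differentiable in time
  in the L2 norm.\<close>

lemma L2_cis_jbr_quotient:
  fixes k :: "'a::euclidean_space \<Rightarrow> complex"
  assumes k: "bounded_supp k" and h: "0 < h" and \<theta>: "\<theta>\<^sup>2 = 1"
  shows "L2_norm (\<lambda>\<xi>. (cis (\<theta> * (s + h) * jbr \<xi>) - cis (\<theta> * s * jbr \<xi>)) / of_real h * k \<xi>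
      - \<i> * of_real \<theta> * of_real (jbr \<xi>) * (cis (\<theta> * s * jbr \<xi>) * k \<xi>)) \<le> h * L2_norm (\<lambda>\<xi>. of_real (jbr \<xi> ^ 2) * k \<xi>)"
proof (rule L2_dominated(2))
  show "(\<lambda>\<xi>. of_real (jbr \<xi> ^ 2) * k \<xi>) \<in> L2" by (rule bounded_supp_L2_integrable(1)[OF bounded_supp_jbr[OF k]])
  show "(\<lambda>\<xi>. (cis (\<theta> * (s + h) * jbr \<xi>) - cis (\<theta> * s * jbr \<xi>)) / of_real h * k \<xi>
      - \<i> * of_real \<theta> * of_real (jbr \<xi>) * (cis (\<theta> * s * jbr \<xi>) * k \<xi>)) \<in> borel_measurable borel"
    using bounded_supp_measurable[OF k] by measurable
  show "AE \<xi> in lborel. norm ((cis (\<theta> * (s + h) * jbr \<xi>) - cis (\<theta> * s * jbr \<xi>)) / of_real h * k \<xi>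
      - \<i> * of_real \<theta> * of_real (jbr \<xi>) * (cis (\<theta> * s * jbr \<xi>) * k \<xi>)) \<le> h * norm (of_real (jbr \<xi> ^ 2) * k \<xi>)"
  proof (rule AE_I2)
    fix \<xi> :: 'a
    define x where "x = \<theta> * h * jbr \<xi>"
    have e: "cis (\<theta> * (s + h) * jbr \<xi>) = cis (\<theta> * s * jbr \<xi>) * cis x" unfolding cis_mult x_def by (simp add: algebra_simps)
    have lin: "\<i> * of_real \<theta> * of_real (jbr \<xi>) = (\<i> * of_real x) / of_real h" using h by (simp add: x_def)
    have "(cis (\<theta> * (s + h) * jbr \<xi>) - cis (\<theta> * s * jbr \<xi>)) / of_real h * k \<xi>
      - \<i> * of_real \<theta> * of_real (jbr \<xi>) * (cis (\<theta> * s * jbr \<xi>) * k \<xi>)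
      = cis (\<theta> * s * jbr \<xi>) * (cis x - 1 - \<i> * of_real x) / of_real h * k \<xi>"
      unfolding e lin by (simp add: algebra_simps diff_divide_distrib add_divide_distrib)
    then have "norm ((cis (\<theta> * (s + h) * jbr \<xi>) - cis (\<theta> * s * jbr \<xi>)) / of_real h * k \<xi>
      - \<i> * of_real \<theta> * of_real (jbr \<xi>) * (cis (\<theta> * s * jbr \<xi>) * k \<xi>)) = norm (cis x - 1 - \<i> * of_real x) / h * norm (k \<xi>)"
      using h by (simp only: norm_mult norm_divide norm_cis mult_1 norm_of_real abs_of_pos)
    also have "\<dots> \<le> x\<^sup>2 / h * norm (k \<xi>)"
      using h by (intro mult_right_mono divide_right_mono norm_cis_minus_linear) auto
    also have "x\<^sup>2 / h = h * (jbr \<xi>)\<^sup>2" using h \<theta> by (simp add: x_def power_mult_distrib power2_eq_square[of h])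
    finally show "norm ((cis (\<theta> * (s + h) * jbr \<xi>) - cis (\<theta> * s * jbr \<xi>)) / of_real h * k \<xi>
      - \<i> * of_real \<theta> * of_real (jbr \<xi>) * (cis (\<theta> * s * jbr \<xi>) * k \<xi>)) \<le> h * norm (of_real (jbr \<xi> ^ 2) * k \<xi>)"
      by (simp only: norm_mult norm_of_real abs_power2 mult.assoc)
  qed
qed (use h in simp)

lemma filterlim_shift_right:
  "0 \<le> s \<Longrightarrow> filterlim (\<lambda>h. s + h) (at s within {0..}) (at_right (0::real))"
  unfolding filterlim_at
proof
  assume s: "0 \<le> s"
  show "\<forall>\<^sub>F h in at_right 0. s + h \<in> {0..} \<and> s + h \<noteq> s"
    using eventually_at_right_less[of "0::real"] by eventually_elim (use s in auto)
  have "((\<lambda>h. s + h) \<longlongrightarrow> s + 0) (at_right 0)" by (intro tendsto_intros)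
  then show "((\<lambda>h. s + h) \<longlongrightarrow> s) (at_right 0)" by simp
qed

context kg_solution
begin

lemma state_continuous:
  assumes t: "0 \<le> t"
  shows "((\<lambda>s. L2_norm (\<lambda>x. u s x - u t x)) \<longlongrightarrow> 0) (at t within {0..})"
    and "((\<lambda>s. L2_norm (\<lambda>x. v s x - v t x)) \<longlongrightarrow> 0) (at t within {0..})"
proof -
  have lim: "((\<lambda>s. H_norm ((u s, v s) - (u t, v t))) \<longlongrightarrow> 0) (at t within {0..})"
    using sol t unfolding KG_global_solution_def H_limit_def by blast
  have H1: "u s \<in> H1" if "0 \<le> s" for s using sol that unfolding KG_global_solution_def H_space_def by auto
  have d: "fst ((u s, v s) - (u t, v t)) = (\<lambda>x. u s x - u t x)" "snd ((u s, v s) - (u t, v t)) = (\<lambda>x. v s x - v t x)" for s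
    by (simp_all add: fun_diff_def)
  have le: "L2_norm (\<lambda>x. u s x - u t x) \<le> H_norm ((u s, v s) - (u t, v t))" "L2_norm (\<lambda>x. v s x - v t x) \<le> H_norm ((u s, v s) - (u t, v t))"
    if s: "0 \<le> s" for s
    using L2_norm_le_H_norm[of "(u s, v s) - (u t, v t)", unfolded d, OF H1_diff[OF H1[OF s] H1[OF t]]] .
  have ev: "\<forall>\<^sub>F s in at t within {0..}. 0 \<le> s" by (simp add: eventually_at_filter)
  show "((\<lambda>s. L2_norm (\<lambda>x. u s x - u t x)) \<longlongrightarrow> 0) (at t within {0..})"
    by (rule Lim_null_comparison[OF eventually_mono[OF ev] lim]) (use le(1) L2_norm_nonneg in simp)
  show "((\<lambda>s. L2_norm (\<lambda>x. v s x - v t x)) \<longlongrightarrow> 0) (at t within {0..})"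
    by (rule Lim_null_comparison[OF eventually_mono[OF ev] lim]) (use le(2) L2_norm_nonneg in simp)
qed

lemma fourier_state_continuous:
  assumes t: "0 \<le> t"
  shows "((\<lambda>s. L2_norm (\<lambda>\<xi>. fourier (u s) \<xi> - fourier (u t) \<xi>)) \<longlongrightarrow> 0) (at t within {0..})"
    and "((\<lambda>s. L2_norm (\<lambda>\<xi>. fourier (v s) \<xi> - fourier (v t) \<xi>)) \<longlongrightarrow> 0) (at t within {0..})"
proof -
  have ev: "\<forall>\<^sub>F s in at t within {0..}. 0 \<le> s" by (simp add: eventually_at_filter)
  show "((\<lambda>s. L2_norm (\<lambda>\<xi>. fourier (u s) \<xi> - fourier (u t) \<xi>)) \<longlongrightarrow> 0) (at t within {0..})"
    by (rule Lim_transform_eventually[OF state_continuous(1)[OF t] eventually_mono[OF ev]])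
       (rule L2_norm_fourier_difference[symmetric, OF u_L2 u_L2[OF t]])
  show "((\<lambda>s. L2_norm (\<lambda>\<xi>. fourier (v s) \<xi> - fourier (v t) \<xi>)) \<longlongrightarrow> 0) (at t within {0..})"
    by (rule Lim_transform_eventually[OF state_continuous(2)[OF t] eventually_mono[OF ev]])
       (rule L2_norm_fourier_difference[symmetric, OF v_L2 v_L2[OF t]])
qed

lemma fourier_u_derivative:
  assumes t: "0 \<le> t"
  shows "((\<lambda>s. L2_norm (\<lambda>\<xi>. (fourier (u s) \<xi> - fourier (u t) \<xi>) / of_real (s - t) - fourier (v t) \<xi>)) \<longlongrightarrow> 0) (at t within {0..})"
proof (rule Lim_transform_eventually)
  show "((\<lambda>s. L2_norm ((\<lambda>x. (u s x - u t x) / of_real (s - t)) - v t)) \<longlongrightarrow> 0) (at t within {0..})"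
    using sol t unfolding KG_global_solution_def L2_limit_def by blast
  have ev: "\<forall>\<^sub>F s in at t within {0..}. 0 \<le> s" by (simp add: eventually_at_filter)
  show "\<forall>\<^sub>F s in at t within {0..}. L2_norm ((\<lambda>x. (u s x - u t x) / of_real (s - t)) - v t)
    = L2_norm (\<lambda>\<xi>. (fourier (u s) \<xi> - fourier (u t) \<xi>) / of_real (s - t) - fourier (v t) \<xi>)"
  proof (rule eventually_mono[OF ev])
    fix s :: real assume s: "0 \<le> s"
    let ?q = "\<lambda>x. inverse (of_real (s - t)) * (u s x - u t x)"
    note d = L2_diff(1)[OF u_L2[OF s] u_L2[OF t]]
    note q = L2_cmult(1)[OF d, of "inverse (of_real (s - t))"]
    have "L2_norm ((\<lambda>x. (u s x - u t x) / of_real (s - t)) - v t) = L2_norm (\<lambda>x. ?q x - v t x)"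
      by (simp add: fun_diff_def divide_inverse mult.commute)
    also have "\<dots> = L2_norm (\<lambda>\<xi>. fourier ?q \<xi> - fourier (v t) \<xi>)"
      by (rule L2_norm_fourier_difference[OF q v_L2[OF t], symmetric])
    also have "\<dots> = L2_norm (\<lambda>\<xi>. (fourier (u s) \<xi> - fourier (u t) \<xi>) / of_real (s - t) - fourier (v t) \<xi>)"
    proof (rule L2_norm_cong_AE)
      show "AE \<xi> in lborel. fourier ?q \<xi> - fourier (v t) \<xi> = (fourier (u s) \<xi> - fourier (u t) \<xi>) / of_real (s - t) - fourier (v t) \<xi>"
        using fourier_cmult[OF d, of "inverse (of_real (s - t))"] fourier_diff[OF u_L2[OF s] u_L2[OF t]]
        by eventually_elim (simp add: divide_inverse mult.commute)
    qed (use L2_measurable[OF fourier_L2(1)[OF q]] L2_measurable[OF fourier_L2(1)[OF v_L2[OF t]]]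
        L2_measurable[OF fourier_L2(1)[OF u_L2[OF t]]] L2_measurable[OF fourier_L2(1)[OF u_L2[OF s]]] in measurable)
    finally show "L2_norm ((\<lambda>x. (u s x - u t x) / of_real (s - t)) - v t)
      = L2_norm (\<lambda>\<xi>. (fourier (u s) \<xi> - fourier (u t) \<xi>) / of_real (s - t) - fourier (v t) \<xi>)" .
  qed
qed

lemma weak_form_interval:
  assumes F: "smooth_cutoff F" and m: "bounded_supp m" and s: "0 \<le> s" "s \<le> t"
  shows "((\<lambda>s. (\<integral>x. N (u s) x s * u s x * fourier_integral m x \<partial>lborel) - (\<integral>\<xi>. fourier (u s) \<xi> * (of_real (jbr \<xi> ^ 2) * m \<xi>) \<partial>lborel))
    has_integral ((\<integral>\<xi>. fourier (v t) \<xi> * m \<xi> \<partial>lborel) - (\<integral>\<xi>. fourier (v s) \<xi> * m \<xi> \<partial>lborel))) {s..t}"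
    (is "(?f has_integral _) _")
proof -
  note 1 = weak_form_bandlimited[OF F m s(1)] and 2 = weak_form_bandlimited[OF F m order_trans[OF s]]
  have i: "?f integrable_on {0..t}" using 2 by blast
  then have "?f integrable_on {s..t}" by (rule integrable_subinterval_real) (use s in auto)
  moreover have "integral {s..t} ?f = (\<integral>\<xi>. fourier (v t) \<xi> * m \<xi> \<partial>lborel) - (\<integral>\<xi>. fourier (v s) \<xi> * m \<xi> \<partial>lborel)"
  proof -
    have "y = q - p" if "x + y = z" "x = p - r" "z = q - r" for x y z p q r :: complex
      proof -
        have "y = z - x" using that(1) by auto
        then show ?thesis using that by simp
      qed
    from this[OF Henstock_Kurzweil_Integration.integral_combine[OF s i] integral_unique[OF 1] integral_unique[OF 2]] show ?thesis .
  qed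
  ultimately show ?thesis using integrable_integral[of ?f "{s..t}"] by simp
qed

text \<open>On the Fourier side, \<open>jbr (fourier u) \<plusminus> i (fourier v)\<close> solves a first-order equation with multiplier \<open>\<mp> i jbr\<close>.
  Conjugating with the free phase (\<open>\<theta>\<close> is the sign) leaves a quantity whose time derivative is the
  nonlinear term paired with \<open>fourier_integral (cis (\<theta> s jbr) m)\<close>, so that dispersion of this
  kernel is all that is needed. It is tested against \<open>m\<close>, as neither \<open>jbr\<^sup>2 (fourier u)\<close> nor
  the nonlinear term need lie in \<open>L2\<close>.\<close>

definition profile :: "real \<Rightarrow> ('a \<Rightarrow> complex) \<Rightarrow> real \<Rightarrow> complex" where
  "profile \<theta> m s = (\<integral>\<xi>. fourier (u s) \<xi> * (cis (\<theta> * s * jbr \<xi>) * (of_real (jbr \<xi> ^ 1) * m \<xi>)) \<partial>lborel)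
     + \<i> * of_real \<theta> * (\<integral>\<xi>. fourier (v s) \<xi> * (cis (\<theta> * s * jbr \<xi>) * m \<xi>) \<partial>lborel)"

lemma pairing_cis_jbr_tendsto:
  fixes k :: "'a \<Rightarrow> complex"
  assumes k: "bounded_supp k" and s: "0 \<le> s"
    and W: "\<And>r. 0 \<le> r \<Longrightarrow> W r \<in> L2" "((\<lambda>r. L2_norm (\<lambda>\<xi>. W r \<xi> - W s \<xi>)) \<longlongrightarrow> 0) (at s within {0..})"
  shows "((\<lambda>r. \<integral>\<xi>. W r \<xi> * (cis (\<theta> * r * jbr \<xi>) * k \<xi>) \<partial>lborel) \<longlongrightarrow> (\<integral>\<xi>. W s \<xi> * (cis (\<theta> * s * jbr \<xi>) * k \<xi>) \<partial>lborel)) (at s within {0..})"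
proof (rule L2_pairing_tendsto)
  have ev: "\<forall>\<^sub>F r in at s within {0..}. 0 \<le> r" by (simp add: eventually_at_filter)
  show "\<forall>\<^sub>F r in at s within {0..}. W r \<in> L2" using ev by eventually_elim (rule W(1))
  note kL = bounded_supp_L2_integrable(1)[OF bounded_supp_cis_jbr[OF k]]
  show "\<forall>\<^sub>F r in at s within {0..}. (\<lambda>\<xi>. cis (\<theta> * r * jbr \<xi>) * k \<xi>) \<in> L2"
    by (rule always_eventually, rule allI, rule kL)
  show "W s \<in> L2" by (rule W(1)[OF s])
  show "(\<lambda>\<xi>. cis (\<theta> * s * jbr \<xi>) * k \<xi>) \<in> L2" by (rule kL)
  show "((\<lambda>r. L2_norm (\<lambda>\<xi>. cis (\<theta> * r * jbr \<xi>) * k \<xi> - cis (\<theta> * s * jbr \<xi>) * k \<xi>)) \<longlongrightarrow> 0) (at s within {0..})"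
  proof (rule Lim_null_comparison[OF always_eventually], rule allI)
    fix r show "norm (L2_norm (\<lambda>\<xi>. cis (\<theta> * r * jbr \<xi>) * k \<xi> - cis (\<theta> * s * jbr \<xi>) * k \<xi>)) \<le> \<bar>\<theta> * r - \<theta> * s\<bar> * L2_norm (\<lambda>\<xi>. of_real (jbr \<xi> ^ 1) * k \<xi>)"
      unfolding real_norm_def abs_of_nonneg[OF L2_norm_nonneg] by (rule L2_cis_jbr_lipschitz[OF k])
    have "((\<lambda>r. \<bar>\<theta> * r - \<theta> * s\<bar> * L2_norm (\<lambda>\<xi>. of_real (jbr \<xi> ^ 1) * k \<xi>)) \<longlongrightarrow> \<bar>\<theta> * s - \<theta> * s\<bar> * L2_norm (\<lambda>\<xi>. of_real (jbr \<xi> ^ 1) * k \<xi>)) (at s within {0..})"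
      by (intro tendsto_mult tendsto_rabs tendsto_diff tendsto_const tendsto_ident_at)
    then show "((\<lambda>r. \<bar>\<theta> * r - \<theta> * s\<bar> * L2_norm (\<lambda>\<xi>. of_real (jbr \<xi> ^ 1) * k \<xi>)) \<longlongrightarrow> 0) (at s within {0..})" by simp
  qed
qed (rule W(2))

lemma pairing_quotient_tendsto:
  fixes k :: "'a \<Rightarrow> complex"
  assumes k: "bounded_supp k" and s: "0 \<le> s" and \<theta>: "\<theta>\<^sup>2 = 1"
    and W: "\<And>r. 0 \<le> r \<Longrightarrow> W r \<in> L2" "((\<lambda>r. L2_norm (\<lambda>\<xi>. W r \<xi> - W s \<xi>)) \<longlongrightarrow> 0) (at s within {0..})"
  shows "((\<lambda>h. \<integral>\<xi>. W (s + h) \<xi> * ((cis (\<theta> * (s + h) * jbr \<xi>) - cis (\<theta> * s * jbr \<xi>)) / of_real h * k \<xi>) \<partial>lborel)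
    \<longlongrightarrow> (\<integral>\<xi>. W s \<xi> * (\<i> * of_real \<theta> * of_real (jbr \<xi>) * (cis (\<theta> * s * jbr \<xi>) * k \<xi>)) \<partial>lborel)) (at_right 0)"
proof (rule L2_pairing_tendsto)
  have ev: "\<forall>\<^sub>F h in at_right (0::real). 0 < h" by (rule eventually_at_right_less)
  show "\<forall>\<^sub>F h in at_right 0. W (s + h) \<in> L2" using ev by eventually_elim (use s W(1) in auto)
  have qL: "(\<lambda>\<xi>. (cis (\<theta> * (s + h) * jbr \<xi>) - cis (\<theta> * s * jbr \<xi>)) / of_real h * k \<xi>) \<in> L2" for h
  proof -
    have "(\<lambda>\<xi>. (cis (\<theta> * (s + h) * jbr \<xi>) - cis (\<theta> * s * jbr \<xi>)) / of_real h * k \<xi>)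
      = (\<lambda>\<xi>. inverse (of_real h) * (cis (\<theta> * (s + h) * jbr \<xi>) * k \<xi> - cis (\<theta> * s * jbr \<xi>) * k \<xi>))"
      by (simp add: fun_eq_iff divide_inverse algebra_simps)
    then show ?thesis
      using L2_cmult(1)[OF L2_diff(1)[OF bounded_supp_L2_integrable(1)[OF bounded_supp_cis_jbr[OF k]] bounded_supp_L2_integrable(1)[OF bounded_supp_cis_jbr[OF k]]]]
      by simp
  qed
  show "\<forall>\<^sub>F h in at_right 0. (\<lambda>\<xi>. (cis (\<theta> * (s + h) * jbr \<xi>) - cis (\<theta> * s * jbr \<xi>)) / of_real h * k \<xi>) \<in> L2"
    by (rule always_eventually, rule allI, rule qL)
  show "W s \<in> L2" by (rule W(1)[OF s])
  show "(\<lambda>\<xi>. \<i> * of_real \<theta> * of_real (jbr \<xi>) * (cis (\<theta> * s * jbr \<xi>) * k \<xi>)) \<in> L2"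
    using L2_cmult(1)[OF bounded_supp_L2_integrable(1)[OF bounded_supp_jbr[OF bounded_supp_cis_jbr[OF k, of "\<theta> * s"], of 1]], of "\<i> * of_real \<theta>"]
    by (simp add: mult.assoc)
  show "((\<lambda>h. L2_norm (\<lambda>\<xi>. W (s + h) \<xi> - W s \<xi>)) \<longlongrightarrow> 0) (at_right 0)"
    by (rule filterlim_compose[OF W(2) filterlim_shift_right[OF s]])
  show "((\<lambda>h. L2_norm (\<lambda>\<xi>. (cis (\<theta> * (s + h) * jbr \<xi>) - cis (\<theta> * s * jbr \<xi>)) / of_real h * k \<xi>
      - \<i> * of_real \<theta> * of_real (jbr \<xi>) * (cis (\<theta> * s * jbr \<xi>) * k \<xi>))) \<longlongrightarrow> 0) (at_right 0)"
  proof (rule Lim_null_comparison[OF eventually_mono[OF ev]])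
    fix h :: real assume h: "0 < h"
    show "norm (L2_norm (\<lambda>\<xi>. (cis (\<theta> * (s + h) * jbr \<xi>) - cis (\<theta> * s * jbr \<xi>)) / of_real h * k \<xi>
      - \<i> * of_real \<theta> * of_real (jbr \<xi>) * (cis (\<theta> * s * jbr \<xi>) * k \<xi>))) \<le> h * L2_norm (\<lambda>\<xi>. of_real (jbr \<xi> ^ 2) * k \<xi>)"
      unfolding real_norm_def abs_of_nonneg[OF L2_norm_nonneg] by (rule L2_cis_jbr_quotient[OF k h \<theta>])
  next
    have "((\<lambda>h. h * L2_norm (\<lambda>\<xi>. of_real (jbr \<xi> ^ 2) * k \<xi>)) \<longlongrightarrow> 0 * L2_norm (\<lambda>\<xi>. of_real (jbr \<xi> ^ 2) * k \<xi>)) (at_right 0)"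
      by (intro tendsto_mult tendsto_const tendsto_ident_at)
    then show "((\<lambda>h. h * L2_norm (\<lambda>\<xi>. of_real (jbr \<xi> ^ 2) * k \<xi>)) \<longlongrightarrow> 0) (at_right 0)" by simp
  qed
qed

lemma fu_L2: "0 \<le> t \<Longrightarrow> fourier (u t) \<in> L2" and fv_L2: "0 \<le> t \<Longrightarrow> fourier (v t) \<in> L2"
  by (rule fourier_L2(1)[OF u_L2], assumption) (rule fourier_L2(1)[OF v_L2])

lemma profile_continuous:
  assumes m: "bounded_supp m"
  shows "continuous_on {0..} (profile \<theta> m)"
  unfolding continuous_on_def
proof
  fix s :: real assume "s \<in> {0..}"
  then have s: "0 \<le> s" by simp
  show "(profile \<theta> m \<longlongrightarrow> profile \<theta> m s) (at s within {0..})"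
    unfolding profile_def[abs_def]
    by (rule tendsto_add[OF pairing_cis_jbr_tendsto[OF bounded_supp_jbr[OF m] s fu_L2 fourier_state_continuous(1)[OF s]]
          tendsto_mult[OF tendsto_const pairing_cis_jbr_tendsto[OF m s fv_L2 fourier_state_continuous(2)[OF s]]]])
qed


lemma profile_dini:
  assumes F: "smooth_cutoff F" and m: "bounded_supp m" and \<theta>: "\<theta>\<^sup>2 = 1" and s: "0 \<le> s" and e: "0 < e"
    and S: "\<And>y. norm (fourier_integral (\<lambda>\<xi>. cis (\<theta> * s * jbr \<xi>) * m \<xi>) y) \<le> S"
  shows "\<forall>\<^sub>F h in at_right 0. norm (profile \<theta> m (s + h) - profile \<theta> m s) \<le> (M * S + e) * h"
proof -
  let ?U = "\<lambda>r. fourier (u r)" and ?V = "\<lambda>r. fourier (v r)"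
  let ?ms = "\<lambda>\<xi>. cis (\<theta> * s * jbr \<xi>) * m \<xi>"
  let ?jm = "\<lambda>\<xi>. of_real (jbr \<xi> ^ 1) * m \<xi>"
  let ?q = "\<lambda>h \<xi>. (cis (\<theta> * (s + h) * jbr \<xi>) - cis (\<theta> * s * jbr \<xi>)) / of_real h"
  define X where "X = (\<integral>\<xi>. ?U s \<xi> * (of_real (jbr \<xi> ^ 2) * ?ms \<xi>) \<partial>lborel)"
  define Y where "Y = (\<integral>\<xi>. ?V s \<xi> * (of_real (jbr \<xi> ^ 1) * ?ms \<xi>) \<partial>lborel)"
  define A1 where "A1 h = (\<integral>\<xi>. ?U (s + h) \<xi> * (?q h \<xi> * ?jm \<xi>) \<partial>lborel)" for h
  define A2 where "A2 h = (\<integral>\<xi>. (?U (s + h) \<xi> - ?U s \<xi>) / of_real h * (cis (\<theta> * s * jbr \<xi>) * ?jm \<xi>) \<partial>lborel)" for h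
  define A3 where "A3 h = (\<integral>\<xi>. ?V (s + h) \<xi> * (?q h \<xi> * m \<xi>) \<partial>lborel)" for h
  define Q where "Q h = (\<integral>\<xi>. ?V (s + h) \<xi> * ?ms \<xi> \<partial>lborel) - (\<integral>\<xi>. ?V s \<xi> * ?ms \<xi> \<partial>lborel)" for h
  have jm: "bounded_supp ?jm" by (rule bounded_supp_jbr[OF m])
  have ms: "bounded_supp ?ms" by (rule bounded_supp_cis_jbr[OF m])
  note bL = bounded_supp_L2_integrable(1)
  have lim1: "(A1 \<longlongrightarrow> \<i> * of_real \<theta> * X) (at_right 0)"
  proof -
    have "(\<lambda>\<xi>. ?U s \<xi> * (\<i> * of_real \<theta> * of_real (jbr \<xi>) * (cis (\<theta> * s * jbr \<xi>) * ?jm \<xi>)))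
      = (\<lambda>\<xi>. (\<i> * of_real \<theta>) * (?U s \<xi> * (of_real (jbr \<xi> ^ 2) * ?ms \<xi>)))"
      by (simp add: fun_eq_iff power2_eq_square mult_ac)
    then show ?thesis
      using pairing_quotient_tendsto[OF jm s \<theta>, of ?U] fu_L2 fourier_state_continuous(1)[OF s]
      unfolding A1_def[abs_def] X_def by (simp only: integral_mult_right_zero)
  qed
  have lim2: "(A2 \<longlongrightarrow> Y) (at_right 0)"
  proof -
    have "Y = (\<integral>\<xi>. ?V s \<xi> * (cis (\<theta> * s * jbr \<xi>) * ?jm \<xi>) \<partial>lborel)"
      unfolding Y_def by (simp only: mult_ac)
    moreover have "(A2 \<longlongrightarrow> (\<integral>\<xi>. ?V s \<xi> * (cis (\<theta> * s * jbr \<xi>) * ?jm \<xi>) \<partial>lborel)) (at_right 0)"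
      unfolding A2_def[abs_def]
    proof (rule L2_pairing_tendsto)
      show "\<forall>\<^sub>F h in at_right 0. (\<lambda>\<xi>. (?U (s + h) \<xi> - ?U s \<xi>) / of_real h) \<in> L2"
      proof (rule eventually_mono[OF eventually_at_right_less])
        fix h :: real assume "0 < h"
        then have "?U (s + h) \<in> L2" using s by (intro fu_L2) simp
        from L2_cmult(1)[OF L2_diff(1)[OF this fu_L2[OF s]], of "inverse (of_real h)"]
        show "(\<lambda>\<xi>. (?U (s + h) \<xi> - ?U s \<xi>) / of_real h) \<in> L2" by (simp only: divide_inverse mult.commute)
      qed
      show "((\<lambda>h. L2_norm (\<lambda>\<xi>. (?U (s + h) \<xi> - ?U s \<xi>) / of_real h - ?V s \<xi>)) \<longlongrightarrow> 0) (at_right 0)"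
        using filterlim_compose[OF fourier_u_derivative[OF s] filterlim_shift_right[OF s]] by (simp only: add_diff_cancel_left')
    qed (use bL[OF bounded_supp_cis_jbr[OF jm, of "\<theta> * s"]] fv_L2[OF s] in simp_all)
    ultimately show ?thesis by simp
  qed
  have lim3: "(A3 \<longlongrightarrow> \<i> * of_real \<theta> * Y) (at_right 0)"
  proof -
    have "(\<lambda>\<xi>. ?V s \<xi> * (\<i> * of_real \<theta> * of_real (jbr \<xi>) * (cis (\<theta> * s * jbr \<xi>) * m \<xi>)))
      = (\<lambda>\<xi>. (\<i> * of_real \<theta>) * (?V s \<xi> * (of_real (jbr \<xi> ^ 1) * ?ms \<xi>)))"
      by (simp add: fun_eq_iff mult_ac)
    then show ?thesis
      using pairing_quotient_tendsto[OF m s \<theta>, of ?V] fv_L2 fourier_state_continuous(2)[OF s]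
      unfolding A3_def[abs_def] Y_def by (simp only: integral_mult_right_zero)
  qed
  have \<theta>\<theta>: "of_real \<theta> * of_real \<theta> = (1::complex)" using \<theta> by (simp add: power2_eq_square flip: of_real_mult)
  have nt: "norm (\<i> * of_real \<theta> :: complex) = 1" using \<theta> by (simp add: norm_mult power2_eq_1_iff) auto
  have "((\<lambda>h. A1 h + A2 h + \<i> * of_real \<theta> * A3 h) \<longlongrightarrow> \<i> * of_real \<theta> * X + Y + \<i> * of_real \<theta> * (\<i> * of_real \<theta> * Y)) (at_right 0)"
    by (intro tendsto_add tendsto_mult tendsto_const lim1 lim2 lim3)
  \<comment> \<open>The two terms in Y, one from the time derivative v of u and one from the
    rotating phase on v, cancel because (i \<theta>)^2 = -1.\<close>
  moreover have "\<i> * of_real \<theta> * X + Y + \<i> * of_real \<theta> * (\<i> * of_real \<theta> * Y) = \<i> * of_real \<theta> * X"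
  proof -
    have "\<i> * of_real \<theta> * (\<i> * of_real \<theta> * Y) = - ((of_real \<theta> * of_real \<theta>) * Y)" by (simp add: mult_ac)
    then show ?thesis unfolding \<theta>\<theta> by simp
  qed
  ultimately have "((\<lambda>h. A1 h + A2 h + \<i> * of_real \<theta> * A3 h) \<longlongrightarrow> \<i> * of_real \<theta> * X) (at_right 0)" by simp
  then have ev1: "\<forall>\<^sub>F h in at_right 0. dist (A1 h + A2 h + \<i> * of_real \<theta> * A3 h) (\<i> * of_real \<theta> * X) < e / 2"
    using e by (intro tendstoD) auto
  let ?P = "\<lambda>r. \<integral>\<xi>. ?U r \<xi> * (of_real (jbr \<xi> ^ 2) * ?ms \<xi>) \<partial>lborel"
  have "(?P \<longlongrightarrow> X) (at s within {0..})"
  proof -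
    have evs: "\<forall>\<^sub>F r in at s within {0..}. 0 \<le> r" by (simp add: eventually_at_filter)
    show ?thesis unfolding X_def
      by (rule L2_pairing_tendsto[OF eventually_mono[OF evs] _ fu_L2[OF s] _ fourier_state_continuous(1)[OF s]])
         (use fu_L2 bL[OF bounded_supp_jbr[OF ms, of 2]] in simp_all)
  qed
  then have "\<forall>\<^sub>F r in at s within {0..}. dist (?P r) X < e / 2" using e by (intro tendstoD) auto
  \<comment> \<open>Continuity of u at s: for h < d the linear term of the weak equation stays
    within e/2 of X on all of [s, s + h].\<close>
  then obtain d where d: "0 < d" "\<And>r. r \<in> {0..} \<Longrightarrow> r \<noteq> s \<Longrightarrow> dist r s < d \<Longrightarrow> dist (?P r) X < e / 2"
    unfolding eventually_at by auto
  have near: "norm (?P r - X) \<le> e / 2" if "s \<le> r" "r < s + d" for r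
  proof (cases "r = s")
    case True then show ?thesis using e by (simp add: X_def)
  next
    case False then show ?thesis using d(2)[of r] that s by (simp add: dist_norm dist_real_def less_imp_le)
  qed
  have ev2: "\<forall>\<^sub>F h in at_right 0. h < d" using d(1) by (intro eventually_at_right_field[THEN iffD2] exI[of _ d]) auto
  have M0: "0 \<le> M" by (rule order_trans[OF _ source_bound[of 0]]) simp_all
  have S0: "0 \<le> S" using S norm_ge_zero order_trans by blast
  show ?thesis
    using ev1 ev2 eventually_at_right_less[of 0]
  proof eventually_elim
    case (elim h)
    have sh: "0 \<le> s + h" "s \<le> s + h" using s elim(3) by auto
    \<comment> \<open>Adding X to the integrand of the weak equation compensates its linear part;
      what remains is the source, bounded by M S, and an error of e/2.\<close>
    have Qb: "norm (Q h + of_real h * X) \<le> (M * S + e / 2) * h"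
    proof -
      let ?f = "\<lambda>r. (\<integral>x. N (u r) x r * u r x * fourier_integral ?ms x \<partial>lborel) - ?P r"
      have "(?f has_integral Q h) {s..s + h}"
        unfolding Q_def by (rule weak_form_interval[OF F ms s sh(2)])
      from has_integral_add[OF this has_integral_const_real[of X s "s + h"]]
      have hi: "((\<lambda>r. ?f r + X) has_integral (Q h + of_real h * X)) (cbox s (s + h))"
        using elim(3) by (simp add: scaleR_conv_of_real)
      have "norm (Q h + of_real h * X) \<le> (M * S + e / 2) * measure lborel (cbox s (s + h))"
      proof (rule has_integral_bound[OF _ hi])
        show "0 \<le> M * S + e / 2" using M0 S0 e by simp
        fix r assume "r \<in> cbox s (s + h)"
        then have r: "s \<le> r" "r \<le> s + h" "0 \<le> r" using s by auto
        let ?S = "\<lambda>x. N (u r) x r * u r x"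
        have "norm (\<integral>x. ?S x * fourier_integral ?ms x \<partial>lborel) \<le> (\<integral>x. S * norm (?S x) \<partial>lborel)"
        proof (rule Bochner_Integration.integral_norm_bound_integral)
          show le1: "norm (?S x * fourier_integral ?ms x) \<le> S * norm (?S x)" for x
            unfolding norm_mult[of "?S x"] using mult_left_mono[OF S[of x] norm_ge_zero[of "?S x"]] by (simp only: mult.commute)
          show i1: "integrable lborel (\<lambda>x. S * norm (?S x))" using source_integrable[OF r(3)] by simp
          show "integrable lborel (\<lambda>x. ?S x * fourier_integral ?ms x)"
          proof (rule Bochner_Integration.integrable_bound[OF i1])
            have [measurable]: "?S \<in> borel_measurable borel" "fourier_integral ?ms \<in> borel_measurable borel"
              using borel_measurable_integrable[OF source_integrable[OF r(3)]] fourier_integral_measurable[OF bounded_supp_measurable[OF ms]] by auto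
            show "(\<lambda>x. ?S x * fourier_integral ?ms x) \<in> borel_measurable lborel" by measurable
            show "AE x in lborel. norm (?S x * fourier_integral ?ms x) \<le> norm (S * norm (?S x))"
              by (intro AE_I2 order_trans[OF le1]) (simp only: real_norm_def abs_ge_self)
          qed
        qed
        also have "\<dots> = S * (\<integral>x. norm (?S x) \<partial>lborel)" by (rule integral_mult_right_zero)
        also have "\<dots> \<le> S * M" by (rule mult_left_mono[OF source_bound[OF r(3)] S0])
        finally have 1: "norm (\<integral>x. ?S x * fourier_integral ?ms x \<partial>lborel) \<le> M * S" by (simp only: mult.commute)
        have 2: "norm (?P r - X) \<le> e / 2" using near[of r] r elim(2) by simp
        have g: "norm (a - b + c) \<le> p + q" if "norm a \<le> p" "norm (b - c) \<le> q" for a b c :: complex and p q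
          using norm_triangle_ineq4[of a "b - c"] that by (simp add: algebra_simps)
        show "norm (?f r + X) \<le> M * S + e / 2" by (rule g[OF 1 2])
      qed
      then show ?thesis using elim(3) by simp
    qed
    txt \<open>The limits of the difference quotients \<open>A1, A2, A3\<close> cancel up to \<open>\<i> \<theta> X\<close>, which is the linear
      part of the weak formulation.\<close>
    have dec: "profile \<theta> m (s + h) - profile \<theta> m s = of_real h * (A1 h + A2 h + \<i> * of_real \<theta> * A3 h) + \<i> * of_real \<theta> * Q h"
    proof -
      have h: "of_real h \<noteq> (0::complex)" using elim(3) by simp
      have P: "of_real h * (\<integral>\<xi>. G \<xi> * (?q h \<xi> * k \<xi>) \<partial>lborel)
          = (\<integral>\<xi>. G \<xi> * (cis (\<theta> * (s + h) * jbr \<xi>) * k \<xi>) \<partial>lborel) - (\<integral>\<xi>. G \<xi> * (cis (\<theta> * s * jbr \<xi>) * k \<xi>) \<partial>lborel)"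
        if k: "bounded_supp k" and G: "G \<in> L2" for k and G :: "'a \<Rightarrow> complex"
      proof -
        have "of_real h * (G \<xi> * (?q h \<xi> * k \<xi>)) = G \<xi> * (cis (\<theta> * (s + h) * jbr \<xi>) * k \<xi>) - G \<xi> * (cis (\<theta> * s * jbr \<xi>) * k \<xi>)" for \<xi>
        proof -
          have "of_real h * (G \<xi> * (?q h \<xi> * k \<xi>)) = G \<xi> * ((of_real h * ?q h \<xi>) * k \<xi>)" by (simp only: mult_ac)
          also have "of_real h * ?q h \<xi> = cis (\<theta> * (s + h) * jbr \<xi>) - cis (\<theta> * s * jbr \<xi>)" using h by simp
          finally show ?thesis by (simp only: left_diff_distrib right_diff_distrib)
        qed
        then have "of_real h * (\<integral>\<xi>. G \<xi> * (?q h \<xi> * k \<xi>) \<partial>lborel)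
          = (\<integral>\<xi>. G \<xi> * (cis (\<theta> * (s + h) * jbr \<xi>) * k \<xi>) - G \<xi> * (cis (\<theta> * s * jbr \<xi>) * k \<xi>) \<partial>lborel)"
          by (simp only: integral_mult_right_zero[symmetric])
        also have "\<dots> = (\<integral>\<xi>. G \<xi> * (cis (\<theta> * (s + h) * jbr \<xi>) * k \<xi>) \<partial>lborel) - (\<integral>\<xi>. G \<xi> * (cis (\<theta> * s * jbr \<xi>) * k \<xi>) \<partial>lborel)"
          by (intro Bochner_Integration.integral_diff L2_mult_integrable G bL bounded_supp_cis_jbr k)
        finally show ?thesis .
      qed
      have P2: "of_real h * A2 h = (\<integral>\<xi>. ?U (s + h) \<xi> * (cis (\<theta> * s * jbr \<xi>) * ?jm \<xi>) \<partial>lborel) - (\<integral>\<xi>. ?U s \<xi> * (cis (\<theta> * s * jbr \<xi>) * ?jm \<xi>) \<partial>lborel)"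
      proof -
        have g: "c * ((a - b) / c * k) = a * k - b * k" if "c \<noteq> 0" for a b c k :: complex
        proof -
          have "c * ((a - b) / c * k) = (a - b) * k" using that by simp
          then show ?thesis by (simp only: left_diff_distrib)
        qed
        have "of_real h * A2 h = (\<integral>\<xi>. ?U (s + h) \<xi> * (cis (\<theta> * s * jbr \<xi>) * ?jm \<xi>) - ?U s \<xi> * (cis (\<theta> * s * jbr \<xi>) * ?jm \<xi>) \<partial>lborel)"
          unfolding A2_def by (simp only: integral_mult_right_zero[symmetric] g[OF h])
        also have "\<dots> = (\<integral>\<xi>. ?U (s + h) \<xi> * (cis (\<theta> * s * jbr \<xi>) * ?jm \<xi>) \<partial>lborel) - (\<integral>\<xi>. ?U s \<xi> * (cis (\<theta> * s * jbr \<xi>) * ?jm \<xi>) \<partial>lborel)"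
          by (intro Bochner_Integration.integral_diff L2_mult_integrable fu_L2 sh s bL bounded_supp_cis_jbr jm)
        finally show ?thesis .
      qed
      have g: "(p1 + c * q1) - (p0 + c * q0) = h * (a1 + a2 + c * a3) + c * (q2 - q0)"
        if "h * a1 = p1 - p2" "h * a2 = p2 - p0" "h * a3 = q1 - q2" for p0 p1 p2 q0 q1 q2 a1 a2 a3 c h :: complex
        using that by algebra
      show ?thesis unfolding profile_def Q_def
        by (rule g[OF P[OF jm fu_L2[OF sh(1)], folded A1_def] P2 P[OF m fv_L2[OF sh(1)], folded A3_def]])
    qed
    let ?A = "A1 h + A2 h + \<i> * of_real \<theta> * A3 h" and ?L = "\<i> * of_real \<theta> * X"
    have "profile \<theta> m (s + h) - profile \<theta> m s = of_real h * (?A - ?L) + \<i> * of_real \<theta> * (Q h + of_real h * X)"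
      unfolding dec by (simp add: algebra_simps)
    also have "norm \<dots> \<le> h * norm (?A - ?L) + norm (Q h + of_real h * X)"
      using norm_triangle_ineq[of "of_real h * (?A - ?L)" "\<i> * of_real \<theta> * (Q h + of_real h * X)"] elim(3)
      unfolding norm_mult[of "\<i> * of_real \<theta>" "Q h + of_real h * X"] nt norm_mult[of "of_real h" "?A - ?L"] norm_of_real by simp
    also have "\<dots> \<le> h * (e / 2) + (M * S + e / 2) * h"
      using elim(1,3) Qb by (intro add_mono mult_left_mono) (simp_all add: dist_norm)
    also have "\<dots> = (M * S + e) * h" by (simp add: algebra_simps)
    finally show ?case .
  qed
qed


text \<open>With the phase frozen at s, dispersion bounds the right derivative of the profile by a
  multiple of R^(n/2 + 1) s^(-n/2), which is integrable at infinity as n >= 3. The estimate sees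
  only |\<theta> s|, so both signs are treated alike.\<close>

lemma profile_bound:
  assumes F: "smooth_cutoff F" and n: "3 \<le> DIM('a)"
  shows "\<exists>K\<ge>0. \<forall>\<theta> R t T. \<forall>x::'a. \<theta>\<^sup>2 = 1 \<longrightarrow> 1 \<le> R \<longrightarrow> R \<le> t \<longrightarrow> t \<le> T \<longrightarrow>
    norm (profile \<theta> (\<lambda>\<xi>. cis (x \<bullet> \<xi>) * of_real (1 - F (norm \<xi> / R))) T
        - profile \<theta> (\<lambda>\<xi>. cis (x \<bullet> \<xi>) * of_real (1 - F (norm \<xi> / R))) t)
      \<le> K * R powr (real DIM('a) / 2 + 1) * t powr (1 - real DIM('a) / 2)"
proof -
  define n where "n = real DIM('a)"
  have n3: "3 \<le> n" using assms(2) by (simp add: n_def)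
  define c where "c = (2 * pi) powr (- real DIM('a) / 2)"
  have c0: "0 \<le> c" by (simp add: c_def)
  obtain C where C: "0 \<le> C" "\<And>R s. \<And>y::'a. 1 \<le> R \<Longrightarrow> R \<le> \<bar>s\<bar> \<Longrightarrow>
      norm (\<integral>\<xi>. cis (y \<bullet> \<xi>) * (cis (s * jbr \<xi>) * of_real (1 - F (norm \<xi> / R))) \<partial>lborel) \<le> C * R * sqrt (R / \<bar>s\<bar>) ^ DIM('a)"
    using dispersive_estimate[OF F, where ?'a='a] by blast
  have M0: "0 \<le> M" by (rule order_trans[OF _ source_bound[of 0]]) simp_all
  \<comment> \<open>Integrating s^(-n/2) from t to infinity gives t^(1 - n/2) / (n/2 - 1).\<close>
  define K where "K = M * (c * C) / (n / 2 - 1)"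
  have K0: "0 \<le> K" using M0 c0 C(1) n3 by (simp add: K_def)
  have "norm (profile \<theta> m T - profile \<theta> m t) \<le> K * R powr (n / 2 + 1) * t powr (1 - n / 2)"
    if \<theta>: "\<theta>\<^sup>2 = 1" and R: "1 \<le> R" "R \<le> t" "t \<le> T" and m_def: "m = (\<lambda>\<xi>. cis (x \<bullet> \<xi>) * of_real (1 - F (norm \<xi> / R)))"
    for \<theta> R t T and x :: 'a and m
  proof -
    have m: "bounded_supp m" unfolding m_def by (rule bounded_supp_cutoff[OF F]) (use R in simp)
    have \<theta>': "\<bar>\<theta>\<bar> = 1" using \<theta> by (auto simp: power2_eq_1_iff)
    have t0: "0 < t" using R by linarith
    \<comment> \<open>The antiderivative of the derivative bound that vanishes at infinity. It is
      nowhere positive, so dropping \<open>\<psi> T\<close> makes the estimate uniform in T.\<close>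
    define \<psi> where "\<psi> s = - (K * R powr (n / 2 + 1)) * s powr (1 - n / 2)" for s
    define S where "S s = c * C * R powr (n / 2 + 1) * s powr (- n / 2)" for s
    have S: "norm (fourier_integral (\<lambda>\<xi>. cis (\<theta> * s * jbr \<xi>) * m \<xi>) y) \<le> S s" if s: "t \<le> s" for s y
    proof -
      have e: "cis (- (\<xi> \<bullet> y)) * (cis (\<theta> * s * jbr \<xi>) * m \<xi>) = cis ((x - y) \<bullet> \<xi>) * (cis (\<theta> * s * jbr \<xi>) * of_real (1 - F (norm \<xi> / R)))" for \<xi>
      proof -
        have "cis ((x - y) \<bullet> \<xi>) = cis (- (\<xi> \<bullet> y)) * cis (x \<bullet> \<xi>)" unfolding cis_mult by (simp add: inner_diff_left inner_diff_right inner_commute)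
        then show ?thesis by (simp add: m_def mult_ac)
      qed
      have "norm (fourier_integral (\<lambda>\<xi>. cis (\<theta> * s * jbr \<xi>) * m \<xi>) y)
        = c * norm (\<integral>\<xi>. cis ((x - y) \<bullet> \<xi>) * (cis (\<theta> * s * jbr \<xi>) * of_real (1 - F (norm \<xi> / R))) \<partial>lborel)"
        unfolding fourier_integral_def c_def[symmetric] norm_mult[of "of_real c"] norm_of_real e abs_of_nonneg[OF c0] ..
      also have "\<dots> \<le> c * (C * R * sqrt (R / \<bar>\<theta> * s\<bar>) ^ DIM('a))"
        using R s \<theta>' t0 by (intro mult_left_mono C(2) c0) (auto simp: abs_mult)
      also have "\<bar>\<theta> * s\<bar> = s" using \<theta>' s t0 by (simp add: abs_mult)
      also have "sqrt (R / s) ^ DIM('a) = R powr (n / 2) * s powr (- n / 2)"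
      proof -
        have "sqrt (R / s) ^ DIM('a) = (R / s) powr (n / 2)"
          using R s t0 by (simp add: powr_half_sqrt[symmetric] powr_powr n_def flip: powr_realpow)
        also have "\<dots> = R powr (n / 2) * s powr (- n / 2)"
          using R s t0 by (simp add: powr_divide powr_minus_divide)
        finally show ?thesis .
      qed
      also have "c * (C * R * (R powr (n / 2) * s powr (- n / 2))) = S s"
        using R by (simp add: S_def powr_add)
      finally show ?thesis .
    qed
    have "norm (profile \<theta> m T - profile \<theta> m t) \<le> \<psi> T - \<psi> t"
    proof (rule one_sided_mean_value_ineq[where B="\<lambda>s. M * S s"])
      show "continuous_on {t..T} (profile \<theta> m)"
        by (rule continuous_on_subset[OF profile_continuous[OF m]]) (use t0 in auto)
      fix s assume "s \<in> {t..T}"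
      then have s: "t \<le> s" "0 < s" using t0 by auto
      have "((\<lambda>s. s powr (1 - n / 2)) has_real_derivative (1 - n / 2) * s powr (1 - n / 2 - 1)) (at s)"
        by (rule has_real_derivative_powr[OF s(2)])
      from DERIV_cmult[OF this, of "- (K * R powr (n / 2 + 1))"]
      have "(\<psi> has_real_derivative - (K * R powr (n / 2 + 1)) * ((1 - n / 2) * s powr (1 - n / 2 - 1))) (at s)"
        unfolding \<psi>_def[abs_def] .
      moreover have "- (K * R powr (n / 2 + 1)) * ((1 - n / 2) * s powr (1 - n / 2 - 1)) = (K * (n / 2 - 1)) * R powr (n / 2 + 1) * s powr (- n / 2)"
        by (simp add: algebra_simps)
      moreover have "K * (n / 2 - 1) = M * (c * C)" using n3 by (simp add: K_def)
      ultimately show "(\<psi> has_real_derivative M * S s) (at s)" by (simp add: S_def mult.assoc)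
    next
      fix s e :: real assume "s \<in> {t..<T}" "0 < e"
      then show "\<forall>\<^sub>F h in at_right 0. norm (profile \<theta> m (s + h) - profile \<theta> m s) \<le> (M * S s + e) * h"
        using t0 by (intro profile_dini[OF F m \<theta>] S) auto
    qed (use R in simp)
    also have "\<dots> \<le> - \<psi> t" using K0 by (simp add: \<psi>_def)
    finally show ?thesis by (simp add: \<psi>_def)
  qed
  then show ?thesis using K0 unfolding n_def by blast
qed

end

section \<open>Cut-offs and balls in L2\<close>

lemma L2_cutoff_tendsto:
  fixes W :: "'a::euclidean_space \<Rightarrow> complex"
  assumes F: "smooth_cutoff F" and W: "W \<in> L2"
  shows "((\<lambda>\<rho>. L2_norm (\<lambda>x. (1 - F (norm x / \<rho>)) *\<^sub>R W x - W x)) \<longlongrightarrow> 0) at_top"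
proof (rule tendsto_at_topI_sequentially)
  fix X :: "nat \<Rightarrow> real" assume X: "filterlim X at_top sequentially"
  obtain B where B: "0 \<le> B" "\<And>l. \<bar>F l\<bar> \<le> B" using smooth_cutoff_bounded[OF F] by blast
  note [measurable] = smooth_cutoff_measurable[OF F] L2_measurable[OF W]
  show "(\<lambda>k. L2_norm (\<lambda>x. (1 - F (norm x / X k)) *\<^sub>R W x - W x)) \<longlonglongrightarrow> 0"
  proof (rule L2_norm_tendsto_dominated)
    show "(\<lambda>x. (1 - F (norm x / X k)) *\<^sub>R W x) \<in> borel_measurable borel" for k by measurable
    show "W \<in> borel_measurable borel" by measurable
    show "AE x in lborel. (\<lambda>k. (1 - F (norm x / X k)) *\<^sub>R W x) \<longlonglongrightarrow> W x"
    proof (rule AE_I2)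
      fix x :: 'a
      have "\<forall>\<^sub>F k in sequentially. 2 * norm x + 1 \<le> X k" using X by (simp add: filterlim_at_top)
      then have "\<forall>\<^sub>F k in sequentially. (1 - F (norm x / X k)) *\<^sub>R W x = W x"
      proof eventually_elim
        case (elim k)
        have "0 < X k" using elim norm_ge_zero[of x] by linarith
        then have "norm x / X k < 1 / 2" using elim by (simp add: divide_less_eq)
        then show ?case using F by (simp add: smooth_cutoff_def)
      qed
      then show "(\<lambda>k. (1 - F (norm x / X k)) *\<^sub>R W x) \<longlonglongrightarrow> W x" by (rule tendsto_eventually)
    qed
    show "(\<lambda>x. of_real B * W x) \<in> L2" by (rule L2_cmult(1)[OF W])
    show "AE x in lborel. norm ((1 - F (norm x / X k)) *\<^sub>R W x - W x) \<le> norm (of_real B * W x)" for k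
    proof (rule AE_I2)
      fix x
      have "(1 - F (norm x / X k)) *\<^sub>R W x - W x = - (F (norm x / X k) *\<^sub>R W x)" by (simp add: scaleR_left_diff_distrib)
      then show "norm ((1 - F (norm x / X k)) *\<^sub>R W x - W x) \<le> norm (of_real B * W x)"
        using mult_right_mono[OF B(2)[of "norm x / X k"] norm_ge_zero[of "W x"]] B(1) by (simp add: norm_mult)
    qed
  qed
qed

text \<open>Passing from a supremum bound to L2 costs the square root of the volume; with radius
  t^\<alpha> this is the origin of the factor t^(\<alpha> n/2).\<close>

lemma L2_norm_le_on_ball:
  fixes g :: "'a::euclidean_space \<Rightarrow> complex"
  assumes g: "g \<in> borel_measurable borel" and r: "0 \<le> r" and A: "0 \<le> A"
    and le: "AE x in lborel. norm (g x) \<le> A * indicator (cball 0 r) x"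
  shows "g \<in> L2" "L2_norm g \<le> A * sqrt (unit_ball_vol (real DIM('a)) * r ^ DIM('a))"
proof -
  let ?i = "\<lambda>x::'a. indicator (cball 0 r) x :: complex"
  have le': "AE x in lborel. norm (g x) \<le> A * norm (?i x)"
  proof -
    have "norm (?i x) = indicator (cball 0 r) x" for x by (simp add: indicator_def)
    then show ?thesis using le by (simp only:)
  qed
  have "(L2_norm ?i)\<^sup>2 = (\<integral>x. indicator (cball (0::'a) r) x \<partial>lborel)"
    unfolding L2_norm_sq by (rule Bochner_Integration.integral_cong) (auto simp: indicator_def)
  also have "\<dots> = measure lborel (cball (0::'a) r)" by simp
  also have "\<dots> = unit_ball_vol (real DIM('a)) * r ^ DIM('a)" by (rule content_cball[OF r])
  finally have "L2_norm ?i = sqrt (unit_ball_vol (real DIM('a)) * r ^ DIM('a))"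
    using real_sqrt_unique[OF _ L2_norm_nonneg] by metis
  then show "g \<in> L2" "L2_norm g \<le> A * sqrt (unit_ball_vol (real DIM('a)) * r ^ DIM('a))"
    using L2_dominated[OF indicator_cball_L2 g le' A] by simp_all
qed

lemma L2_pairing_subst:
  assumes "Y \<in> L2" "y \<in> L2" "z \<in> L2"
  shows "norm (\<integral>\<xi>. Y \<xi> * z \<xi> \<partial>lborel) \<le> norm (\<integral>\<xi>. Y \<xi> * y \<xi> \<partial>lborel) + L2_norm Y * L2_norm (\<lambda>\<xi>. y \<xi> - z \<xi>)"
proof -
  have "(\<integral>\<xi>. Y \<xi> * (y \<xi> - z \<xi>) \<partial>lborel) = (\<integral>\<xi>. Y \<xi> * y \<xi> \<partial>lborel) - (\<integral>\<xi>. Y \<xi> * z \<xi> \<partial>lborel)"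
    unfolding right_diff_distrib by (intro Bochner_Integration.integral_diff L2_mult_integrable assms)
  with L2_pairing_bound[OF assms(1) L2_diff(1)[OF assms(2,3)]]
    norm_triangle_ineq4[of "\<integral>\<xi>. Y \<xi> * y \<xi> \<partial>lborel" "\<integral>\<xi>. Y \<xi> * (y \<xi> - z \<xi>) \<partial>lborel"]
  show ?thesis by simp
qed

section \<open>The scattering limit\<close>

text \<open>What the limit argument uses of a component of the pulled-back solution, isolated so
  that it is carried out once for both. Up to normalisation, \<open>decay\<close> bounds pointwise
  the frequency-localised difference of two members, uniformly in the later time T.\<close>

locale dispersive_family =
  fixes X :: "real \<Rightarrow> 'a::euclidean_space \<Rightarrow> complex" and F1 :: "real \<Rightarrow> real" and E K :: real
  assumes dim: "3 \<le> DIM('a)" and F1: "smooth_cutoff F1"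
    and X_L2: "0 \<le> t \<Longrightarrow> X t \<in> L2" and X_bound: "0 \<le> t \<Longrightarrow> L2_norm (X t) \<le> E" and K: "0 \<le> K"
    and decay: "1 \<le> R \<Longrightarrow> R \<le> t \<Longrightarrow> t \<le> T \<Longrightarrow>
      norm (\<integral>\<xi>. (fourier (X T) \<xi> - fourier (X t) \<xi>) * (cis (x \<bullet> \<xi>) * of_real (1 - F1 (norm \<xi> / R))) \<partial>lborel)
        \<le> K * R powr (real DIM('a) / 2 + 1) * t powr (1 - real DIM('a) / 2)"
begin

lemma hat_L2: "0 \<le> t \<Longrightarrow> fourier (X t) \<in> L2" and hat_bound: "0 \<le> t \<Longrightarrow> L2_norm (fourier (X t)) \<le> E"
  using fourier_L2[OF X_L2, of t] X_bound[of t] by auto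

lemma E_nonneg: "0 \<le> E" using X_bound[of 0] L2_norm_nonneg[of "X 0"] by linarith

text \<open>Band-limited transforms of integrable functions are dense, and for these the pairing is controlled
  by the supremum bound \<open>decay\<close>.\<close>

lemma pairing_Cauchy:
  assumes \<zeta>: "\<zeta> \<in> L2" and e: "0 < e"
  shows "\<exists>t0\<ge>0. \<forall>t T. t0 \<le> t \<longrightarrow> t \<le> T \<longrightarrow> norm (\<integral>\<xi>. (fourier (X T) \<xi> - fourier (X t) \<xi>) * \<zeta> \<xi> \<partial>lborel) \<le> e"
proof -
  define c where "c = (2 * pi) powr (- real DIM('a) / 2)"
  have c0: "0 \<le> c" by (simp add: c_def)
  obtain B where B: "0 \<le> B" "\<And>l. \<bar>F1 l\<bar> \<le> B" using smooth_cutoff_bounded[OF F1] by blast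
  note [measurable] = smooth_cutoff_measurable[OF F1]
  \<comment> \<open>Replacing \<zeta> by z costs at most 2 E times (2 + B) e1: truncation in x,
    amplified by the bound 1 + B of the cut-off, and the cut-off error itself. The choice makes this
    at most e/2, with 2 E + 1 in place of 2 E to exclude zero.\<close>
  define e1 where "e1 = e / (2 * (2 * E + 1) * (2 + B))"
  have pos: "0 < (2 * (2 * E + 1) * (2 + B))" using E_nonneg B(1) by (intro mult_pos_pos) auto
  have e1: "0 < e1" unfolding e1_def by (rule divide_pos_pos[OF e pos])
  define \<eta> where "\<eta> = inverse_fourier \<zeta>"
  have \<eta>: "\<eta> \<in> L2" unfolding \<eta>_def by (rule inverse_fourier_L2(1)[OF \<zeta>])
  have f\<eta>: "AE \<xi> in lborel. fourier \<eta> \<xi> = \<zeta> \<xi>" unfolding \<eta>_def by (rule fourier_inverse_fourier[OF \<zeta>])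
  have "\<forall>\<^sub>F r in at_top. L2_norm (\<lambda>x. indicator (cball 0 r) x *\<^sub>R \<eta> x - \<eta> x) < e1"
    using L2_trunc_tendsto[OF \<eta>] e1 by (rule order_tendstoD(2))
  then obtain r where r: "L2_norm (\<lambda>x. indicator (cball 0 r) x *\<^sub>R \<eta> x - \<eta> x) < e1"
    using eventually_happens trivial_limit_at_top_linorder by blast
  \<comment> \<open>Truncation makes the inverse transform of \<zeta> integrable, so that a supremum
    bound can be paired with it.\<close>
  define h where "h = (\<lambda>x. indicator (cball 0 r) x *\<^sub>R \<eta> x)"
  have h: "h \<in> L2" "integrable lborel h" unfolding h_def by (rule L2_trunc[OF \<eta>], rule L2_trunc_integrable[OF \<eta>])
  have d1: "L2_norm (\<lambda>\<xi>. fourier h \<xi> - \<zeta> \<xi>) < e1"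
  proof -
    have "L2_norm (\<lambda>\<xi>. fourier h \<xi> - \<zeta> \<xi>) = L2_norm (\<lambda>\<xi>. fourier h \<xi> - fourier \<eta> \<xi>)"
    proof (rule L2_norm_cong_AE)
      show "AE \<xi> in lborel. fourier h \<xi> - \<zeta> \<xi> = fourier h \<xi> - fourier \<eta> \<xi>" using f\<eta> by eventually_elim simp
    qed (use L2_measurable[OF fourier_L2(1)[OF h(1)]] L2_measurable[OF \<zeta>] L2_measurable[OF fourier_L2(1)[OF \<eta>]] in measurable)
    moreover have "L2_norm (\<lambda>x. h x - \<eta> x) < e1" using r by (simp only: h_def)
    ultimately show ?thesis by (simp only: L2_norm_fourier_difference[OF h(1) \<eta>])
  qed
  have "\<forall>\<^sub>F R in at_top. L2_norm (\<lambda>\<xi>. (1 - F1 (norm \<xi> / R)) *\<^sub>R \<zeta> \<xi> - \<zeta> \<xi>) < e1 \<and> 1 \<le> R"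
    by (rule eventually_conj[OF order_tendstoD(2)[OF L2_cutoff_tendsto[OF F1 \<zeta>] e1] eventually_ge_at_top])
  then obtain R where R: "L2_norm (\<lambda>\<xi>. (1 - F1 (norm \<xi> / R)) *\<^sub>R \<zeta> \<xi> - \<zeta> \<xi>) < e1" "1 \<le> R"
    using eventually_happens trivial_limit_at_top_linorder by blast
  let ?\<chi> = "\<lambda>\<xi>::'a. 1 - F1 (norm \<xi> / R)"
  have \<chi>b: "\<bar>?\<chi> \<xi>\<bar> \<le> 1 + B" for \<xi> using B(2)[of "norm \<xi> / R"] by linarith
  have \<chi>m: "?\<chi> \<in> borel_measurable borel" by measurable
  have \<chi>L: "(\<lambda>\<xi>. of_real (?\<chi> \<xi>) :: complex) \<in> L2"
    using bounded_supp_L2_integrable(1)[OF bounded_supp_cutoff[OF F1, of R 0]] R(2) by simp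
  note fh = fourier_L2(1)[OF h(1)]
  define z where "z = (\<lambda>\<xi>. ?\<chi> \<xi> *\<^sub>R fourier h \<xi>)"
  have zL: "z \<in> L2" unfolding z_def by (rule L2_scaleR_bounded(1)[OF fh \<chi>m \<chi>b])
  have dz: "L2_norm (\<lambda>\<xi>. z \<xi> - \<zeta> \<xi>) \<le> (2 + B) * e1"
  proof -
    note cL = L2_scaleR_bounded[OF L2_diff(1)[OF fh \<zeta>] \<chi>m \<chi>b]
    note \<chi>\<zeta> = L2_scaleR_bounded(1)[OF \<zeta> \<chi>m \<chi>b]
    have "L2_norm (\<lambda>\<xi>. z \<xi> - \<zeta> \<xi>) \<le> L2_norm (\<lambda>\<xi>. z \<xi> - ?\<chi> \<xi> *\<^sub>R \<zeta> \<xi>) + L2_norm (\<lambda>\<xi>. ?\<chi> \<xi> *\<^sub>R \<zeta> \<xi> - \<zeta> \<xi>)"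
      by (rule L2_triangle[OF zL \<chi>\<zeta> \<zeta>])
    also have "(\<lambda>\<xi>. z \<xi> - ?\<chi> \<xi> *\<^sub>R \<zeta> \<xi>) = (\<lambda>\<xi>. ?\<chi> \<xi> *\<^sub>R (fourier h \<xi> - \<zeta> \<xi>))"
      by (simp only: z_def scaleR_right_diff_distrib)
    also have "L2_norm \<dots> + L2_norm (\<lambda>\<xi>. ?\<chi> \<xi> *\<^sub>R \<zeta> \<xi> - \<zeta> \<xi>) \<le> (1 + B) * e1 + e1"
      using order_trans[OF cL(2) mult_left_mono[OF less_imp_le[OF d1]]] R(1) B(1) by (intro add_mono) auto
    finally show ?thesis by (simp add: algebra_simps)
  qed
  define H where "H = (\<integral>x. norm (h x) \<partial>lborel)"
  have H0: "0 \<le> H" by (simp add: H_def)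
  define S where "S t = c * (K * R powr (real DIM('a) / 2 + 1) * t powr (1 - real DIM('a) / 2)) * H" for t :: real
  have "(S \<longlongrightarrow> c * (K * R powr (real DIM('a) / 2 + 1) * 0) * H) at_top"
    unfolding S_def using dim by (intro tendsto_mult tendsto_const tendsto_neg_powr filterlim_ident) simp
  then have "\<forall>\<^sub>F t in at_top. S t < e / 2 \<and> R \<le> t"
    using e by (intro eventually_conj order_tendstoD(2) eventually_ge_at_top) auto
  then obtain t0 where t0: "\<And>t. t0 \<le> t \<Longrightarrow> S t < e / 2 \<and> R \<le> t" unfolding eventually_at_top_linorder by blast
  show ?thesis
  proof (intro exI[of _ "max t0 0"] conjI allI impI)
    fix t T :: real assume t: "max t0 0 \<le> t" "t \<le> T"
    then have t': "R \<le> t" "S t < e / 2" "0 \<le> t" "0 \<le> T" using t0[of t] by auto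
    let ?Y = "\<lambda>\<xi>. fourier (X T) \<xi> - fourier (X t) \<xi>"
    note Y = L2_diff[OF hat_L2[OF t'(4)] hat_L2[OF t'(3)]]
    have YE: "L2_norm ?Y \<le> 2 * E" using Y(2) hat_bound[OF t'(4)] hat_bound[OF t'(3)] by linarith
    let ?G = "\<lambda>\<xi>. ?Y \<xi> * of_real (?\<chi> \<xi>)"
    have G1: "integrable lborel ?G" by (rule L2_mult_integrable[OF Y(1) \<chi>L])
    have G2: "?G \<in> L2"
      using L2_scaleR_bounded(1)[OF Y(1) \<chi>m \<chi>b] by (simp add: scaleR_conv_of_real mult.commute)
    have FG: "norm (fourier_integral ?G x) \<le> c * (K * R powr (real DIM('a) / 2 + 1) * t powr (1 - real DIM('a) / 2))" for x
    proof -
      have "cis (- (\<xi> \<bullet> x)) * ?G \<xi> = ?Y \<xi> * (cis ((- x) \<bullet> \<xi>) * of_real (?\<chi> \<xi>))" for \<xi>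
        by (simp add: inner_commute mult_ac)
      then have "fourier_integral ?G x = of_real c * (\<integral>\<xi>. ?Y \<xi> * (cis ((- x) \<bullet> \<xi>) * of_real (?\<chi> \<xi>)) \<partial>lborel)"
        unfolding fourier_integral_def c_def[symmetric] by (simp only:)
      then show ?thesis
        using mult_left_mono[OF decay[OF R(2) t'(1) t(2), of "- x"] c0] c0 by (simp only: norm_mult norm_of_real abs_of_nonneg)
    qed
    \<comment> \<open>The cut-off goes to the difference of the profiles and Parseval moves the
      transform off h: a function small in supremum norm is integrated against an integrable
      one.\<close>
    have "(\<integral>\<xi>. ?Y \<xi> * z \<xi> \<partial>lborel) = (\<integral>\<xi>. ?G \<xi> * fourier h \<xi> \<partial>lborel)"
      by (simp only: z_def scaleR_conv_of_real mult.assoc)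
    also have "\<dots> = (\<integral>x. fourier ?G x * h x \<partial>lborel)" by (rule Parseval[OF G2 h(1), symmetric])
    also have "\<dots> = (\<integral>x. fourier_integral ?G x * h x \<partial>lborel)"
    proof (rule integral_cong_AE)
      show "AE x in lborel. fourier ?G x * h x = fourier_integral ?G x * h x"
        using fourier_eq_integral_AE[OF G2 G1] by eventually_elim simp
    qed (use L2_measurable[OF fourier_L2(1)[OF G2]] L2_measurable[OF h(1)] fourier_integral_measurable[OF L2_measurable[OF G2]] in measurable)
    also have "norm \<dots> \<le> (\<integral>x. c * (K * R powr (real DIM('a) / 2 + 1) * t powr (1 - real DIM('a) / 2)) * norm (h x) \<partial>lborel)"
    proof (rule Bochner_Integration.integral_norm_bound_integral)
      let ?c = "c * (K * R powr (real DIM('a) / 2 + 1) * t powr (1 - real DIM('a) / 2))"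
      show le1: "norm (fourier_integral ?G x * h x) \<le> ?c * norm (h x)" for x
        unfolding norm_mult[of _ "h x"] by (rule mult_right_mono[OF FG norm_ge_zero])
      show i1: "integrable lborel (\<lambda>x. ?c * norm (h x))" by (rule integrable_mult_right[OF integrable_norm[OF h(2)]])
      show "integrable lborel (\<lambda>x. fourier_integral ?G x * h x)"
      proof (rule Bochner_Integration.integrable_bound[OF i1])
        show "(\<lambda>x. fourier_integral ?G x * h x) \<in> borel_measurable lborel"
          using fourier_integral_measurable[OF L2_measurable[OF G2]] L2_measurable[OF h(1)] by measurable
        show "AE x in lborel. norm (fourier_integral ?G x * h x) \<le> norm (?c * norm (h x))"
          by (intro AE_I2 order_trans[OF le1]) (simp only: real_norm_def abs_ge_self)
      qed
    qed
    also have "\<dots> = S t" unfolding S_def H_def by (rule integral_mult_right_zero)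
    finally have "norm (\<integral>\<xi>. ?Y \<xi> * z \<xi> \<partial>lborel) \<le> e / 2" using t'(2) by linarith
    moreover have "L2_norm ?Y * L2_norm (\<lambda>\<xi>. z \<xi> - \<zeta> \<xi>) \<le> e / 2"
    proof -
      have "L2_norm ?Y * L2_norm (\<lambda>\<xi>. z \<xi> - \<zeta> \<xi>) \<le> (2 * E + 1) * ((2 + B) * e1)"
        using YE dz E_nonneg L2_norm_nonneg by (intro mult_mono) auto
      also have "\<dots> = e / 2"
      proof -
        have "a * (b * (e / (2 * a * b))) = e / 2" if "a \<noteq> 0" "b \<noteq> 0" for a b :: real using that by (simp add: field_simps)
        moreover have "2 * E + 1 \<noteq> 0" "2 + B \<noteq> 0" using E_nonneg B(1) by linarith+
        ultimately show ?thesis unfolding e1_def .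
      qed
      finally show ?thesis .
    qed
    ultimately show "norm (\<integral>\<xi>. ?Y \<xi> * \<zeta> \<xi> \<partial>lborel) \<le> e"
      using L2_pairing_subst[OF Y(1) zL \<zeta>] by linarith
  qed simp
qed

text \<open>Integer times provide a sequence. Each pairing is Cauchy, its limit is linear in \<zeta>
  and bounded by E times the norm, and the Riesz theorem represents it.\<close>

lemma weak_limit:
  "\<exists>Z\<in>L2. \<forall>\<zeta>\<in>L2. (\<lambda>k. \<integral>\<xi>. fourier (X (real k)) \<xi> * \<zeta> \<xi> \<partial>lborel) \<longlonglongrightarrow> (\<integral>\<xi>. Z \<xi> * \<zeta> \<xi> \<partial>lborel)"
proof -
  define a where "a \<zeta> k = (\<integral>\<xi>. fourier (X (real k)) \<xi> * \<zeta> \<xi> \<partial>lborel)" for \<zeta> k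
  have conv: "a \<zeta> \<longlonglongrightarrow> lim (a \<zeta>)" if \<zeta>: "\<zeta> \<in> L2" for \<zeta>
  proof -
    have "Cauchy (a \<zeta>)"
    proof (rule CauchyI')
      fix e :: real assume e: "0 < e"
      then obtain t0 where t0: "0 \<le> t0" "\<And>t T. t0 \<le> t \<Longrightarrow> t \<le> T \<Longrightarrow>
          norm (\<integral>\<xi>. (fourier (X T) \<xi> - fourier (X t) \<xi>) * \<zeta> \<xi> \<partial>lborel) \<le> e / 2"
        using pairing_Cauchy[OF \<zeta>, of "e / 2"] by auto
      show "\<exists>M. \<forall>m\<ge>M. \<forall>k>m. dist (a \<zeta> m) (a \<zeta> k) < e"
      proof (intro exI[of _ "nat \<lceil>t0\<rceil>"] allI impI)
        fix m k :: nat assume m: "nat \<lceil>t0\<rceil> \<le> m" "m < k"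
        have "(\<integral>\<xi>. (fourier (X (real k)) \<xi> - fourier (X (real m)) \<xi>) * \<zeta> \<xi> \<partial>lborel) = a \<zeta> k - a \<zeta> m"
          unfolding a_def left_diff_distrib by (intro Bochner_Integration.integral_diff L2_mult_integrable hat_L2 \<zeta>) auto
        moreover have "norm (\<integral>\<xi>. (fourier (X (real k)) \<xi> - fourier (X (real m)) \<xi>) * \<zeta> \<xi> \<partial>lborel) \<le> e / 2"
          using m by (intro t0(2)) linarith+
        ultimately show "dist (a \<zeta> m) (a \<zeta> k) < e" using e by (simp add: dist_norm norm_minus_commute)
      qed
    qed
    then show ?thesis by (simp add: Cauchy_convergent_iff convergent_LIMSEQ_iff)
  qed
  have "\<exists>Z\<in>L2. \<forall>\<zeta>\<in>L2. lim (a \<zeta>) = (\<integral>\<xi>. Z \<xi> * \<zeta> \<xi> \<partial>lborel)"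
  proof (rule L2_Riesz)
    fix f g :: "'a \<Rightarrow> complex" assume fg: "f \<in> L2" "g \<in> L2"
    have "a (\<lambda>x. f x + g x) k = a f k + a g k" for k
      unfolding a_def distrib_left by (intro Bochner_Integration.integral_add L2_mult_integrable hat_L2 fg) auto
    then have "a (\<lambda>x. f x + g x) = (\<lambda>k. a f k + a g k)" by (rule ext)
    then show "lim (a (\<lambda>x. f x + g x)) = lim (a f) + lim (a g)"
      using tendsto_add[OF conv[OF fg(1)] conv[OF fg(2)]] by (simp add: limI)
  next
    fix c and f :: "'a \<Rightarrow> complex" assume f: "f \<in> L2"
    have "a (\<lambda>x. c * f x) k = c * a f k" for k
      unfolding a_def by (simp only: mult.left_commute[of _ c] integral_mult_right_zero)
    then have "a (\<lambda>x. c * f x) = (\<lambda>k. c * a f k)" by (rule ext)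
    then show "lim (a (\<lambda>x. c * f x)) = c * lim (a f)"
      using tendsto_mult[OF tendsto_const conv[OF f], of c] by (simp add: limI)
  next
    fix f :: "'a \<Rightarrow> complex" assume f: "f \<in> L2"
    show "norm (lim (a f)) \<le> E * L2_norm f"
    proof (rule Lim_bounded[OF tendsto_norm[OF conv[OF f]], of 0], intro allI impI)
      fix k
      show "norm (a f k) \<le> E * L2_norm f"
        unfolding a_def using mult_right_mono[OF hat_bound[of "real k"] L2_norm_nonneg[of f]]
        by (intro order_trans[OF L2_pairing_bound[OF hat_L2 f]]) auto
    qed
  qed
  then obtain Z where Z: "Z \<in> L2" "\<And>\<zeta>. \<zeta> \<in> L2 \<Longrightarrow> lim (a \<zeta>) = (\<integral>\<xi>. Z \<xi> * \<zeta> \<xi> \<partial>lborel)" by blast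
  show ?thesis
  proof (intro bexI[OF _ Z(1)] ballI)
    fix \<zeta> :: "'a \<Rightarrow> complex" assume \<zeta>: "\<zeta> \<in> L2"
    show "(\<lambda>k. \<integral>\<xi>. fourier (X (real k)) \<xi> * \<zeta> \<xi> \<partial>lborel) \<longlonglongrightarrow> (\<integral>\<xi>. Z \<xi> * \<zeta> \<xi> \<partial>lborel)"
      using conv[OF \<zeta>] unfolding Z(2)[OF \<zeta>] unfolding a_def[abs_def] .
  qed
qed


text \<open>Z, the inverse transform of the weak limit, is chosen before \<open>Fc\<close>, \<alpha>
  and \<beta>; this order of quantifiers is the asserted independence of the parameters.\<close>

theorem scattering_limit:
  "\<exists>Z\<in>L2. \<forall>Fc \<alpha> \<beta>. smooth_cutoff Fc \<longrightarrow> (\<alpha>, \<beta>) \<in> I_nl DIM('a) \<longrightarrow>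
     (\<forall>\<^sub>F t in at_top. F_scalar Fc F1 \<alpha> \<beta> t (X t) \<in> L2) \<and>
     ((\<lambda>t. L2_norm (\<lambda>x. F_scalar Fc F1 \<alpha> \<beta> t (X t) x - Z x)) \<longlongrightarrow> 0) at_top"
proof -
  define n where "n = real DIM('a)"
  define c where "c = (2 * pi) powr (- n / 2)"
  have c0: "0 \<le> c" by (simp add: c_def)
  obtain Y where Y: "Y \<in> L2" and Ylim: "\<And>\<zeta>. \<zeta> \<in> L2 \<Longrightarrow>
      (\<lambda>k. \<integral>\<xi>. fourier (X (real k)) \<xi> * \<zeta> \<xi> \<partial>lborel) \<longlonglongrightarrow> (\<integral>\<xi>. Y \<xi> * \<zeta> \<xi> \<partial>lborel)"
    using weak_limit by blast
  obtain B1 where B1: "0 \<le> B1" "\<And>l. \<bar>F1 l\<bar> \<le> B1" using smooth_cutoff_bounded[OF F1] by blast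
  note [measurable] = smooth_cutoff_measurable[OF F1]
  define Z where "Z = inverse_fourier Y"
  have Z: "Z \<in> L2" unfolding Z_def by (rule inverse_fourier_L2(1)[OF Y])
  have FZ: "AE \<xi> in lborel. fourier Z \<xi> = Y \<xi>" unfolding Z_def by (rule fourier_inverse_fourier[OF Y])
  \<comment> \<open>The later time in \<open>decay\<close> is sent to infinity along the integers.
    The localising function lies in L2, so weak convergence suffices, and the bound is uniform in
    the later time.\<close>
  have dec: "norm (\<integral>\<xi>. (fourier (X t) \<xi> - Y \<xi>) * (cis (x \<bullet> \<xi>) * of_real (1 - F1 (norm \<xi> / R))) \<partial>lborel)
      \<le> K * R powr (n / 2 + 1) * t powr (1 - n / 2)" if R: "1 \<le> R" "R \<le> t" for R t and x :: 'a
  proof -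
    let ?\<zeta> = "\<lambda>\<xi>::'a. cis (x \<bullet> \<xi>) * of_real (1 - F1 (norm \<xi> / R))"
    have \<zeta>: "?\<zeta> \<in> L2" using bounded_supp_L2_integrable(1)[OF bounded_supp_cutoff[OF F1, of R x]] R by simp
    have t: "0 \<le> t" using R by linarith
    have sub: "(\<integral>\<xi>. (f \<xi> - g \<xi>) * ?\<zeta> \<xi> \<partial>lborel) = (\<integral>\<xi>. f \<xi> * ?\<zeta> \<xi> \<partial>lborel) - (\<integral>\<xi>. g \<xi> * ?\<zeta> \<xi> \<partial>lborel)"
      if "f \<in> L2" "g \<in> L2" for f g :: "'a \<Rightarrow> complex"
      unfolding left_diff_distrib by (intro Bochner_Integration.integral_diff L2_mult_integrable that \<zeta>)
    have "(\<lambda>k. norm ((\<integral>\<xi>. fourier (X (real k)) \<xi> * ?\<zeta> \<xi> \<partial>lborel) - (\<integral>\<xi>. fourier (X t) \<xi> * ?\<zeta> \<xi> \<partial>lborel)))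
      \<longlonglongrightarrow> norm ((\<integral>\<xi>. Y \<xi> * ?\<zeta> \<xi> \<partial>lborel) - (\<integral>\<xi>. fourier (X t) \<xi> * ?\<zeta> \<xi> \<partial>lborel))"
      by (rule tendsto_norm[OF tendsto_diff[OF Ylim[OF \<zeta>] tendsto_const]])
    then have "norm ((\<integral>\<xi>. Y \<xi> * ?\<zeta> \<xi> \<partial>lborel) - (\<integral>\<xi>. fourier (X t) \<xi> * ?\<zeta> \<xi> \<partial>lborel)) \<le> K * R powr (n / 2 + 1) * t powr (1 - n / 2)"
    proof (rule Lim_bounded[of _ _ "nat \<lceil>t\<rceil>"], intro allI impI)
      fix k assume "nat \<lceil>t\<rceil> \<le> k"
      then have k: "t \<le> real k" by linarith
      show "norm ((\<integral>\<xi>. fourier (X (real k)) \<xi> * ?\<zeta> \<xi> \<partial>lborel) - (\<integral>\<xi>. fourier (X t) \<xi> * ?\<zeta> \<xi> \<partial>lborel)) \<le> K * R powr (n / 2 + 1) * t powr (1 - n / 2)"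
        using decay[OF R k, of x] unfolding sub[OF hat_L2[OF of_nat_0_le_iff] hat_L2[OF t]] n_def .
    qed
    then show ?thesis unfolding sub[OF hat_L2[OF t] Y] by (simp only: norm_minus_commute)
  qed
  have main: "(\<forall>\<^sub>F t in at_top. F_scalar Fc F1 \<alpha> \<beta> t (X t) \<in> L2) \<and>
     ((\<lambda>t. L2_norm (\<lambda>x. F_scalar Fc F1 \<alpha> \<beta> t (X t) x - Z x)) \<longlongrightarrow> 0) at_top"
    if Fc: "smooth_cutoff Fc" and ab: "(\<alpha>, \<beta>) \<in> I_nl DIM('a)" for Fc \<alpha> \<beta>
  proof -
    have \<alpha>: "0 < \<alpha>" and \<beta>: "0 < \<beta>" "\<beta> < 1" and \<beta>n: "\<beta> < n / (n + 3) * (1 - \<alpha>) - 2 / (n + 3)"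
      using ab by (auto simp: I_nl_def n_def)
    obtain Bc where Bc: "0 \<le> Bc" "\<And>l. \<bar>Fc l\<bar> \<le> Bc" using smooth_cutoff_bounded[OF Fc] by blast
    note [measurable] = smooth_cutoff_measurable[OF Fc]
    let ?\<chi> = "\<lambda>t \<xi>::'a. 1 - F1 (norm \<xi> / t powr \<beta>)" and ?g = "\<lambda>t x::'a. 1 - Fc (norm x / t powr \<alpha>)"
    have \<chi>b: "\<bar>?\<chi> t \<xi>\<bar> \<le> 1 + B1" for t \<xi> using B1(2)[of "norm \<xi> / t powr \<beta>"] by linarith
    have gb: "\<bar>?g t x\<bar> \<le> 1 + Bc" for t x using Bc(2)[of "norm x / t powr \<alpha>"] by linarith
    have \<chi>m: "?\<chi> t \<in> borel_measurable borel" for t by measurable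
    have gm: "?g t \<in> borel_measurable borel" for t by measurable
    have fmL: "fourier_mult (?\<chi> t) f \<in> L2" if "f \<in> L2" for f :: "'a \<Rightarrow> complex" and t
      by (rule fourier_mult_L2[OF fourier_mult_bounded[OF that \<chi>m \<chi>b]])
    have FL: "F_scalar Fc F1 \<alpha> \<beta> t f \<in> L2" if "f \<in> L2" for f :: "'a \<Rightarrow> complex" and t
      unfolding F_scalar_def by (rule L2_scaleR_bounded(1)[OF fmL[OF that] gm gb])
    \<comment> \<open>Supremum bound for the compared functions: 1 + Bc from the spatial cut-off, c
      from the normalisation of the inverse transform, the rest from \<open>dec\<close> at R =
      t^\<beta>.\<close>
    define A where "A t = (1 + Bc) * (c * (K * (t powr \<beta>) powr (n / 2 + 1) * t powr (1 - n / 2)))" for t :: real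
    define V where "V = unit_ball_vol n"
    have V0: "0 \<le> V" by (simp add: V_def n_def)
    have diff: "L2_norm (\<lambda>x. F_scalar Fc F1 \<alpha> \<beta> t (X t) x - F_scalar Fc F1 \<alpha> \<beta> t Z x) \<le> A t * sqrt (V * (t powr \<alpha>) ^ DIM('a))"
      if t: "1 \<le> t" for t
    proof -
      have t0: "0 \<le> t" using t by simp
      \<comment> \<open>As 0 < \<beta> < 1 and t >= 1, the frequency t^\<beta> lies in the range 1
        <= R <= t of the dispersive bound.\<close>
      have R: "1 \<le> t powr \<beta>" "t powr \<beta> \<le> t"
        using t \<beta> ge_one_powr_ge_zero[of t \<beta>] powr_mono[of \<beta> 1 t] by auto
      have supp: "?\<chi> t \<xi> = 0" if "t powr \<beta> < norm \<xi>" for \<xi> :: 'a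
      proof -
        have "1 \<le> norm \<xi> / t powr \<beta>" using that R(1) by (subst pos_le_divide_eq) auto
        then show ?thesis using F1 unfolding smooth_cutoff_def by simp
      qed
      have e: "AE x in lborel. fourier_mult (?\<chi> t) f x = of_real c * (\<integral>\<xi>. cis (x \<bullet> \<xi>) * (?\<chi> t \<xi> *\<^sub>R fourier f \<xi>) \<partial>lborel)"
        if "f \<in> L2" for f
        unfolding c_def n_def by (rule fourier_mult_eq_integral[OF that \<chi>m \<chi>b supp])
      note e1 = e[OF X_L2[OF t0]] and e2 = e[OF Z]
      have i: "integrable lborel (\<lambda>\<xi>. cis (x \<bullet> \<xi>) * (?\<chi> t \<xi> *\<^sub>R f \<xi>))" if "f \<in> L2" for f :: "'a \<Rightarrow> complex" and x
      proof -
        have "(\<lambda>\<xi>. cis (x \<bullet> \<xi>) * (?\<chi> t \<xi> *\<^sub>R f \<xi>)) = (\<lambda>\<xi>. f \<xi> * (cis (x \<bullet> \<xi>) * of_real (?\<chi> t \<xi>)))"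
          by (simp add: fun_eq_iff scaleR_conv_of_real mult_ac)
        moreover have "integrable lborel \<dots>"
          using R by (intro L2_mult_integrable that bounded_supp_L2_integrable(1)[OF bounded_supp_cutoff[OF F1]]) simp
        ultimately show ?thesis by simp
      qed
      have "AE x in lborel. norm (F_scalar Fc F1 \<alpha> \<beta> t (X t) x - F_scalar Fc F1 \<alpha> \<beta> t Z x) \<le> A t * indicator (cball 0 (t powr \<alpha>)) x"
        using e1 e2
      proof eventually_elim
        case (elim x)
        let ?I = "\<integral>\<xi>. (fourier (X t) \<xi> - Y \<xi>) * (cis (x \<bullet> \<xi>) * of_real (?\<chi> t \<xi>)) \<partial>lborel"
        have "(\<integral>\<xi>. cis (x \<bullet> \<xi>) * (?\<chi> t \<xi> *\<^sub>R fourier Z \<xi>) \<partial>lborel) = (\<integral>\<xi>. cis (x \<bullet> \<xi>) * (?\<chi> t \<xi> *\<^sub>R Y \<xi>) \<partial>lborel)"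
        proof (rule integral_cong_AE)
          show "AE \<xi> in lborel. cis (x \<bullet> \<xi>) * (?\<chi> t \<xi> *\<^sub>R fourier Z \<xi>) = cis (x \<bullet> \<xi>) * (?\<chi> t \<xi> *\<^sub>R Y \<xi>)"
            using FZ by eventually_elim simp
        qed (use L2_measurable[OF fourier_L2(1)[OF Z]] L2_measurable[OF Y] in measurable)
        moreover have "?I = (\<integral>\<xi>. cis (x \<bullet> \<xi>) * (?\<chi> t \<xi> *\<^sub>R fourier (X t) \<xi>) - cis (x \<bullet> \<xi>) * (?\<chi> t \<xi> *\<^sub>R Y \<xi>) \<partial>lborel)"
          by (rule Bochner_Integration.integral_cong) (simp_all add: scaleR_conv_of_real algebra_simps)
        moreover have "\<dots> = (\<integral>\<xi>. cis (x \<bullet> \<xi>) * (?\<chi> t \<xi> *\<^sub>R fourier (X t) \<xi>) \<partial>lborel) - (\<integral>\<xi>. cis (x \<bullet> \<xi>) * (?\<chi> t \<xi> *\<^sub>R Y \<xi>) \<partial>lborel)"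
          by (intro Bochner_Integration.integral_diff i hat_L2 t0 Y)
        ultimately have "fourier_mult (?\<chi> t) (X t) x - fourier_mult (?\<chi> t) Z x = of_real c * ?I"
          unfolding elim by (simp only: right_diff_distrib)
        then have "F_scalar Fc F1 \<alpha> \<beta> t (X t) x - F_scalar Fc F1 \<alpha> \<beta> t Z x = ?g t x *\<^sub>R (of_real c * ?I)"
          unfolding F_scalar_def by (simp only: scaleR_right_diff_distrib[symmetric])
        then have eq: "norm (F_scalar Fc F1 \<alpha> \<beta> t (X t) x - F_scalar Fc F1 \<alpha> \<beta> t Z x) = \<bar>?g t x\<bar> * (c * norm ?I)"
          using c0 by (simp only: norm_scaleR norm_mult norm_of_real abs_of_nonneg)
        show ?case
        proof (cases "norm x \<le> t powr \<alpha>")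
          case True
          have "\<bar>?g t x\<bar> * (c * norm ?I) \<le> A t"
            unfolding A_def using dec[OF R, of x] by (intro mult_mono gb mult_left_mono c0) (use Bc(1) c0 in auto)
          then show ?thesis using True eq by simp
        next
          case False
          have "0 < t powr \<alpha>" using t by simp
          then have "1 \<le> norm x / t powr \<alpha>" using False by (subst pos_le_divide_eq) auto
          then have "?g t x = 0" using Fc unfolding smooth_cutoff_def by simp
          then show ?thesis using False eq by simp
        qed
      qed
      then show ?thesis unfolding V_def n_def
      proof (rule L2_norm_le_on_ball(2)[rotated 3])
        show "(\<lambda>x. F_scalar Fc F1 \<alpha> \<beta> t (X t) x - F_scalar Fc F1 \<alpha> \<beta> t Z x) \<in> borel_measurable borel"
          by (rule L2_measurable[OF L2_diff(1)[OF FL[OF X_L2[OF t0]] FL[OF Z]]])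
        show "0 \<le> A t" using Bc(1) c0 K by (simp add: A_def)
      qed simp
    qed
    txt \<open>The supremum bound costs a factor \<open>t powr (\<alpha> * n / 2)\<close> on the support of the spatial cut-off;
      the definition of \<open>I_nl\<close> makes the total exponent negative.\<close>
    have lim1: "((\<lambda>t. A t * sqrt (V * (t powr \<alpha>) ^ DIM('a))) \<longlongrightarrow> 0) at_top"
    proof -
      define p where "p = \<beta> * (n / 2 + 1) + (1 - n / 2) + \<alpha> * n / 2"
      have n3: "3 \<le> n" using dim by (simp add: n_def)
      \<comment> \<open>Twice p is \<beta> (n + 2) - (n (1 - \<alpha>) - 2), and \<beta> (n + 2) <=
        \<beta> (n + 3) as \<beta> > 0.\<close>
      have "p < 0"
      proof -
        have "\<beta> * (n + 3) < n * (1 - \<alpha>) - 2"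
          using \<beta>n n3 by (simp add: pos_less_divide_eq flip: diff_divide_distrib)
        moreover have "\<beta> * (n / 2 + 1) \<le> \<beta> * ((n + 3) / 2)" using \<beta>(1) by (intro mult_left_mono) auto
        ultimately show ?thesis unfolding p_def by (simp add: algebra_simps)
      qed
      define k where "k = (1 + Bc) * c * K * sqrt V"
      have "((\<lambda>t. k * t powr p) \<longlongrightarrow> k * 0) at_top"
        by (intro tendsto_mult tendsto_const tendsto_neg_powr filterlim_ident \<open>p < 0\<close>)
      moreover have "\<forall>\<^sub>F t in at_top. k * t powr p = A t * sqrt (V * (t powr \<alpha>) ^ DIM('a))"
        using eventually_gt_at_top[of 0]
      proof eventually_elim
        case (elim t)
        have "sqrt ((t powr \<alpha>) ^ DIM('a)) = t powr (\<alpha> * n / 2)"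
          using elim by (simp add: powr_half_sqrt[symmetric] powr_powr n_def flip: powr_realpow)
        moreover have "t powr p = t powr (\<beta> * (n / 2 + 1)) * t powr (1 - n / 2) * t powr (\<alpha> * n / 2)"
          unfolding p_def powr_add ..
        ultimately show ?case unfolding A_def k_def real_sqrt_mult powr_powr by (simp only: mult_ac)
      qed
      ultimately show ?thesis by (simp add: filterlim_cong[OF refl refl])
    qed
    have pow: "filterlim (\<lambda>t::real. t powr a) at_top at_top" if "0 < a" for a
      using that by real_asymp
    have lim2: "((\<lambda>t. L2_norm (\<lambda>x. F_scalar Fc F1 \<alpha> \<beta> t Z x - Z x)) \<longlongrightarrow> 0) at_top"
    proof (rule Lim_null_comparison[OF always_eventually])
      let ?d = "\<lambda>t. (1 + Bc) * L2_norm (\<lambda>\<xi>. ?\<chi> t \<xi> *\<^sub>R fourier Z \<xi> - fourier Z \<xi>) + L2_norm (\<lambda>x. ?g t x *\<^sub>R Z x - Z x)"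
      have "(?d \<longlongrightarrow> (1 + Bc) * 0 + 0) at_top"
        by (intro tendsto_add tendsto_mult tendsto_const filterlim_compose[OF L2_cutoff_tendsto[OF F1 fourier_L2(1)[OF Z]] pow[OF \<beta>(1)]]
            filterlim_compose[OF L2_cutoff_tendsto[OF Fc Z] pow[OF \<alpha>]])
      then show "(?d \<longlongrightarrow> 0) at_top" by simp
      show "\<forall>t. norm (L2_norm (\<lambda>x. F_scalar Fc F1 \<alpha> \<beta> t Z x - Z x)) \<le> ?d t"
      proof
        fix t
        let ?f = "fourier_mult (?\<chi> t) Z"
        note f = fmL[OF Z, of t]
        note s = L2_scaleR_bounded[OF L2_diff(1)[OF f Z] gm gb, of t]
        have "L2_norm (\<lambda>x. F_scalar Fc F1 \<alpha> \<beta> t Z x - Z x)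
          \<le> L2_norm (\<lambda>x. F_scalar Fc F1 \<alpha> \<beta> t Z x - ?g t x *\<^sub>R Z x) + L2_norm (\<lambda>x. ?g t x *\<^sub>R Z x - Z x)"
          by (rule L2_triangle[OF FL[OF Z] L2_scaleR_bounded(1)[OF Z gm gb] Z])
        also have "(\<lambda>x. F_scalar Fc F1 \<alpha> \<beta> t Z x - ?g t x *\<^sub>R Z x) = (\<lambda>x. ?g t x *\<^sub>R (?f x - Z x))"
          by (simp only: F_scalar_def scaleR_right_diff_distrib)
        also have "L2_norm \<dots> \<le> (1 + Bc) * L2_norm (\<lambda>x. ?f x - Z x)" by (rule s(2))
        also have "L2_norm (\<lambda>x. ?f x - Z x) = L2_norm (\<lambda>\<xi>. fourier ?f \<xi> - fourier Z \<xi>)"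
          by (rule L2_norm_fourier_difference[OF f Z, symmetric])
        also have "\<dots> = L2_norm (\<lambda>\<xi>. ?\<chi> t \<xi> *\<^sub>R fourier Z \<xi> - fourier Z \<xi>)"
        proof (rule L2_norm_cong_AE)
          show "AE \<xi> in lborel. fourier ?f \<xi> - fourier Z \<xi> = ?\<chi> t \<xi> *\<^sub>R fourier Z \<xi> - fourier Z \<xi>"
            using fourier_fourier_mult[OF fourier_mult_bounded[OF Z \<chi>m \<chi>b]] by eventually_elim simp
        qed (use L2_measurable[OF fourier_L2(1)[OF Z]] L2_measurable[OF fourier_L2(1)[OF f]] in measurable)
        finally show "norm (L2_norm (\<lambda>x. F_scalar Fc F1 \<alpha> \<beta> t Z x - Z x)) \<le> ?d t"
          by (simp add: L2_norm_nonneg)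
      qed
    qed
    have "((\<lambda>t. L2_norm (\<lambda>x. F_scalar Fc F1 \<alpha> \<beta> t (X t) x - Z x)) \<longlongrightarrow> 0) at_top"
    proof (rule Lim_null_comparison[OF eventually_mono[OF eventually_ge_at_top[of 1]]])
      show "((\<lambda>t. A t * sqrt (V * (t powr \<alpha>) ^ DIM('a)) + L2_norm (\<lambda>x. F_scalar Fc F1 \<alpha> \<beta> t Z x - Z x)) \<longlongrightarrow> 0) at_top"
        using tendsto_add[OF lim1 lim2] by simp
      fix t :: real assume t: "1 \<le> t"
      then have "X t \<in> L2" by (intro X_L2) simp
      from L2_triangle[OF FL[OF this] FL[OF Z] Z, of t t] diff[OF t]
      show "norm (L2_norm (\<lambda>x. F_scalar Fc F1 \<alpha> \<beta> t (X t) x - Z x)) \<le> A t * sqrt (V * (t powr \<alpha>) ^ DIM('a)) + L2_norm (\<lambda>x. F_scalar Fc F1 \<alpha> \<beta> t Z x - Z x)"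
        unfolding real_norm_def abs_of_nonneg[OF L2_norm_nonneg] by linarith
    qed
    moreover have "\<forall>\<^sub>F t in at_top. F_scalar Fc F1 \<alpha> \<beta> t (X t) \<in> L2"
      using eventually_ge_at_top[of 0] by eventually_elim (rule FL[OF X_L2])
    ultimately show ?thesis by blast
  qed
  then show ?thesis using Z by blast
qed

end

section \<open>The channel wave operator\<close>

text \<open>The energy norm dominates the L2 norms of both components because \<open>jbr\<close> is
  at least 1; so uniqueness reduces to that of L2 limits.\<close>

lemma H_limit_unique:
  assumes l: "H_limit X w F" "H_limit X w' F" and F: "F \<noteq> bot"
  shows "H_eq w w'"
proof -
  have L: "L2_limit (\<lambda>t. fst (X t)) (fst y) F" "L2_limit (\<lambda>t. snd (X t)) (snd y) F" if "H_limit X y F" for y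
  proof -
    have ev: "\<forall>\<^sub>F t in F. X t \<in> H_space" and y: "y \<in> H_space" and lim: "((\<lambda>t. H_norm (X t - y)) \<longlongrightarrow> 0) F"
      using that by (auto simp: H_limit_def)
    have d: "fst (X t - y) = (\<lambda>x. fst (X t) x - fst y x)" "snd (X t - y) = (\<lambda>x. snd (X t) x - snd y x)" for t
      by (simp_all add: fst_diff snd_diff fun_diff_def)
    have le: "\<forall>\<^sub>F t in F. L2_norm (fst (X t - y)) \<le> H_norm (X t - y) \<and> L2_norm (snd (X t - y)) \<le> H_norm (X t - y)"
      using ev
    proof eventually_elim
      case (elim t)
      have "fst (X t - y) \<in> H1" unfolding d using elim y by (intro H1_diff) (auto simp: H_space_def)
      then show ?case using L2_norm_le_H_norm by blast
    qed
    show "L2_limit (\<lambda>t. fst (X t)) (fst y) F"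
      unfolding L2_limit_def
    proof (intro conjI)
      show "\<forall>\<^sub>F t in F. fst (X t) \<in> L2" using ev by eventually_elim (auto simp: H_space_def H1_def)
      show "fst y \<in> L2" using y by (auto simp: H_space_def H1_def)
      show "((\<lambda>t. L2_norm (fst (X t) - fst y)) \<longlongrightarrow> 0) F" unfolding fst_diff[symmetric]
        by (rule Lim_null_comparison[OF eventually_mono[OF le] lim]) (use L2_norm_nonneg in simp)
    qed
    show "L2_limit (\<lambda>t. snd (X t)) (snd y) F"
      unfolding L2_limit_def
    proof (intro conjI)
      show "\<forall>\<^sub>F t in F. snd (X t) \<in> L2" using ev by eventually_elim (auto simp: H_space_def)
      show "snd y \<in> L2" using y by (auto simp: H_space_def)
      show "((\<lambda>t. L2_norm (snd (X t) - snd y)) \<longlongrightarrow> 0) F" unfolding snd_diff[symmetric]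
        by (rule Lim_null_comparison[OF eventually_mono[OF le] lim]) (use L2_norm_nonneg in simp)
    qed
  qed
  have "AE x in lborel. fst w x = fst w' x" by (rule L2_limit_unique_AE[OF L(1)[OF l(1)] L(1)[OF l(2)] F])
  moreover have "AE x in lborel. snd w x = snd w' x" by (rule L2_limit_unique_AE[OF L(2)[OF l(1)] L(2)[OF l(2)] F])
  ultimately show ?thesis unfolding H_eq_def by eventually_elim simp
qed

lemma inverse_jbr_bounded: "\<bar>1 / jbr \<xi>\<bar> \<le> 1"
  using jbr_ge_1[of \<xi>] jbr_pos[of \<xi>] by simp

lemma fourier_mult_inverse_jbr:
  assumes f: "f \<in> L2"
  shows "fourier_mult (\<lambda>\<xi>. 1 / jbr \<xi>) f \<in> H1"
    and "AE \<xi> in lborel. jbr \<xi> *\<^sub>R fourier (fourier_mult (\<lambda>\<xi>. 1 / jbr \<xi>) f) \<xi> = fourier f \<xi>"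
proof -
  have m: "(\<lambda>\<xi>::'a. 1 / jbr \<xi>) \<in> borel_measurable borel" by measurable
  note b = fourier_mult_bounded[OF f m inverse_jbr_bounded]
  show ae: "AE \<xi> in lborel. jbr \<xi> *\<^sub>R fourier (fourier_mult (\<lambda>\<xi>. 1 / jbr \<xi>) f) \<xi> = fourier f \<xi>"
    using fourier_fourier_mult[OF b]
  proof eventually_elim
    case (elim \<xi>) then show ?case using jbr_pos[of \<xi>] by simp
  qed
  have "(\<lambda>\<xi>. jbr \<xi> *\<^sub>R fourier (fourier_mult (\<lambda>\<xi>. 1 / jbr \<xi>) f) \<xi>) \<in> L2"
  proof (rule L2_cong_AE[OF _ fourier_L2(1)[OF f]])
    show "AE \<xi> in lborel. fourier f \<xi> = jbr \<xi> *\<^sub>R fourier (fourier_mult (\<lambda>\<xi>. 1 / jbr \<xi>) f) \<xi>"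
      using ae by eventually_elim simp
    show "(\<lambda>\<xi>. jbr \<xi> *\<^sub>R fourier (fourier_mult (\<lambda>\<xi>. 1 / jbr \<xi>) f) \<xi>) \<in> borel_measurable borel"
      using L2_measurable[OF fourier_L2(1)[OF fourier_mult_L2[OF b]]] by measurable
  qed
  then show "fourier_mult (\<lambda>\<xi>. 1 / jbr \<xi>) f \<in> H1" using fourier_mult_L2[OF b] by (simp add: H1_def)
qed

text \<open>The multiplier 1 / \<open>jbr\<close> is an isometry from L2 into H1, which reduces
  convergence in the energy space to L2 convergence of two scalar components.\<close>

lemma H_norm_fourier_mult_inverse_jbr:
  assumes f: "f \<in> L2" "f' \<in> L2"
  shows "H_norm ((fourier_mult (\<lambda>\<xi>. 1 / jbr \<xi>) f, g) - (fourier_mult (\<lambda>\<xi>. 1 / jbr \<xi>) f', g'))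
    = sqrt ((L2_norm (\<lambda>x. f x - f' x))\<^sup>2 + (L2_norm (\<lambda>x. g x - g' x))\<^sup>2)"
proof -
  let ?J = "fourier_mult (\<lambda>\<xi>. 1 / jbr \<xi>)"
  let ?d = "\<lambda>x. ?J f x - ?J f' x"
  note h = fourier_mult_inverse_jbr(1)[OF f(1)] fourier_mult_inverse_jbr(1)[OF f(2)]
  have hL: "?J f \<in> L2" "?J f' \<in> L2" using h by (auto simp: H1_def)
  have dL: "(\<lambda>\<xi>. jbr \<xi> *\<^sub>R fourier ?d \<xi>) \<in> L2" using H1_diff[OF h] by (simp add: H1_def)
  have "L2_norm (fourier_mult jbr ?d) = L2_norm (\<lambda>\<xi>. jbr \<xi> *\<^sub>R fourier ?d \<xi>)"
    by (rule L2_norm_fourier_mult[OF dL])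
  also have "\<dots> = L2_norm (\<lambda>\<xi>. fourier f \<xi> - fourier f' \<xi>)"
  proof (rule L2_norm_cong_AE)
    show "AE \<xi> in lborel. jbr \<xi> *\<^sub>R fourier ?d \<xi> = fourier f \<xi> - fourier f' \<xi>"
      using fourier_diff[OF hL] fourier_mult_inverse_jbr(2)[OF f(1)] fourier_mult_inverse_jbr(2)[OF f(2)]
      by eventually_elim (simp add: scaleR_diff_right)
    show "(\<lambda>\<xi>. jbr \<xi> *\<^sub>R fourier ?d \<xi>) \<in> borel_measurable borel" by (rule L2_measurable[OF dL])
    show "(\<lambda>\<xi>. fourier f \<xi> - fourier f' \<xi>) \<in> borel_measurable borel"
      by (rule L2_measurable[OF L2_diff(1)[OF fourier_L2(1)[OF f(1)] fourier_L2(1)[OF f(2)]]])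
  qed
  also have "\<dots> = L2_norm (\<lambda>x. f x - f' x)" by (rule L2_norm_fourier_difference[OF f])
  finally show ?thesis unfolding H_norm_def fst_diff snd_diff fst_conv snd_conv fun_diff_def by (simp only:)
qed

lemma fourier_mult_sum:
  assumes "f \<in> L2" "(\<lambda>\<xi>. m \<xi> *\<^sub>R fourier f \<xi>) \<in> L2" "g \<in> L2" "(\<lambda>\<xi>. k \<xi> *\<^sub>R fourier g \<xi>) \<in> L2"
  shows "(\<lambda>x. fourier_mult m f x + fourier_mult k g x) \<in> L2"
    and "AE \<xi> in lborel. fourier (\<lambda>x. fourier_mult m f x + fourier_mult k g x) \<xi> = m \<xi> *\<^sub>R fourier f \<xi> + k \<xi> *\<^sub>R fourier g \<xi>"
proof -
  note L = fourier_mult_L2[OF assms(2)] fourier_mult_L2[OF assms(4)]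
  show "(\<lambda>x. fourier_mult m f x + fourier_mult k g x) \<in> L2" by (rule L2_add(1)[OF L])
  show "AE \<xi> in lborel. fourier (\<lambda>x. fourier_mult m f x + fourier_mult k g x) \<xi> = m \<xi> *\<^sub>R fourier f \<xi> + k \<xi> *\<^sub>R fourier g \<xi>"
    using fourier_add[OF L] fourier_fourier_mult[OF assms(2)] fourier_fourier_mult[OF assms(4)] by eventually_elim simp
qed

section \<open>The solution pulled back by the free flow\<close>

context kg_solution
begin

text \<open>\<open>F_matrix\<close> sandwiches the scalar cut-off between 1 / \<open>jbr\<close> and
  \<open>jbr\<close> in the first component. Including the inner \<open>jbr\<close> here makes this
  component a curve in L2 to which \<open>F_scalar\<close> applies directly.\<close>

definition back_u :: "real \<Rightarrow> 'a \<Rightarrow> complex" where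
  "back_u t = fourier_mult jbr (fst (U0 (- t) (u t, v t)))"

definition back_v :: "real \<Rightarrow> 'a \<Rightarrow> complex" where
  "back_v t = snd (U0 (- t) (u t, v t))"

text \<open>The pair (\<open>hat_u\<close>, \<open>hat_v\<close>) is (\<open>jbr\<close> times the
  transform of u, transform of v) rotated by the angle t \<open>jbr\<close>. These are explicit
  representatives of transforms that \<open>fourier\<close> determines only up to null sets.\<close>

definition hat_u :: "real \<Rightarrow> 'a \<Rightarrow> complex" where
  "hat_u t \<xi> = (cos (t * jbr \<xi>) *\<^sub>R (jbr \<xi> *\<^sub>R fourier (u t) \<xi>) + (- sin (t * jbr \<xi>)) *\<^sub>R fourier (v t) \<xi>)"

definition hat_v :: "real \<Rightarrow> 'a \<Rightarrow> complex" where
  "hat_v t \<xi> = (sin (t * jbr \<xi>) *\<^sub>R (jbr \<xi> *\<^sub>R fourier (u t) \<xi>) + cos (t * jbr \<xi>) *\<^sub>R fourier (v t) \<xi>)"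

lemma hat_L2:
  assumes t: "0 \<le> t"
  shows "hat_u t \<in> L2" "L2_norm (hat_u t) \<le> 2 * E" "hat_v t \<in> L2" "L2_norm (hat_v t) \<le> 2 * E"
proof -
  have vb: "L2_norm (fourier (v t)) \<le> E" using v_norm_le[OF t] by (simp add: Plancherel[OF v_L2[OF t]])
  have b: "(\<lambda>\<xi>. m \<xi> *\<^sub>R (jbr \<xi> *\<^sub>R fourier (u t) \<xi>) + k \<xi> *\<^sub>R fourier (v t) \<xi>) \<in> L2"
    "L2_norm (\<lambda>\<xi>. m \<xi> *\<^sub>R (jbr \<xi> *\<^sub>R fourier (u t) \<xi>) + k \<xi> *\<^sub>R fourier (v t) \<xi>) \<le> 2 * E"
    if m: "m \<in> borel_measurable borel" "\<And>\<xi>. \<bar>m \<xi>\<bar> \<le> 1" and k: "k \<in> borel_measurable borel" "\<And>\<xi>. \<bar>k \<xi>\<bar> \<le> 1" for m k :: "'a \<Rightarrow> real"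
  proof -
    note 1 = L2_scaleR_bounded[OF jbr_u_L2[OF t] m] and 2 = L2_scaleR_bounded[OF fv_L2[OF t] k]
    show "(\<lambda>\<xi>. m \<xi> *\<^sub>R (jbr \<xi> *\<^sub>R fourier (u t) \<xi>) + k \<xi> *\<^sub>R fourier (v t) \<xi>) \<in> L2" by (rule L2_add(1)[OF 1(1) 2(1)])
    show "L2_norm (\<lambda>\<xi>. m \<xi> *\<^sub>R (jbr \<xi> *\<^sub>R fourier (u t) \<xi>) + k \<xi> *\<^sub>R fourier (v t) \<xi>) \<le> 2 * E"
      using L2_add(2)[OF 1(1) 2(1)] 1(2) 2(2) jbr_u_norm_le[OF t] vb by linarith
  qed
  show "hat_u t \<in> L2" "L2_norm (hat_u t) \<le> 2 * E" unfolding hat_u_def[abs_def] by (rule b; simp)+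
  show "hat_v t \<in> L2" "L2_norm (hat_v t) \<le> 2 * E" unfolding hat_v_def[abs_def] by (rule b; simp)+
qed

lemma back_v:
  assumes t: "0 \<le> t"
  shows "back_v t \<in> L2" "AE \<xi> in lborel. fourier (back_v t) \<xi> = hat_v t \<xi>"
proof -
  have "(\<lambda>\<xi>. sin (t * jbr \<xi>) *\<^sub>R (jbr \<xi> *\<^sub>R fourier (u t) \<xi>)) \<in> L2"
    by (rule L2_scaleR_bounded(1)[OF jbr_u_L2[OF t], of _ 1]) simp_all
  then have 1: "(\<lambda>\<xi>. (- sin (- t * jbr \<xi>) * jbr \<xi>) *\<^sub>R fourier (u t) \<xi>) \<in> L2" by simp
  have 2: "(\<lambda>\<xi>. cos (- t * jbr \<xi>) *\<^sub>R fourier (v t) \<xi>) \<in> L2"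
    by (rule L2_scaleR_bounded(1)[OF fv_L2[OF t], of _ 1]) simp_all
  have e: "back_v t = (\<lambda>x. fourier_mult (\<lambda>\<xi>. - sin (- t * jbr \<xi>) * jbr \<xi>) (u t) x + fourier_mult (\<lambda>\<xi>. cos (- t * jbr \<xi>)) (v t) x)"
    unfolding back_v_def U0_def by (simp only: fst_conv snd_conv)
  show "back_v t \<in> L2" unfolding e by (rule fourier_mult_sum(1)[OF u_L2[OF t] 1 v_L2[OF t] 2])
  show "AE \<xi> in lborel. fourier (back_v t) \<xi> = hat_v t \<xi>"
    unfolding e using fourier_mult_sum(2)[OF u_L2[OF t] 1 v_L2[OF t] 2]
    by eventually_elim (simp add: hat_v_def)
qed

lemma back_u:
  assumes t: "0 \<le> t"
  shows "back_u t \<in> L2" "AE \<xi> in lborel. fourier (back_u t) \<xi> = hat_u t \<xi>"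
proof -
  let ?f = "fst (U0 (- t) (u t, v t))"
  have 1: "(\<lambda>\<xi>. cos (- t * jbr \<xi>) *\<^sub>R fourier (u t) \<xi>) \<in> L2"
    by (rule L2_scaleR_bounded(1)[OF fu_L2[OF t], of _ 1]) simp_all
  have "\<bar>sin (- t * jbr \<xi>) / jbr \<xi>\<bar> \<le> 1" for \<xi> :: 'a
  proof -
    have "\<bar>sin (- t * jbr \<xi>)\<bar> \<le> jbr \<xi>" using abs_sin_le_one[of "- t * jbr \<xi>"] jbr_ge_1[of \<xi>] by linarith
    then show ?thesis using jbr_pos[of \<xi>] by (simp add: abs_divide divide_le_eq)
  qed
  then have 2: "(\<lambda>\<xi>. (sin (- t * jbr \<xi>) / jbr \<xi>) *\<^sub>R fourier (v t) \<xi>) \<in> L2"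
    by (intro L2_scaleR_bounded(1)[OF fv_L2[OF t], of _ 1]) simp_all
  have e: "?f = (\<lambda>x. fourier_mult (\<lambda>\<xi>. cos (- t * jbr \<xi>)) (u t) x + fourier_mult (\<lambda>\<xi>. sin (- t * jbr \<xi>) / jbr \<xi>) (v t) x)"
    unfolding U0_def by (simp only: fst_conv snd_conv)
  note s = fourier_mult_sum[OF u_L2[OF t] 1 v_L2[OF t] 2, folded e]
  have ae: "AE \<xi> in lborel. hat_u t \<xi> = jbr \<xi> *\<^sub>R fourier ?f \<xi>"
    using s(2)
  proof eventually_elim
    case (elim \<xi>)
    have "jbr \<xi> *\<^sub>R ((sin (- t * jbr \<xi>) / jbr \<xi>) *\<^sub>R fourier (v t) \<xi>) = (- sin (t * jbr \<xi>)) *\<^sub>R fourier (v t) \<xi>"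
      using jbr_pos[of \<xi>] by simp
    then show ?case unfolding elim hat_u_def scaleR_add_right by (simp add: mult.commute)
  qed
  have jL: "(\<lambda>\<xi>. jbr \<xi> *\<^sub>R fourier ?f \<xi>) \<in> L2"
    by (rule L2_cong_AE[OF ae hat_L2(1)[OF t]]) (use L2_measurable[OF fourier_L2(1)[OF s(1)]] in measurable)
  show "back_u t \<in> L2" unfolding back_u_def by (rule fourier_mult_L2[OF jL])
  show "AE \<xi> in lborel. fourier (back_u t) \<xi> = hat_u t \<xi>"
    unfolding back_u_def using fourier_fourier_mult[OF jL] ae by eventually_elim simp
qed

lemma back_norm_le:
  assumes t: "0 \<le> t" shows "L2_norm (back_u t) \<le> 2 * E" "L2_norm (back_v t) \<le> 2 * E"
proof -
  have *: "L2_norm f \<le> 2 * E" if "f \<in> L2" "AE \<xi> in lborel. fourier f \<xi> = g \<xi>" "g \<in> L2" "L2_norm g \<le> 2 * E" for f g :: "'a \<Rightarrow> complex"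
    using L2_norm_cong_AE[OF that(2) L2_measurable[OF fourier_L2(1)[OF that(1)]] L2_measurable[OF that(3)]] that(4)
    by (simp add: Plancherel[OF that(1)])
  show "L2_norm (back_u t) \<le> 2 * E" by (rule *[OF back_u[OF t] hat_L2(1,2)[OF t]])
  show "L2_norm (back_v t) \<le> 2 * E" by (rule *[OF back_v[OF t] hat_L2(3,4)[OF t]])
qed

text \<open>Euler's formulas: \<open>hat_u\<close> plus or minus i \<open>hat_v\<close> is the phase
  of sign \<theta> times \<open>jbr\<close> (fourier u) plus i \<theta> (fourier v), the integrand
  of \<open>profile\<close>. Decay of both profiles therefore passes to both components.\<close>

lemma profile_hat:
  assumes m: "bounded_supp m" and s: "0 \<le> s"
  shows "(\<integral>\<xi>. hat_u s \<xi> * m \<xi> \<partial>lborel) = 1 / 2 * (profile 1 m s + profile (- 1) m s)"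
    and "(\<integral>\<xi>. hat_v s \<xi> * m \<xi> \<partial>lborel) = 1 / (2 * \<i>) * (profile 1 m s - profile (- 1) m s)"
proof -
  let ?U = "\<lambda>\<theta> \<xi>. fourier (u s) \<xi> * (cis (\<theta> * s * jbr \<xi>) * (of_real (jbr \<xi> ^ 1) * m \<xi>))"
  let ?V = "\<lambda>\<theta> \<xi>. fourier (v s) \<xi> * (cis (\<theta> * s * jbr \<xi>) * m \<xi>)"
  let ?d = "\<lambda>\<theta> \<xi>. ?U \<theta> \<xi> + \<i> * of_real \<theta> * ?V \<theta> \<xi>"
  have iU: "integrable lborel (?U \<theta>)" for \<theta>
    by (intro L2_mult_integrable fu_L2 s bounded_supp_L2_integrable(1) bounded_supp_cis_jbr bounded_supp_jbr m)
  have "integrable lborel (?V \<theta>)" for \<theta>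
    by (intro L2_mult_integrable fv_L2 s bounded_supp_L2_integrable(1) bounded_supp_cis_jbr m)
  then have iV: "integrable lborel (\<lambda>\<xi>. \<i> * of_real \<theta> * ?V \<theta> \<xi>)" for \<theta> by (rule integrable_mult_right)
  have i: "integrable lborel (?d \<theta>)" for \<theta> by (rule Bochner_Integration.integrable_add[OF iU iV])
  have p: "profile \<theta> m s = (\<integral>\<xi>. ?d \<theta> \<xi> \<partial>lborel)" for \<theta>
    unfolding profile_def Bochner_Integration.integral_add[OF iU iV] integral_mult_right_zero ..
  have c: "cis (1 * s * jbr \<xi>) = of_real (cos (s * jbr \<xi>)) + \<i> * of_real (sin (s * jbr \<xi>))"
    "cis (- 1 * s * jbr \<xi>) = of_real (cos (s * jbr \<xi>)) - \<i> * of_real (sin (s * jbr \<xi>))" for \<xi> :: 'a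
    by (simp_all add: complex_eq_iff)
  have gu: "1 / 2 * ((U * ((C + \<i> * S) * (J * k)) + \<i> * 1 * (V * ((C + \<i> * S) * k))) + (U * ((C - \<i> * S) * (J * k)) + \<i> * - 1 * (V * ((C - \<i> * S) * k))))
      = (C * (J * U) + - S * V) * k" for U V C S J k :: complex
    by (simp add: algebra_simps)
  have gv: "1 / (2 * \<i>) * ((U * ((C + \<i> * S) * (J * k)) + \<i> * 1 * (V * ((C + \<i> * S) * k))) - (U * ((C - \<i> * S) * (J * k)) + \<i> * - 1 * (V * ((C - \<i> * S) * k))))
      = (S * (J * U) + C * V) * k" for U V C S J k :: complex
  proof -
    have "(U * ((C + \<i> * S) * (J * k)) + \<i> * 1 * (V * ((C + \<i> * S) * k))) - (U * ((C - \<i> * S) * (J * k)) + \<i> * - 1 * (V * ((C - \<i> * S) * k)))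
      = (2 * \<i>) * ((S * (J * U) + C * V) * k)" by (simp add: algebra_simps)
    then show ?thesis by simp
  qed
  have "hat_u s \<xi> * m \<xi> = 1 / 2 * (?d 1 \<xi> + ?d (- 1) \<xi>)" for \<xi>
    unfolding c of_real_1 of_real_minus gu power_one_right by (simp add: hat_u_def scaleR_conv_of_real)
  then show "(\<integral>\<xi>. hat_u s \<xi> * m \<xi> \<partial>lborel) = 1 / 2 * (profile 1 m s + profile (- 1) m s)"
    unfolding p Bochner_Integration.integral_add[OF i i, symmetric] by (simp only: integral_mult_right_zero)
  have "hat_v s \<xi> * m \<xi> = 1 / (2 * \<i>) * (?d 1 \<xi> - ?d (- 1) \<xi>)" for \<xi>
    unfolding c of_real_1 of_real_minus gv power_one_right by (simp add: hat_v_def scaleR_conv_of_real)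
  then show "(\<integral>\<xi>. hat_v s \<xi> * m \<xi> \<partial>lborel) = 1 / (2 * \<i>) * (profile 1 m s - profile (- 1) m s)"
    unfolding p Bochner_Integration.integral_diff[OF i i, symmetric] by (simp only: integral_mult_right_zero)
qed

lemma dispersive_back:
  assumes F: "smooth_cutoff F" and n: "3 \<le> DIM('a)"
  obtains K where "dispersive_family back_u F (2 * E) K" "dispersive_family back_v F (2 * E) K"
proof -
  let ?m = "\<lambda>R (x::'a) \<xi>. cis (x \<bullet> \<xi>) * of_real (1 - F (norm \<xi> / R))"
  obtain K where K: "0 \<le> K" "\<And>\<theta> R t T. \<And>x::'a. \<theta>\<^sup>2 = 1 \<Longrightarrow> 1 \<le> R \<Longrightarrow> R \<le> t \<Longrightarrow> t \<le> T \<Longrightarrow>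
      norm (profile \<theta> (?m R x) T - profile \<theta> (?m R x) t) \<le> K * R powr (real DIM('a) / 2 + 1) * t powr (1 - real DIM('a) / 2)"
    using profile_bound[OF F n] by blast
  have tr: "(\<integral>\<xi>. (fourier f \<xi> - fourier g \<xi>) * k \<xi> \<partial>lborel) = (\<integral>\<xi>. f' \<xi> * k \<xi> \<partial>lborel) - (\<integral>\<xi>. g' \<xi> * k \<xi> \<partial>lborel)"
    if "f \<in> L2" "AE \<xi> in lborel. fourier f \<xi> = f' \<xi>" "f' \<in> L2" "g \<in> L2" "AE \<xi> in lborel. fourier g \<xi> = g' \<xi>" "g' \<in> L2" "k \<in> L2"
    for f f' g g' k :: "'a \<Rightarrow> complex"
  proof -
    have "(\<integral>\<xi>. (fourier f \<xi> - fourier g \<xi>) * k \<xi> \<partial>lborel) = (\<integral>\<xi>. f' \<xi> * k \<xi> - g' \<xi> * k \<xi> \<partial>lborel)"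
    proof (rule integral_cong_AE)
      show "AE \<xi> in lborel. (fourier f \<xi> - fourier g \<xi>) * k \<xi> = f' \<xi> * k \<xi> - g' \<xi> * k \<xi>"
        using that(2,5) by eventually_elim (simp add: left_diff_distrib)
    qed (use L2_measurable[OF fourier_L2(1)[OF that(1)]] L2_measurable[OF fourier_L2(1)[OF that(4)]]
        L2_measurable[OF that(3)] L2_measurable[OF that(6)] L2_measurable[OF that(7)] in measurable)
    also have "\<dots> = (\<integral>\<xi>. f' \<xi> * k \<xi> \<partial>lborel) - (\<integral>\<xi>. g' \<xi> * k \<xi> \<partial>lborel)"
      by (intro Bochner_Integration.integral_diff L2_mult_integrable that)
    finally show ?thesis .
  qed
  have half: "norm (1 / 2 * (a + b)) \<le> B" "norm (1 / (2 * \<i>) * (a - b)) \<le> B" if "norm a \<le> B" "norm b \<le> B" for a b :: complex and B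
  proof -
    have "norm (a + b) \<le> 2 * B" "norm (a - b) \<le> 2 * B"
      using norm_triangle_ineq[of a b] norm_triangle_ineq4[of a b] that by linarith+
    then show "norm (1 / 2 * (a + b)) \<le> B" "norm (1 / (2 * \<i>) * (a - b)) \<le> B"
      by (simp_all add: norm_mult norm_divide)
  qed
  have dec: "norm (\<integral>\<xi>. (fourier (back_u T) \<xi> - fourier (back_u t) \<xi>) * ?m R x \<xi> \<partial>lborel)
        \<le> K * R powr (real DIM('a) / 2 + 1) * t powr (1 - real DIM('a) / 2)"
      "norm (\<integral>\<xi>. (fourier (back_v T) \<xi> - fourier (back_v t) \<xi>) * ?m R x \<xi> \<partial>lborel)
        \<le> K * R powr (real DIM('a) / 2 + 1) * t powr (1 - real DIM('a) / 2)"
    if R: "1 \<le> R" "R \<le> t" "t \<le> T" for R t T and x :: 'a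
  proof -
    have t: "0 \<le> t" "0 \<le> T" and R0: "0 < R" using R by linarith+
    note m = bounded_supp_cutoff[OF F R0, of x]
    note mL = bounded_supp_L2_integrable(1)[OF m]
    have p: "norm (profile 1 (?m R x) T - profile 1 (?m R x) t) \<le> K * R powr (real DIM('a) / 2 + 1) * t powr (1 - real DIM('a) / 2)"
      "norm (profile (- 1) (?m R x) T - profile (- 1) (?m R x) t) \<le> K * R powr (real DIM('a) / 2 + 1) * t powr (1 - real DIM('a) / 2)"
      by (rule K(2)[OF _ R]; simp)+
    have g: "k * (a + b) - k * (a' + b') = k * ((a - a') + (b - b'))" "k * (a - b) - k * (a' - b') = k * ((a - a') - (b - b'))"
      for k a b a' b' :: complex by (simp_all add: algebra_simps)
    show "norm (\<integral>\<xi>. (fourier (back_u T) \<xi> - fourier (back_u t) \<xi>) * ?m R x \<xi> \<partial>lborel)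
        \<le> K * R powr (real DIM('a) / 2 + 1) * t powr (1 - real DIM('a) / 2)"
      unfolding tr[OF back_u[OF t(2)] hat_L2(1)[OF t(2)] back_u[OF t(1)] hat_L2(1)[OF t(1)] mL]
        profile_hat(1)[OF m t(1)] profile_hat(1)[OF m t(2)] g by (rule half(1)[OF p])
    show "norm (\<integral>\<xi>. (fourier (back_v T) \<xi> - fourier (back_v t) \<xi>) * ?m R x \<xi> \<partial>lborel)
        \<le> K * R powr (real DIM('a) / 2 + 1) * t powr (1 - real DIM('a) / 2)"
      unfolding tr[OF back_v[OF t(2)] hat_L2(3)[OF t(2)] back_v[OF t(1)] hat_L2(3)[OF t(1)] mL]
        profile_hat(2)[OF m t(1)] profile_hat(2)[OF m t(2)] g by (rule half(2)[OF p])
  qed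
  show ?thesis
  proof (rule that[of K])
    show "dispersive_family back_u F (2 * E) K"
      by unfold_locales (rule n F back_u(1) back_norm_le(1) K(1) dec(1); assumption?)+
    show "dispersive_family back_v F (2 * E) K"
      by unfold_locales (rule n F back_v(1) back_norm_le(2) K(1) dec(2); assumption?)+
  qed
qed

text \<open>The scalar limits Za and Zb of the two components give w = (Za multiplied by 1 /
  \<open>jbr\<close>, Zb). One w serves all admissible exponents, since Za and Zb do not depend on
  them.\<close>

theorem channel_wave_operator:
  assumes Fc: "smooth_cutoff Fc" and F1: "smooth_cutoff F1" and n: "3 \<le> DIM('a)"
  shows "\<exists>w. \<forall>\<alpha> \<beta>. (\<alpha>, \<beta>) \<in> I_nl DIM('a) \<longrightarrow> H_limit (\<lambda>t. F_matrix Fc F1 \<alpha> \<beta> t (U0 (- t) (u t, v t))) w at_top"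
proof -
  obtain K where K: "dispersive_family back_u F1 (2 * E) K" "dispersive_family back_v F1 (2 * E) K"
    using dispersive_back[OF F1 n] by blast
  obtain Za where Za: "Za \<in> L2" and la: "\<And>\<alpha> \<beta>. (\<alpha>, \<beta>) \<in> I_nl DIM('a) \<Longrightarrow> (\<forall>\<^sub>F t in at_top. F_scalar Fc F1 \<alpha> \<beta> t (back_u t) \<in> L2) \<and>
      ((\<lambda>t. L2_norm (\<lambda>x. F_scalar Fc F1 \<alpha> \<beta> t (back_u t) x - Za x)) \<longlongrightarrow> 0) at_top"
    using dispersive_family.scattering_limit[OF K(1)] Fc by blast
  obtain Zb where Zb: "Zb \<in> L2" and lb: "\<And>\<alpha> \<beta>. (\<alpha>, \<beta>) \<in> I_nl DIM('a) \<Longrightarrow> (\<forall>\<^sub>F t in at_top. F_scalar Fc F1 \<alpha> \<beta> t (back_v t) \<in> L2) \<and>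
      ((\<lambda>t. L2_norm (\<lambda>x. F_scalar Fc F1 \<alpha> \<beta> t (back_v t) x - Zb x)) \<longlongrightarrow> 0) at_top"
    using dispersive_family.scattering_limit[OF K(2)] Fc by blast
  let ?J = "fourier_mult (\<lambda>\<xi>::'a. 1 / jbr \<xi>)"
  have "H_limit (\<lambda>t. F_matrix Fc F1 \<alpha> \<beta> t (U0 (- t) (u t, v t))) (?J Za, Zb) at_top" if ab: "(\<alpha>, \<beta>) \<in> I_nl DIM('a)" for \<alpha> \<beta>
  proof -
    let ?a = "\<lambda>t. F_scalar Fc F1 \<alpha> \<beta> t (back_u t)" and ?b = "\<lambda>t. F_scalar Fc F1 \<alpha> \<beta> t (back_v t)"
    have M: "F_matrix Fc F1 \<alpha> \<beta> t (U0 (- t) (u t, v t)) = (?J (?a t), ?b t)" for t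
      unfolding F_matrix_def back_u_def back_v_def ..
    have ev: "\<forall>\<^sub>F t in at_top. ?a t \<in> L2 \<and> ?b t \<in> L2" using la[OF ab] lb[OF ab] by (simp add: eventually_conj_iff)
    have lim: "((\<lambda>t. sqrt ((L2_norm (\<lambda>x. ?a t x - Za x))\<^sup>2 + (L2_norm (\<lambda>x. ?b t x - Zb x))\<^sup>2)) \<longlongrightarrow> sqrt (0\<^sup>2 + 0\<^sup>2)) at_top"
      using la[OF ab] lb[OF ab] by (intro tendsto_real_sqrt tendsto_add tendsto_power) blast+
    show ?thesis unfolding H_limit_def M
    proof (intro conjI)
      show "\<forall>\<^sub>F t in at_top. (?J (?a t), ?b t) \<in> H_space"
        using ev by eventually_elim (simp add: H_space_def fourier_mult_inverse_jbr(1))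
      show "(?J Za, Zb) \<in> H_space" using Za Zb by (simp add: H_space_def fourier_mult_inverse_jbr(1))
      show "((\<lambda>t. H_norm ((?J (?a t), ?b t) - (?J Za, Zb))) \<longlongrightarrow> 0) at_top"
      proof (rule Lim_transform_eventually[OF lim[simplified]])
        show "\<forall>\<^sub>F t in at_top. sqrt ((L2_norm (\<lambda>x. ?a t x - Za x))\<^sup>2 + (L2_norm (\<lambda>x. ?b t x - Zb x))\<^sup>2) = H_norm ((?J (?a t), ?b t) - (?J Za, Zb))"
          using ev by eventually_elim (simp only: H_norm_fourier_mult_inverse_jbr[OF _ Za])
      qed
    qed
  qed
  then show ?thesis by blast
qed

end

theorem theorem1p7:
  fixes N :: "(real ^ 'n \<Rightarrow> complex) \<Rightarrow> real ^ 'n \<Rightarrow> real \<Rightarrow> complex"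
    and u v :: "real \<Rightarrow> real ^ 'n \<Rightarrow> complex"
    and Fc F1 :: "real \<Rightarrow> real"
  assumes "CARD('n) \<ge> 3"
    and "smooth_cutoff Fc" and "smooth_cutoff F1"
    and "KG_global_solution N u v"
    and "bdd_above ((\<lambda>t. H_norm (u t, v t)) ` {0..})"
    and "\<And>t. t \<ge> 0 \<Longrightarrow> integrable lborel (\<lambda>x. N (u t) x t * u t x)"
    and "bdd_above ((\<lambda>t. \<integral>x. norm (N (u t) x t * u t x) \<partial>lborel) ` {0..})"
  shows "(\<forall>(\<alpha>, \<beta>) \<in> I_nl CARD('n).
            \<exists>w. H_limit (\<lambda>t. F_matrix Fc F1 \<alpha> \<beta> t (U0 (- t) (u t, v t))) w at_top)
       \<and> (\<forall>(\<alpha>, \<beta>) \<in> I_nl CARD('n). \<forall>(\<alpha>', \<beta>') \<in> I_nl CARD('n). \<forall>w w'.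
            H_limit (\<lambda>t. F_matrix Fc F1 \<alpha> \<beta> t (U0 (- t) (u t, v t))) w at_top \<longrightarrow>
            H_limit (\<lambda>t. F_matrix Fc F1 \<alpha>' \<beta>' t (U0 (- t) (u t, v t))) w' at_top \<longrightarrow>
            H_eq w w')"
proof -
  obtain E where E: "\<And>t. 0 \<le> t \<Longrightarrow> H_norm (u t, v t) \<le> E"
    using assms(5) unfolding bdd_above_def by auto
  obtain M where M: "\<And>t. 0 \<le> t \<Longrightarrow> (\<integral>x. norm (N (u t) x t * u t x) \<partial>lborel) \<le> M"
    using assms(7) unfolding bdd_above_def by auto
  interpret kg_solution N u v E M
    by standard (rule assms(4) E assms(6) M; assumption?)+
  have dim: "DIM(real ^ 'n) = CARD('n)" by simp
  obtain w where w: "\<And>\<alpha> \<beta>. (\<alpha>, \<beta>) \<in> I_nl CARD('n) \<Longrightarrow> H_limit (\<lambda>t. F_matrix Fc F1 \<alpha> \<beta> t (U0 (- t) (u t, v t))) w at_top"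
    using channel_wave_operator[OF assms(2,3)] assms(1) unfolding dim by blast
  \<comment> \<open>By uniqueness any limit, for any admissible pair, equals the common limit w
    almost everywhere; two such limits are then compared through w.\<close>
  have eq: "H_eq w1 w" if "(\<alpha>, \<beta>) \<in> I_nl CARD('n)" "H_limit (\<lambda>t. F_matrix Fc F1 \<alpha> \<beta> t (U0 (- t) (u t, v t))) w1 at_top" for \<alpha> \<beta> w1
    by (rule H_limit_unique[OF that(2) w[OF that(1)]]) simp
  have "H_eq w1 w2" if "H_eq w1 w" "H_eq w2 w" for w1 w2
    using that unfolding H_eq_def by (auto elim: eventually_elim2)
  with w eq show ?thesis by blast
qed

end
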